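(* Let $G$ be a closed knotted trivalent graph (KTG, with framing not necessarily orientable) with edge set $E$ and vertex set $V$, let $col:E\to\frac{\mathbb N}{2}$ be an admissible coloring, and let $$\langle\langle G,col\rangle\rangle := \langle G,col\rangle\,\frac{\prod_{e\in E,\ \chi(e)=1}[2col(e)]!}{\prod_{v\in V}[a_v+b_v-c_v]!\,[b_v+c_v-a_v]!\,[c_v+a_v-b_v]!}$$ be its renormalized Kauffman bracket, where $a_v,b_v,c_v$ are the colors of the three edges at $v$, and $\chi(e)=1$ if $e$ touches a vertex and $\chi(e)=0$ if $e$ is a closed circle. Then there exist $m,n\in\mathbb Z$ such that $$\langle\langle G,col\rangle\rangle\in(\sqrt{-1})^m q^{\frac n4}\,\mathbb Z[q,q^{-1}],$$ and moreover $\langle\langle G,col\rangle\rangle(\sqrt{-1})^{-m}q^{-\frac n4}$ is divisible in $\mathbb Z[q,q^{-1}]$ by $[2col(e)+1]$ for each edge $e$ of $G$. If the framing of $G$ is orientable, then this holds with $m=0$ and $n$ even.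
   Context: Here $q$ is generic (a formal variable, with fractional powers adjoined), $[n]=\frac{q^n-q^{-n}}{q-q^{-1}}$, $[n]!=\prod_{j=1}^n[j]$, $[0]!=1$. KTG: a finite trivalent graph $G\subset S^3$ (edges that are closed circles without vertices are allowed) equipped with a framing, i.e. the germ of a smooth surface $S\subset S^3$, possibly non-orientable, containing $G$ and retracting onto $G$. "Closed" means without univalent vertices. Admissible coloring: a map $col:E\to\frac{\mathbb N}{2}$ (half-natural numbers, $0$ allowed) such that at each vertex $v$ with incident colors $a_v,b_v,c_v$ one has $a_v+b_v+c_v\in\mathbb N$ and $a_v+b_v\ge c_v$, $b_v+c_v\ge a_v$, $c_v+a_v\ge b_v$. Kauffman bracket $\langle G,col\rangle$, blackboard framing case: let $D$ be a planar diagram of $G$ whose blackboard framing (a surface containing $G$ nearly parallel to the projection plane) is the framing of $G$. (0) If $G$ is a framed link with all colors $\frac12$, then $\langle G,\frac12\rangle\in\mathbb Z[q^{\pm 1/2}]$ is computed from $D$ by the rules: a positive crossing (drawn with the overstrand going from bottom left to top right) equals $q^{1/2}$ times the two vertical parallel strands plus $q^{-1/2}$ times cup-over-cap; each disjoint trivial circle contributes a factor $-[2]$; the empty diagram has value $1$. (1) In general, replace each edge $e$ of color $a$ by the formal sum of braids on $2a$ strands (parallel in the blackboard framing) $JW_{2a}=\sum_{\sigma\in\mathfrak S_{2a}}\frac{q^{-a(2a-1)+\frac32T(\sigma)}}{[2a]!}\hat\sigma$, where $\hat\sigma$ is the positive braid with the minimal number $T(\sigma)$ of crossings inducing the permutation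 $\sigma$. (2) At each vertex with colors $a,b,c$ connect the $2a+2b+2c$ free endpoints in the unique planar way with no strand returning to the same edge (so $a+b-c$ strands connect the edges colored $a$ and $b$, etc.). (3) This yields a formal combination $\sum_ic_iL_i$ of blackboard-framed links, and $\langle G,col\rangle:=\sum_ic_i\langle L_i,\frac12\rangle$. General framing: let $D$ be any diagram of $G$, and for each edge $e$ let $g_e\in\frac12\mathbb Z$ be the difference between the framing of $e$ in $G$ and the blackboard framing, measured in full twists (positive half twists counted as $+\frac12$; a positive full twist on a strand of color $\frac12$ multiplies the bracket by $-q^{3/2}$). Then $\langle G,col\rangle:=F(D,col)\,\langle D,col\rangle$, where $\langle D,col\rangle$ is the bracket of $G$ equipped with the blackboard framing of $D$ and $F(D,col)=\prod_{e\in E}(\sqrt{-1})^{4g_ecol(e)}q^{2g_e(col(e)^2+col(e))}$. The result is an isotopy invariant of the colored framed graph. *)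

theory Defs
  imports Complex_Main
    "HOL-Computational_Algebra.Polynomial_Factorial"
    "HOL-Combinatorics.Permutations"
    "HOL-Library.FuncSet"
begin

section \<open>Coefficients\<close>

text \<open>
  Scalars are the rational functions over the complex numbers in one variable \<open>t\<close>, which stands
  for the fourth root of the formal variable \<open>q\<close>. No power of \<open>q\<close> outside (1/4)Z ever occurs.
\<close>

type_synonym scalar = "complex poly fract"

definition t :: scalar where "t = to_fract [:0, 1:]"

definition qpow :: "rat \<Rightarrow> scalar"
  \<comment> \<open>the power of \<open>q\<close> with exponent \<open>r\<close>; only meant for \<open>4 * r\<close> an integer\<close>
  where "qpow r = t powi \<lfloor>4 * r\<rfloor>"

definition q :: scalar where "q = qpow 1"

definition imag :: scalar where "imag = to_fract [:\<i>:]"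

definition qint :: "nat \<Rightarrow> scalar" where
  "qint n = (q powi int n - q powi (- int n)) / (q - inverse q)"

definition qfact :: "nat \<Rightarrow> scalar" where
  "qfact n = (\<Prod>j\<in>{1..n}. qint j)"

definition int_laurent :: "scalar set"
  \<comment> \<open>the subring \<open>Z[q, 1/q]\<close>\<close>
  where "int_laurent = {\<Sum>k\<in>K. of_int (c k) * q powi k | (K :: int set) (c :: int \<Rightarrow> int). finite K}"


section \<open>Planar diagrams of trivalent graphs\<close>

text \<open>
  Up to planar isotopy a diagram is generic with respect to the height function, so that it is a
  stack of layers, listed from bottom to top, each of which contains exactly one elementary piece
  and otherwise vertical strands. The argument \<open>i\<close> is the number of vertical strands to the left of
  the piece; positions are counted from 0.
  \<^item> \<open>Cup\<close> is a local minimum (no strand below, two above), \<open>Cap\<close> a local maximum.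
  \<^item> \<open>Pos\<close> is a crossing whose overstrand goes from bottom left to top right, \<open>Neg\<close> one whose
    overstrand goes from bottom right to top left.
  \<^item> \<open>Merge\<close> is a vertex with two edges below and one above, \<open>Split\<close> one with one edge below and
    two above.
\<close>

datatype layer = Cup nat | Cap nat | Pos nat | Neg nat | Merge nat | Split nat

type_synonym diagram = "layer list"

fun fits :: "layer \<Rightarrow> nat \<Rightarrow> bool" where
  "fits (Cup i) n \<longleftrightarrow> i \<le> n"
| "fits (Split i) n \<longleftrightarrow> i + 1 \<le> n"
| "fits (Cap i) n \<longleftrightarrow> i + 2 \<le> n"
| "fits (Pos i) n \<longleftrightarrow> i + 2 \<le> n"
| "fits (Neg i) n \<longleftrightarrow> i + 2 \<le> n"
| "fits (Merge i) n \<longleftrightarrow> i + 2 \<le> n"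

fun width_after :: "layer \<Rightarrow> nat \<Rightarrow> nat" where
  "width_after (Cup i) n = n + 2"
| "width_after (Cap i) n = n - 2"
| "width_after (Pos i) n = n"
| "width_after (Neg i) n = n"
| "width_after (Merge i) n = n - 1"
| "width_after (Split i) n = n + 1"

text \<open>Level \<open>k\<close> is the horizontal line just below the layer \<open>D ! k\<close>.\<close>

definition width :: "diagram \<Rightarrow> nat \<Rightarrow> nat" where
  "width D k = fold width_after (take k D) 0"

definition closed_diagram :: "diagram \<Rightarrow> bool" where
  "closed_diagram D \<longleftrightarrow> (\<forall>k<length D. fits (D ! k) (width D k)) \<and> width D (length D) = 0"

text \<open>A point \<open>(k, i)\<close> is the intersection of level \<open>k\<close> with the strand at position \<open>i\<close>.\<close>

type_synonym point = "nat \<times> nat"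

definition points :: "diagram \<Rightarrow> point set" where
  "points D = {(k, i). k \<le> length D \<and> i < width D k}"

fun arcs :: "layer \<Rightarrow> nat \<Rightarrow> (point \<times> point) set"
  \<comment> \<open>endpoints of the arcs running inside a layer at level \<open>k\<close>; the edges at a vertex end there\<close>
  where
  "arcs (Cup i) k = {((k, j), (Suc k, j)) | j. j < i} \<union> {((k, j), (Suc k, j + 2)) | j. i \<le> j}
     \<union> {((Suc k, i), (Suc k, Suc i))}"
| "arcs (Cap i) k = {((k, j), (Suc k, j)) | j. j < i} \<union> {((k, j + 2), (Suc k, j)) | j. i \<le> j}
     \<union> {((k, i), (k, Suc i))}"
| "arcs (Pos i) k = {((k, j), (Suc k, transpose i (Suc i) j)) | j. True}"
| "arcs (Neg i) k = {((k, j), (Suc k, transpose i (Suc i) j)) | j. True}"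
| "arcs (Merge i) k = {((k, j), (Suc k, j)) | j. j < i} \<union> {((k, Suc j), (Suc k, j)) | j. i < j}"
| "arcs (Split i) k = {((k, j), (Suc k, j)) | j. j < i} \<union> {((k, j), (Suc k, Suc j)) | j. i < j}"

definition linked :: "diagram \<Rightarrow> (point \<times> point) set" where
  "linked D = (\<Union>k<length D. arcs (D ! k) k) \<inter> points D \<times> points D"

text \<open>
  An edge (or a circle without vertices) is represented by the set of points lying on it. Every
  edge and every circle meets some level, so none is lost.
\<close>

type_synonym edge = "point set"

definition edge_of :: "diagram \<Rightarrow> point \<Rightarrow> edge" where
  "edge_of D p = {p' \<in> points D. (p, p') \<in> (linked D \<union> (linked D)\<inverse>)\<^sup>*}"

definition edges :: "diagram \<Rightarrow> edge set" where
  "edges D = edge_of D ` points D"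

text \<open>A vertex is represented by the index of the layer containing it.\<close>

definition vertices :: "diagram \<Rightarrow> nat set" where
  "vertices D = {k. k < length D \<and> (\<exists>i. D ! k = Merge i \<or> D ! k = Split i)}"

fun ends_in_layer :: "layer \<Rightarrow> nat \<Rightarrow> point \<times> point \<times> point" where
  "ends_in_layer (Merge i) k = ((k, i), (k, Suc i), (Suc k, i))"
| "ends_in_layer (Split i) k = ((Suc k, i), (Suc k, Suc i), (k, i))"
| "ends_in_layer _ k = undefined"

definition ends :: "diagram \<Rightarrow> nat \<Rightarrow> point \<times> point \<times> point"
  \<comment> \<open>the three edge ends at the vertex \<open>v\<close>; an edge which is a loop at \<open>v\<close> contributes two of them\<close>
  where "ends D v = ends_in_layer (D ! v) v"

definition half_edges :: "diagram \<Rightarrow> (nat \<times> point) set" where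
  "half_edges D =
     {(v, p). v \<in> vertices D \<and> (case ends D v of (x, y, z) \<Rightarrow> p = x \<or> p = y \<or> p = z)}"

definition touches_vertex :: "diagram \<Rightarrow> edge \<Rightarrow> bool" where
  "touches_vertex D e \<longleftrightarrow> (\<exists>(v, p) \<in> half_edges D. p \<in> e)"


section \<open>Framed graphs and colorings\<close>

text \<open>
  A framed graph is presented by a diagram together with, for each edge, the difference (in full
  twists, half twists being allowed) between its framing and the blackboard framing.
\<close>

record ktg =
  diagram :: diagram
  twist :: "edge \<Rightarrow> rat"

abbreviation edge_set :: "ktg \<Rightarrow> edge set" where "edge_set G \<equiv> edges (diagram G)"
abbreviation vertex_set :: "ktg \<Rightarrow> nat set" where "vertex_set G \<equiv> vertices (diagram G)"

definition closed_ktg :: "ktg \<Rightarrow> bool" where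
  "closed_ktg G \<longleftrightarrow> closed_diagram (diagram G) \<and> (\<forall>e\<in>edge_set G. 2 * twist G e \<in> \<int>)"

text \<open>
  The framing surface consists of discs around the vertices, lying in the projection plane, and of
  bands along the edges, the band along \<open>e\<close> making \<open>2 * twist G e\<close> half twists relative to the
  plane. Crossings do not matter: there, both bands stay parallel to the plane. An orientation of
  the surface restricts on the disc at \<open>v\<close> to the orientation of the plane or to its opposite,
  recorded by \<open>s v\<close>; it extends over a band iff the signs at the two ends of the band agree
  exactly when the number of half twists is even. Circles give annuli or Moebius bands.
\<close>

definition orientable_framing :: "ktg \<Rightarrow> bool" where
  "orientable_framing G \<longleftrightarrow>
     (\<forall>e\<in>edge_set G. \<not> touches_vertex (diagram G) e \<longrightarrow> twist G e \<in> \<int>) \<and>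
     (\<exists>s :: nat \<Rightarrow> bool. \<forall>e\<in>edge_set G.
        \<forall>(v, p) \<in> half_edges (diagram G). \<forall>(v', p') \<in> half_edges (diagram G).
          p \<in> e \<and> p' \<in> e \<and> (v, p) \<noteq> (v', p') \<longrightarrow> (s v = s v' \<longleftrightarrow> twist G e \<in> \<int>))"

type_synonym coloring = "edge \<Rightarrow> rat"

definition end_colors :: "diagram \<Rightarrow> coloring \<Rightarrow> nat \<Rightarrow> rat \<times> rat \<times> rat" where
  "end_colors D col v =
     (case ends D v of (x, y, z) \<Rightarrow> (col (edge_of D x), col (edge_of D y), col (edge_of D z)))"

definition admissible :: "diagram \<Rightarrow> coloring \<Rightarrow> bool" where
  "admissible D col \<longleftrightarrow>
     (\<forall>e\<in>edges D. 2 * col e \<in> \<nat>) \<and>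
     (\<forall>v\<in>vertices D. case end_colors D col v of (a, b, c) \<Rightarrow>
        a + b + c \<in> \<nat> \<and> a + b \<ge> c \<and> b + c \<ge> a \<and> c + a \<ge> b)"

definition to_nat :: "rat \<Rightarrow> nat"
  \<comment> \<open>only meant for rationals which are natural numbers\<close>
  where "to_nat x = nat \<lfloor>x\<rfloor>"


section \<open>The bracket of a link diagram\<close>

text \<open>
  Expansion over the crossings from bottom to top; \<open>acc\<close> is the part already without crossings.
  In the term cup-over-cap the cap is the lower layer. The rule for \<open>Neg\<close> is the one for \<open>Pos\<close>
  rotated by a right angle. A diagram without crossings and vertices consists of disjoint circles,
  one for each of its \<open>edges\<close>. The value is meaningless on diagrams with vertices.
\<close>

fun link_bracket_aux :: "diagram \<Rightarrow> diagram \<Rightarrow> scalar" where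
  "link_bracket_aux acc [] = (- qint 2) ^ card (edges acc)"
| "link_bracket_aux acc (Pos i # D) =
     qpow (1/2) * link_bracket_aux acc D + qpow (-1/2) * link_bracket_aux (acc @ [Cap i, Cup i]) D"
| "link_bracket_aux acc (Neg i # D) =
     qpow (-1/2) * link_bracket_aux acc D + qpow (1/2) * link_bracket_aux (acc @ [Cap i, Cup i]) D"
| "link_bracket_aux acc (l # D) = link_bracket_aux (acc @ [l]) D"

definition link_bracket :: "diagram \<Rightarrow> scalar" where
  "link_bracket D = link_bracket_aux [] D"


section \<open>Jones--Wenzl elements\<close>

text \<open>
  A positive braid is a list of generators, from bottom to top; the generator \<open>i\<close> crosses the
  strands at positions \<open>i\<close> and \<open>i + 1\<close> positively.
\<close>

definition braid_perm :: "nat list \<Rightarrow> nat \<Rightarrow> nat"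
  \<comment> \<open>sends the bottom position of a strand to its top position\<close>
  where "braid_perm w = fold (\<lambda>i. transpose i (Suc i)) w"

definition min_braid :: "nat \<Rightarrow> (nat \<Rightarrow> nat) \<Rightarrow> nat list"
  \<comment> \<open>a shortest positive braid on \<open>n\<close> strands inducing \<open>\<sigma>\<close>; any two of them are isotopic\<close>
  where "min_braid n \<sigma> = (ARG_MIN length w. (\<forall>i\<in>set w. Suc i < n) \<and> braid_perm w = \<sigma>)"

definition min_crossings :: "nat \<Rightarrow> (nat \<Rightarrow> nat) \<Rightarrow> nat" where
  "min_crossings n \<sigma> = length (min_braid n \<sigma>)"

definition jw_coeff :: "rat \<Rightarrow> (nat \<Rightarrow> nat) \<Rightarrow> scalar" where
  "jw_coeff a \<sigma> =
     qpow (- a * (2 * a - 1) + 3/2 * of_nat (min_crossings (to_nat (2 * a)) \<sigma>))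
       / qfact (to_nat (2 * a))"


section \<open>Cabling\<close>

definition strands :: "diagram \<Rightarrow> coloring \<Rightarrow> nat \<Rightarrow> nat \<Rightarrow> nat" where
  "strands D col k i = to_nat (2 * col (edge_of D (k, i)))"

fun cable_layer :: "(nat \<Rightarrow> nat) \<Rightarrow> (nat \<Rightarrow> nat) \<Rightarrow> layer \<Rightarrow> diagram"
  \<comment> \<open>\<open>m i\<close> and \<open>m' i\<close> are the numbers of parallel strands replacing the strand at position \<open>i\<close>
     below and above the layer; at a vertex the numbers of strands are twice the colors,
     whence the divisions by 2\<close>
  where
  "cable_layer m m' (Cup i) = map (\<lambda>j. Cup ((\<Sum>l<i. m l) + j)) [0..<m' i]"
| "cable_layer m m' (Cap i) = map (\<lambda>j. Cap ((\<Sum>l<i. m l) + j)) (rev [0..<m i])"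
| "cable_layer m m' (Pos i) =
     concat (map (\<lambda>j. map (\<lambda>r. Pos ((\<Sum>l<i. m l) + j + r)) [0..<m (Suc i)]) (rev [0..<m i]))"
| "cable_layer m m' (Neg i) =
     concat (map (\<lambda>j. map (\<lambda>r. Neg ((\<Sum>l<i. m l) + j + r)) [0..<m (Suc i)]) (rev [0..<m i]))"
| "cable_layer m m' (Merge i) = (let s = (m i + m (Suc i) - m' i) div 2 in
     map (\<lambda>j. Cap ((\<Sum>l<i. m l) + (m i - s) + j)) (rev [0..<s]))"
| "cable_layer m m' (Split i) = (let s = (m' i + m' (Suc i) - m i) div 2 in
     map (\<lambda>j. Cup ((\<Sum>l<i. m l) + (m' i - s) + j)) [0..<s])"

definition base_point :: "edge \<Rightarrow> point"
  \<comment> \<open>where the Jones--Wenzl element is inserted; the bracket does not depend on this choice\<close>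
  where "base_point e = (SOME p. p \<in> e)"

definition insert_braids :: "diagram \<Rightarrow> coloring \<Rightarrow> (edge \<Rightarrow> nat \<Rightarrow> nat) \<Rightarrow> nat \<Rightarrow> diagram" where
  "insert_braids D col \<sigma> k = concat (map (\<lambda>i.
     if base_point (edge_of D (k, i)) = (k, i)
     then map (\<lambda>x. Pos ((\<Sum>l<i. strands D col k l) + x))
            (min_braid (strands D col k i) (\<sigma> (edge_of D (k, i))))
     else []) [0..<width D k])"

definition cable :: "diagram \<Rightarrow> coloring \<Rightarrow> (edge \<Rightarrow> nat \<Rightarrow> nat) \<Rightarrow> diagram"
  \<comment> \<open>the link diagram in which the edge \<open>e\<close> carries the minimal braid of the permutation \<open>\<sigma> e\<close>\<close>
  where "cable D col \<sigma> = concat (map (\<lambda>k.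
     insert_braids D col \<sigma> k @ cable_layer (strands D col k) (strands D col (Suc k)) (D ! k))
     [0..<length D])"


section \<open>The Kauffman bracket of a colored framed graph\<close>

definition blackboard_bracket :: "diagram \<Rightarrow> coloring \<Rightarrow> scalar" where
  "blackboard_bracket D col =
     (\<Sum>\<sigma> \<in> (\<Pi>\<^sub>E e\<in>edges D. {\<pi>. \<pi> permutes {..<to_nat (2 * col e)}}).
        (\<Prod>e\<in>edges D. jw_coeff (col e) (\<sigma> e)) * link_bracket (cable D col \<sigma>))"

definition framing_factor :: "ktg \<Rightarrow> coloring \<Rightarrow> scalar" where
  "framing_factor G col =
     (\<Prod>e\<in>edge_set G. imag powi \<lfloor>4 * twist G e * col e\<rfloor>
        * qpow (2 * twist G e * ((col e)\<^sup>2 + col e)))"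

definition kauffman_bracket :: "ktg \<Rightarrow> coloring \<Rightarrow> scalar" where
  "kauffman_bracket G col = framing_factor G col * blackboard_bracket (diagram G) col"

definition renormalized_bracket :: "ktg \<Rightarrow> coloring \<Rightarrow> scalar" where
  "renormalized_bracket G col =
     kauffman_bracket G col
     * (\<Prod>e\<in>{e \<in> edge_set G. touches_vertex (diagram G) e}. qfact (to_nat (2 * col e)))
     / (\<Prod>v\<in>vertex_set G. case end_colors (diagram G) col v of (a, b, c) \<Rightarrow>
          qfact (to_nat (a + b - c)) * qfact (to_nat (b + c - a)) * qfact (to_nat (c + a - b)))"

definition divides_in_int_laurent :: "scalar \<Rightarrow> scalar \<Rightarrow> bool" where
  "divides_in_int_laurent x y \<longleftrightarrow> x \<in> int_laurent \<and> y \<in> int_laurent \<and> (\<exists>z\<in>int_laurent. y = x * z)"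

end

theory Submission
  imports Defs
begin

text \<open>
  The bracket is evaluated with the R-matrix model: strands carry the two-dimensional module with
  basis \<open>+\<close>, \<open>-\<close>, a level of a diagram with \<open>n\<close> strands carries vectors indexed by strings of signs,
  and the Jones--Wenzl element is the rank one projection, in each weight space, onto the
  \<open>q\<close>-symmetric vectors. It absorbs itself and slides along the whole edge, so that it may be
  inserted at every point of the cabled graph. The vectors that survive are then functions of the
  weights of the edges only, and after rescaling by \<open>q\<close>-factorials all elementary layers act on them by
  matrices over \<open>Z[q, 1/q]\<close>. The scales multiply to the normalization of the theorem because
  an edge with \<open>r\<close> points has \<open>r\<close> arcs, or \<open>r - 1\<close> arcs if it ends at vertices.

  For the divisibility, cut the diagram at a point of an edge of color \<open>n/2\<close> and move this strand to
  the far left. The vector below the cut is killed by the lowering operator of the quantum group and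
  the functional above the cut kills its image, which forces the contributions of the
  weights \<open>0, ..., n\<close> to be a geometric progression of ratio \<open>q\<^sup>2\<close>; its sum is \<open>q\<^sup>n [n + 1]\<close> times
  an integral element.

  The framing factor is \<open>i\<^sup>m\<close> times a power of \<open>t\<close>, and for orientable framings \<open>m\<close> is even by a
  count of half-edges, since the numbers of strands at a vertex have even sum.
\<close>

text \<open>The obstacle is denominators. Each Jones--Wenzl element brings a factor 1/[n]!, and the
  R-matrix of two cabled strands contains 1/[j]!, while only the factorials of the normalization may
  remain. In the basis [k]! u_k, where u_k is the q-symmetric vector of weight k, the factor 1/[j]!
  is always absorbed by a q-binomial, for both signs of a crossing, and the Jones--Wenzl
  denominators shrink to one explicit scale per layer. A bare cup or vertex leads out of the
  q-symmetric vectors; only with a Jones--Wenzl element at every point do all vectors depend on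
  weights alone. Hence absorption and sliding come before any integrality statement. Crossings
  contribute half-integral powers of q through a single common factor each; quarter powers of q and
  the powers of i come from the framing factor alone. A strand is moved to the far left before the
  diagram is cut because the lowering operator then splits into two terms, one on the strand and one
  on everything else, which can be balanced against each other.\<close>

definition qh :: scalar where "qh = qpow (1/2)"

lemma t_nonzero [simp]: "t \<noteq> 0"
  by (simp add: t_def)

lemma qh_eq: "qh = t powi 2"
  by (simp add: qh_def qpow_def)

lemma qh_nonzero [simp]: "qh \<noteq> 0"
  by (simp add: qh_eq)

lemma q_eq_t: "q = t powi 4"
  by (simp add: q_def qpow_def)

lemma q_nonzero [simp]: "q \<noteq> 0"
  by (simp add: q_eq_t)

lemma q_eq: "q = qh * qh"
  by (simp add: q_eq_t qh_eq power_int_add[symmetric])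

lemma q_powi: "q powi k = qh powi (2 * k)"
  by (simp add: q_eq power_int_mult power2_eq_square)

lemma qpow_minus_half: "qpow (-1/2) = inverse qh"
proof -
  have "\<lfloor>4 * (-1/2 :: rat)\<rfloor> = -2" by simp
  thus ?thesis by (simp add: qpow_def qh_eq power_int_minus)
qed

lemma t_power: "t ^ n = to_fract (monom 1 n)"
  by (induction n) (simp_all add: t_def monom_Suc to_fract_mult[symmetric] one_pCons flip: to_fract_1)

lemma t_power_neq_1: "n > 0 \<Longrightarrow> t ^ n \<noteq> 1"
  by (metis t_power to_fract_eq_iff to_fract_1 monom_eq_iff' monom_0 one_pCons bot_nat_0.not_eq_extremum one_neq_zero)

lemma q_power_neq_1: "n > 0 \<Longrightarrow> q ^ n \<noteq> 1"
  using t_power_neq_1[of "4 * n"] by (simp add: q_eq_t power_mult)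

lemma q_neq_inverse: "q - inverse q \<noteq> 0"
  using q_power_neq_1[of 2] by (auto simp: field_simps power2_eq_square)

section \<open>Quantum integers, factorials and Gaussian binomials\<close>

definition qdiff :: scalar where "qdiff = q - inverse q"

lemma qdiff_nonzero [simp]: "qdiff \<noteq> 0"
  using q_neq_inverse by (simp add: qdiff_def)

lemma qdiff_qint: "qdiff * qint n = q powi int n - q powi (- int n)"
  using q_neq_inverse by (simp add: qint_def qdiff_def)

lemma qint_0 [simp]: "qint 0 = 0"
  by (simp add: qint_def)

lemma qint_1 [simp]: "qint (Suc 0) = 1"
  using q_neq_inverse by (simp add: qint_def power_int_minus)

lemma qint_nonzero [simp]: "n > 0 \<Longrightarrow> qint n \<noteq> 0"
proof
  assume "n > 0" "qint n = 0"
  hence "q powi int n = q powi (- int n)"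
    using qdiff_qint[of n] by simp
  hence "q ^ n * q ^ n = 1"
    by (simp add: power_int_minus field_simps)
  thus False
    using q_power_neq_1[of "n + n"] \<open>n > 0\<close> by (simp add: power_add)
qed

lemma qint_add: "qint (m + n) = q powi int n * qint m + q powi (- int m) * qint n"
proof -
  have "qdiff * qint (m + n) = qdiff * (q powi int n * qint m + q powi (- int m) * qint n)"
    unfolding distrib_left mult.left_commute[of qdiff] qdiff_qint
    by (simp add: power_int_add power_int_diff power_int_minus field_simps power_add)
  thus ?thesis by simp
qed

lemma qint_add': "qint (m + n) = q powi (- int n) * qint m + q powi (int m) * qint n"
  using qint_add[of n m] by (simp add: add.commute)

lemma qint_Suc: "qint (Suc n) = q * qint n + q powi (- int n)"
  using qint_add[of n 1] by simp

lemma qint_2: "qint 2 = q + inverse q"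
  using qint_Suc[of 1] by (simp add: numeral_2_eq_2 power_int_minus)

lemma qfact_0 [simp]: "qfact 0 = 1"
  by (simp add: qfact_def)

lemma qfact_Suc: "qfact (Suc n) = qint (Suc n) * qfact n"
  by (simp add: qfact_def prod.nat_ivl_Suc' mult.commute)

lemma qfact_nonzero [simp]: "qfact n \<noteq> 0"
  by (induction n) (simp_all add: qfact_Suc)

lemma qfact_add_split: "qfact (n + j) = qfact n * (\<Prod>i<j. qint (n + Suc i))"
  by (induction j) (simp_all add: qfact_Suc mult.commute mult.left_commute)

text \<open>The Gaussian binomial in the form symmetric under q -> 1/q. The value 0 for k > n keeps
  the Pascal rules valid at the edge k = n.\<close>

definition qbin :: "nat \<Rightarrow> nat \<Rightarrow> scalar" where
  "qbin n k = (if k \<le> n then qfact n / (qfact k * qfact (n - k)) else 0)"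

lemma qbin_0_right [simp]: "qbin n 0 = 1"
  by (simp add: qbin_def)

lemma qbin_same [simp]: "qbin n n = 1"
  by (simp add: qbin_def)

lemma qbin_0_left: "qbin 0 k = (if k = 0 then 1 else 0)"
  by (simp add: qbin_def)

lemma qbin_eq_0: "n < k \<Longrightarrow> qbin n k = 0"
  by (simp add: qbin_def)

lemma qbin_nonzero: "k \<le> n \<Longrightarrow> qbin n k \<noteq> 0"
  by (simp add: qbin_def)

lemma qbin_sym: "k \<le> n \<Longrightarrow> qbin n (n - k) = qbin n k"
  by (simp add: qbin_def mult.commute)

lemma qbin_add: "qbin (a + b) a = qfact (a + b) / (qfact a * qfact b)"
  by (simp add: qbin_def)

text \<open>Both q-Pascal rules are the same computation; they differ only in which of the two
  decompositions of [n+1] into [n-k] and [k+1] is fed in.\<close>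

lemma qbin_Suc_aux:
  assumes "qint (Suc n) = x * qint (n - k) + y * qint (Suc k)" and "k \<le> n"
  shows "qbin (Suc n) (Suc k) = x * qbin n (Suc k) + y * qbin n k"
proof (cases "k = n")
  case True
  thus ?thesis using assms(1) by (simp add: qbin_eq_0 nonzero_divide_eq_eq)
next
  case False
  then obtain d where d: "n = Suc (k + d)"
    using assms(2) by (metis less_imp_Suc_add le_neq_implies_less)
  have "x * qint (Suc d) + y * qint (Suc k) = qint (Suc (Suc (k + d)))"
    using assms(1) by (simp add: d)
  moreover have "x * qbin n (Suc k) + y * qbin n k =
      qfact n * (x * qint (Suc d) + y * qint (Suc k)) / (qfact (Suc k) * qfact (Suc d))"
    by (simp add: qbin_def d qfact_Suc field_simps Suc_diff_le)
  ultimately show ?thesis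
    by (simp add: qbin_def d qfact_Suc Suc_diff_le)
qed

lemma qbin_Suc:
  assumes "k \<le> n"
  shows "qbin (Suc n) (Suc k) = q powi (int (Suc k)) * qbin n (Suc k) + q powi (- int (n - k)) * qbin n k"
  using assms qint_add[of "n - k" "Suc k"] by (intro qbin_Suc_aux) simp_all

lemma qbin_Suc':
  assumes "k \<le> n"
  shows "qbin (Suc n) (Suc k) = q powi (- int (Suc k)) * qbin n (Suc k) + q powi (int (n - k)) * qbin n k"
  using assms qint_add'[of "n - k" "Suc k"] by (intro qbin_Suc_aux) simp_all

subsection \<open>The ring of integral Laurent polynomials\<close>

lemma int_laurentI: "finite K \<Longrightarrow> (\<Sum>k\<in>K. of_int (c k) * q powi k) \<in> int_laurent"
  unfolding int_laurent_def by blast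

lemma int_laurent_monom: "of_int a * q powi k \<in> int_laurent"
  using int_laurentI[of "{k}" "\<lambda>_. a"] by simp

lemma int_laurent_0 [simp, intro]: "0 \<in> int_laurent"
  using int_laurent_monom[of 0] by simp

lemma int_laurent_of_int [simp, intro]: "of_int a \<in> int_laurent"
  using int_laurent_monom[of a 0] by simp

lemma int_laurent_1 [simp, intro]: "1 \<in> int_laurent"
  using int_laurent_of_int[of 1] by simp

lemma int_laurent_powi [simp, intro]: "q powi k \<in> int_laurent"
  using int_laurent_monom[of 1] by simp

lemma int_laurent_add [intro]:
  assumes "x \<in> int_laurent" "y \<in> int_laurent"
  shows "x + y \<in> int_laurent"
proof -
  obtain K c where x: "finite K" "x = (\<Sum>k\<in>K. of_int (c k) * q powi k)"
    using assms(1) unfolding int_laurent_def by blast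
  obtain L d where y: "finite L" "y = (\<Sum>k\<in>L. of_int (d k) * q powi k)"
    using assms(2) unfolding int_laurent_def by blast
  define c' where "c' = (\<lambda>k. if k \<in> K then c k else 0)"
  define d' where "d' = (\<lambda>k. if k \<in> L then d k else 0)"
  have "x = (\<Sum>k\<in>K \<union> L. of_int (c' k) * q powi k)"
    unfolding x by (rule sum.mono_neutral_cong_left) (auto simp: x y c'_def)
  moreover have "y = (\<Sum>k\<in>K \<union> L. of_int (d' k) * q powi k)"
    unfolding y by (rule sum.mono_neutral_cong_left) (auto simp: x y d'_def)
  ultimately have "x + y = (\<Sum>k\<in>K \<union> L. of_int (c' k + d' k) * q powi k)"
    by (simp add: sum.distrib algebra_simps)
  thus ?thesis using x y by (simp only: int_laurentI finite_Un)
qed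

lemma int_laurent_sum [intro]: "(\<And>i. i \<in> I \<Longrightarrow> f i \<in> int_laurent) \<Longrightarrow> sum f I \<in> int_laurent"
  by (induction I rule: infinite_finite_induct) auto

lemma int_laurent_mult [intro]:
  assumes "x \<in> int_laurent" "y \<in> int_laurent"
  shows "x * y \<in> int_laurent"
proof -
  obtain K c where x: "finite K" "x = (\<Sum>k\<in>K. of_int (c k) * q powi k)"
    using assms(1) unfolding int_laurent_def by blast
  obtain L d where y: "finite L" "y = (\<Sum>k\<in>L. of_int (d k) * q powi k)"
    using assms(2) unfolding int_laurent_def by blast
  have "x * y = (\<Sum>k\<in>K. \<Sum>l\<in>L. of_int (c k * d l) * q powi (k + l))"
    by (simp add: x y sum_product power_int_add mult_ac)
  also have "\<dots> \<in> int_laurent"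
    by (intro int_laurent_sum int_laurent_monom)
  finally show ?thesis .
qed

lemma int_laurent_uminus [intro]: "x \<in> int_laurent \<Longrightarrow> - x \<in> int_laurent"
  using int_laurent_mult[OF int_laurent_of_int[of "-1"]] by simp

lemma int_laurent_diff [intro]: "x \<in> int_laurent \<Longrightarrow> y \<in> int_laurent \<Longrightarrow> x - y \<in> int_laurent"
  using int_laurent_add[OF _ int_laurent_uminus] by simp

lemma int_laurent_power [intro]: "x \<in> int_laurent \<Longrightarrow> x ^ n \<in> int_laurent"
  by (induction n) auto

lemma int_laurent_prod [intro]: "(\<And>i. i \<in> I \<Longrightarrow> f i \<in> int_laurent) \<Longrightarrow> prod f I \<in> int_laurent"
  by (induction I rule: infinite_finite_induct) auto

lemma int_laurent_q [simp, intro]: "q \<in> int_laurent" "inverse q \<in> int_laurent"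
  using int_laurent_powi[of 1] int_laurent_powi[of "-1"] by (simp_all add: power_int_minus)

lemma int_laurent_qdiff [simp, intro]: "qdiff \<in> int_laurent"
  unfolding qdiff_def by (intro int_laurent_diff int_laurent_q)

lemma int_laurent_qint [simp, intro]: "qint n \<in> int_laurent"
  by (induction n) (auto simp: qint_Suc intro!: int_laurent_add int_laurent_mult)

text \<open>Integrality is read off from a Pascal rule, whose coefficients are powers of q; the
  quotient of factorials does not show it.\<close>

lemma int_laurent_qbin [simp, intro]: "qbin n k \<in> int_laurent"
proof (induction n arbitrary: k)
  case 0
  show ?case by (simp add: qbin_0_left)
next
  case (Suc n)
  show ?case
  proof (cases k)
    case (Suc k')
    show ?thesis
    proof (cases "k' \<le> n")
      case True
      show ?thesis unfolding Suc qbin_Suc[OF True]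
        by (intro int_laurent_add int_laurent_mult Suc.IH int_laurent_powi)
    qed (simp add: Suc qbin_eq_0)
  qed simp
qed

section \<open>The tensor functor on link diagrams\<close>

text \<open>A string lists the signs of the strands from left to right, \<open>True\<close> standing for \<open>+\<close>.\<close>

type_synonym vec = "bool list \<Rightarrow> scalar"

text \<open>The weights satisfy \<open>capw True * cupw False = 1\<close> and
  \<open>capw False * cupw True = 1\<close>, which straightens a zigzag, and the products
  \<open>capw b * cupw b\<close> add up to -q - 1/q, the value of a circle. The uneven distribution
  over cup and cap avoids square roots and keeps both in Z[q,1/q].\<close>

definition cupw :: "bool \<Rightarrow> scalar" where "cupw b = (if b then 1 else - inverse q)"
definition capw :: "bool \<Rightarrow> scalar" where "capw b = (if b then - q else 1)"

text \<open>A vector is stored as its coefficient function, so an operator tells which coefficients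
  below a layer contribute to the coefficient of \<open>s\<close> above it. Lengths are not part of
  the type: a vector is meaningful only on strings as long as its level is wide, and most equalities
  below are restricted to one length.\<close>

definition opcup :: "nat \<Rightarrow> vec \<Rightarrow> vec" where
  "opcup i v s = (if Suc i < length s \<and> s ! i \<noteq> s ! Suc i
     then cupw (s ! i) * v (take i s @ drop (i + 2) s) else 0)"

definition opcap :: "nat \<Rightarrow> vec \<Rightarrow> vec" where
  "opcap i v s = capw True * v (take i s @ True # False # drop i s)
     + capw False * v (take i s @ False # True # drop i s)"

text \<open>On vertices the identity is a mere placeholder: the diagrams identified with link
  brackets are cabled ones, which are \<open>vertex_free\<close>.\<close>

fun layer_op :: "layer \<Rightarrow> vec \<Rightarrow> vec" where
  "layer_op (Cup i) v = opcup i v"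
| "layer_op (Cap i) v = opcap i v"
| "layer_op (Pos i) v = (\<lambda>s. qh * v s + inverse qh * opcup i (opcap i v) s)"
| "layer_op (Neg i) v = (\<lambda>s. inverse qh * v s + qh * opcup i (opcap i v) s)"
| "layer_op (Merge i) v = v"
| "layer_op (Split i) v = v"

definition ev :: "diagram \<Rightarrow> vec \<Rightarrow> vec" where
  "ev D v = fold layer_op D v"

definition vac :: vec where "vac s = (if s = [] then 1 else 0)"

lemma ev_Nil [simp]: "ev [] v = v"
  and ev_Cons: "ev (l # D) v = ev D (layer_op l v)"
  and ev_append: "ev (D @ D') v = ev D' (ev D v)"
  by (simp_all add: ev_def)

lemma opcup_pat: "length p = i \<Longrightarrow> opcup i v (p @ a # b # r) = (if a \<noteq> b then cupw a * v (p @ r) else 0)"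
  by (auto simp: opcup_def nth_append)

lemma opcap_pat: "length p = i \<Longrightarrow> opcap i v (p @ r) = - q * v (p @ True # False # r) + v (p @ False # True # r)"
  by (auto simp: opcap_def capw_def)

lemma split_list2:
  assumes "Suc i < length s"
  obtains p a b r where "s = p @ a # b # r" "length p = i"
proof
  show "s = take i s @ s ! i # s ! Suc i # drop (Suc (Suc i)) s"
    using assms by (metis Cons_nth_drop_Suc Suc_lessD append_take_drop_id)
qed (use assms in simp)

lemma split_list1:
  assumes "i \<le> length s"
  obtains p r where "s = p @ r" "length p = i"
  by (rule that[of "take i s" "drop i s"]) (use assms in simp_all)

lemma layer_op_lin: "layer_op l (\<lambda>s. a * v s + b * w s) = (\<lambda>s. a * layer_op l v s + b * layer_op l w s)"
  by (cases l) (auto simp: fun_eq_iff opcup_def opcap_def algebra_simps)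

lemma ev_lin: "ev D (\<lambda>s. a * v s + b * w s) = (\<lambda>s. a * ev D v s + b * ev D w s)"
  by (induction D arbitrary: v w) (simp_all add: ev_Cons layer_op_lin)

lemma layer_op_cong:
  assumes "\<And>s. length s = n \<Longrightarrow> v s = w s" "fits l n" "length s = width_after l n"
    "\<nexists>i. l = Merge i" "\<nexists>i. l = Split i"
  shows "layer_op l v s = layer_op l w s"
proof (cases l)
  case (Cup i)
  thus ?thesis using assms by (auto simp: opcup_def)
next
  case (Cap i)
  thus ?thesis using assms by (auto simp: opcap_def)
next
  case (Pos i)
  thus ?thesis using assms by (auto simp: opcup_def opcap_def)
next
  case (Neg i)
  thus ?thesis using assms by (auto simp: opcup_def opcap_def)
qed (use assms in auto)

subsection \<open>Composable layers\<close>

fun wfd :: "nat \<Rightarrow> diagram \<Rightarrow> nat \<Rightarrow> bool" where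
  "wfd n [] m \<longleftrightarrow> n = m"
| "wfd n (l # D) m \<longleftrightarrow> fits l n \<and> wfd (width_after l n) D m"

lemma wfd_append: "wfd n (D @ D') m \<longleftrightarrow> (\<exists>k. wfd n D k \<and> wfd k D' m)"
  by (induction D arbitrary: n) auto

lemma wfd_iff: "wfd n D m \<longleftrightarrow>
  (\<forall>k<length D. fits (D ! k) (fold width_after (take k D) n)) \<and> fold width_after D n = m"
proof (induction D arbitrary: n)
  case (Cons l D)
  show ?case by (auto simp: Cons.IH less_Suc_eq_0_disj)
qed simp

definition vertex_free :: "diagram \<Rightarrow> bool" where
  "vertex_free D \<longleftrightarrow> (\<forall>l\<in>set D. (\<nexists>i. l = Merge i \<or> l = Split i))"

lemma ev_cong:
  assumes "wfd n D m" "vertex_free D" "\<And>s. length s = n \<Longrightarrow> v s = w s" "length s = m"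
  shows "ev D v s = ev D w s"
  using assms
proof (induction D arbitrary: n v w)
  case (Cons l D)
  have "ev D (layer_op l v) s = ev D (layer_op l w) s"
    by (rule Cons.IH[of "width_after l n"])
      (use Cons.prems layer_op_cong[of n v w l] in \<open>auto simp: vertex_free_def\<close>)
  thus ?case by (simp add: ev_Cons)
qed simp

subsection \<open>Components of diagrams without crossings\<close>

definition conn :: "diagram \<Rightarrow> (point \<times> point) set" where
  "conn D = (linked D \<union> (linked D)\<inverse>)\<^sup>*"

lemma conn_refl [simp]: "(p, p) \<in> conn D"
  by (simp add: conn_def)

lemma conn_sym: "(p, p') \<in> conn D \<Longrightarrow> (p', p) \<in> conn D"
  unfolding conn_def by (rule symD[OF sym_rtrancl[OF sym_Un_converse]])

lemma conn_trans: "(p, p') \<in> conn D \<Longrightarrow> (p', p'') \<in> conn D \<Longrightarrow> (p, p'') \<in> conn D"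
  unfolding conn_def by (rule rtrancl_trans)

lemma linked_conn: "(p, p') \<in> linked D \<Longrightarrow> (p, p') \<in> conn D"
  unfolding conn_def by blast

lemma edge_of_eq_iff:
  assumes "p' \<in> points D"
  shows "edge_of D p = edge_of D p' \<longleftrightarrow> (p, p') \<in> conn D"
proof
  assume "edge_of D p = edge_of D p'"
  moreover have "p' \<in> edge_of D p'" using assms by (simp add: edge_of_def)
  ultimately have "p' \<in> edge_of D p" by simp
  thus "(p, p') \<in> conn D" by (simp add: edge_of_def conn_def)
next
  assume *: "(p, p') \<in> conn D"
  show "edge_of D p = edge_of D p'"
    unfolding edge_of_def conn_def[symmetric]
    using conn_trans[OF *] conn_trans[OF conn_sym[OF *]] by blast
qed

text \<open>A numbering of the components. It can be updated when a layer is added on top, whereas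
  the point sets produced by \<open>edge_of\<close> change with every layer.\<close>

definition labels :: "diagram \<Rightarrow> (point \<Rightarrow> nat) \<Rightarrow> bool" where
  "labels D \<kappa> \<longleftrightarrow> (\<forall>(p, p') \<in> linked D. \<kappa> p = \<kappa> p') \<and>
     (\<forall>p\<in>points D. \<forall>p'\<in>points D. \<kappa> p = \<kappa> p' \<longrightarrow> (p, p') \<in> conn D)"

lemma labels_conn:
  assumes "labels D \<kappa>" "(p, p') \<in> conn D"
  shows "\<kappa> p = \<kappa> p'"
  using assms(2) unfolding conn_def
  by induction (use assms(1) in \<open>auto simp: labels_def\<close>)

lemma card_edges_labels:
  assumes "labels D \<kappa>"
  shows "card (edges D) = card (\<kappa> ` points D)"
proof -
  have *: "(p, p') \<in> conn D \<longleftrightarrow> \<kappa> p' = \<kappa> p" if "p \<in> points D" "p' \<in> points D" for p p'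
    using assms that labels_conn[OF assms, of p p'] by (auto simp: labels_def)
  hence "edge_of D p = {p' \<in> points D. \<kappa> p' = \<kappa> p}" if "p \<in> points D" for p
    using *[OF that] unfolding edge_of_def conn_def[symmetric] by (intro Collect_cong conj_cong refl) simp
  hence "edges D = (\<lambda>y. {p' \<in> points D. \<kappa> p' = y}) ` (\<kappa> ` points D)"
    unfolding edges_def image_image by (rule image_cong[OF refl])
  moreover have "inj_on (\<lambda>y. {p' \<in> points D. \<kappa> p' = y}) (\<kappa> ` points D)"
    by (rule inj_onI) blast
  ultimately show ?thesis by (simp add: card_image)
qed

lemma width_snoc: "k \<le> length D \<Longrightarrow> width (D @ [l]) k = width D k"
  by (simp add: width_def)

lemma width_snoc_top: "width (D @ [l]) (Suc (length D)) = width_after l (width D (length D))"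
  by (simp add: width_def)

lemma points_snoc: "points (D @ [l]) =
    points D \<union> {(Suc (length D), i) | i. i < width_after l (width D (length D))}"
  by (auto simp: points_def width_snoc width_snoc_top le_Suc_eq)

lemma arcs_levels:
  assumes "(p, p') \<in> arcs l k"
  shows "fst p \<le> Suc k \<and> fst p' \<le> Suc k"
  using assms by (cases l) auto

lemma linked_snoc: "linked (D @ [l]) = linked D \<union>
    (arcs l (length D) \<inter> points (D @ [l]) \<times> points (D @ [l]))"
proof -
  let ?A = "\<Union>k<length D. arcs (D ! k) k"
  have "(\<Union>k<length D. arcs ((D @ [l]) ! k) k) = ?A"
    by (rule SUP_cong) (simp_all add: nth_append)
  moreover have "{..<length (D @ [l])} = insert (length D) {..<length D}" by auto
  ultimately have 1: "(\<Union>k<length (D @ [l]). arcs ((D @ [l]) ! k) k) = ?A \<union> arcs l (length D)"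
    by (simp only: UN_insert nth_append_length Un_commute)
  \<comment> \<open>Arcs of the lower layers reach level \<open>length D\<close> at most, so the
    layer \<open>l\<close> gives them no new endpoints.\<close>
  have "p \<in> points D \<and> p' \<in> points D"
    if "k < length D" "(p, p') \<in> arcs (D ! k) k" "p \<in> points (D @ [l])" "p' \<in> points (D @ [l])" for p p' k
    using arcs_levels[OF that(2)] that(1,3,4) by (auto simp: points_snoc)
  moreover have "points D \<subseteq> points (D @ [l])" unfolding points_snoc by blast
  ultimately have 2: "?A \<inter> points (D @ [l]) \<times> points (D @ [l]) = ?A \<inter> points D \<times> points D"
    by (intro subset_antisym subsetI; elim IntE UN_E; clarsimp) (fast | blast)+
  show ?thesis unfolding linked_def 1 Int_Un_distrib2 2 ..
qed

lemma finite_points: "finite (points D)"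
proof -
  have "points D \<subseteq> (SIGMA k:{..length D}. {..<width D k})"
    by (auto simp: points_def)
  thus ?thesis by (rule finite_subset) auto
qed

lemma conn_snoc: "(p, p') \<in> conn D \<Longrightarrow> (p, p') \<in> conn (D @ [l])"
  unfolding conn_def by (rule rtrancl_mono[THEN subsetD]) (auto simp: linked_snoc)

text \<open>
  \<open>noncrossing ls v\<close>: the vector \<open>v\<close> is the value of a planar family of arcs whose endpoints, from left to
  right, belong to the components \<open>ls\<close>.
\<close>

inductive noncrossing :: "nat list \<Rightarrow> vec \<Rightarrow> bool" where
  noncrossing_Nil: "noncrossing [] vac"
| noncrossing_cup: "noncrossing (A @ B) v \<Longrightarrow> x \<notin> set (A @ B) \<Longrightarrow> noncrossing (A @ x # x # B) (opcup (length A) v)"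

lemma noncrossing_relabel: "noncrossing ls v \<Longrightarrow> inj_on g (set ls) \<Longrightarrow> noncrossing (map g ls) v"
proof (induction rule: noncrossing.induct)
  case (noncrossing_cup A B v x)
  have "noncrossing (map g A @ map g B) v"
    using noncrossing_cup.IH noncrossing_cup.prems by (auto simp: inj_on_def)
  moreover have "g x \<notin> set (map g A @ map g B)"
    using noncrossing_cup.prems noncrossing_cup.hyps(2) by (force simp: inj_on_def)
  ultimately have "noncrossing (map g A @ g x # g x # map g B) (opcup (length (map g A)) v)"
    by (rule noncrossing.noncrossing_cup)
  thus ?case by simp
qed (simp add: noncrossing.noncrossing_Nil)

section \<open>Temperley--Lieb relations between a cap and a cup\<close>

lemma opcap_opcup_same:
  assumes "i \<le> length s"
  shows "opcap i (opcup i v) s = - qint 2 * v s"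
proof -
  obtain p r where s: "s = p @ r" "length p = i" using assms by (rule split_list1)
  show ?thesis unfolding s(1) using s(2)
    by (simp add: opcap_pat opcup_pat cupw_def qint_2 algebra_simps)
qed

lemma opcap_opcup_right:
  assumes "i < length s"
  shows "opcap i (opcup (Suc i) v) s = v s"
proof -
  obtain p r where s: "s = p @ r" "length p = i" using assms by (metis less_imp_le split_list1)
  obtain a r' where r: "r = a # r'" using s assms by (cases r) auto
  have "opcup (Suc i) v (p @ x # y # r) = (if y \<noteq> a then cupw y * v (p @ x # r') else 0)" for x y
    using opcup_pat[of "p @ [x]" "Suc i" v y a r'] s by (simp add: r)
  thus ?thesis unfolding s(1) using s(2) by (cases a) (simp_all add: opcap_pat cupw_def r)
qed

lemma opcap_opcup_left:
  assumes "i < length s"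
  shows "opcap (Suc i) (opcup i v) s = v s"
proof -
  obtain p r where s: "s = p @ r" "length p = i" using assms by (metis less_imp_le split_list1)
  obtain a r' where r: "r = a # r'" using s assms by (cases r) auto
  have "opcap (Suc i) (opcup i v) (p @ a # r') = - q * opcup i v (p @ a # True # False # r')
     + opcup i v (p @ a # False # True # r')"
    using opcap_pat[of "p @ [a]" "Suc i" "opcup i v" r'] s by simp
  thus ?thesis unfolding s(1) r using s(2) by (cases a) (simp_all add: opcup_pat cupw_def)
qed

lemma opcap_opcup_far_left:
  assumes "length z = k"
  shows "opcap (length p) (opcup (length p + 2 + k) v) (p @ z @ a # b # r) =
    opcup (length p + k) (opcap (length p) v) (p @ z @ a # b # r)"
proof -
  have 1: "opcup (length p + 2 + k) v (p @ x # y # z @ a # b # r) =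
      (if a \<noteq> b then cupw a * v (p @ x # y # z @ r) else 0)" for x y
    using opcup_pat[of "p @ x # y # z" "length p + 2 + k" v a b r] assms by simp
  have 2: "opcup (length p + k) w (p @ z @ a # b # r) = (if a \<noteq> b then cupw a * w (p @ z @ r) else 0)" for w
    using opcup_pat[of "p @ z" "length p + k" w a b r] assms by simp
  show ?thesis unfolding 2 opcap_pat[OF refl] 1 by (simp add: algebra_simps)
qed

lemma opcap_opcup_far_right:
  assumes "length z = k"
  shows "opcap (length p + 2 + k) (opcup (length p) v) (p @ a # b # z @ r) =
    opcup (length p) (opcap (length p + k) v) (p @ a # b # z @ r)"
proof -
  have 1: "opcap (length p + 2 + k) w (p @ a # b # z @ r) =
      - q * w (p @ a # b # z @ True # False # r) + w (p @ a # b # z @ False # True # r)" for w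
    using opcap_pat[of "p @ a # b # z" "length p + 2 + k" w r] assms by simp
  have 2: "opcap (length p + k) v (p @ z @ r) =
      - q * v (p @ z @ True # False # r) + v (p @ z @ False # True # r)"
    using opcap_pat[of "p @ z" "length p + k" v r] assms by simp
  show ?thesis unfolding 1 opcup_pat[OF refl] 2 by (simp add: algebra_simps)
qed

lemma noncrossing_count: "noncrossing ls v \<Longrightarrow> x \<in> set ls \<Longrightarrow> count_list ls x = 2"
  by (induction rule: noncrossing.induct) (auto simp: count_list_0_iff)

text \<open>The cap is compared with the cup added last. Sharing both ends closes a circle, sharing
  one end straightens a zigzag, and sharing none lets the cap pass to the smaller family, where
  induction applies. The relabelling \<open>id(b := a)\<close> records that the cap joins two
  components.\<close>

lemma noncrossing_cap:
  assumes "noncrossing ls v" "ls = A @ a # b # B"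
  shows "\<exists>v'. noncrossing (map (id(b := a)) (A @ B)) v' \<and>
    (\<forall>s. length s = length (A @ B) \<longrightarrow> opcap (length A) v s = (if a = b then - qint 2 else 1) * v' s)"
  using assms
proof (induction arbitrary: A a b B rule: noncrossing.induct)
  case (noncrossing_cup A1 B1 v x)
  let ?g = "id(b := a)"
  consider (same) "A1 = A" | (right) "A1 = A @ [a]" | (left) "A = A1 @ [x]"
    | (far_left) Z where "A1 = A @ a # b # Z" | (far_right) Z where "A = A1 @ x # x # Z"
    using noncrossing_cup.prems
    by (auto simp: append_eq_append_conv2 Cons_eq_append_conv append_eq_Cons_conv)
  thus ?case
  proof cases
    case same
    hence [simp]: "a = x" "b = x" "B = B1" using noncrossing_cup.prems by auto
    have "?g = id" by auto
    thus ?thesis using noncrossing_cup.hyps(1) same opcap_opcup_same[of "length A" _ v]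
      by (intro exI[of _ v]) auto
  next
    case right
    hence [simp]: "b = x" "B = x # B1" using noncrossing_cup.prems by auto
    have "a \<noteq> x" using right noncrossing_cup.hyps by auto
    \<comment> \<open>Here \<open>b\<close> is the fresh label \<open>x\<close>: only the other end
      of the last cup is renamed, and it becomes an end of the component \<open>a\<close>.\<close>
    have "map ?g (A @ B) = A1 @ B1"
      using right noncrossing_cup.hyps(2) by (auto simp: map_idI)
    hence "noncrossing (map ?g (A @ B)) v" using noncrossing_cup.hyps(1) by simp
    thus ?thesis
    proof (intro exI[of _ v] conjI allI impI)
      fix s :: "bool list" assume "length s = length (A @ B)"
      thus "opcap (length A) (opcup (length A1) v) s = (if a = b then - qint 2 else 1) * v s"
        using right opcap_opcup_right[of "length A" s v] \<open>a \<noteq> x\<close> by simp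
    qed
  next
    case left
    hence [simp]: "a = x" "B1 = b # B" using noncrossing_cup.prems by auto
    have "b \<noteq> x" using left noncrossing_cup.hyps by auto
    \<comment> \<open>Here \<open>a\<close> is the fresh label \<open>x\<close>, so renaming
      \<open>b\<close> to it identifies no two labels of the smaller family.\<close>
    have "inj_on ?g (set (A1 @ B1))"
      using noncrossing_cup.hyps(2) by (auto simp: inj_on_def)
    hence "noncrossing (map ?g (A1 @ B1)) v" using noncrossing_relabel noncrossing_cup.hyps(1) by blast
    moreover have "map ?g (A1 @ B1) = map ?g (A @ B)" using left by simp
    ultimately have "noncrossing (map ?g (A @ B)) v" by (simp only:)
    thus ?thesis
    proof (intro exI[of _ v] conjI allI impI)
      fix s :: "bool list" assume "length s = length (A @ B)"
      thus "opcap (length A) (opcup (length A1) v) s = (if a = b then - qint 2 else 1) * v s"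
        using left opcap_opcup_left[of "length A1" s v] \<open>b \<noteq> x\<close> by simp
    qed
  next
    case far_left
    hence B: "B = Z @ x # x # B1" using noncrossing_cup.prems by auto
    have fresh: "x \<notin> set (map ?g ((A @ Z) @ B1))" "x \<noteq> a" "x \<noteq> b"
      using far_left noncrossing_cup.hyps by auto
    obtain v' where v': "noncrossing (map ?g (A @ (Z @ B1))) v'"
      "\<And>s. length s = length (A @ (Z @ B1)) \<Longrightarrow> opcap (length A) v s = (if a = b then - qint 2 else 1) * v' s"
    proof -
      have "A1 @ B1 = A @ a # b # Z @ B1" using far_left by simp
      from noncrossing_cup.IH[OF this] show ?thesis using that by blast
    qed
    have "noncrossing (map ?g (A @ Z) @ x # x # map ?g B1) (opcup (length (map ?g (A @ Z))) v')"
      by (rule noncrossing.noncrossing_cup) (use v'(1) fresh in auto)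
    moreover have "map ?g (A @ Z) @ x # x # map ?g B1 = map ?g (A @ B)"
      using B fresh by simp
    ultimately have "noncrossing (map ?g (A @ B)) (opcup (length (A @ Z)) v')" by (simp only: length_map)
    moreover have "opcap (length A) (opcup (length A1) v) s =
        (if a = b then - qint 2 else 1) * opcup (length (A @ Z)) v' s" if ls: "length s = length (A @ B)" for s
    proof -
      obtain pz c d r where s: "s = pz @ c # d # r" "length pz = length (A @ Z)"
        using ls B by (auto intro: split_list2[of "length (A @ Z)" s])
      obtain p z where pz: "pz = p @ z" "length p = length A"
        using s by (auto intro: split_list1[of "length A" pz])
      have z: "length z = length Z" using pz s by simp
      have "length r = length B1" using ls s B by simp
      hence *: "opcap (length A) v (p @ z @ r) = (if a = b then - qint 2 else 1) * v' (p @ z @ r)"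
        using v'(2)[of "p @ z @ r"] pz z by simp
      have "opcap (length A) (opcup (length A1) v) s = opcup (length p + length Z) (opcap (length p) v) s"
        using opcap_opcup_far_left[OF z, of p v c d r] pz far_left s by simp
      also have "\<dots> = (if c \<noteq> d then cupw c * opcap (length A) v (p @ z @ r) else 0)"
        using opcup_pat[of "p @ z" "length p + length Z" _ c d r] s pz z by simp
      also have "\<dots> = (if a = b then - qint 2 else 1) * opcup (length (A @ Z)) v' s"
        using opcup_pat[of "p @ z" "length (A @ Z)" v' c d r] s pz z * by simp
      finally show ?thesis .
    qed
    ultimately show ?thesis by blast
  next
    case far_right
    hence B1: "B1 = Z @ a # b # B" using noncrossing_cup.prems by auto
    have fresh: "x \<notin> set (map ?g (A1 @ Z @ B))" "x \<noteq> a" "x \<noteq> b"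
      using B1 noncrossing_cup.hyps by auto
    obtain v' where v': "noncrossing (map ?g ((A1 @ Z) @ B)) v'"
      "\<And>s. length s = length ((A1 @ Z) @ B) \<Longrightarrow>
        opcap (length (A1 @ Z)) v s = (if a = b then - qint 2 else 1) * v' s"
    proof -
      have "A1 @ B1 = (A1 @ Z) @ a # b # B" using B1 by simp
      from noncrossing_cup.IH[OF this] show ?thesis using that by blast
    qed
    have "noncrossing (map ?g A1 @ x # x # map ?g (Z @ B)) (opcup (length (map ?g A1)) v')"
      by (rule noncrossing.noncrossing_cup) (use v'(1) fresh in auto)
    moreover have "map ?g A1 @ x # x # map ?g (Z @ B) = map ?g (A @ B)"
      using far_right fresh by simp
    ultimately have "noncrossing (map ?g (A @ B)) (opcup (length A1) v')" by (simp only: length_map)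
    moreover have "opcap (length A) (opcup (length A1) v) s =
        (if a = b then - qint 2 else 1) * opcup (length A1) v' s" if ls: "length s = length (A @ B)" for s
    proof -
      have "Suc (length A1) < length s" using ls far_right by simp
      then obtain p c d r where s: "s = p @ c # d # r" "length p = length A1"
        by (rule split_list2)
      obtain z r' where r: "r = z @ r'" "length z = length Z"
        using s ls far_right by (auto intro: split_list1[of "length Z" r])
      have "length r' = length B" using ls s r far_right by simp
      hence *: "opcap (length A1 + length Z) v (p @ z @ r') = (if a = b then - qint 2 else 1) * v' (p @ z @ r')"
        using v'(2)[of "p @ z @ r'"] r s by simp
      have "opcap (length A) (opcup (length A1) v) s = opcup (length p) (opcap (length p + length Z) v) s"
        using opcap_opcup_far_right[OF r(2), of p v c d r'] far_right s r by simp
      also have "\<dots> = (if c \<noteq> d then cupw c * opcap (length A1 + length Z) v (p @ z @ r') else 0)"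
        using s r by (simp add: opcup_pat)
      also have "\<dots> = (if a = b then - qint 2 else 1) * opcup (length A1) v' s"
        using s r * by (simp add: opcup_pat)
      finally show ?thesis .
    qed
    ultimately show ?thesis by blast
  qed
qed simp

lemma noncrossing_same_fresh:
  assumes "noncrossing (A @ a # a # B) v"
  shows "a \<notin> set (A @ B)"
  using noncrossing_count[OF assms, of a] by (auto simp: count_list_0_iff)

lemma noncrossing_diff_mem:
  assumes "noncrossing (A @ a # b # B) v" "a \<noteq> b"
  shows "a \<in> set (A @ B)"
proof -
  have "count_list (A @ B) a \<noteq> 0" using noncrossing_count[OF assms(1), of a] assms(2) by simp
  thus ?thesis by (simp only: count_list_0_iff not_not)
qed

text \<open>The components seen so far are split into \<open>c\<close> closed circles, each worth
  -[2], and the arcs still open at the top level, whose planar pattern is \<open>v\<close>. At width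
  0 nothing is open and the number of circles is the number of labels.\<close>

lemma planar_value:
  assumes "wfd 0 D w" "\<forall>l\<in>set D. \<exists>i. l = Cup i \<or> l = Cap i"
  shows "\<exists>\<kappa> ls v c. labels D \<kappa> \<and> ls = map (\<lambda>i. \<kappa> (length D, i)) [0..<w] \<and> noncrossing ls v \<and>
     (\<forall>s. length s = w \<longrightarrow> ev D vac s = (- qint 2) ^ c * v s) \<and>
     card (\<kappa> ` points D) = c + card (set ls)"
  using assms
proof (induction D arbitrary: w rule: rev_induct)
  case Nil
  have "labels [] (\<lambda>_. 0)" by (simp add: labels_def linked_def points_def width_def)
  thus ?case using Nil noncrossing_Nil by (auto simp: points_def width_def intro!: exI[of _ "\<lambda>_. 0"] exI[of _ 0] exI[of _ vac])
next
  case (snoc l D)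
  let ?n = "length D"
  obtain w0 where w0: "wfd 0 D w0" "fits l w0" "w = width_after l w0"
    using snoc.prems(1) by (auto simp: wfd_append)
  have width: "width D ?n = w0" using w0(1) by (simp add: wfd_iff width_def)
  obtain \<kappa> ls v c where IH: "labels D \<kappa>" "ls = map (\<lambda>i. \<kappa> (?n, i)) [0..<w0]" "noncrossing ls v"
      "\<And>s. length s = w0 \<Longrightarrow> ev D vac s = (- qint 2) ^ c * v s" "card (\<kappa> ` points D) = c + card (set ls)"
    using snoc.IH[OF w0(1)] snoc.prems(2) by auto
  have len: "length ls = w0" by (simp add: IH(2))
  have nth_ls: "ls ! i = \<kappa> (?n, i)" if "i < w0" for i using that by (simp add: IH(2))
  have top: "(?n, i) \<in> points D" if "i < w0" for i using that width by (simp add: points_def)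
  have old_lt: "fst p \<le> ?n" if "p \<in> points D" for p using that by (auto simp: points_def)
  have notold: "(Suc ?n, j) \<notin> points D" for j using old_lt by fastforce
  have pts: "points (D @ [l]) = points D \<union> {(Suc ?n, i) | i. i < w}"
    by (simp add: points_snoc width w0)
  have old_lab: "\<kappa> p = \<kappa> p'" if "(p, p') \<in> linked D" for p p' using IH(1) that by (auto simp: labels_def)
  have old_linked: "p \<in> points D" "p' \<in> points D" if "(p, p') \<in> linked D" for p p'
    using that by (auto simp: linked_def)
  have old_conn: "(p, p') \<in> conn (D @ [l])" if "p \<in> points D" "p' \<in> points D" "\<kappa> p = \<kappa> p'" for p p'
    using IH(1) that conn_snoc by (auto simp: labels_def)
  have arc_conn: "(p, p') \<in> conn (D @ [l])"
    if "(p, p') \<in> arcs l ?n" "p \<in> points (D @ [l])" "p' \<in> points (D @ [l])" for p p'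
    using that by (intro linked_conn) (simp add: linked_snoc)
  consider (cup) i where "l = Cup i" | (cap) i where "l = Cap i"
    using snoc.prems(2) by auto
  thus ?case
  proof cases
    case cup
    have i: "i \<le> w0" "w = w0 + 2" using w0 cup by auto
    obtain x where x: "x \<notin> \<kappa> ` points D"
      using finite_points[of D] ex_new_if_finite[OF infinite_UNIV_nat] by blast
    define ls' where "ls' = take i ls @ x # x # drop i ls"
    define \<kappa>' where "\<kappa>' = (\<lambda>(k, j). if k = Suc ?n then ls' ! j else \<kappa> (k, j))"
    have lens': "length ls' = w" using i len by (simp add: ls'_def)
    have nth': "ls' ! j = (if j < i then \<kappa> (?n, j) else if j \<le> Suc i then x else \<kappa> (?n, j - 2))"
      if "j < w" for j
      using that i len by (auto simp: ls'_def nth_append nth_Cons' nth_ls)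
    have old: "\<kappa>' p = \<kappa> p" if "p \<in> points D" for p
      using old_lt[OF that] by (auto simp: \<kappa>'_def split: prod.splits)
    have new: "\<kappa>' (Suc ?n, j) = ls' ! j" for j by (simp add: \<kappa>'_def)
    have x_ls: "x \<notin> set ls" using x top by (auto simp: IH(2))
    have rep: "\<exists>p'\<in>points D. (p, p') \<in> conn (D @ [l]) \<and> \<kappa> p' = \<kappa>' p"
      if px: "p \<in> points (D @ [l])" "\<kappa>' p \<noteq> x" for p
    proof (cases "p \<in> points D")
      case True
      thus ?thesis using old[OF True] by (intro bexI[of _ p]) auto
    next
      case False
      then obtain j where p: "p = (Suc ?n, j)" "j < w" using px(1) pts by auto
      hence j: "j < i \<or> Suc i < j" using px(2) nth' new by (auto split: if_splits)
      define j' where "j' = (if j < i then j else j - 2)"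
      have j': "j' < w0" "((?n, j'), p) \<in> arcs l ?n" using j p i by (auto simp: j'_def cup intro!: exI[of _ "j - 2"])
      have "\<kappa> (?n, j') = \<kappa>' p" using j p nth' new by (auto simp: j'_def)
      thus ?thesis using arc_conn[OF j'(2)] top[OF j'(1)] px(1) pts conn_sym by blast
    qed
    have xtop: "p = (Suc ?n, i) \<or> p = (Suc ?n, Suc i)" if px: "p \<in> points (D @ [l])" "\<kappa>' p = x" for p
    proof -
      have "p \<notin> points D" using px x old[of p] by (metis imageI)
      then obtain j where p: "p = (Suc ?n, j)" "j < w" using px(1) pts by auto
      have "ls' ! j = x" using px p new by simp
      moreover have "\<kappa> (?n, j) \<noteq> x" if "j < w0" for j using x top[OF that] by auto
      ultimately show ?thesis using nth'[OF p(2)] p i by (auto split: if_splits)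
    qed
    have cupc: "((Suc ?n, i), (Suc ?n, Suc i)) \<in> conn (D @ [l])"
      using i pts by (intro arc_conn) (auto simp: cup)
    have "labels (D @ [l]) \<kappa>'"
      unfolding labels_def
    proof (intro conjI ballI impI)
      fix pp assume "pp \<in> linked (D @ [l])"
      then consider "pp \<in> linked D" | "pp \<in> arcs l ?n" "fst pp \<in> points (D @ [l])" "snd pp \<in> points (D @ [l])"
        by (auto simp: linked_snoc)
      thus "case pp of (p, p') \<Rightarrow> \<kappa>' p = \<kappa>' p'"
      proof cases
        case 1
        thus ?thesis using old old_lab old_linked by (cases pp) auto
      next
        case 2
        have *: "(?n, j) \<in> points D" if "fst pp = (?n, j)" for j using 2(2) that pts by auto
        show ?thesis using 2 i cup nth' new
          by (cases pp) (auto simp: pts[unfolded cup] notold old *)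
      qed
    next
      fix p p' assume p: "p \<in> points (D @ [l])" "p' \<in> points (D @ [l])" "\<kappa>' p = \<kappa>' p'"
      show "(p, p') \<in> conn (D @ [l])"
      proof (cases "\<kappa>' p = x")
        case True
        thus ?thesis using xtop[of p] xtop[of p'] p cupc conn_sym by auto
      next
        case False
        then obtain r r' where "r \<in> points D" "(p, r) \<in> conn (D @ [l])" "\<kappa> r = \<kappa>' p"
           "r' \<in> points D" "(p', r') \<in> conn (D @ [l])" "\<kappa> r' = \<kappa>' p'"
          using rep[of p] rep[of p'] p by auto
        thus ?thesis using old_conn[of r r'] p(3) conn_trans conn_sym by metis
      qed
    qed
    moreover have "ls' = map (\<lambda>i. \<kappa>' (length (D @ [l]), i)) [0..<w]"
      by (rule nth_equalityI) (simp_all add: lens' new)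
    moreover have "noncrossing ls' (opcup i v)"
      using noncrossing_cup[of "take i ls" "drop i ls" v x] IH(3) x_ls i len by (simp add: ls'_def min_absorb2)
    moreover have "ev (D @ [l]) vac s = (- qint 2) ^ c * opcup i v s" if "length s = w" for s
      using that i IH(4) by (auto simp: ev_append ev_Cons cup opcup_def)
    moreover have "card (\<kappa>' ` points (D @ [l])) = c + card (set ls')"
    proof -
      have "\<kappa>' ` points (D @ [l]) = insert x (\<kappa> ` points D)"
      proof (intro subset_antisym subsetI)
        fix y assume "y \<in> \<kappa>' ` points (D @ [l])"
        then obtain p where "p \<in> points (D @ [l])" "y = \<kappa>' p" by (rule imageE)
        thus "y \<in> insert x (\<kappa> ` points D)" using rep[of p] by (cases "y = x") (auto intro: rev_image_eqI)
      next
        fix y assume "y \<in> insert x (\<kappa> ` points D)"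
        moreover have "x = \<kappa>' (Suc ?n, i)" using i nth'[of i] new by simp
        moreover have "(Suc ?n, i) \<in> points (D @ [l])" using pts i by auto
        moreover have "\<kappa> ` points D \<subseteq> \<kappa>' ` points (D @ [l])" 
        proof -
          have "\<kappa> ` points D = \<kappa>' ` points D" by (rule image_cong) (simp_all add: old)
          thus ?thesis unfolding pts by blast
        qed
        ultimately show "y \<in> \<kappa>' ` points (D @ [l])" by blast
      qed
      moreover have "set ls' = insert x (set ls)"
      proof -
        have "set ls = set (take i ls) \<union> set (drop i ls)" by (metis append_take_drop_id set_append)
        thus ?thesis by (auto simp: ls'_def)
      qed
      ultimately show ?thesis using x x_ls IH(5) finite_points by simp
    qed
    ultimately show ?thesis by blast
  next
    case cap
    have i: "i + 2 \<le> w0" "w = w0 - 2" using w0 cap by auto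
    define a where "a = \<kappa> (?n, i)"
    define b where "b = \<kappa> (?n, Suc i)"
    define g where "g = id(b := a)"
    define ls' where "ls' = map g (take i ls @ drop (Suc (Suc i)) ls)"
    define \<kappa>' where "\<kappa>' = (\<lambda>(k, j). if k = Suc ?n then ls' ! j else g (\<kappa> (k, j)))"
    have ls: "ls = take i ls @ a # b # drop (Suc (Suc i)) ls"
      using i len by (metis a_def b_def nth_ls Cons_nth_drop_Suc Suc_le_lessD Suc_lessD add_2_eq_Suc' append_take_drop_id)
    have lens': "length ls' = w" using i len by (simp add: ls'_def)
    have nth': "ls' ! j = (if j < i then g (\<kappa> (?n, j)) else g (\<kappa> (?n, Suc (Suc j))))"
      if "j < w" for j
      using that i len by (auto simp: ls'_def nth_append nth_ls)
    have old: "\<kappa>' p = g (\<kappa> p)" if "p \<in> points D" for p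
      using old_lt[OF that] by (auto simp: \<kappa>'_def split: prod.splits)
    have new: "\<kappa>' (Suc ?n, j) = ls' ! j" for j by (simp add: \<kappa>'_def)
    have ab: "(?n, i) \<in> points D" "(?n, Suc i) \<in> points D" using top i by auto
    have rep: "\<exists>p'\<in>points D. (p, p') \<in> conn (D @ [l]) \<and> g (\<kappa> p') = \<kappa>' p"
      if px: "p \<in> points (D @ [l])" for p
    proof (cases "p \<in> points D")
      case True
      thus ?thesis using old[OF True] by (intro bexI[of _ p]) auto
    next
      case False
      then obtain j where p: "p = (Suc ?n, j)" "j < w" using px(1) pts by auto
      define j' where "j' = (if j < i then j else j + 2)"
      have j': "j' < w0" "((?n, j'), p) \<in> arcs l ?n" using p i by (auto simp: j'_def cap)
      have "g (\<kappa> (?n, j')) = \<kappa>' p" using p nth' new by (auto simp: j'_def)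
      thus ?thesis using arc_conn[OF j'(2)] top[OF j'(1)] px(1) pts conn_sym by blast
    qed
    have capc: "((?n, i), (?n, Suc i)) \<in> conn (D @ [l])"
      using ab pts by (intro arc_conn) (auto simp: cap)
    have near: "(r, (?n, i)) \<in> conn (D @ [l])" if "r \<in> points D" "\<kappa> r = a \<or> \<kappa> r = b" for r
      using that(2) old_conn[OF that(1) ab(1)] old_conn[OF that(1) ab(2)] conn_sym[OF capc] conn_trans
      unfolding a_def b_def by blast
    have merge: "(r, r') \<in> conn (D @ [l])" if "r \<in> points D" "r' \<in> points D" "g (\<kappa> r) = g (\<kappa> r')" for r r'
    proof (cases "\<kappa> r = \<kappa> r'")
      case True
      thus ?thesis using old_conn that by blast
    next
      case False
      hence "\<kappa> r = a \<or> \<kappa> r = b" "\<kappa> r' = a \<or> \<kappa> r' = b" using that(3) by (auto simp: g_def split: if_splits)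
      thus ?thesis using near[OF that(1)] near[OF that(2)] conn_sym conn_trans by blast
    qed
    have "labels (D @ [l]) \<kappa>'"
      unfolding labels_def
    proof (intro conjI ballI impI)
      fix pp assume "pp \<in> linked (D @ [l])"
      then consider "pp \<in> linked D" | "pp \<in> arcs l ?n" "fst pp \<in> points (D @ [l])" "snd pp \<in> points (D @ [l])"
        by (auto simp: linked_snoc)
      thus "case pp of (p, p') \<Rightarrow> \<kappa>' p = \<kappa>' p'"
      proof cases
        case 1
        thus ?thesis using old old_lab old_linked by (cases pp) auto
      next
        case 2
        have *: "(?n, j) \<in> points D" if "fst pp = (?n, j)" for j using 2(2) that pts by auto
        have "g a = g b" by (simp add: g_def)
        thus ?thesis using 2 i cap nth' new ab
          by (cases pp) (auto simp: pts[unfolded cap] notold old * a_def b_def)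
      qed
    next
      fix p p' assume p: "p \<in> points (D @ [l])" "p' \<in> points (D @ [l])" "\<kappa>' p = \<kappa>' p'"
      then obtain r r' where "r \<in> points D" "(p, r) \<in> conn (D @ [l])" "g (\<kappa> r) = \<kappa>' p"
           "r' \<in> points D" "(p', r') \<in> conn (D @ [l])" "g (\<kappa> r') = \<kappa>' p'"
          using rep[of p] rep[of p'] by auto
      thus "(p, p') \<in> conn (D @ [l])" using merge[of r r'] p(3) conn_trans conn_sym by metis
    qed
    moreover have "ls' = map (\<lambda>i. \<kappa>' (length (D @ [l]), i)) [0..<w]"
      by (rule nth_equalityI) (simp_all add: lens' new)
    moreover obtain v' where v': "noncrossing ls' v'"
      "\<And>s. length s = w \<Longrightarrow> opcap i v s = (if a = b then - qint 2 else 1) * v' s"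
      using noncrossing_cap[OF IH(3) ls] i len unfolding ls'_def g_def by (auto simp: min_def)
    \<comment> \<open>A circle is closed exactly when the cap joins the two ends of one component;
      otherwise two components become one.\<close>
    moreover define c' where "c' = (if a = b then Suc c else c)"
    moreover have "ev (D @ [l]) vac s = (- qint 2) ^ c' * v' s" if "length s = w" for s
    proof -
      have "ev (D @ [l]) vac s = (- qint 2) ^ c * opcap i v s"
        using that i by (simp add: ev_append ev_Cons cap opcap_def IH(4) algebra_simps)
      thus ?thesis using v'(2)[OF that] by (simp add: c'_def)
    qed
    moreover have "card (\<kappa>' ` points (D @ [l])) = c' + card (set ls')"
    proof -
      have img: "\<kappa>' ` points (D @ [l]) = g ` (\<kappa> ` points D)"
      proof (intro subset_antisym subsetI)
        fix y assume "y \<in> \<kappa>' ` points (D @ [l])"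
        then obtain p where "p \<in> points (D @ [l])" "y = \<kappa>' p" by (rule imageE)
        thus "y \<in> g ` (\<kappa> ` points D)" using rep[of p] by (auto intro: rev_image_eqI)
      next
        fix y assume "y \<in> g ` (\<kappa> ` points D)"
        then obtain p where "p \<in> points D" "y = g (\<kappa> p)" by blast
        thus "y \<in> \<kappa>' ` points (D @ [l])" using old[of p] pts by (intro rev_image_eqI[of p]) auto
      qed
      have ls'_set: "set ls' = g ` set (take i ls @ drop (Suc (Suc i)) ls)"
        by (simp only: ls'_def set_map)
      have ls_set: "set ls = insert a (insert b (set (take i ls @ drop (Suc (Suc i)) ls)))"
      proof -
        have "set ls = set (take i ls @ a # b # drop (Suc (Suc i)) ls)" using ls by simp
        thus ?thesis by auto
      qed
      have noncrossing: "noncrossing (take i ls @ a # b # drop (Suc (Suc i)) ls) v" using IH(3) ls by simp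
      show ?thesis
      \<comment> \<open>Closing a circle removes \<open>a\<close> from the open labels only, which
        the larger \<open>c'\<close> makes up for. Merging removes \<open>b\<close> from both sets,
        while \<open>a\<close> stays open at another end.\<close>
      proof (cases "a = b")
        case True
        hence "g = id" by (auto simp: g_def)
        moreover have "a \<notin> set (take i ls @ drop (Suc (Suc i)) ls)"
          using noncrossing_same_fresh noncrossing True by blast
        ultimately show ?thesis using IH(5) True
          by (simp add: img ls'_set ls_set c'_def)
      next
        case False
        have "a \<in> set (take i ls @ drop (Suc (Suc i)) ls)"
          using noncrossing_diff_mem[OF noncrossing False] .
        hence "set ls' = set ls - {b}" unfolding ls'_set ls_set using False
          by (auto simp: g_def image_iff)
        moreover have "g ` (\<kappa> ` points D) = \<kappa> ` points D - {b}"
          using ab False by (force simp: g_def a_def image_iff)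
        moreover have "b \<in> set ls" "b \<in> \<kappa> ` points D" using ls_set ab by (auto simp: b_def)
        ultimately show ?thesis using IH(5) False finite_points
          using card_gt_0_iff[of "set ls"] by (auto simp: img c'_def card_Diff_singleton)
      qed
    qed
    ultimately show ?thesis by blast
  qed
qed

lemma planar_bracket:
  assumes "wfd 0 D 0" "\<forall>l\<in>set D. \<exists>i. l = Cup i \<or> l = Cap i"
  shows "(- qint 2) ^ card (edges D) = ev D vac []"
proof -
  obtain \<kappa> v c where *: "labels D \<kappa>" "noncrossing [] v" "\<And>s. length s = 0 \<Longrightarrow> ev D vac s = (- qint 2) ^ c * v s"
     "card (\<kappa> ` points D) = c + card (set ([] :: nat list))"
    using planar_value[OF assms] by auto
  have "v = vac" using *(2) by (cases rule: noncrossing.cases) auto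
  thus ?thesis using *(3)[of "[]"] *(4) card_edges_labels[OF *(1)] by (simp add: vac_def)
qed

text \<open>The Kauffman relation is the definition of \<open>layer_op\<close> on a crossing and
  \<open>ev\<close> is linear, so expanding crossings commutes with evaluating; planar diagrams are
  settled by counting circles.\<close>

lemma link_bracket_aux_ev:
  assumes "wfd 0 (acc @ D) 0" "\<forall>l\<in>set acc. \<exists>i. l = Cup i \<or> l = Cap i" "vertex_free D"
  shows "link_bracket_aux acc D = ev D (ev acc vac) []"
  using assms
proof (induction acc D rule: link_bracket_aux.induct)
  case (1 acc)
  thus ?case by (simp add: planar_bracket)
next
  case (2 acc i D)
  obtain k where k: "wfd 0 acc k" "i + 2 \<le> k" "wfd k D 0" using 2(3) by (auto simp: wfd_append)
  have k': "wfd 0 ((acc @ [Cap i, Cup i]) @ D) 0"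
    unfolding wfd_append using k by (intro exI[of _ k] conjI) auto
  have "link_bracket_aux (acc @ [Cap i, Cup i]) D = ev D (ev (acc @ [Cap i, Cup i]) vac) []"
    by (rule 2(2)) (use 2(4,5) k k' in \<open>auto simp: vertex_free_def\<close>)
  moreover have "link_bracket_aux acc D = ev D (ev acc vac) []"
    by (rule 2(1)) (use 2(4,5) k in \<open>auto simp: wfd_append vertex_free_def\<close>)
  ultimately show ?case
    by (simp add: ev_append ev_Cons ev_lin qh_def[symmetric] qpow_minus_half[simplified])
next
  case (3 acc i D)
  obtain k where k: "wfd 0 acc k" "i + 2 \<le> k" "wfd k D 0" using 3(3) by (auto simp: wfd_append)
  have k': "wfd 0 ((acc @ [Cap i, Cup i]) @ D) 0"
    unfolding wfd_append using k by (intro exI[of _ k] conjI) auto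
  have "link_bracket_aux (acc @ [Cap i, Cup i]) D = ev D (ev (acc @ [Cap i, Cup i]) vac) []"
    by (rule 3(2)) (use 3(4,5) k k' in \<open>auto simp: vertex_free_def\<close>)
  moreover have "link_bracket_aux acc D = ev D (ev acc vac) []"
    by (rule 3(1)) (use 3(4,5) k in \<open>auto simp: wfd_append vertex_free_def\<close>)
  ultimately show ?case
    by (simp add: ev_append ev_Cons ev_lin qh_def[symmetric] qpow_minus_half[simplified])
qed (auto simp: ev_append ev_Cons vertex_free_def)

lemma link_bracket_ev:
  assumes "wfd 0 D 0" "vertex_free D"
  shows "link_bracket D = ev D vac []"
  using link_bracket_aux_ev[of "[]" D] assms by (simp add: link_bracket_def)

section \<open>Crossings and braids\<close>

definition swp :: "nat \<Rightarrow> bool list \<Rightarrow> bool list" where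
  "swp i s = s[i := s ! Suc i, Suc i := s ! i]"

text \<open>The R-matrix of the two-dimensional module: the parameters (\<open>qh\<close>,
  \<open>True\<close>) give a positive crossing, (\<open>inverse qh\<close>, \<open>False\<close>) a
  negative one. On strings too short for the crossing the value is the one that
  \<open>layer_op\<close> produces there, so that the two agree as functions.\<close>

definition xop :: "scalar \<Rightarrow> bool \<Rightarrow> nat \<Rightarrow> vec \<Rightarrow> vec" where
  "xop hh c i v s = (if Suc i < length s \<and> s ! i \<noteq> s ! Suc i
     then inverse hh * v (swp i s) + (if s ! i = c then 0 else (hh - inverse hh ^ 3) * v s)
     else hh * v s)"

lemma xop_pat: "length p = i \<Longrightarrow> xop hh c i v (p @ a # b # r) = (if a = b then hh * v (p @ a # b # r)
    else inverse hh * v (p @ b # a # r) + (if a = c then 0 else (hh - inverse hh ^ 3) * v (p @ a # b # r)))"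
  by (auto simp: xop_def swp_def nth_append list_update_append)

lemma xop_pat1: "length p = i \<Longrightarrow> xop hh c (Suc i) v (p @ x # a # b # r) = (if a = b then hh * v (p @ x # a # b # r)
    else inverse hh * v (p @ x # b # a # r) + (if a = c then 0 else (hh - inverse hh ^ 3) * v (p @ x # a # b # r)))"
  using xop_pat[of "p @ [x]" "Suc i" hh c v a b r] by simp

lemma xop_out: "\<not> Suc i < length s \<Longrightarrow> xop hh c i v s = hh * v s"
  by (simp add: xop_def)

lemma layer_op_Pos: "layer_op (Pos i) = xop qh True i"
proof (intro ext)
  fix v s
  show "layer_op (Pos i) v s = xop qh True i v s"
  proof (cases "Suc i < length s")
    case True
    then obtain p a b r where s: "s = p @ a # b # r" "length p = i" by (rule split_list2)
    show ?thesis unfolding s(1) using s(2)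
      by (cases a; cases b) (simp_all add: xop_pat opcup_pat opcap_pat cupw_def q_eq field_simps power3_eq_cube)
  qed (simp add: xop_out opcup_def)
qed

lemma layer_op_Neg: "layer_op (Neg i) = xop (inverse qh) False i"
proof (intro ext)
  fix v s
  show "layer_op (Neg i) v s = xop (inverse qh) False i v s"
  proof (cases "Suc i < length s")
    case True
    then obtain p a b r where s: "s = p @ a # b # r" "length p = i" by (rule split_list2)
    show ?thesis unfolding s(1) using s(2)
      by (cases a; cases b) (simp_all add: xop_pat opcup_pat opcap_pat cupw_def q_eq field_simps power3_eq_cube)
  qed (simp add: xop_out opcup_def)
qed

lemma split_list3:
  assumes "Suc (Suc i) < length s"
  obtains p a b c r where "s = p @ a # b # c # r" "length p = i"
proof -
  have "Suc i < length s" using assms by simp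
  then obtain p a b r where s: "s = p @ a # b # r" "length p = i" by (rule split_list2)
  then obtain c r' where "r = c # r'" using assms by (cases r) auto
  thus ?thesis using s that by blast
qed

lemma xop_inverse:
  assumes "hh \<noteq> 0" "c' = (\<not> c)"
  shows "xop hh c i (xop (inverse hh) c' i v) = v"
proof (rule ext)
  fix s show "xop hh c i (xop (inverse hh) c' i v) s = v s"
  proof (cases "Suc i < length s")
    case True
    then obtain p a b r where s: "s = p @ a # b # r" "length p = i" by (rule split_list2)
    show ?thesis unfolding s(1) using assms s(2)
      by (cases a; cases b; cases c) (simp_all add: xop_pat field_simps power3_eq_cube)
  qed (simp add: xop_out assms)
qed

lemma xop_far:
  assumes "Suc i < j"
  shows "xop hh c i (xop hh' c' j v) = xop hh' c' j (xop hh c i v)"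
proof (rule ext)
  fix s :: "bool list"
  have l: "length (swp k s) = length s" for k s by (simp add: swp_def)
  have 1: "swp i s ! j = s ! j" "swp i s ! Suc j = s ! Suc j"
     "swp j s ! i = s ! i" "swp j s ! Suc i = s ! Suc i"
    using assms by (auto simp: swp_def)
  have nu: "xs[k := x] ! m = (if k = m \<and> k < length xs then x else xs ! m)" for xs :: "bool list" and k m x
    by (cases "k < length xs") (simp_all add: nth_list_update list_update_beyond)
  have 2: "swp i (swp j s) = swp j (swp i s)"
    by (rule nth_equalityI) (use assms in \<open>simp_all add: swp_def nu\<close>)
  show "xop hh c i (xop hh' c' j v) s = xop hh' c' j (xop hh c i v) s"
    unfolding xop_def l 1 2 by (simp add: algebra_simps)
qed

lemma xop_braid_same:
  assumes "hh \<noteq> 0" "Suc (Suc i) < length s"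
  shows "xop hh c (Suc i) (xop hh c i (xop hh c (Suc i) v)) s = xop hh c i (xop hh c (Suc i) (xop hh c i v)) s"
proof -
  obtain p x y z r where s: "s = p @ x # y # z # r" "length p = i"
    using assms(2) by (rule split_list3)
  show ?thesis unfolding s(1) using assms(1) s(2)
    by (cases x; cases y; cases z; cases c) (simp_all add: xop_pat xop_pat1 field_simps power3_eq_cube)
qed

text \<open>Mixed braid relations, needed to slide the positive crossings of a Jones--Wenzl braid
  through a cable of negative crossings.\<close>

lemma xop_braid_opp:
  assumes "hh \<noteq> 0" "Suc (Suc i) < length s" "c' = (\<not> c)"
  shows "xop (inverse hh) c' (Suc i) (xop (inverse hh) c' i (xop hh c (Suc i) v)) s =
      xop hh c i (xop (inverse hh) c' (Suc i) (xop (inverse hh) c' i v)) s"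
    and "xop (inverse hh) c' i (xop (inverse hh) c' (Suc i) (xop hh c i v)) s =
      xop hh c (Suc i) (xop (inverse hh) c' i (xop (inverse hh) c' (Suc i) v)) s"
proof -
  obtain p x y z r where s: "s = p @ x # y # z # r" "length p = i"
    using assms(2) by (rule split_list3)
  show "xop (inverse hh) c' (Suc i) (xop (inverse hh) c' i (xop hh c (Suc i) v)) s =
      xop hh c i (xop (inverse hh) c' (Suc i) (xop (inverse hh) c' i v)) s"
    unfolding s(1) assms(3) using assms(1) s(2)
    by (cases x; cases y; cases z; cases c) (simp_all add: xop_pat xop_pat1 field_simps power3_eq_cube)
  show "xop (inverse hh) c' i (xop (inverse hh) c' (Suc i) (xop hh c i v)) s =
      xop hh c (Suc i) (xop (inverse hh) c' i (xop (inverse hh) c' (Suc i) v)) s"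
    unfolding s(1) assms(3) using assms(1) s(2)
    by (cases x; cases y; cases z; cases c) (simp_all add: xop_pat xop_pat1 field_simps power3_eq_cube)
qed

definition xword :: "diagram \<Rightarrow> bool" where
  "xword D \<longleftrightarrow> (\<forall>l\<in>set D. \<exists>i. l = Pos i \<or> l = Neg i)"

lemma xword_simps [simp]: "xword []" "xword (l # D) \<longleftrightarrow> (\<exists>i. l = Pos i \<or> l = Neg i) \<and> xword D"
  "xword (D @ D') \<longleftrightarrow> xword D \<and> xword D'" "xword (map Pos w)" "xword (map Neg w)"
  by (auto simp: xword_def)

lemma layer_op_x_cong:
  assumes "l = Pos i \<or> l = Neg i" "\<And>s. length s = n \<Longrightarrow> v s = w s" "length s = n"
  shows "layer_op l v s = layer_op l w s"
proof -
  have "xop hh c i v s = xop hh c i w s" for hh c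
    using assms(3) by (simp add: xop_def swp_def assms(2))
  thus ?thesis using assms(1) layer_op_Pos layer_op_Neg by metis
qed

lemma ev_x_cong:
  assumes "xword D" "\<And>s. length s = n \<Longrightarrow> v s = w s" "length s = n"
  shows "ev D v s = ev D w s"
  using assms(1,2)
proof (induction D arbitrary: v w)
  case Nil
  show ?case using Nil(2)[OF assms(3)] by simp
next
  case (Cons l D)
  obtain i where l: "l = Pos i \<or> l = Neg i" using Cons.prems(1) by auto
  have "layer_op l v s = layer_op l w s" if "length s = n" for s
    by (rule layer_op_x_cong[OF l Cons.prems(2) that])
  hence "ev D (layer_op l v) s = ev D (layer_op l w) s"
    using Cons.prems(1) by (intro Cons.IH) simp_all
  thus ?case by (simp add: ev_Cons)
qed

section \<open>Words of crossings as operators\<close>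

definition eqd :: "nat \<Rightarrow> diagram \<Rightarrow> diagram \<Rightarrow> bool" where
  "eqd n D D' \<longleftrightarrow> (\<forall>v s. length s = n \<longrightarrow> ev D v s = ev D' v s)"

lemma eqd_refl [simp]: "eqd n D D"
  by (simp add: eqd_def)

lemma eqd_sym: "eqd n D D' \<Longrightarrow> eqd n D' D"
  by (simp add: eqd_def)

lemma eqd_trans [trans]: "eqd n D D' \<Longrightarrow> eqd n D' D'' \<Longrightarrow> eqd n D D''"
  by (simp add: eqd_def)

lemma eqd_append:
  assumes "eqd n P P'" "eqd n Q Q'" "xword Q"
  shows "eqd n (P @ Q) (P' @ Q')"
  unfolding eqd_def
proof (intro allI impI)
  fix v s assume s: "length (s :: bool list) = n"
  have "ev Q (ev P v) s = ev Q (ev P' v) s"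
    by (rule ev_x_cong[OF assms(3) _ s]) (use assms(1) in \<open>simp add: eqd_def\<close>)
  also have "\<dots> = ev Q' (ev P' v) s" using assms(2) s by (simp add: eqd_def)
  finally show "ev (P @ Q) v s = ev (P' @ Q') v s" by (simp add: ev_append)
qed

lemma eqd_Cons: "eqd n D D' \<Longrightarrow> eqd n (l # D) (l # D')"
  by (simp add: eqd_def ev_Cons)

lemma eqd_far:
  assumes "l = Pos i \<or> l = Neg i" "l' = Pos j \<or> l' = Neg j" "Suc i < j \<or> Suc j < i"
  shows "eqd n [l, l'] [l', l]"
proof -
  have *: "xop hh c i (xop hh' c' j v) = xop hh' c' j (xop hh c i v)" for hh c hh' c' v
    using assms(3) xop_far by metis
  show ?thesis using assms(1,2)
    by (auto simp: eqd_def ev_Cons layer_op_Pos layer_op_Neg * simp del: layer_op.simps)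
qed

lemma eqd_far_word:
  assumes "l = Pos i \<or> l = Neg i" "\<And>l'. l' \<in> set D \<Longrightarrow> \<exists>j. (l' = Pos j \<or> l' = Neg j) \<and> (Suc i < j \<or> Suc j < i)"
  shows "eqd n (l # D) (D @ [l])"
  using assms(2)
proof (induction D)
  case (Cons l' D)
  have x: "xword D" unfolding xword_def using Cons.prems by (meson list.set_intros(2))
  obtain j where j: "l' = Pos j \<or> l' = Neg j" "Suc i < j \<or> Suc j < i"
    using Cons.prems[of l'] by auto
  have "eqd n ([l, l'] @ D) ([l', l] @ D)"
    by (intro eqd_append eqd_far[OF assms(1) j] eqd_refl x)
  hence 1: "eqd n (l # l' # D) (l' # l # D)" by simp
  have 2: "eqd n (l' # (l # D)) (l' # (D @ [l]))"
    by (intro eqd_Cons Cons.IH) (use Cons.prems in simp)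
  show ?case using eqd_trans[OF 1 2] by simp
qed simp

lemma eqd_braid:
  assumes "X = Pos \<or> X = Neg" "Suc (Suc i) < n"
  shows "eqd n [Pos (Suc i), X i, X (Suc i)] [X i, X (Suc i), Pos i]"
    and "eqd n [Pos i, X (Suc i), X i] [X (Suc i), X i, Pos (Suc i)]"
  using assms by (auto simp: eqd_def ev_Cons layer_op_Pos layer_op_Neg xop_braid_same xop_braid_opp
      simp del: layer_op.simps)

lemma eqd_Pos_Neg: "eqd n [Pos i, Neg i] []"
  using xop_inverse[of "inverse qh" True False]
  by (simp add: eqd_def ev_Cons layer_op_Pos layer_op_Neg del: layer_op.simps)

subsection \<open>Inversions and reduced words\<close>

definition invset :: "nat \<Rightarrow> (nat \<Rightarrow> nat) \<Rightarrow> (nat \<times> nat) set" where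
  "invset n \<sigma> = {(a, b). a < b \<and> b < n \<and> \<sigma> a > \<sigma> b}"

definition invs :: "nat \<Rightarrow> (nat \<Rightarrow> nat) \<Rightarrow> nat" where
  "invs n \<sigma> = card (invset n \<sigma>)"

abbreviation adj :: "nat \<Rightarrow> nat \<Rightarrow> nat" where "adj i \<equiv> transpose i (Suc i)"

lemma finite_invset: "finite (invset n \<sigma>)"
  by (rule finite_subset[of _ "{..<n} \<times> {..<n}"]) (auto simp: invset_def)

text \<open>Precomposing with \<open>adj i\<close> relabels the inversions bijectively and creates
  exactly one more, the pair (i, i+1) itself.\<close>

lemma invs_asc:
  assumes "Suc i < n" "\<sigma> i < \<sigma> (Suc i)"
  shows "invs n (\<sigma> \<circ> adj i) = Suc (invs n \<sigma>)"
proof -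
  let ?f = "\<lambda>(a, b). (adj i a, adj i b)"
  have "invset n (\<sigma> \<circ> adj i) = insert (i, Suc i) (?f ` invset n \<sigma>)"
  proof (intro subset_antisym subsetI)
    fix x assume "x \<in> invset n (\<sigma> \<circ> adj i)"
    then obtain a b where x: "x = (a, b)" "a < b" "b < n" "\<sigma> (adj i a) > \<sigma> (adj i b)"
      by (auto simp: invset_def)
    show "x \<in> insert (i, Suc i) (?f ` invset n \<sigma>)"
    proof (cases "x = (i, Suc i)")
      case False
      have "(adj i a, adj i b) \<in> invset n \<sigma>"
        using False x assms(1) by (auto simp: invset_def transpose_def)
      moreover have "x = ?f (adj i a, adj i b)" using x by simp
      ultimately show ?thesis by blast
    qed simp
  next
    fix x assume "x \<in> insert (i, Suc i) (?f ` invset n \<sigma>)"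
    thus "x \<in> invset n (\<sigma> \<circ> adj i)"
    proof
      assume "x \<in> ?f ` invset n \<sigma>"
      then obtain a b where ab: "(a, b) \<in> invset n \<sigma>" "x = (adj i a, adj i b)" by auto
      have "(a, b) \<noteq> (i, Suc i)" using ab assms by (auto simp: invset_def)
      thus ?thesis using ab assms(1) by (auto simp: invset_def transpose_def)
    qed (use assms in \<open>auto simp: invset_def\<close>)
  qed
  moreover have "(i, Suc i) \<notin> ?f ` invset n \<sigma>"
    by (auto simp: invset_def transpose_def split: if_splits)
  moreover have "inj_on ?f (invset n \<sigma>)"
    by (rule inj_onI) (auto simp: transpose_eq_iff)
  ultimately show ?thesis
    by (simp add: invs_def finite_invset card_image)
qed

lemma invs_id: "invs n id = 0"
proof -
  have "invset n id = {}" by (auto simp: invset_def)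
  thus ?thesis by (simp only: invs_def card.empty)
qed

lemma invs_desc:
  assumes "Suc i < n" "\<sigma> i > \<sigma> (Suc i)"
  shows "invs n \<sigma> = Suc (invs n (\<sigma> \<circ> adj i))"
  using invs_asc[of i n "\<sigma> \<circ> adj i"] assms by (simp add: o_assoc[symmetric])

lemma permutes_adj: "Suc i < n \<Longrightarrow> adj i permutes {..<n}"
  by (rule permutes_swap_id) auto

lemma permutes_comp_adj: "\<sigma> permutes {..<n} \<Longrightarrow> Suc i < n \<Longrightarrow> \<sigma> \<circ> adj i permutes {..<n}"
  using permutes_compose[OF permutes_adj] by blast

lemma comp_adj_adj [simp]: "\<sigma> \<circ> adj i \<circ> adj i = \<sigma>"
  by (simp add: o_assoc[symmetric])

lemma permutes_adj_cases:
  assumes "\<sigma> permutes S"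
  shows "\<sigma> i < \<sigma> (Suc i) \<or> \<sigma> (Suc i) < \<sigma> i"
  using permutes_inj[OF assms] by (metis injD linorder_neqE_nat n_not_Suc_n)

lemma braid_perm_Nil [simp]: "braid_perm [] = id"
  and braid_perm_Cons: "braid_perm (i # w) = braid_perm w \<circ> adj i"
  by (simp_all add: braid_perm_def fun_eq_iff)

abbreviation bword :: "nat \<Rightarrow> nat list \<Rightarrow> bool" where
  "bword n w \<equiv> (\<forall>i\<in>set w. Suc i < n)"

lemma braid_perm_permutes: "bword n w \<Longrightarrow> braid_perm w permutes {..<n}"
  by (induction w) (auto simp: braid_perm_Cons permutes_comp_adj simp del: o_apply intro: permutes_id)

lemma invs_braid_perm_le: "bword n w \<Longrightarrow> invs n (braid_perm w) \<le> length w"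
proof (induction w)
  case Nil
  show ?case by (simp only: braid_perm_Nil invs_id)
next
  case (Cons i w)
  consider "braid_perm w i < braid_perm w (Suc i)" | "braid_perm w (Suc i) < braid_perm w i"
    using permutes_adj_cases braid_perm_permutes Cons.prems by (metis list.set_intros(2))
  thus ?case using Cons invs_asc[of i n "braid_perm w"] invs_desc[of i n "braid_perm w"]
    by cases (auto simp: braid_perm_Cons simp del: o_apply)
qed

lemma permutes_no_descent:
  assumes "\<sigma> permutes {..<n}" "\<And>i. Suc i < n \<Longrightarrow> \<sigma> i < \<sigma> (Suc i)"
  shows "\<sigma> = id"
proof (rule permutes_natset_ge[OF assms(1)])
  have "i < n \<longrightarrow> i \<le> \<sigma> i" for i
  proof (induction i)
    case (Suc i)
    thus ?case using assms(2)[of i] by auto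
  qed simp
  thus "\<forall>i\<in>{..<n}. i \<le> \<sigma> i" by auto
qed

lemma ex_reduced:
  assumes "\<sigma> permutes {..<n}"
  shows "\<exists>w. bword n w \<and> braid_perm w = \<sigma> \<and> length w = invs n \<sigma>"
  using assms
proof (induction "invs n \<sigma>" arbitrary: \<sigma> rule: less_induct)
  case less
  show ?case
  proof (cases "\<exists>i. Suc i < n \<and> \<sigma> (Suc i) < \<sigma> i")
    case True
    then obtain i where i: "Suc i < n" "\<sigma> (Suc i) < \<sigma> i" by blast
    have inv: "invs n \<sigma> = Suc (invs n (\<sigma> \<circ> adj i))" by (rule invs_desc[OF i])
    then obtain w where "bword n w" "braid_perm w = \<sigma> \<circ> adj i" "length w = invs n (\<sigma> \<circ> adj i)"
      using less.hyps[of "\<sigma> \<circ> adj i"] permutes_comp_adj[OF less.prems i(1)] by auto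
    thus ?thesis using inv i by (intro exI[of _ "i # w"]) (auto simp: braid_perm_Cons simp del: o_apply)
  next
    case False
    hence id: "\<sigma> = id" using permutes_no_descent[OF less.prems] permutes_adj_cases[OF less.prems] by blast
    show ?thesis by (intro exI[of _ "[]"]) (simp only: id invs_id, simp)
  qed
qed

text \<open>Inversions bound the length of every word from below, and bubble sort attains the bound,
  which pins down the length of the word chosen by \<open>ARG_MIN\<close>.\<close>

lemma min_braid:
  assumes "\<sigma> permutes {..<n}"
  shows "bword n (min_braid n \<sigma>)" "braid_perm (min_braid n \<sigma>) = \<sigma>" "length (min_braid n \<sigma>) = invs n \<sigma>"
proof -
  obtain w where w: "bword n w \<and> braid_perm w = \<sigma>" "length w = invs n \<sigma>"
    using ex_reduced[OF assms] by blast
  have 1: "bword n (min_braid n \<sigma>) \<and> braid_perm (min_braid n \<sigma>) = \<sigma>"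
    unfolding min_braid_def by (rule arg_min_natI[of _ w]) (rule w(1))
  have 2: "length (min_braid n \<sigma>) \<le> length w"
    unfolding min_braid_def by (rule arg_min_nat_le) (rule w(1))
  show "bword n (min_braid n \<sigma>)" "braid_perm (min_braid n \<sigma>) = \<sigma>" using 1 by auto
  show "length (min_braid n \<sigma>) = invs n \<sigma>"
    using 1 2 w invs_braid_perm_le[of "min_braid n \<sigma>" n] by auto
qed

definition reduced :: "nat \<Rightarrow> nat list \<Rightarrow> bool" where
  "reduced n w \<longleftrightarrow> bword n w \<and> length w = invs n (braid_perm w)"

lemma reduced_ConsD:
  assumes "reduced n (i # w)"
  shows "reduced n w" "Suc i < n" "braid_perm (i # w) (Suc i) < braid_perm (i # w) i"
proof -
  have w: "bword n w" "Suc i < n" "Suc (length w) = invs n (braid_perm w \<circ> adj i)"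
    using assms by (auto simp: reduced_def braid_perm_Cons)
  have le: "invs n (braid_perm w) \<le> length w" by (rule invs_braid_perm_le[OF w(1)])
  have "braid_perm w i < braid_perm w (Suc i)"
  proof (rule ccontr)
    assume "\<not> ?thesis"
    hence "braid_perm w (Suc i) < braid_perm w i"
      using permutes_adj_cases[OF braid_perm_permutes[OF w(1)]] by blast
    thus False using invs_desc[OF w(2), of "braid_perm w"] le w(3) by simp
  qed
  thus "reduced n w" "Suc i < n" "braid_perm (i # w) (Suc i) < braid_perm (i # w) i"
    using w le invs_asc[OF w(2), of "braid_perm w"] by (auto simp: reduced_def braid_perm_Cons)
qed

lemma ex_reduced':
  assumes "\<sigma> permutes {..<n}"
  obtains w where "reduced n w" "braid_perm w = \<sigma>"
  using ex_reduced[OF assms] by (auto simp: reduced_def)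

lemma reduced_Cons:
  assumes "reduced n w" "Suc i < n" "braid_perm w i < braid_perm w (Suc i)"
  shows "reduced n (i # w)"
  using assms invs_asc[of i n "braid_perm w"] by (auto simp: reduced_def braid_perm_Cons simp del: o_apply)

lemma comp_adj_eqD: "\<sigma> \<circ> adj i = \<rho> \<circ> adj i \<Longrightarrow> \<sigma> = \<rho>"
  by (metis comp_adj_adj)

text \<open>Matsumoto's theorem, stated for the operators. The first letters \<open>i\<close> and
  \<open>j\<close> of the two words are descents of the common permutation \<sigma>. Reduced words
  beginning with both letters, or with a braid word in them, are compared with each of the given
  words by induction on the length.\<close>

lemma matsumoto:
  assumes "reduced n u" "reduced n w" "braid_perm u = braid_perm w"
  shows "eqd n (map Pos u) (map Pos w)"
  using assms
proof (induction "length u" arbitrary: u w rule: less_induct)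
  case less
  have len: "length u = length w" using less.prems by (simp add: reduced_def)
  show ?case
  proof (cases u)
    case Nil
    thus ?thesis using len by simp
  next
    case (Cons i u')
    then obtain j w' where w: "w = j # w'" using len by (cases w) auto
    define \<sigma> where "\<sigma> = braid_perm u"
    have \<sigma>: "\<sigma> permutes {..<n}" unfolding \<sigma>_def
      by (rule braid_perm_permutes) (use less.prems(1) in \<open>simp add: reduced_def\<close>)
    have u': "reduced n u'" "Suc i < n" "\<sigma> (Suc i) < \<sigma> i" "braid_perm u' = \<sigma> \<circ> adj i"
      using reduced_ConsD[of n i u'] less.prems(1) by (auto simp: Cons \<sigma>_def braid_perm_Cons)
    have w': "reduced n w'" "Suc j < n" "\<sigma> (Suc j) < \<sigma> j" "braid_perm w' = \<sigma> \<circ> adj j"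
      using reduced_ConsD[of n j w'] less.prems(2,3) by (auto simp: w \<sigma>_def braid_perm_Cons)
    have IH: "eqd n (map Pos x) (map Pos y)"
      if "reduced n x" "reduced n y" "braid_perm x = braid_perm y" "Suc (length x) = length u" for x y
      using less.hyps[of x y] that by simp
    have l: "Suc (length u') = length u" "Suc (length w') = length u" using Cons w len by auto
    \<comment> \<open>Distant descents: \<sigma> has reduced words i j x and j i x with one tail x,
      and these differ by a far commutation.\<close>
    have far: ?thesis if "Suc i < j \<or> Suc j < i"
    proof -
      obtain x where x: "reduced n x" "braid_perm x = \<sigma> \<circ> adj i \<circ> adj j"
        using ex_reduced'[OF permutes_comp_adj[OF permutes_comp_adj[OF \<sigma> u'(2)] w'(2)]] by blast
      have comm: "adj i \<circ> adj j = adj j \<circ> adj i"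
        using that by (auto simp: fun_eq_iff transpose_def)
      have jx: "reduced n (j # x)" using x(1) w'(2)
        by (rule reduced_Cons) (use that w'(3) in \<open>simp only: x(2) o_apply, auto simp: transpose_def\<close>)
      have ix: "reduced n (i # x)" using x(1) u'(2)
        by (rule reduced_Cons) (use that u'(3) in \<open>simp only: x(2) o_apply, auto simp: transpose_def\<close>)
      have "braid_perm (j # x) = \<sigma> \<circ> adj i" by (simp only: braid_perm_Cons x(2) comp_adj_adj)
      hence "eqd n (map Pos u') (map Pos (j # x))" using IH[OF u'(1) jx] u'(4) l by simp
      hence 1: "eqd n (map Pos u) (Pos i # map Pos (j # x))" unfolding Cons list.map(2) by (intro eqd_Cons)
      have "braid_perm (i # x) = \<sigma> \<circ> (adj i \<circ> adj j) \<circ> adj i" by (simp only: braid_perm_Cons x(2) o_assoc)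
      also have "\<dots> = \<sigma> \<circ> adj j" unfolding comm by (simp only: o_assoc comp_adj_adj)
      finally have "eqd n (map Pos w') (map Pos (i # x))" using IH[OF w'(1) ix] w'(4) l by simp
      hence 2: "eqd n (map Pos w) (Pos j # map Pos (i # x))" unfolding w list.map(2) by (intro eqd_Cons)
      have "eqd n ([Pos i, Pos j] @ map Pos x) ([Pos j, Pos i] @ map Pos x)"
        by (intro eqd_append eqd_far[of _ i _ j]) (simp_all add: that)
      hence "eqd n (Pos i # map Pos (j # x)) (Pos j # map Pos (i # x))" by simp
      from eqd_trans[OF eqd_trans[OF 1 this] eqd_sym[OF 2]] show ?thesis .
    qed
    \<comment> \<open>Adjacent descents: \<sigma> reverses the order of three consecutive positions,
      hence has reduced words beginning with k, k+1, k and with k+1, k, k+1 and ending in one tail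
      x.\<close>
    have braid: "eqd n (map Pos (k # a)) (map Pos (Suc k # b))"
      if k: "Suc (Suc k) < n" "\<sigma> (Suc (Suc k)) < \<sigma> (Suc k)" "\<sigma> (Suc k) < \<sigma> k"
        and a: "reduced n a" "braid_perm a = \<sigma> \<circ> adj k" "Suc (length a) = length u"
        and b: "reduced n b" "braid_perm b = \<sigma> \<circ> adj (Suc k)" "Suc (length b) = length u" for k a b
    proof -
      have k': "Suc k < n" using k(1) by simp
      have comm: "adj k \<circ> adj (Suc k) \<circ> adj k = adj (Suc k) \<circ> adj k \<circ> adj (Suc k)"
      proof (rule ext)
        fix x
        consider "x = k" | "x = Suc k" | "x = Suc (Suc k)" | "x \<noteq> k" "x \<noteq> Suc k" "x \<noteq> Suc (Suc k)"
          by blast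
        thus "(adj k \<circ> adj (Suc k) \<circ> adj k) x = (adj (Suc k) \<circ> adj k \<circ> adj (Suc k)) x"
          by cases (simp_all add: transpose_def)
      qed
      obtain x where x: "reduced n x" "braid_perm x = \<sigma> \<circ> adj k \<circ> adj (Suc k) \<circ> adj k"
        using ex_reduced'[OF permutes_comp_adj[OF permutes_comp_adj[OF permutes_comp_adj[OF \<sigma> k'] k(1)] k']] by blast
      have kx: "reduced n (k # x)" using x(1) Suc_lessD[OF k(1)]
        by (rule reduced_Cons) (simp only: x(2) o_apply, use k in \<open>simp add: transpose_def\<close>)
      have skx: "reduced n (Suc k # k # x)" using kx k(1)
        by (rule reduced_Cons) (simp only: x(2) o_apply braid_perm_Cons, use k in \<open>simp add: transpose_def\<close>)
      have sx: "reduced n (Suc k # x)" using x(1) k(1)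
        by (rule reduced_Cons) (simp only: x(2) o_apply, use k in \<open>simp add: transpose_def\<close>)
      have ksx: "reduced n (k # Suc k # x)" using sx Suc_lessD[OF k(1)]
        by (rule reduced_Cons) (simp only: x(2) o_apply braid_perm_Cons, use k in \<open>simp add: transpose_def\<close>)
      have "braid_perm (Suc k # k # x) = \<sigma> \<circ> adj k" by (simp only: braid_perm_Cons x(2) comp_adj_adj)
      hence "eqd n (map Pos a) (map Pos (Suc k # k # x))" using IH[OF a(1) skx] a by simp
      hence 1: "eqd n (map Pos (k # a)) (Pos k # map Pos (Suc k # k # x))" unfolding list.map(2) by (intro eqd_Cons)
      have "\<sigma> \<circ> (adj k \<circ> adj (Suc k) \<circ> adj k) = \<sigma> \<circ> (adj (Suc k) \<circ> adj k \<circ> adj (Suc k))"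
        by (simp only: comm)
      hence "braid_perm x = \<sigma> \<circ> adj (Suc k) \<circ> adj k \<circ> adj (Suc k)" unfolding x(2) o_assoc .
      hence "braid_perm (k # Suc k # x) = \<sigma> \<circ> adj (Suc k)" by (simp only: braid_perm_Cons comp_adj_adj)
      hence "eqd n (map Pos b) (map Pos (k # Suc k # x))" using IH[OF b(1) ksx] b by simp
      hence 2: "eqd n (map Pos (Suc k # b)) (Pos (Suc k) # map Pos (k # Suc k # x))" unfolding list.map(2) by (intro eqd_Cons)
      have "eqd n ([Pos k, Pos (Suc k), Pos k] @ map Pos x) ([Pos (Suc k), Pos k, Pos (Suc k)] @ map Pos x)"
        by (intro eqd_append eqd_braid(2)) (simp_all add: k)
      hence "eqd n (Pos k # map Pos (Suc k # k # x)) (Pos (Suc k) # map Pos (k # Suc k # x))" by simp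
      from eqd_trans[OF eqd_trans[OF 1 this] eqd_sym[OF 2]] show ?thesis .
    qed
    consider "i = j" | "Suc i < j \<or> Suc j < i" | "j = Suc i" | "i = Suc j" by linarith
    thus ?thesis
    proof cases
      case 1
      hence "eqd n (map Pos u') (map Pos w')" using IH[OF u'(1) w'(1)] u'(4) w'(4) l by simp
      thus ?thesis by (simp add: Cons w 1 eqd_Cons)
    next
      case 2
      thus ?thesis by (rule far)
    next
      case 3
      note j = w'[unfolded 3]
      show ?thesis unfolding Cons w 3
        by (rule braid[OF j(2,3) u'(3) u'(1,4) l(1) j(1,4) l(2)])
    next
      case 4
      note i = u'[unfolded 4]
      show ?thesis unfolding Cons w 4
        by (rule eqd_sym[OF braid[OF i(2,3) w'(3) w'(1,4) l(2) i(1,4) l(1)]])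
    qed
  qed
qed

section \<open>The Jones--Wenzl element\<close>

subsection \<open>Weighted sums over strings\<close>

primrec cnt :: "bool list \<Rightarrow> nat" where
  "cnt [] = 0"
| "cnt (a # s) = (if a then Suc (cnt s) else cnt s)"

lemma cnt_append [simp]: "cnt (s @ s') = cnt s + cnt s'"
  by (induction s) auto

lemma cnt_le_length: "cnt s \<le> length s"
  by (induction s) auto

lemma cnt_rev [simp]: "cnt (rev s) = cnt s"
  by (induction s) auto

lemma cnt_map_Not: "cnt (map Not s) = length s - cnt s"
  by (induction s) (auto simp: Suc_diff_le cnt_le_length)

lemma cnt_replicate [simp]: "cnt (replicate k a) = (if a then k else 0)"
  by (induction k) auto

text \<open>\<open>Uw s\<close> is q to the number of pairs with a sign - to the left of a sign +.
  Restricted to one weight it is the q-symmetric vector, a common eigenvector of all braid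
  generators.\<close>

primrec Uw :: vec where
  "Uw [] = 1"
| "Uw (a # s) = (if a then 1 else q ^ cnt s) * Uw s"

lemma Uw_nonzero [simp]: "Uw s \<noteq> 0"
  by (induction s) auto

lemma Uw_append: "Uw (s @ s') = Uw s * Uw s' * q ^ ((length s - cnt s) * cnt s')"
  by (induction s) (auto simp: power_add Suc_diff_le[OF cnt_le_length] mult_ac)

lemma Uw_rev_Not: "Uw (rev (map Not s)) = Uw s"
proof (induction s)
  case (Cons a s)
  have "length s - (length s - cnt s) = cnt s" using cnt_le_length[of s] by simp
  thus ?case using Cons by (cases a) (simp_all add: Uw_append cnt_map_Not)
qed simp

definition strs :: "nat \<Rightarrow> bool list set" where "strs n = {s. length s = n}"
definition cl :: "nat \<Rightarrow> nat \<Rightarrow> bool list set" where "cl n k = {s. length s = n \<and> cnt s = k}"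

lemma finite_strs [simp]: "finite (strs n)"
  unfolding strs_def using finite_lists_length_eq[of "UNIV :: bool set" n] by simp

lemma cl_subset: "cl n k \<subseteq> strs n"
  by (auto simp: cl_def strs_def)

lemma finite_cl [simp]: "finite (cl n k)"
  using cl_subset finite_strs finite_subset by blast

lemma strs_0 [simp]: "strs 0 = {[]}"
  by (auto simp: strs_def)

lemma sum_strs_Suc: "(\<Sum>s\<in>strs (Suc n). f s) = (\<Sum>s\<in>strs n. f (True # s)) + (\<Sum>s\<in>strs n. f (False # s))"
proof -
  have "strs (Suc n) = (#) True ` strs n \<union> (#) False ` strs n"
    by (auto simp: strs_def length_Suc_conv)
  moreover have "(#) True ` strs n \<inter> (#) False ` strs n = {}" by auto
  ultimately show ?thesis
    by (simp add: sum.union_disjoint sum.reindex)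
qed

lemma sum_strs_add: "(\<Sum>s\<in>strs (m + n). f s) = (\<Sum>s\<in>strs m. \<Sum>s'\<in>strs n. f (s @ s'))"
  by (induction m arbitrary: f) (simp_all add: sum_strs_Suc)

lemma sum_cl: "(\<Sum>s\<in>cl n k. f s) = (\<Sum>s\<in>strs n. if cnt s = k then f s else 0)"
proof -
  have "cl n k = {s \<in> strs n. cnt s = k}" by (auto simp: cl_def strs_def)
  thus ?thesis by (simp add: sum.inter_filter)
qed

text \<open>The square length of the q-symmetric vector of weight k for the standard bilinear form;
  it normalizes the projection onto that vector.\<close>

definition nrm :: "nat \<Rightarrow> nat \<Rightarrow> scalar" where
  "nrm n k = (\<Sum>s\<in>cl n k. (Uw s)\<^sup>2)"

lemma sum_strs_cnt: "(\<Sum>s\<in>strs n. (Uw s)\<^sup>2 * f (cnt s)) = (\<Sum>k\<le>n. nrm n k * f k)"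
proof -
  have "(\<Sum>k\<le>n. nrm n k * f k) = (\<Sum>k\<le>n. \<Sum>s\<in>strs n. if cnt s = k then (Uw s)\<^sup>2 * f k else 0)"
    unfolding nrm_def sum_cl sum_distrib_right by (intro sum.cong refl) auto
  also have "\<dots> = (\<Sum>s\<in>strs n. \<Sum>k\<le>n. if cnt s = k then (Uw s)\<^sup>2 * f k else 0)"
    by (rule sum.swap)
  also have "\<dots> = (\<Sum>s\<in>strs n. (Uw s)\<^sup>2 * f (cnt s))"
  proof (intro sum.cong refl)
    fix s assume "s \<in> strs n"
    hence "cnt s \<le> n" using cnt_le_length[of s] by (simp add: strs_def)
    thus "(\<Sum>k\<le>n. if cnt s = k then (Uw s)\<^sup>2 * f k else 0) = (Uw s)\<^sup>2 * f (cnt s)"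
      by (simp add: sum.delta')
  qed
  finally show ?thesis by simp
qed

lemma nrm_Suc_0: "nrm (Suc n) 0 = nrm n 0"
  by (simp add: nrm_def sum_cl sum_strs_Suc cong: if_cong)

lemma nrm_Suc_Suc: "nrm (Suc n) (Suc k) = nrm n k + q ^ (2 * Suc k) * nrm n (Suc k)"
proof -
  have "(\<Sum>s\<in>strs n. if cnt s = Suc k then (q ^ cnt s * Uw s)\<^sup>2 else 0) =
      q ^ (2 * Suc k) * (\<Sum>s\<in>strs n. if cnt s = Suc k then (Uw s)\<^sup>2 else 0)"
    unfolding sum_distrib_left
    by (intro sum.cong refl) (simp add: power_mult_distrib power2_eq_square power_add[symmetric] mult_2)
  thus ?thesis by (simp add: nrm_def sum_cl sum_strs_Suc cong: if_cong)
qed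

lemma nrm_eq_0: "n < k \<Longrightarrow> nrm n k = 0"
proof -
  assume "n < k"
  hence "s \<notin> cl n k" for s using cnt_le_length[of s] by (auto simp: cl_def)
  hence "cl n k = {}" by blast
  thus ?thesis by (simp add: nrm_def)
qed

text \<open>This is the generating function of inversions of two-letter words in the variable q^2.
  Splitting off the first sign gives a q-Pascal rule; passing to symmetric binomials produces the
  shift q^(k(n-k)).\<close>

lemma nrm_eq: "k \<le> n \<Longrightarrow> nrm n k = q ^ (k * (n - k)) * qbin n k"
proof (induction n arbitrary: k)
  case 0
  thus ?case by (simp add: nrm_def sum_cl)
next
  case (Suc n)
  show ?case
  proof (cases k)
    case 0
    thus ?thesis using Suc.IH[of 0] by (simp add: nrm_Suc_0)
  next
    case k: (Suc j)
    hence j: "j \<le> n" using Suc.prems by simp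
    then obtain d where d: "n = j + d" by (metis le_Suc_ex)
    have "q ^ (Suc j * d) * (q powi int (Suc j) * qbin n (Suc j)) = q ^ (2 * Suc j) * nrm n (Suc j)"
    proof (cases d)
      case 0
      thus ?thesis by (simp add: d qbin_eq_0 nrm_eq_0)
    next
      case (Suc d')
      have "nrm n (Suc j) = q ^ (Suc j * d') * qbin n (Suc j)"
        using Suc.IH[of "Suc j"] by (simp add: d Suc)
      moreover have "q ^ (Suc j * d) * q powi int (Suc j) = q ^ (2 * Suc j) * q ^ (Suc j * d')"
        unfolding power_int_of_nat power_add[symmetric] by (rule arg_cong[of _ _ "(^) q"]) (simp add: Suc)
      ultimately show ?thesis by (simp only: mult.assoc[symmetric])
    qed
    moreover have "q ^ (Suc j * d) * (q powi (- int d) * qbin n j) = nrm n j"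
      using Suc.IH[OF j] by (simp add: d power_int_minus power_add field_simps)
    ultimately show ?thesis
      using qbin_Suc[OF j] by (simp add: k nrm_Suc_Suc d algebra_simps)
  qed
qed

lemma nrm_nonzero: "k \<le> n \<Longrightarrow> nrm n k \<noteq> 0"
  by (simp add: nrm_eq qbin_nonzero)

lemma nrm_sym: "k \<le> n \<Longrightarrow> nrm n (n - k) = nrm n k"
  by (simp add: nrm_eq qbin_sym mult.commute)

definition srt :: "nat \<Rightarrow> nat \<Rightarrow> bool list" where
  "srt n k = replicate k True @ replicate (n - k) False"

text \<open>Bubble sort: each exchange of a pair -+ for +- costs a factor q, and \<open>Uw\<close>
  counts the exchanges needed to reach the sorted string.\<close>

lemma sort_string:
  fixes F :: vec
  assumes "\<And>p r. length p + length r + 2 = n \<Longrightarrow> F (p @ False # True # r) = q * F (p @ True # False # r)"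
    and "length s = n"
  shows "F s = Uw s * F (srt n (cnt s))"
proof -
  have move: "F (p @ False # replicate k True @ r) = q ^ k * F (p @ replicate k True @ False # r)"
    if "length p + k + length r + 1 = n" for p k r
    using that
  proof (induction k arbitrary: p)
    case (Suc k)
    have "F (p @ False # replicate (Suc k) True @ r) = q * F ((p @ [True]) @ False # replicate k True @ r)"
      using assms(1)[of p "replicate k True @ r"] Suc.prems by simp
    also have "\<dots> = q * (q ^ k * F ((p @ [True]) @ replicate k True @ False # r))"
      by (subst Suc.IH) (use Suc.prems in auto)
    finally show ?case by simp
  qed simp
  have "F (p @ s) = Uw s * F (p @ srt (length s) (cnt s))" if "length (p @ s) = n" for p s
    using that
  proof (induction s arbitrary: p)
    case (Cons a s)
    have IH: "F (p @ a # s) = Uw s * F (p @ a # srt (length s) (cnt s))"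
      using Cons.IH[of "p @ [a]"] Cons.prems by simp
    show ?case
    proof (cases a)
      case True
      thus ?thesis using IH by (simp add: srt_def)
    next
      case False
      have "F (p @ False # srt (length s) (cnt s)) =
         q ^ cnt s * F (p @ replicate (cnt s) True @ False # replicate (length s - cnt s) False)"
        unfolding srt_def by (rule move) (use Cons.prems cnt_le_length[of s] in simp)
      thus ?thesis using IH False cnt_le_length[of s] by (simp add: srt_def Suc_diff_le)
    qed
  qed (simp add: srt_def)
  from this[of "[]" s] show ?thesis using assms(2) by simp
qed

subsection \<open>The symmetrizer\<close>

text \<open>The factor q^(3/2) per crossing in the Jones--Wenzl formula turns the crossing into a
  Hecke generator, with eigenvalues q^2 and -1.\<close>

definition braid_gen :: "nat \<Rightarrow> vec \<Rightarrow> vec" where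
  "braid_gen i v = (\<lambda>s. qh ^ 3 * xop qh True i v s)"

definition evT :: "nat list \<Rightarrow> vec \<Rightarrow> vec" where
  "evT w v = (\<lambda>s. qh ^ (3 * length w) * ev (map Pos w) v s)"

lemma ev_scale: "ev D (\<lambda>s. a * v s) = (\<lambda>s. a * ev D v s)"
  using ev_lin[of D a v 0 v] by simp

lemma evT_Cons: "evT (i # w) v = evT w (braid_gen i v)"
  by (simp add: evT_def ev_Cons braid_gen_def layer_op_Pos ev_scale power_add mult_ac del: layer_op.simps)

lemma evT_Nil [simp]: "evT [] v = v"
  by (simp add: evT_def)

lemma evT_lin: "evT w (\<lambda>s. a * v s + b * u s) = (\<lambda>s. a * evT w v s + b * evT w u s)"
  by (simp add: evT_def ev_lin algebra_simps)

lemma evT_cong: "(\<And>s. length s = n \<Longrightarrow> v s = u s) \<Longrightarrow> length s = n \<Longrightarrow> evT w v s = evT w u s"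
  unfolding evT_def by (subst ev_x_cong[of _ n v u]) simp_all

lemma braid_gen_braid_gen:
  assumes "Suc i < length s"
  shows "braid_gen i (braid_gen i v) s = (q\<^sup>2 - 1) * braid_gen i v s + q\<^sup>2 * v s"
proof -
  obtain p a b r where s: "s = p @ a # b # r" "length p = i" using assms by (rule split_list2)
  show ?thesis unfolding s(1) using s(2)
    by (cases a; cases b) (simp_all add: braid_gen_def xop_pat q_eq field_simps power2_eq_square power3_eq_cube)
qed

lemma evT_reduced:
  assumes "reduced n u" "reduced n w" "braid_perm u = braid_perm w" "length s = n"
  shows "evT u v s = evT w v s"
  using matsumoto[OF assms(1-3)] assms by (simp add: evT_def eqd_def reduced_def)

lemma min_braid_reduced: "\<sigma> permutes {..<n} \<Longrightarrow> reduced n (min_braid n \<sigma>)"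
  by (simp add: reduced_def min_braid)

definition perms :: "nat \<Rightarrow> (nat \<Rightarrow> nat) set" where "perms n = {\<sigma>. \<sigma> permutes {..<n}}"

lemma finite_perms [simp]: "finite (perms n)"
  unfolding perms_def by (rule finite_permutations) simp

definition symm :: "nat \<Rightarrow> vec \<Rightarrow> vec" where
  "symm n v s = (\<Sum>\<sigma>\<in>perms n. evT (min_braid n \<sigma>) v s)"

lemma evT_min_braid_asc:
  assumes "\<sigma> \<in> perms n" "Suc i < n" "\<sigma> i < \<sigma> (Suc i)" "length s = n"
  shows "evT (min_braid n (\<sigma> \<circ> adj i)) v s = evT (min_braid n \<sigma>) (braid_gen i v) s"
proof -
  have \<sigma>: "\<sigma> permutes {..<n}" using assms(1) by (simp add: perms_def)
  have "evT (min_braid n (\<sigma> \<circ> adj i)) v s = evT (i # min_braid n \<sigma>) v s"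
  proof (rule evT_reduced[OF _ _ _ assms(4)])
    show "reduced n (min_braid n (\<sigma> \<circ> adj i))"
      by (rule min_braid_reduced[OF permutes_comp_adj[OF \<sigma> assms(2)]])
    show "reduced n (i # min_braid n \<sigma>)"
      by (rule reduced_Cons[OF min_braid_reduced[OF \<sigma>] assms(2)]) (simp add: min_braid(2)[OF \<sigma>] assms(3))
    show "braid_perm (min_braid n (\<sigma> \<circ> adj i)) = braid_perm (i # min_braid n \<sigma>)"
      by (simp only: min_braid(2)[OF permutes_comp_adj[OF \<sigma> assms(2)]] braid_perm_Cons min_braid(2)[OF \<sigma>])
  qed
  thus ?thesis by (simp add: evT_Cons)
qed

lemma sum_perms_asc:
  assumes "Suc i < n"
  shows "(\<Sum>\<sigma>\<in>perms n. f \<sigma>) = (\<Sum>\<sigma>\<in>{\<sigma>\<in>perms n. \<sigma> i < \<sigma> (Suc i)}. f \<sigma> + f (\<sigma> \<circ> adj i))"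
proof -
  let ?A = "{\<sigma>\<in>perms n. \<sigma> i < \<sigma> (Suc i)}"
  have "perms n = ?A \<union> (\<lambda>\<sigma>. \<sigma> \<circ> adj i) ` ?A"
  proof (intro subset_antisym subsetI)
    fix \<sigma> assume \<sigma>: "\<sigma> \<in> perms n"
    show "\<sigma> \<in> ?A \<union> (\<lambda>\<sigma>. \<sigma> \<circ> adj i) ` ?A"
    proof (cases "\<sigma> i < \<sigma> (Suc i)")
      case False
      hence "\<sigma> (Suc i) < \<sigma> i" using permutes_adj_cases[of \<sigma> "{..<n}" i] \<sigma> by (auto simp: perms_def)
      hence "\<sigma> \<circ> adj i \<in> ?A"
        using \<sigma> permutes_comp_adj[OF _ assms] by (simp add: perms_def)
      moreover have "\<sigma> = (\<sigma> \<circ> adj i) \<circ> adj i" by simp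
      ultimately show ?thesis by blast
    qed (use \<sigma> in simp)
  next
    fix \<sigma> assume "\<sigma> \<in> ?A \<union> (\<lambda>\<sigma>. \<sigma> \<circ> adj i) ` ?A"
    thus "\<sigma> \<in> perms n" using permutes_comp_adj[OF _ assms] by (auto simp: perms_def)
  qed
  moreover have "?A \<inter> (\<lambda>\<sigma>. \<sigma> \<circ> adj i) ` ?A = {}" by auto
  moreover have "inj_on (\<lambda>\<sigma>. \<sigma> \<circ> adj i) ?A" by (rule inj_onI) (rule comp_adj_eqD)
  moreover have "finite ?A" by simp
  ultimately have "(\<Sum>\<sigma>\<in>perms n. f \<sigma>) = (\<Sum>\<sigma>\<in>?A. f \<sigma>) + (\<Sum>\<sigma>\<in>?A. f (\<sigma> \<circ> adj i))"
    by (metis (no_types, lifting) finite_imageI sum.union_disjoint sum.reindex_cong)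
  thus ?thesis by (simp add: sum.distrib)
qed

text \<open>Permutations are paired as \<sigma> and \<open>\<sigma> \<circ> adj i\<close> with
  \<sigma> ascending at i. Writing T for the generator, each pair contributes a multiple of 1 + T,
  and the quadratic relation gives (1 + T) T = q^2 (1 + T).\<close>

lemma symm_braid_gen:
  assumes "Suc i < n" "length s = n"
  shows "symm n (braid_gen i v) s = q\<^sup>2 * symm n v s"
proof -
  let ?A = "{\<sigma>\<in>perms n. \<sigma> i < \<sigma> (Suc i)}"
  have "symm n (braid_gen i v) s = (\<Sum>\<sigma>\<in>?A. q\<^sup>2 * (evT (min_braid n \<sigma>) v s + evT (min_braid n (\<sigma> \<circ> adj i)) v s))"
    unfolding symm_def sum_perms_asc[OF assms(1)]
  proof (intro sum.cong refl)
    fix \<sigma> assume \<sigma>: "\<sigma> \<in> ?A"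
    have "evT (min_braid n \<sigma>) (braid_gen i (braid_gen i v)) s = evT (min_braid n \<sigma>) (\<lambda>s. (q\<^sup>2 - 1) * braid_gen i v s + q\<^sup>2 * v s) s"
      by (rule evT_cong[of n]) (use assms braid_gen_braid_gen in auto)
    thus "evT (min_braid n \<sigma>) (braid_gen i v) s + evT (min_braid n (\<sigma> \<circ> adj i)) (braid_gen i v) s =
        q\<^sup>2 * (evT (min_braid n \<sigma>) v s + evT (min_braid n (\<sigma> \<circ> adj i)) v s)"
      using evT_min_braid_asc[of \<sigma> n i s] \<sigma> assms unfolding evT_lin by (simp add: algebra_simps)
  qed
  also have "\<dots> = q\<^sup>2 * symm n v s"
    unfolding symm_def sum_perms_asc[OF assms(1)] by (simp add: sum_distrib_left)
  finally show ?thesis .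
qed

section \<open>The symmetrizer has rank one in each weight\<close>

definition dlt :: "bool list \<Rightarrow> vec" where "dlt s s' = (if s' = s then 1 else 0)"

lemma braid_gen_dlt:
  assumes "length p + length r + 2 = n" "length s = n"
  shows "braid_gen (length p) (dlt (p @ True # False # r)) s = q * dlt (p @ False # True # r) s"
proof -
  have "Suc (length p) < length s" using assms by simp
  then obtain p' a b r' where s: "s = p' @ a # b # r'" "length p' = length p" by (rule split_list2)
  have "length r' = length r" using s assms by simp
  thus ?thesis unfolding s(1) using s(2)
    by (cases a; cases b) (simp_all add: braid_gen_def xop_pat dlt_def q_eq field_simps power3_eq_cube)
qed

lemma symm_cong: "(\<And>s. length s = n \<Longrightarrow> v s = u s) \<Longrightarrow> length s = n \<Longrightarrow> symm n v s = symm n u s"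
  unfolding symm_def by (intro sum.cong refl evT_cong) auto

lemma symm_scale: "symm n (\<lambda>s. a * v s) s = a * symm n v s"
  using evT_lin[of _ a v 0 v] by (simp add: symm_def sum_distrib_left)

lemma symm_0: "symm n (\<lambda>s. 0) s = 0"
  using symm_scale[of n 0 "\<lambda>_. 0"] by simp

lemma symm_add: "symm n (\<lambda>s. v s + u s) s = symm n v s + symm n u s"
  using evT_lin[of _ 1 v 1 u] by (simp add: symm_def sum.distrib)

lemma symm_sum: "finite I \<Longrightarrow> symm n (\<lambda>s. \<Sum>i\<in>I. f i s) s = (\<Sum>i\<in>I. symm n (f i) s)"
  by (induction I rule: finite_induct) (simp_all add: symm_0 symm_add)

text \<open>A generator sends the basis vector with +- at a place to q times the one with -+, and
  the symmetrizer absorbs generators at the price q^2. Comparing the two shows that the columns of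
  the symmetrizer satisfy the hypothesis of \<open>sort_string\<close>.\<close>

lemma symm_dlt:
  assumes "length s = n" "length s' = n"
  shows "symm n (dlt s') s = Uw s' * symm n (dlt (srt n (cnt s'))) s"
proof (rule sort_string[where F = "\<lambda>s'. symm n (dlt s') s"])
  fix p r :: "bool list" assume pr: "length p + length r + 2 = n"
  let ?a = "symm n (dlt (p @ False # True # r)) s" and ?b = "symm n (dlt (p @ True # False # r)) s"
  have "symm n (braid_gen (length p) (dlt (p @ True # False # r))) s = q\<^sup>2 * ?b"
    by (rule symm_braid_gen) (use pr assms in auto)
  moreover have "symm n (braid_gen (length p) (dlt (p @ True # False # r))) s = symm n (\<lambda>s. q * dlt (p @ False # True # r) s) s"
    by (rule symm_cong) (use braid_gen_dlt pr assms in auto)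
  ultimately have "q * ?a = q * (q * ?b)" by (simp add: symm_scale power2_eq_square)
  thus "?a = q * ?b" by simp
qed (rule assms(2))

lemma symm_expand:
  assumes "length s = n"
  shows "symm n v s = (\<Sum>s'\<in>strs n. v s' * Uw s' * symm n (dlt (srt n (cnt s'))) s)"
proof -
  have "symm n v s = symm n (\<lambda>s. \<Sum>s'\<in>strs n. v s' * dlt s' s) s"
    by (rule symm_cong[OF _ assms]) (simp add: dlt_def strs_def[symmetric] sum.delta' if_distrib cong: if_cong, simp add: strs_def)
  also have "\<dots> = (\<Sum>s'\<in>strs n. v s' * symm n (dlt s') s)"
    by (simp add: symm_sum symm_scale)
  also have "\<dots> = (\<Sum>s'\<in>strs n. v s' * Uw s' * symm n (dlt (srt n (cnt s'))) s)"
    by (intro sum.cong refl) (use symm_dlt assms in \<open>auto simp: strs_def\<close>)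
  finally show ?thesis .
qed

text \<open>The Poincare polynomial of the symmetric group at q^2; it is the eigenvalue of the
  symmetrizer on the q-symmetric vectors.\<close>

definition poincare :: "nat \<Rightarrow> scalar" where "poincare n = (\<Sum>\<sigma>\<in>perms n. q ^ (2 * invs n \<sigma>))"

definition Uk :: "nat \<Rightarrow> vec" where "Uk k s = (if cnt s = k then Uw s else 0)"

lemma braid_gen_Uk:
  assumes "Suc i < length s"
  shows "braid_gen i (Uk k) s = q\<^sup>2 * Uk k s"
proof -
  obtain p a b r where s: "s = p @ a # b # r" "length p = i" using assms by (rule split_list2)
  show ?thesis unfolding s(1) using s(2)
    by (cases a; cases b) (simp_all add: braid_gen_def xop_pat Uk_def Uw_append q_eq field_simps power2_eq_square power3_eq_cube power_add power_mult_distrib)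
qed

lemma evT_Uk:
  assumes "bword n w" "length s = n"
  shows "evT w (Uk k) s = q ^ (2 * length w) * Uk k s"
  using assms
proof (induction w)
  case (Cons i w)
  have "evT (i # w) (Uk k) s = evT w (\<lambda>s. q\<^sup>2 * Uk k s + 0 * Uk k s) s"
    unfolding evT_Cons by (rule evT_cong[of n]) (use Cons.prems braid_gen_Uk in auto)
  also have "\<dots> = q\<^sup>2 * evT w (Uk k) s" by (subst evT_lin) simp
  finally show ?case using Cons by (simp add: power_add power2_eq_square)
qed simp

lemma symm_Uk:
  assumes "length s = n"
  shows "symm n (Uk k) s = poincare n * Uk k s"
  unfolding symm_def poincare_def sum_distrib_right
proof (intro sum.cong refl)
  fix \<sigma> assume "\<sigma> \<in> perms n"
  hence "\<sigma> permutes {..<n}" by (simp add: perms_def)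
  note m = min_braid[OF this]
  show "evT (min_braid n \<sigma>) (Uk k) s = q ^ (2 * invs n \<sigma>) * Uk k s"
    using evT_Uk[OF m(1) assms, of k] by (simp only: m(3))
qed

text \<open>
  On strings with a given number of signs \<open>+\<close> this is the orthogonal projection onto the line
  spanned by \<open>Uw\<close>.
\<close>

definition jw :: "nat \<Rightarrow> vec \<Rightarrow> vec" where
  "jw n v s = Uw s * (\<Sum>s'\<in>cl n (cnt s). Uw s' * v s') / nrm n (cnt s)"

text \<open>All columns of one weight are multiples of the sorted one, so the known image of the
  eigenvector \<open>Uk k\<close> determines it.\<close>

lemma symm_srt:
  assumes "length s = n" "k \<le> n"
  shows "symm n (dlt (srt n k)) s = poincare n * Uk k s / nrm n k"
proof -
  have "poincare n * Uk k s = (\<Sum>s'\<in>strs n. Uk k s' * Uw s' * symm n (dlt (srt n (cnt s'))) s)"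
    using symm_expand[OF assms(1), of "Uk k"] symm_Uk[OF assms(1)] by simp
  also have "\<dots> = (\<Sum>s'\<in>strs n. (if cnt s' = k then (Uw s')\<^sup>2 else 0) * symm n (dlt (srt n k)) s)"
    by (intro sum.cong refl) (simp add: Uk_def power2_eq_square)
  also have "\<dots> = nrm n k * symm n (dlt (srt n k)) s"
    by (simp add: nrm_def sum_cl sum_distrib_right)
  finally show ?thesis using nrm_nonzero[OF assms(2)] by (simp add: field_simps)
qed

lemma symm_eq_jw:
  assumes "length s = n"
  shows "symm n v s = poincare n * jw n v s"
proof -
  have "symm n v s = (\<Sum>s'\<in>strs n. v s' * Uw s' * symm n (dlt (srt n (cnt s'))) s)"
    by (rule symm_expand[OF assms])
  also have "\<dots> = (\<Sum>s'\<in>strs n. if cnt s' = cnt s then Uw s' * v s' * (poincare n * Uw s / nrm n (cnt s)) else 0)"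
  proof (intro sum.cong refl)
    fix s' assume "s' \<in> strs n"
    hence "cnt s' \<le> n" using cnt_le_length[of s'] by (simp add: strs_def)
    thus "v s' * Uw s' * symm n (dlt (srt n (cnt s'))) s =
       (if cnt s' = cnt s then Uw s' * v s' * (poincare n * Uw s / nrm n (cnt s)) else 0)"
      using symm_srt[OF assms, of "cnt s'"] by (simp add: Uk_def)
  qed
  also have "\<dots> = poincare n * jw n v s"
    unfolding sum_cl[symmetric] sum_distrib_right[symmetric] by (simp add: jw_def)
  finally show ?thesis .
qed

lemma q_geometric: "(\<Sum>j\<le>n. q ^ (2 * j)) = q ^ n * qint (Suc n)"
proof (induction n)
  case (Suc n)
  have "q ^ Suc n * qint (Suc (Suc n)) = q ^ n * qint (Suc n) + q ^ (2 * Suc n)"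
  proof -
    have "qint (Suc (Suc n)) = inverse q * qint (Suc n) + q ^ Suc n"
      using qint_add'[of "Suc n" 1] by (simp add: power_int_minus del: power_Suc of_nat_Suc)
    hence "q ^ Suc n * qint (Suc (Suc n)) = (q * inverse q) * (q ^ n * qint (Suc n)) + q ^ (Suc n + Suc n)"
      by (simp add: algebra_simps power_add)
    thus ?thesis by (simp add: mult_2)
  qed
  thus ?case using Suc by simp
qed simp

text \<open>Permutations are sorted by the position j of the largest value n. Moving that value one
  place to the left creates one inversion, hence a factor q^2, and the positions sum to a geometric
  series.\<close>

lemma poincare_Suc: "poincare (Suc n) = q ^ n * qint (Suc n) * poincare n"
proof -
  define f where "f = (\<lambda>j. \<Sum>\<sigma>\<in>{\<sigma>\<in>perms (Suc n). \<sigma> j = n}. q ^ (2 * invs (Suc n) \<sigma>))"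
  have step: "f j = q\<^sup>2 * f (Suc j)" if "j < n" for j
  proof -
    have "f j = (\<Sum>\<sigma>\<in>{\<sigma>\<in>perms (Suc n). \<sigma> (Suc j) = n}. q ^ (2 * invs (Suc n) (\<sigma> \<circ> adj j)))"
      unfolding f_def
    proof (rule sum.reindex_bij_witness[of _ "\<lambda>\<sigma>. \<sigma> \<circ> adj j" "\<lambda>\<sigma>. \<sigma> \<circ> adj j"])
      fix \<sigma> assume "\<sigma> \<in> {\<sigma>\<in>perms (Suc n). \<sigma> j = n}"
      thus "\<sigma> \<circ> adj j \<in> {\<sigma>\<in>perms (Suc n). \<sigma> (Suc j) = n}"
        using that permutes_comp_adj[of \<sigma> "Suc n" j] by (simp add: perms_def)
    next
      fix \<sigma> assume "\<sigma> \<in> {\<sigma>\<in>perms (Suc n). \<sigma> (Suc j) = n}"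
      thus "\<sigma> \<circ> adj j \<in> {\<sigma>\<in>perms (Suc n). \<sigma> j = n}"
        using that permutes_comp_adj[of \<sigma> "Suc n" j] by (simp add: perms_def)
    qed simp_all
    also have "\<dots> = (\<Sum>\<sigma>\<in>{\<sigma>\<in>perms (Suc n). \<sigma> (Suc j) = n}. q\<^sup>2 * q ^ (2 * invs (Suc n) \<sigma>))"
    proof (intro sum.cong refl)
      fix \<sigma> assume \<sigma>: "\<sigma> \<in> {\<sigma>\<in>perms (Suc n). \<sigma> (Suc j) = n}"
      hence p: "\<sigma> permutes {..<Suc n}" by (simp add: perms_def)
      have "\<sigma> j < Suc n" using permutes_in_image[OF p, of j] that by simp
      moreover have "\<sigma> j \<noteq> \<sigma> (Suc j)" using permutes_inj[OF p] by (metis injD n_not_Suc_n)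
      ultimately have "\<sigma> j < \<sigma> (Suc j)" using \<sigma> by simp
      hence "invs (Suc n) (\<sigma> \<circ> adj j) = Suc (invs (Suc n) \<sigma>)"
        using that by (intro invs_asc) simp_all
      thus "q ^ (2 * invs (Suc n) (\<sigma> \<circ> adj j)) = q\<^sup>2 * q ^ (2 * invs (Suc n) \<sigma>)"
        by (simp add: power2_eq_square)
    qed
    finally show ?thesis by (simp add: f_def sum_distrib_left)
  qed
  have base: "f n = poincare n"
  proof -
    have "{\<sigma>\<in>perms (Suc n). \<sigma> n = n} = perms n"
    proof (intro subset_antisym subsetI)
      fix \<sigma> assume "\<sigma> \<in> {\<sigma>\<in>perms (Suc n). \<sigma> n = n}"
      thus "\<sigma> \<in> perms n"
        by (auto simp: perms_def less_Suc_eq intro!: permutes_superset[of _ "{..<Suc n}"])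
    next
      fix \<sigma> assume "\<sigma> \<in> perms n"
      thus "\<sigma> \<in> {\<sigma>\<in>perms (Suc n). \<sigma> n = n}"
        by (auto simp: perms_def intro: permutes_subset permutes_not_in)
    qed
    moreover have "invs (Suc n) \<sigma> = invs n \<sigma>" if "\<sigma> \<in> perms n" for \<sigma>
    proof -
      have p: "\<sigma> permutes {..<n}" using that by (simp add: perms_def)
      have "\<sigma> n = n" using permutes_not_in[OF p] by simp
      moreover have "\<sigma> a < n" if "a < n" for a using permutes_in_image[OF p, of a] that by simp
      ultimately have "invset (Suc n) \<sigma> = invset n \<sigma>"
        by (auto simp: invset_def less_Suc_eq) (metis less_asym)
      thus ?thesis by (simp add: invs_def)
    qed
    ultimately show ?thesis by (simp add: f_def poincare_def)
  qed
  have fj: "f (n - j) = q ^ (2 * j) * poincare n" if "j \<le> n" for j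
    using that
  proof (induction j)
    case (Suc j)
    have "f (n - Suc j) = q\<^sup>2 * f (n - j)"
      using step[of "n - Suc j"] Suc.prems by (simp add: Suc_diff_Suc)
    thus ?case using Suc by (simp add: power2_eq_square)
  qed (simp add: base)
  have "poincare (Suc n) = (\<Sum>j\<le>n. f j)"
  proof -
    have "poincare (Suc n) = (\<Sum>\<sigma>\<in>perms (Suc n). \<Sum>j\<le>n. if \<sigma> j = n then q ^ (2 * invs (Suc n) \<sigma>) else 0)"
      unfolding poincare_def
    proof (intro sum.cong refl)
      fix \<sigma> assume "\<sigma> \<in> perms (Suc n)"
      hence p: "\<sigma> permutes {..<Suc n}" by (simp add: perms_def)
      have "inv \<sigma> n \<in> {..<Suc n}" using permutes_in_image[OF permutes_inv[OF p], of n] by simp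
      hence i: "inv \<sigma> n \<le> n" by simp
      have "\<sigma> j = n \<longleftrightarrow> inv \<sigma> n = j" for j using permutes_inv_eq[OF p] by auto
      thus "q ^ (2 * invs (Suc n) \<sigma>) = (\<Sum>j\<le>n. if \<sigma> j = n then q ^ (2 * invs (Suc n) \<sigma>) else 0)"
        using i by (simp add: sum.delta')
    qed
    also have "\<dots> = (\<Sum>j\<le>n. \<Sum>\<sigma>\<in>perms (Suc n). if \<sigma> j = n then q ^ (2 * invs (Suc n) \<sigma>) else 0)"
      by (rule sum.swap)
    also have "\<dots> = (\<Sum>j\<le>n. f j)"
      by (simp add: f_def sum.inter_filter)
    finally show ?thesis .
  qed
  also have "\<dots> = (\<Sum>j\<le>n. f (n - j))"
    by (rule sum.reindex_bij_witness[of _ "\<lambda>j. n - j" "\<lambda>j. n - j"]) auto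
  also have "\<dots> = (\<Sum>j\<le>n. q ^ (2 * j)) * poincare n"
    using fj by (simp add: sum_distrib_right)
  finally show ?thesis by (simp add: q_geometric)
qed

text \<open>With n = 2a this is q^(a(2a-1)) [2a]!, the denominator in the definition of the
  Jones--Wenzl element. So that element is the symmetrizer divided by its eigenvalue, an
  idempotent.\<close>

lemma poincare_eq: "poincare n = qh ^ (n * (n - 1)) * qfact n"
proof (induction n)
  case 0
  have "perms 0 = {id}" by (auto simp: perms_def)
  thus ?case by (simp add: poincare_def invs_def invset_def)
next
  case (Suc n)
  have "qh ^ (Suc n * n) = q ^ n * qh ^ (n * (n - 1))"
    by (cases n) (simp_all add: q_eq power_mult_distrib power_add[symmetric] algebra_simps)
  thus ?case using Suc by (simp add: poincare_Suc qfact_Suc)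
qed

lemma jw_coeff_eq:
  assumes "2 * a = of_nat n" "\<sigma> permutes {..<n}"
  shows "jw_coeff a \<sigma> = qh ^ (3 * invs n \<sigma>) / (qh ^ (n * (n - 1)) * qfact n)"
proof -
  have n: "to_nat (2 * a) = n" by (simp add: assms(1) to_nat_def)
  \<comment> \<open>\<open>qpow\<close> rounds four times its exponent, so this number has to be
    exhibited as an integer before powers can be compared.\<close>
  have "4 * (- a * (2 * a - 1) + 3/2 * of_nat (invs n \<sigma>)) =
      - 2 * ((2 * a) * (2 * a - 1)) + 6 * of_nat (invs n \<sigma>)" by (simp add: algebra_simps)
  also have "\<dots> = of_int (- 2 * (int n * (int n - 1)) + 6 * int (invs n \<sigma>))"
    by (simp add: assms(1))
  finally have "qpow (- a * (2 * a - 1) + 3/2 * of_nat (invs n \<sigma>)) =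
      t powi (- 2 * (int n * (int n - 1)) + 6 * int (invs n \<sigma>))"
    unfolding qpow_def by (simp only: floor_of_int)
  also have "- 2 * (int n * (int n - 1)) + 6 * int (invs n \<sigma>) =
      2 * (int (3 * invs n \<sigma>) - int (n * (n - 1)))"
    by (cases n) (simp_all add: algebra_simps)
  also have "t powi \<dots> = qh powi (int (3 * invs n \<sigma>) - int (n * (n - 1)))"
    unfolding qh_eq by (rule power_int_mult)
  also have "\<dots> = qh ^ (3 * invs n \<sigma>) / qh ^ (n * (n - 1))"
    by (subst power_int_diff) (simp_all only: power_int_of_nat qh_nonzero simp_thms)
  finally show ?thesis
    by (simp add: jw_coeff_def min_crossings_def n min_braid(3)[OF assms(2)])
qed

theorem jw_sum:
  assumes "2 * a = of_nat n" "length s = n"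
  shows "(\<Sum>\<sigma>\<in>perms n. jw_coeff a \<sigma> * ev (map Pos (min_braid n \<sigma>)) v s) = jw n v s"
proof -
  have "(\<Sum>\<sigma>\<in>perms n. jw_coeff a \<sigma> * ev (map Pos (min_braid n \<sigma>)) v s) =
      (\<Sum>\<sigma>\<in>perms n. evT (min_braid n \<sigma>) v s / poincare n)"
    by (intro sum.cong refl)
      (auto simp: perms_def jw_coeff_eq[OF assms(1)] poincare_eq evT_def min_braid(3))
  also have "\<dots> = symm n v s / poincare n" by (simp add: symm_def sum_divide_distrib)
  also have "\<dots> = jw n v s" by (simp add: symm_eq_jw[OF assms(2)] poincare_eq)
  finally show ?thesis .
qed

section \<open>Cabled crossings\<close>

subsection \<open>Locality\<close>

fun sh :: "nat \<Rightarrow> layer \<Rightarrow> layer" where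
  "sh k (Cup i) = Cup (k + i)" | "sh k (Cap i) = Cap (k + i)"
| "sh k (Pos i) = Pos (k + i)" | "sh k (Neg i) = Neg (k + i)"
| "sh k (Merge i) = Merge (k + i)" | "sh k (Split i) = Split (k + i)"

lemma opcup_shift: "opcup (length p + i) v (p @ s) = opcup i (\<lambda>z. v (p @ z)) s"
  by (simp add: opcup_def nth_append add.assoc)

lemma opcap_shift: "opcap (length p + i) v (p @ s) = opcap i (\<lambda>z. v (p @ z)) s"
  by (simp add: opcap_def)

lemma layer_op_shift: "layer_op (sh (length p) l) v (p @ s) = layer_op l (\<lambda>z. v (p @ z)) s"
proof -
  have "opcup i (\<lambda>z. opcap (length p + i) v (p @ z)) s = opcup i (opcap i (\<lambda>z. v (p @ z))) s" for i
    by (simp add: opcap_shift)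
  thus ?thesis by (cases l) (simp_all add: opcup_shift opcap_shift)
qed

lemma ev_shift: "ev (map (sh (length p)) D) v (p @ s) = ev D (\<lambda>z. v (p @ z)) s"
proof (induction D arbitrary: v)
  case (Cons l D)
  have "ev (map (sh (length p)) (l # D)) v (p @ s) = ev D (\<lambda>z. layer_op (sh (length p) l) v (p @ z)) s"
    using Cons.IH by (simp add: ev_Cons)
  thus ?case by (simp add: layer_op_shift ev_Cons)
qed simp

lemma opcup_suffix: "Suc i < length s \<Longrightarrow> opcup i v (s @ r) = opcup i (\<lambda>z. v (z @ r)) s"
  by (simp add: opcup_def nth_append)

lemma opcap_suffix: "i \<le> length s \<Longrightarrow> opcap i v (s @ r) = opcap i (\<lambda>z. v (z @ r)) s"
  by (simp add: opcap_def)

lemma layer_op_suffix: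
  assumes "fits l n" "length s = width_after l n" "\<nexists>i. l = Merge i" "\<nexists>i. l = Split i"
  shows "layer_op l v (s @ r) = layer_op l (\<lambda>z. v (z @ r)) s"
proof -
  have *: "opcup i (\<lambda>z. opcap i v (z @ r)) s = opcup i (opcap i (\<lambda>z. v (z @ r))) s" for i
    by (simp add: opcup_def opcap_suffix)
  show ?thesis using assms
    by (cases l) (auto simp: opcup_suffix opcap_suffix *)
qed

lemma ev_suffix:
  assumes "wfd n D m" "vertex_free D" "length s = m"
  shows "ev D v (s @ r) = ev D (\<lambda>z. v (z @ r)) s"
  using assms(1,2)
proof (induction D arbitrary: n v)
  case (Cons l D)
  have l: "fits l n" "wfd (width_after l n) D m" "vertex_free D" "\<nexists>i. l = Merge i" "\<nexists>i. l = Split i"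
    using Cons.prems by (auto simp: vertex_free_def)
  have "ev (l # D) v (s @ r) = ev D (\<lambda>z. layer_op l v (z @ r)) s"
    using Cons.IH[OF l(2,3)] by (simp add: ev_Cons)
  also have "\<dots> = ev D (layer_op l (\<lambda>z. v (z @ r))) s"
    by (rule ev_cong[OF l(2,3) _ assms(3)]) (rule layer_op_suffix[OF l(1) _ l(4,5)])
  finally show ?case by (simp add: ev_Cons)
qed simp

lemma ev_local:
  assumes "wfd n D (length s)" "vertex_free D" "length p = k"
  shows "ev (map (sh k) D) v (p @ s @ r) = ev D (\<lambda>z. v (p @ z @ r)) s"
  using ev_shift[of p D v "s @ r"] ev_suffix[OF assms(1,2) refl] assms(3) by simp

lemma wfd_Pos: "bword n w \<Longrightarrow> wfd n (map Pos w) n"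
  by (induction w) auto

lemma vertex_free_simps [simp]: "vertex_free []" "vertex_free (D @ D') \<longleftrightarrow> vertex_free D \<and> vertex_free D'"
  "vertex_free (l # D) \<longleftrightarrow> (\<nexists>i. l = Merge i \<or> l = Split i) \<and> vertex_free D"
  by (auto simp: vertex_free_def)

lemma xword_vertex_free: "xword D \<Longrightarrow> vertex_free D"
  by (auto simp: xword_def vertex_free_def)

subsection \<open>Cables of crossings\<close>

definition row :: "(nat \<Rightarrow> layer) \<Rightarrow> nat \<Rightarrow> nat \<Rightarrow> diagram" where
  "row X k m = map (\<lambda>r. X (k + r)) [0..<m]"

text \<open>Each of the n strands of the left bundle crosses the m strands of the right bundle in
  one \<open>row\<close>. The rightmost strand goes first, the order used by
  \<open>cable_layer\<close>.\<close>

definition xcab :: "(nat \<Rightarrow> layer) \<Rightarrow> nat \<Rightarrow> nat \<Rightarrow> nat \<Rightarrow> diagram" where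
  "xcab X k n m = concat (map (\<lambda>j. row X (k + j) m) (rev [0..<n]))"

lemma xcab_0 [simp]: "xcab X k 0 m = []"
  by (simp add: xcab_def)

lemma xcab_Suc: "xcab X k (Suc n) m = row X (k + n) m @ xcab X k n m"
  by (simp add: xcab_def)

lemma xcab_Suc': "xcab X k (Suc n) m = xcab X (Suc k) n m @ row X k m"
  by (induction n) (simp_all add: xcab_Suc)

lemma row_0 [simp]: "row X k 0 = []"
  by (simp add: row_def)

lemma row_Suc: "row X k (Suc m) = row X k m @ [X (k + m)]"
  by (simp add: row_def)

lemma row_Suc': "row X k (Suc m) = X k # row X (Suc k) m"
  by (simp add: row_def upt_conv_Cons map_Suc_upt[symmetric] comp_def del: upt_Suc)

lemma row_add: "row X k (m + m') = row X k m @ row X (k + m) m'"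
  by (induction m') (simp_all add: row_Suc add.assoc[symmetric])

lemma set_row: "set (row X k m) = (\<lambda>r. X (k + r)) ` {..<m}"
  by (auto simp: row_def)

lemma set_xcab: "l \<in> set (xcab X k n m) \<Longrightarrow> \<exists>j<n. \<exists>r<m. l = X (k + j + r)"
  by (auto simp: xcab_def set_row)

abbreviation crossing :: "(nat \<Rightarrow> layer) \<Rightarrow> bool" where "crossing X \<equiv> X = Pos \<or> X = Neg"

lemma xword_row [simp]: "crossing X \<Longrightarrow> xword (row X k m)"
  by (auto simp: xword_def set_row)

lemma xword_xcab [simp]: "crossing X \<Longrightarrow> xword (xcab X k n m)"
  using set_xcab[of _ X k n m] by (fastforce simp: xword_def)

lemma row_sh: "crossing X \<Longrightarrow> row X (k + k') m = map (sh k) (row X k' m)"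
  by (auto simp: row_def add.assoc)

lemma xcab_sh: "crossing X \<Longrightarrow> xcab X (k + k') n m = map (sh k) (xcab X k' n m)"
  by (induction n) (simp_all add: xcab_Suc row_sh add.assoc)

lemma wfd_row: "crossing X \<Longrightarrow> k + m < N \<Longrightarrow> wfd N (row X k m) N"
  by (induction m arbitrary: k) (auto simp: row_Suc')

lemma wfd_xcab: "crossing X \<Longrightarrow> k + n + m \<le> N \<Longrightarrow> wfd N (xcab X k n m) N"
  by (induction n) (auto simp: xcab_Suc wfd_append intro!: exI[of _ N] wfd_row)

lemma eqd_app_left: "eqd n Q Q' \<Longrightarrow> eqd n (P @ Q) (P @ Q')"
  by (simp add: eqd_def ev_append)

lemma eqd_app_right: "eqd n P P' \<Longrightarrow> xword Q \<Longrightarrow> eqd n (P @ Q) (P' @ Q)"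
  by (rule eqd_append) simp_all

section \<open>Sliding a positive crossing through a cabled crossing\<close>

lemma slide_row:
  assumes X: "crossing X" and "Suc x < m" "k + m < N"
  shows "eqd N (Pos (Suc (k + x)) # row X k m) (row X k m @ [Pos (k + x)])"
proof -
  obtain d where m: "m = x + (2 + d)" using assms(2) by (metis add_2_eq_Suc add_Suc_right less_imp_Suc_add add_Suc)
  let ?i = "k + x"
  have two: "row X ?i 2 = [X ?i, X (Suc ?i)]" by (simp add: numeral_2_eq_2 row_Suc)
  have row: "row X k m = row X k x @ [X ?i, X (Suc ?i)] @ row X (?i + 2) d"
    unfolding m row_add two by simp
  have 1: "eqd N (Pos (Suc ?i) # row X k x) (row X k x @ [Pos (Suc ?i)])"
    by (rule eqd_far_word[OF disjI1[OF refl]]) (use X in \<open>auto simp: set_row\<close>)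
  have 2: "eqd N [Pos (Suc ?i), X ?i, X (Suc ?i)] [X ?i, X (Suc ?i), Pos ?i]"
    by (rule eqd_braid(1)[OF X]) (use m assms in simp)
  have 3: "eqd N (Pos ?i # row X (?i + 2) d) (row X (?i + 2) d @ [Pos ?i])"
    by (rule eqd_far_word[OF disjI1[OF refl]]) (use X in \<open>auto simp: set_row\<close>)
  have "eqd N ((Pos (Suc ?i) # row X k x) @ [X ?i, X (Suc ?i)] @ row X (?i + 2) d)
     ((row X k x @ [Pos (Suc ?i)]) @ [X ?i, X (Suc ?i)] @ row X (?i + 2) d)"
    by (rule eqd_app_right[OF 1]) (use X in auto)
  also have "eqd N \<dots> (row X k x @ [X ?i, X (Suc ?i), Pos ?i] @ row X (?i + 2) d)"
    using eqd_app_left[OF eqd_app_right[OF 2, of "row X (?i + 2) d"], of "row X k x"] X by simp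
  also have "eqd N \<dots> ((row X k x @ [X ?i, X (Suc ?i)]) @ row X (?i + 2) d @ [Pos ?i])"
    using eqd_app_left[OF 3, of "row X k x @ [X ?i, X (Suc ?i)]"] by simp
  finally show ?thesis by (simp add: row)
qed

text \<open>A crossing of two neighbouring strands is carried past m transverse strands, with one
  braid relation for each of them.\<close>

lemma slide_two_rows:
  assumes X: "crossing X" and "Suc (x + m) < N"
  shows "eqd N (Pos x # row X (Suc x) m @ row X x m) (row X (Suc x) m @ row X x m @ [Pos (x + m)])"
  using assms(2)
proof (induction m)
  case (Suc m)
  let ?i = "x + m"
  let ?A = "row X (Suc x) m" and ?B = "row X x m"
  have "eqd N (X (Suc ?i) # ?B) (?B @ [X (Suc ?i)])"
    by (rule eqd_far_word[of _ "Suc ?i"]) (use X in \<open>auto simp: set_row\<close>)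
  hence "eqd N (?A @ (X (Suc ?i) # ?B) @ [X ?i]) (?A @ (?B @ [X (Suc ?i)]) @ [X ?i])"
    by (intro eqd_app_left eqd_app_right) (use X in auto)
  hence comm: "eqd N (row X (Suc x) (Suc m) @ row X x (Suc m)) (?A @ ?B @ [X (Suc ?i), X ?i])"
    by (simp add: row_Suc)
  have "eqd N (Pos x # row X (Suc x) (Suc m) @ row X x (Suc m)) (Pos x # ?A @ ?B @ [X (Suc ?i), X ?i])"
    by (rule eqd_Cons[OF comm])
  also have "eqd N \<dots> (?A @ ?B @ [Pos ?i, X (Suc ?i), X ?i])"
    using eqd_app_right[OF Suc.IH, of "[X (Suc ?i), X ?i]"] Suc.prems X by auto
  also have "eqd N \<dots> (?A @ ?B @ [X (Suc ?i), X ?i, Pos (Suc ?i)])"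
    by (intro eqd_app_left eqd_braid(2)[OF X]) (use Suc.prems in simp)
  also have "eqd N \<dots> (row X (Suc x) (Suc m) @ row X x (Suc m) @ [Pos (x + Suc m)])"
    using eqd_sym[OF eqd_app_right[OF comm, of "[Pos (Suc ?i)]"]] by simp
  finally show ?case .
qed simp

lemma slide_right:
  assumes X: "crossing X" and "Suc x < m" "k + n + m \<le> N"
  shows "eqd N (Pos (k + n + x) # xcab X k n m) (xcab X k n m @ [Pos (k + x)])"
  using assms(3)
proof (induction n arbitrary: k)
  case (Suc n)
  have "eqd N (Pos (Suc k + n + x) # xcab X (Suc k) n m) (xcab X (Suc k) n m @ [Pos (Suc k + x)])"
    by (rule Suc.IH) (use Suc.prems in simp)
  hence "eqd N ((Pos (Suc k + n + x) # xcab X (Suc k) n m) @ row X k m) ((xcab X (Suc k) n m @ [Pos (Suc k + x)]) @ row X k m)"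
    by (rule eqd_app_right) (use X in simp)
  also have "eqd N \<dots> (xcab X (Suc k) n m @ row X k m @ [Pos (k + x)])"
    using eqd_app_left[OF slide_row[OF X assms(2), of k N], of "xcab X (Suc k) n m"] Suc.prems by simp
  finally show ?case by (simp add: xcab_Suc')
qed simp

lemma slide_left:
  assumes X: "crossing X" and "Suc x < n" "k + n + m \<le> N"
  shows "eqd N (Pos (k + x) # xcab X k n m) (xcab X k n m @ [Pos (k + m + x)])"
  using assms(2,3)
proof (induction n)
  case (Suc n)
  show ?case
  proof (cases "Suc x < n")
    case True
    have "eqd N (Pos (k + x) # row X (k + n) m) (row X (k + n) m @ [Pos (k + x)])"
      by (rule eqd_far_word[OF disjI1[OF refl]]) (use X True in \<open>auto simp: set_row\<close>)
    hence "eqd N ((Pos (k + x) # row X (k + n) m) @ xcab X k n m) ((row X (k + n) m @ [Pos (k + x)]) @ xcab X k n m)"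
      by (rule eqd_app_right) (use X in simp)
    also have "eqd N \<dots> (row X (k + n) m @ xcab X k n m @ [Pos (k + m + x)])"
      using eqd_app_left[OF Suc.IH[OF True], of "row X (k + n) m"] Suc.prems by simp
    finally show ?thesis by (simp add: xcab_Suc)
  next
    case False
    hence n: "n = Suc x" using Suc.prems by simp
    have "eqd N (Pos (k + x) # row X (Suc (k + x)) m @ row X (k + x) m)
       (row X (Suc (k + x)) m @ row X (k + x) m @ [Pos (k + x + m)])"
      by (rule slide_two_rows[OF X]) (use Suc.prems n in simp)
    hence "eqd N ((Pos (k + x) # row X (Suc (k + x)) m @ row X (k + x) m) @ xcab X k x m)
       ((row X (Suc (k + x)) m @ row X (k + x) m @ [Pos (k + x + m)]) @ xcab X k x m)"
      by (rule eqd_app_right) (use X in simp)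
    also have "eqd N (Pos (k + x + m) # xcab X k x m) (xcab X k x m @ [Pos (k + x + m)])"
    proof (rule eqd_far_word[OF disjI1[OF refl]])
      fix l assume "l \<in> set (xcab X k x m)"
      then obtain j r where "j < x" "r < m" "l = X (k + j + r)" using set_xcab by blast
      thus "\<exists>j. (l = Pos j \<or> l = Neg j) \<and> (Suc (k + x + m) < j \<or> Suc j < k + x + m)"
        using X by (intro exI[of _ "k + j + r"]) auto
    qed
    hence "eqd N ((row X (Suc (k + x)) m @ row X (k + x) m @ [Pos (k + x + m)]) @ xcab X k x m)
       ((row X (Suc (k + x)) m @ row X (k + x) m) @ xcab X k x m @ [Pos (k + x + m)])"
      using eqd_app_left[of N _ _ "row X (Suc (k + x)) m @ row X (k + x) m"] by simp
    finally show ?thesis by (simp add: xcab_Suc n add.commute add.left_commute)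
  qed
qed simp

lemma slide_right_word:
  assumes X: "crossing X" and "bword m w" "k + n + m \<le> N"
  shows "eqd N (map (\<lambda>i. Pos (k + n + i)) w @ xcab X k n m) (xcab X k n m @ map (\<lambda>i. Pos (k + i)) w)"
  using assms(2)
proof (induction w)
  case (Cons i w)
  have "eqd N (Pos (k + n + i) # map (\<lambda>i. Pos (k + n + i)) w @ xcab X k n m)
     (Pos (k + n + i) # xcab X k n m @ map (\<lambda>i. Pos (k + i)) w)"
    by (rule eqd_Cons) (use Cons in simp)
  also have "eqd N \<dots> ((xcab X k n m @ [Pos (k + i)]) @ map (\<lambda>i. Pos (k + i)) w)"
    using eqd_app_right[OF slide_right[OF X, of i m k n N], of "map (\<lambda>i. Pos (k + i)) w"] Cons.prems assms(3)
    by (auto simp: xword_def)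
  finally show ?case by simp
qed simp

lemma slide_left_word:
  assumes X: "crossing X" and "bword n w" "k + n + m \<le> N"
  shows "eqd N (map (\<lambda>i. Pos (k + i)) w @ xcab X k n m) (xcab X k n m @ map (\<lambda>i. Pos (k + m + i)) w)"
  using assms(2)
proof (induction w)
  case (Cons i w)
  have "eqd N (Pos (k + i) # map (\<lambda>i. Pos (k + i)) w @ xcab X k n m)
     (Pos (k + i) # xcab X k n m @ map (\<lambda>i. Pos (k + m + i)) w)"
    by (rule eqd_Cons) (use Cons in simp)
  also have "eqd N \<dots> ((xcab X k n m @ [Pos (k + m + i)]) @ map (\<lambda>i. Pos (k + m + i)) w)"
    using eqd_app_right[OF slide_left[OF X, of i n k m N], of "map (\<lambda>i. Pos (k + m + i)) w"] Cons.prems assms(3)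
    by (auto simp: xword_def)
  finally show ?case by simp
qed simp

section \<open>Cabled crossings read by columns, and their inverses\<close>

definition xcol :: "(nat \<Rightarrow> layer) \<Rightarrow> nat \<Rightarrow> nat \<Rightarrow> diagram" where
  "xcol X k n = map (\<lambda>j. X (k + j)) (rev [0..<n])"

lemma xcol_Suc: "xcol X k (Suc n) = X (k + n) # xcol X k n"
  by (simp add: xcol_def)

lemma xcol_Suc': "xcol X k (Suc n) = xcol X (Suc k) n @ [X k]"
  by (induction n) (simp_all add: xcol_def)

lemma set_xcol: "set (xcol X k n) = (\<lambda>r. X (k + r)) ` {..<n}"
  by (auto simp: xcol_def)

lemma far_words:
  assumes "\<And>l. l \<in> set P \<Longrightarrow> \<exists>i. (l = Pos i \<or> l = Neg i) \<and>
     (\<forall>l'\<in>set Q. \<exists>j. (l' = Pos j \<or> l' = Neg j) \<and> (Suc i < j \<or> Suc j < i))"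
  shows "eqd n (P @ Q) (Q @ P)"
  using assms
proof (induction P)
  case (Cons l P)
  obtain i where i: "l = Pos i \<or> l = Neg i"
    "\<forall>l'\<in>set Q. \<exists>j. (l' = Pos j \<or> l' = Neg j) \<and> (Suc i < j \<or> Suc j < i)"
    using Cons.prems[of l] by auto
  have xP: "xword P" unfolding xword_def
  proof
    fix l' assume "l' \<in> set P"
    thus "\<exists>i. l' = Pos i \<or> l' = Neg i" using Cons.prems[of l'] by auto
  qed
  have "eqd n (l # P @ Q) (l # Q @ P)"
    by (intro eqd_Cons Cons.IH) (use Cons.prems in simp)
  also have "eqd n \<dots> ((Q @ [l]) @ P)"
    using eqd_app_right[OF eqd_far_word[OF i(1), of Q] xP] i(2) by simp
  finally show ?case by simp
qed simp

text \<open>Far commutations alone postpone the crossings of the last strand of the right bundle to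
  the end. In this form a cable and its mirror image cancel strand by strand.\<close>

lemma xcab_xcol:
  assumes X: "crossing X"
  shows "eqd N (xcab X k n (Suc m)) (xcab X k n m @ xcol X (k + m) n)"
proof (induction n arbitrary: k)
  case 0
  show ?case by (simp add: xcol_def)
next
  case (Suc n)
  have "eqd N (xcab X (Suc k) n (Suc m) @ row X k m @ [X (k + m)])
     ((xcab X (Suc k) n m @ xcol X (Suc k + m) n) @ row X k m @ [X (k + m)])"
    by (rule eqd_app_right[OF Suc.IH]) (use X in auto)
  also have "eqd N (xcol X (Suc k + m) n @ row X k m) (row X k m @ xcol X (Suc k + m) n)"
  proof (rule far_words)
    fix l assume "l \<in> set (xcol X (Suc k + m) n)"
    then obtain r where "l = X (Suc k + m + r)" by (auto simp: set_xcol)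
    thus "\<exists>i. (l = Pos i \<or> l = Neg i) \<and>
     (\<forall>l'\<in>set (row X k m). \<exists>j. (l' = Pos j \<or> l' = Neg j) \<and> (Suc i < j \<or> Suc j < i))"
      using X by (intro exI[of _ "Suc k + m + r"]) (auto simp: set_row)
  qed
  hence "eqd N (xcab X (Suc k) n m @ (xcol X (Suc k + m) n @ row X k m) @ [X (k + m)])
     (xcab X (Suc k) n m @ (row X k m @ xcol X (Suc k + m) n) @ [X (k + m)])"
    by (intro eqd_app_left eqd_app_right) (use X in auto)
  hence "eqd N ((xcab X (Suc k) n m @ xcol X (Suc k + m) n) @ row X k m @ [X (k + m)])
     (xcab X k (Suc n) m @ xcol X (k + m) (Suc n))"
    by (simp add: xcab_Suc' xcol_Suc')
  finally show ?case by (simp add: xcab_Suc' row_Suc)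
qed

lemma xcol_row_inverse: "eqd N (xcol Pos k n @ row Neg k n) []"
proof (induction n)
  case (Suc n)
  have "eqd N (Pos (k + n) # (xcol Pos k n @ row Neg k n) @ [Neg (k + n)]) (Pos (k + n) # [] @ [Neg (k + n)])"
    by (intro eqd_Cons eqd_app_right Suc.IH) simp
  also have "eqd N (Pos (k + n) # [] @ [Neg (k + n)]) []" using eqd_Pos_Neg by simp
  finally show ?case by (simp add: xcol_Suc row_Suc)
qed (simp add: xcol_def)

lemma xcab_inverse: "eqd N (xcab Pos k n m @ xcab Neg k m n) []"
proof (induction m)
  case 0
  have "xcab Pos k n 0 = []" for n by (induction n) (simp_all add: xcab_Suc)
  thus ?case by simp
next
  case (Suc m)
  have "eqd N (xcab Pos k n (Suc m) @ xcab Neg k (Suc m) n)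
     ((xcab Pos k n m @ xcol Pos (k + m) n) @ row Neg (k + m) n @ xcab Neg k m n)"
    unfolding xcab_Suc[of Neg] by (rule eqd_app_right[OF xcab_xcol]) simp_all
  also have "eqd N (xcab Pos k n m @ (xcol Pos (k + m) n @ row Neg (k + m) n) @ xcab Neg k m n)
     (xcab Pos k n m @ [] @ xcab Neg k m n)"
    by (intro eqd_app_left eqd_app_right xcol_row_inverse) simp
  hence "eqd N ((xcab Pos k n m @ xcol Pos (k + m) n) @ row Neg (k + m) n @ xcab Neg k m n)
     (xcab Pos k n m @ xcab Neg k m n)" by simp
  also note Suc.IH
  finally show ?case .
qed

section \<open>Invariance under the quantum group\<close>

text \<open>
  The lowering operator acts by its iterated coproduct: it lowers one tensor factor, and the factors
  to the right of that one are scaled according to their weights.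
\<close>

definition spin :: "bool list \<Rightarrow> int" where "spin s = 2 * int (cnt s) - int (length s)"

primrec lower :: "bool list \<Rightarrow> vec \<Rightarrow> scalar" where
  "lower [] v = 0"
| "lower (a # s) v = (if a then 0 else q powi spin s * v (True # s)) + lower s (\<lambda>z. v (a # z))"

lemma spin_simps [simp]: "spin [] = 0" "spin (True # s) = spin s + 1" "spin (False # s) = spin s - 1"
  "spin (s @ s') = spin s + spin s'"
  by (simp_all add: spin_def)

lemma lower_lin: "lower s (\<lambda>z. a * v z + b * w z) = a * lower s v + b * lower s w"
  by (induction s arbitrary: v w) (simp_all add: algebra_simps)

lemma lower_scale: "lower s (\<lambda>z. a * v z) = a * lower s v"
  using lower_lin[of s a v 0 v] by simp

lemma lower_0 [simp]: "lower s (\<lambda>z. 0) = 0"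
  using lower_scale[of s 0 "\<lambda>_. 0"] by simp

lemma lower_sum: "finite I \<Longrightarrow> lower s (\<lambda>z. \<Sum>i\<in>I. f i z) = (\<Sum>i\<in>I. lower s (f i))"
proof (induction I rule: finite_induct)
  case (insert x I)
  thus ?case using lower_lin[of s 1 "f x" 1 "\<lambda>z. \<Sum>i\<in>I. f i z"] by simp
qed simp

lemma lower_neg: "lower s (\<lambda>z. - (a * v z)) = - (a * lower s v)"
  using lower_scale[of s "- a" v] by simp

lemma lower_cong: "(\<And>z. length z = length s \<Longrightarrow> v z = w z) \<Longrightarrow> lower s v = lower s w"
proof (induction s arbitrary: v w)
  case (Cons a s)
  have "lower s (\<lambda>z. v (a # z)) = lower s (\<lambda>z. w (a # z))"
    by (rule Cons.IH) (use Cons.prems in simp)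
  thus ?case using Cons.prems[of "True # s"] by simp
qed simp

lemma lower_append: "lower (p @ s) v = q powi spin s * lower p (\<lambda>z. v (z @ s)) + lower s (\<lambda>z. v (p @ z))"
  by (induction p arbitrary: v) (simp_all add: power_int_add algebra_simps)

text \<open>The two-strand vector created by a cup has weight zero and is annihilated by the
  lowering operator: its two contributions cancel because \<open>cupw False = - inverse q\<close>.
  Only the lowering of the other strands is left.\<close>

lemma lower_opcup:
  assumes "Suc i < length s"
  shows "lower s (opcup i v) = opcup i (\<lambda>z. lower z v) s"
proof -
  obtain p a b r where s: "s = p @ a # b # r" "length p = i" using assms by (rule split_list2)
  have 1: "lower p (\<lambda>z. opcup i v (z @ a # b # r)) = lower p (\<lambda>z. (if a \<noteq> b then cupw a else 0) * v (z @ r))"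
    by (rule lower_cong) (use s in \<open>simp add: opcup_pat\<close>)
  have 2: "lower r (\<lambda>z. if c then d * v (p @ z) else 0) = (if c then d else 0) * lower r (\<lambda>z. v (p @ z))" for c d
    by (simp add: lower_scale)
  have "spin (a # b # r) = spin r" if "a \<noteq> b" using that by (cases a; cases b) simp_all
  hence 3: "q powi spin (a # b # r) * ((if a \<noteq> b then cupw a else 0) * x) =
      (if a \<noteq> b then cupw a else 0) * (q powi spin r * x)" for x by simp
  show ?thesis unfolding s(1) lower_append 1 lower_scale 3 using s(2)
    by (cases a; cases b; simp add: opcup_pat 2 lower_append cupw_def lower_scale lower_neg power_int_diff;
        (simp add: field_simps)?)
qed

lemma lower_opcap:
  assumes "i \<le> length s"
  shows "lower s (opcap i v) = opcap i (\<lambda>z. lower z v) s"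
proof -
  obtain p r where s: "s = p @ r" "length p = i" using assms by (rule split_list1)
  have 1: "lower p (\<lambda>z. opcap i v (z @ r)) =
      lower p (\<lambda>z. - q * v (z @ True # False # r) + 1 * v (z @ False # True # r))"
    by (rule lower_cong) (use s in \<open>simp add: opcap_pat\<close>)
  have 2: "lower r (\<lambda>z. opcap i v (p @ z)) =
      lower r (\<lambda>z. - q * v (p @ True # False # z) + 1 * v (p @ False # True # z))"
    by (rule lower_cong) (use s in \<open>simp add: opcap_pat\<close>)
  show ?thesis unfolding s(1) opcap_pat[OF s(2)] unfolding lower_append 1 2 lower_lin
    by (simp add: algebra_simps power_int_add power_int_diff)
qed

lemma lower_layer_op:
  assumes "fits l n" "length s = width_after l n" "\<nexists>i. l = Merge i" "\<nexists>i. l = Split i"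
  shows "lower s (layer_op l v) = layer_op l (\<lambda>z. lower z v) s"
proof -
  have *: "opcup i (\<lambda>z. lower z (opcap i v)) s = opcup i (opcap i (\<lambda>z. lower z v)) s" for i
    using lower_opcap[of i "take i s @ drop (i + 2) s" v]
    by (cases "Suc i < length s") (simp_all add: opcup_def)
  show ?thesis using assms
    by (cases l) (auto simp: lower_opcup lower_opcap lower_lin *)
qed

lemma lower_ev:
  assumes "wfd n D m" "vertex_free D" "length s = m"
  shows "lower s (ev D v) = ev D (\<lambda>z. lower z v) s"
  using assms(1,2)
proof (induction D arbitrary: n v)
  case (Cons l D)
  have l: "fits l n" "wfd (width_after l n) D m" "vertex_free D" "\<nexists>i. l = Merge i" "\<nexists>i. l = Split i"
    using Cons.prems by auto
  have "lower s (ev (l # D) v) = ev D (\<lambda>z. lower z (layer_op l v)) s"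
    using Cons.IH[OF l(2,3)] by (simp add: ev_Cons)
  also have "\<dots> = ev D (layer_op l (\<lambda>z. lower z v)) s"
    by (rule ev_cong[OF l(2,3) _ assms(3)]) (rule lower_layer_op[OF l(1) _ l(4,5)])
  finally show ?case by (simp add: ev_Cons)
qed simp

text \<open>All strings that contribute to the lowering at \<open>s\<close> have one sign + more
  than \<open>s\<close>, so \<open>f\<close> enters through a single value.\<close>

lemma lower_weighted: "lower s (\<lambda>z. f (cnt z) * Uw z) = f (Suc (cnt s)) * lower s Uw"
proof (induction s arbitrary: f)
  case (Cons a s)
  have "lower s (\<lambda>z. f (cnt z) * (q ^ cnt z * Uw z)) = f (Suc (cnt s)) * (q ^ Suc (cnt s) * lower s Uw)"
    using Cons.IH[of "\<lambda>k. f k * q ^ k"] by (simp add: mult.assoc)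
  moreover have "lower s (\<lambda>z. q ^ cnt z * Uw z) = q ^ Suc (cnt s) * lower s Uw"
    using Cons.IH[of "\<lambda>k. q ^ k"] by simp
  ultimately show ?case
    using Cons.IH[of "\<lambda>k. f (Suc k)"] by (cases a) (simp_all add: algebra_simps)
qed simp

text \<open>The action of the lowering operator on the irreducible module in its q-symmetric basis:
  u_(k+1) goes to [n-k] u_k.\<close>

lemma lower_Uw: "lower s Uw = qint (length s - cnt s) * Uw s"
proof (induction s)
  case (Cons a s)
  have d: "length s = cnt s + (length s - cnt s)" using cnt_le_length[of s] by simp
  show ?case
  proof (cases a)
    case True
    thus ?thesis using Cons by simp
  next
    case False
    have "lower s (\<lambda>z. Uw (False # z)) = q ^ Suc (cnt s) * lower s Uw"
      using lower_weighted[of s "\<lambda>k. q ^ k"] by simp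
    moreover have "qint (Suc (length s - cnt s)) * q ^ cnt s =
        q powi spin s + q ^ Suc (cnt s) * qint (length s - cnt s)"
    proof -
      have "spin s = int (cnt s) - int (length s - cnt s)" using d by (simp add: spin_def)
      hence "q powi spin s = q ^ cnt s / q ^ (length s - cnt s)" by (simp add: power_int_diff)
      thus ?thesis by (simp add: qint_Suc power_int_minus field_simps)
    qed
    ultimately show ?thesis using Cons False cnt_le_length[of s]
      by (simp add: Suc_diff_le) (simp add: algebra_simps)
  qed
qed simp

section \<open>Cabled layers\<close>

type_synonym bvec = "bool list list \<Rightarrow> scalar"

subsection \<open>Finite linear functionals\<close>

text \<open>Vectors are functions on infinitely many strings, and no tensor products are formed.
  Functionals of finite support replace them: \<open>lfun_swap\<close> expresses that operators on
  different blocks commute.\<close>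

definition lfun :: "(('a \<Rightarrow> scalar) \<Rightarrow> scalar) \<Rightarrow> bool" where
  "lfun \<Lambda> \<longleftrightarrow> (\<exists>xs. \<forall>v. \<Lambda> v = (\<Sum>(c, x)\<leftarrow>xs. c * v x))"

lemma lfun_point [intro]: "lfun (\<lambda>v. v x)"
  unfolding lfun_def by (intro exI[of _ "[(1, x)]"]) simp

lemma lfun_0 [intro]: "lfun (\<lambda>v. 0)"
  unfolding lfun_def by (intro exI[of _ "[]"]) simp

lemma lfun_add [intro]:
  assumes "lfun \<Lambda>" "lfun M"
  shows "lfun (\<lambda>v. \<Lambda> v + M v)"
proof -
  obtain xs ys where "\<And>v. \<Lambda> v = (\<Sum>(c, x)\<leftarrow>xs. c * v x)" "\<And>v. M v = (\<Sum>(c, x)\<leftarrow>ys. c * v x)"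
    using assms unfolding lfun_def by blast
  thus ?thesis unfolding lfun_def by (intro exI[of _ "xs @ ys"]) simp
qed

lemma lfun_scale [intro]:
  assumes "lfun \<Lambda>"
  shows "lfun (\<lambda>v. a * \<Lambda> v)"
proof -
  obtain xs where "\<And>v. \<Lambda> v = (\<Sum>(c, x)\<leftarrow>xs. c * v x)"
    using assms unfolding lfun_def by blast
  thus ?thesis unfolding lfun_def
    by (intro exI[of _ "map (\<lambda>(c, x). (a * c, x)) xs"])
      (simp add: sum_list_const_mult[symmetric] comp_def case_prod_beta mult.assoc)
qed

lemma lfun_sum [intro]: "(\<And>i. i \<in> I \<Longrightarrow> lfun (\<Lambda> i)) \<Longrightarrow> lfun (\<lambda>v. \<Sum>i\<in>I. \<Lambda> i v)"
  by (induction I rule: infinite_finite_induct) auto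

lemma lfun_comp:
  assumes "lfun \<Lambda>" "\<And>x. lfun (M x)"
  shows "lfun (\<lambda>v. \<Lambda> (\<lambda>x. M x v))"
proof -
  obtain xs where *: "\<And>v. \<Lambda> v = (\<Sum>(c, x)\<leftarrow>xs. c * v x)"
    using assms(1) unfolding lfun_def by blast
  have "lfun (\<lambda>v. \<Sum>(c, x)\<leftarrow>xs. c * M x v)" for xs
  proof (induction xs)
    case (Cons cx xs)
    show ?case by (cases cx) (simp, intro lfun_add lfun_scale assms(2) Cons.IH)
  qed (simp add: lfun_0)
  thus ?thesis by (simp add: *)
qed

lemma lfun_lin:
  assumes "lfun \<Lambda>"
  shows "\<Lambda> (\<lambda>x. a * v x + b * w x) = a * \<Lambda> v + b * \<Lambda> w"
proof -
  obtain xs where *: "\<And>v. \<Lambda> v = (\<Sum>(c, x)\<leftarrow>xs. c * v x)"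
    using assms unfolding lfun_def by blast
  show ?thesis unfolding * by (induction xs) (auto simp: algebra_simps)
qed

lemma lfun_scaled: "lfun \<Lambda> \<Longrightarrow> \<Lambda> (\<lambda>x. a * v x) = a * \<Lambda> v"
  using lfun_lin[of \<Lambda> a v 0 v] by simp

lemma lfun_zero: "lfun \<Lambda> \<Longrightarrow> \<Lambda> (\<lambda>x. 0) = 0"
  using lfun_scaled[of \<Lambda> 0 "\<lambda>_. 0"] by simp

lemma lfun_sums: "lfun \<Lambda> \<Longrightarrow> \<Lambda> (\<lambda>x. \<Sum>i\<in>I. f i x) = (\<Sum>i\<in>I. \<Lambda> (f i))"
proof (induction I rule: infinite_finite_induct)
  case (insert i I)
  thus ?case using lfun_lin[of \<Lambda> 1 "f i" 1 "\<lambda>x. \<Sum>i\<in>I. f i x"] by simp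
qed (simp_all add: lfun_zero)

lemma lfun_swap:
  assumes "lfun \<Lambda>" "lfun M"
  shows "\<Lambda> (\<lambda>x. M (\<lambda>y. f x y)) = M (\<lambda>y. \<Lambda> (\<lambda>x. f x y))"
proof -
  obtain xs where *: "\<And>v. M v = (\<Sum>(c, x)\<leftarrow>xs. c * v x)"
    using assms(2) unfolding lfun_def by blast
  have "\<Lambda> (\<lambda>x. \<Sum>(c, y)\<leftarrow>xs. c * f x y) = (\<Sum>(c, y)\<leftarrow>xs. c * \<Lambda> (\<lambda>x. f x y))"
  proof (induction xs)
    case (Cons cy xs)
    obtain c y where cy: "cy = (c, y)" by (cases cy)
    show ?case using Cons lfun_lin[OF assms(1), of c "\<lambda>x. f x y" 1 "\<lambda>x. \<Sum>(c, y)\<leftarrow>xs. c * f x y"]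
      by (simp add: cy)
  qed (simp add: lfun_zero[OF assms(1)])
  thus ?thesis by (simp add: *)
qed

lemma lfun_opcup: "lfun (\<lambda>v. opcup i v s)"
proof (cases "Suc i < length s \<and> s ! i \<noteq> s ! Suc i")
  case True
  hence "(\<lambda>v. opcup i v s) = (\<lambda>v. cupw (s ! i) * v (take i s @ drop (i + 2) s))"
    by (auto simp: opcup_def)
  thus ?thesis by (simp only:) (intro lfun_scale lfun_point)
next
  case False
  hence "(\<lambda>v. opcup i v s) = (\<lambda>v. 0)" by (auto simp: opcup_def)
  thus ?thesis by (simp only: lfun_0)
qed

lemma lfun_opcap: "lfun (\<lambda>v. opcap i v s)"
  unfolding opcap_def by (intro lfun_add lfun_scale lfun_point)

lemma lfun_layer_op: "lfun (\<lambda>v. layer_op l v s)"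
proof -
  have "lfun (\<lambda>v. opcup i (opcap i v) s)" for i
    using lfun_comp[of "\<lambda>v. opcup i v s" "\<lambda>x v. opcap i v x"] lfun_opcup lfun_opcap by blast
  thus ?thesis by (cases l) (simp_all add: lfun_opcup lfun_opcap lfun_add lfun_scale lfun_point)
qed

lemma lfun_ev: "lfun (\<lambda>v. ev D v s)"
proof (induction D arbitrary: s)
  case (Cons l D)
  show ?case unfolding ev_Cons by (rule lfun_comp[OF Cons.IH lfun_layer_op])
qed auto

subsection \<open>The Jones--Wenzl element as an operator\<close>

definition jc :: "nat \<Rightarrow> (nat \<Rightarrow> nat) \<Rightarrow> scalar" where
  "jc n \<sigma> = qh ^ (3 * invs n \<sigma>) / (qh ^ (n * (n - 1)) * qfact n)"

text \<open>The sum over braids, as in the bracket. This form slides along edges and is visibly a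
  finite functional; the closed form \<open>jw\<close>, which agrees with it on strings of length n,
  serves for computations.\<close>

definition JW :: "nat \<Rightarrow> vec \<Rightarrow> vec" where
  "JW n v s = (\<Sum>\<sigma>\<in>perms n. jc n \<sigma> * ev (map Pos (min_braid n \<sigma>)) v s)"

lemma JW_eq: "length s = n \<Longrightarrow> JW n v s = jw n v s"
  using jw_sum[of "of_nat n / 2" n s v] jw_coeff_eq[of "of_nat n / 2" n]
  by (simp add: JW_def jc_def perms_def)

lemma lfun_JW: "lfun (\<lambda>v. JW n v s)"
  unfolding JW_def by (intro lfun_sum lfun_scale lfun_ev)

lemma JW_cong: "(\<And>s. length s = n \<Longrightarrow> v s = w s) \<Longrightarrow> length s = n \<Longrightarrow> JW n v s = JW n w s"
  unfolding JW_def by (intro sum.cong refl arg_cong2[of _ _ _ _ "(*)"] ev_x_cong) auto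

lemma jw_idem:
  assumes "length s = n"
  shows "jw n (jw n v) s = jw n v s"
proof -
  let ?k = "cnt s"
  have n0: "nrm n ?k \<noteq> 0" using nrm_nonzero cnt_le_length[of s] assms by simp
  define S where "S = (\<Sum>s'\<in>cl n ?k. Uw s' * v s')"
  have "(\<Sum>s'\<in>cl n ?k. Uw s' * jw n v s') = (\<Sum>s'\<in>cl n ?k. (Uw s')\<^sup>2 * (S / nrm n ?k))"
    by (intro sum.cong refl) (simp add: cl_def jw_def S_def power2_eq_square)
  also have "\<dots> = nrm n ?k * (S / nrm n ?k)" by (simp only: nrm_def sum_distrib_right[symmetric])
  finally have "(\<Sum>s'\<in>cl n ?k. Uw s' * jw n v s') = S" using n0 by simp
  thus ?thesis by (simp add: jw_def[of n "jw n v"]) (simp add: jw_def S_def)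
qed

lemma JW_idem:
  assumes "length s = n"
  shows "JW n (JW n v) s = JW n v s"
proof -
  have "JW n (JW n v) s = JW n (jw n v) s" by (rule JW_cong[OF _ assms]) (rule JW_eq)
  thus ?thesis by (simp add: JW_eq assms jw_idem)
qed

definition app :: "nat \<Rightarrow> (vec \<Rightarrow> vec) \<Rightarrow> bvec \<Rightarrow> bvec" where
  "app i X v ss = X (\<lambda>x. v (ss[i := x])) (ss ! i)"

lemma app_pat: "length A = i \<Longrightarrow> app i X v (A @ x # B) = X (\<lambda>z. v (A @ z # B)) x"
  by (simp add: app_def list_update_append nth_append)

lemma app_JW_commute: "app i (JW n) (app j (JW m) v) = app j (JW m) (app i (JW n) v)" if "i \<noteq> j"
proof
  fix ss
  have "app i (JW n) (app j (JW m) v) ss = JW n (\<lambda>x. JW m (\<lambda>y. v (ss[i := x, j := y])) (ss ! j)) (ss ! i)"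
    using that by (simp add: app_def)
  also have "\<dots> = JW m (\<lambda>y. JW n (\<lambda>x. v (ss[i := x, j := y])) (ss ! i)) (ss ! j)"
    by (rule lfun_swap[OF lfun_JW lfun_JW])
  also have "\<dots> = JW m (\<lambda>y. JW n (\<lambda>x. v (ss[j := y, i := x])) (ss ! i)) (ss ! j)"
    by (simp only: list_update_swap[OF that])
  also have "\<dots> = app j (JW m) (app i (JW n) v) ss"
    using that by (simp add: app_def)
  finally show "app i (JW n) (app j (JW m) v) ss = app j (JW m) (app i (JW n) v) ss" .
qed

lemma app_JW_idem: "i < length ss \<Longrightarrow> length (ss ! i) = n \<Longrightarrow> app i (JW n) (app i (JW n) v) ss = app i (JW n) v ss"
  by (simp add: app_def JW_idem)

subsection \<open>Shapes\<close>

abbreviation shape :: "bool list list \<Rightarrow> nat list" where "shape ss \<equiv> map length ss"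

primrec cut :: "nat list \<Rightarrow> bool list \<Rightarrow> bool list list" where
  "cut [] s = []"
| "cut (n # ns) s = take n s # cut ns (drop n s)"

lemma cut_concat: "shape ss = ns \<Longrightarrow> cut ns (concat ss) = ss"
  by (induction ns arbitrary: ss) auto

lemma shape_cut: "length s = sum_list ns \<Longrightarrow> shape (cut ns s) = ns"
  by (induction ns arbitrary: s) auto

lemma concat_cut: "length s = sum_list ns \<Longrightarrow> concat (cut ns s) = s"
  by (induction ns arbitrary: s) auto

lemma length_concat_shape: "shape ss = ns \<Longrightarrow> length (concat ss) = sum_list ns"
  by (auto simp: length_concat)

lemma cut_append: "length a = sum_list A \<Longrightarrow> cut (A @ B) (a @ b) = cut A a @ cut B b"
  by (induction A arbitrary: a) auto

lemma shape_append_cases: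
  assumes "shape ss = A @ B"
  obtains SA SB where "ss = SA @ SB" "shape SA = A" "shape SB = B"
  using assms by (metis append_eq_map_conv)

subsection \<open>Cups and caps\<close>

definition cups :: "nat \<Rightarrow> diagram" where "cups n = map Cup [0..<n]"
definition caps :: "nat \<Rightarrow> diagram" where "caps n = map Cap (rev [0..<n])"

text \<open>The string at the other end of a bundle of nested cups or caps: the order is reversed
  and each sign changes. It preserves \<open>Uw\<close> and exchanges the weights k and n -
  k.\<close>

definition bar :: "bool list \<Rightarrow> bool list" where "bar x = rev (map Not x)"

lemma length_bar [simp]: "length (bar x) = length x"
  and bar_bar [simp]: "bar (bar x) = x"
  and cnt_bar: "cnt (bar x) = length x - cnt x"
  by (simp_all add: bar_def rev_map comp_def cnt_map_Not)

lemma Uw_bar [simp]: "Uw (bar x) = Uw x"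
  by (simp add: bar_def Uw_rev_Not)

lemma bar_snoc: "bar (x @ [a]) = (\<not> a) # bar x"
  by (simp add: bar_def)

definition cw :: "bool list \<Rightarrow> scalar" where "cw x = (- inverse q) ^ (length x - cnt x)"
definition kw :: "bool list \<Rightarrow> scalar" where "kw x = (- q) ^ cnt x"

lemma ev_cups:
  assumes "length x = n" "length y = n" "length p = k"
  shows "ev (map (sh k) (cups n)) v (p @ x @ y @ r) = (if y = bar x then cw x * v (p @ r) else 0)"
  using assms(1,2)
proof (induction n arbitrary: x y)
  case (Suc n)
  obtain x' a where x: "x = x' @ [a]" "length x' = n"
    using Suc.prems by (metis length_Suc_conv_rev)
  obtain b y' where y: "y = b # y'" "length y' = n"
    using Suc.prems by (metis length_Suc_conv)
  have c: "length x' + (if a then 1 else 0) - cnt x' = (length x' - cnt x') + (if a then 1 else 0)"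
    using cnt_le_length[of x'] by simp
  have "ev (map (sh k) (cups (Suc n))) v (p @ x @ y @ r) =
     opcup (k + n) (ev (map (sh k) (cups n)) v) ((p @ x') @ a # b # (y' @ r))"
    by (simp add: cups_def ev_append ev_Cons x y)
  also have "\<dots> = (if a \<noteq> b then cupw a * ev (map (sh k) (cups n)) v ((p @ x') @ (y' @ r)) else 0)"
    by (rule opcup_pat) (simp add: assms x)
  also have "\<dots> = (if a \<noteq> b then cupw a * (if y' = bar x' then cw x' * v (p @ r) else 0) else 0)"
    using Suc.IH[OF x(2) y(2)] by simp
  also have "\<dots> = (if y = bar x then cw x * v (p @ r) else 0)"
    using cnt_le_length[of x'] by (auto simp: x y bar_snoc cw_def cupw_def Suc_diff_le)
  finally show ?case .
qed (simp add: cups_def bar_def cw_def)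

lemma ev_caps:
  assumes "length p = k"
  shows "ev (map (sh k) (caps n)) v (p @ r) = (\<Sum>x\<in>strs n. kw x * v (p @ x @ bar x @ r))"
proof (induction n arbitrary: v)
  case (Suc n)
  have "ev (map (sh k) (caps (Suc n))) v (p @ r) = ev (map (sh k) (caps n)) (opcap (k + n) v) (p @ r)"
    by (simp add: caps_def ev_Cons)
  also have "\<dots> = (\<Sum>x\<in>strs n. kw x * opcap (k + n) v ((p @ x) @ (bar x @ r)))"
    using Suc.IH by simp
  also have "\<dots> = (\<Sum>x\<in>strs n. kw x * (- q * v ((p @ x) @ True # False # bar x @ r) + v ((p @ x) @ False # True # bar x @ r)))"
    by (intro sum.cong refl) (subst opcap_pat, auto simp: assms strs_def)
  also have "\<dots> = (\<Sum>x\<in>strs n. \<Sum>z\<in>strs 1. kw (x @ z) * v (p @ (x @ z) @ bar (x @ z) @ r))"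
    by (intro sum.cong refl) (simp add: sum_strs_Suc bar_snoc kw_def algebra_simps)
  also have "\<dots> = (\<Sum>x\<in>strs (Suc n). kw x * v (p @ x @ bar x @ r))"
    using sum_strs_add[of "\<lambda>x. kw x * v (p @ x @ bar x @ r)" n 1] by simp
  finally show ?case .
qed (simp add: caps_def bar_def kw_def)

subsection \<open>Local form of a cabled layer\<close>

text \<open>A layer with the strand numbers of the edges it involves, below and above. At a vertex
  x, s, y are the numbers of strands joining two of its edges, so that the triangle inequalities and
  the parity condition are built in.\<close>

inductive loc :: "layer \<Rightarrow> nat \<Rightarrow> nat list \<Rightarrow> nat list \<Rightarrow> bool" where
  "loc (Cup i) i [] [n, n]"
| "loc (Cap i) i [n, n] []"
| "loc (Pos i) i [n, m] [m, n]"
| "loc (Neg i) i [n, m] [m, n]"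
| "loc (Merge i) i [x + s, s + y] [x + y]"
| "loc (Split i) i [x + y] [x + s, s + y]"

definition lay :: "layer \<Rightarrow> nat list \<Rightarrow> nat list \<Rightarrow> bvec \<Rightarrow> bvec" where
  "lay l ns ns' v ss = ev (cable_layer ((!) ns) ((!) ns') l) (\<lambda>s. v (cut ns s)) (concat ss)"

fun core :: "layer \<Rightarrow> nat list \<Rightarrow> nat list \<Rightarrow> diagram" where
  "core (Cup i) C C' = cups (C' ! 0)"
| "core (Cap i) C C' = caps (C ! 0)"
| "core (Pos i) C C' = xcab Pos 0 (C ! 0) (C ! 1)"
| "core (Neg i) C C' = xcab Neg 0 (C ! 0) (C ! 1)"
| "core (Merge i) C C' = (let s = (C ! 0 + C ! 1 - C' ! 0) div 2 in map (sh (C ! 0 - s)) (caps s))"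
| "core (Split i) C C' = (let s = (C' ! 0 + C' ! 1 - C ! 0) div 2 in map (sh (C' ! 0 - s)) (cups s))"

lemma offset: "length A = i \<Longrightarrow> (\<Sum>l<i. (A @ B) ! l) = sum_list A"
  by (simp add: sum_list_sum_nth nth_append atLeast0LessThan)

lemma offset': "length A = i \<Longrightarrow> (\<Sum>l<i. A ! l) = sum_list A"
  using offset[of A i "[]"] by simp

lemma cable_layer_core:
  assumes "loc l i C C'" "length A = i"
  shows "cable_layer ((!) (A @ C @ B)) ((!) (A @ C' @ B)) l = map (sh (sum_list A)) (core l C C')"
  using assms(1)
proof cases
  case (3 n m)
  thus ?thesis using assms(2) xcab_sh[of Pos "sum_list A" 0 n m]
    by (simp add: offset offset' nth_append xcab_def row_def)
next
  case (4 n m)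
  thus ?thesis using assms(2) xcab_sh[of Neg "sum_list A" 0 n m]
    by (simp add: offset offset' nth_append xcab_def row_def)
qed (use assms(2) in \<open>simp_all add: offset offset' nth_append cups_def caps_def Let_def add.assoc\<close>)

lemma wfd_cups: "k \<le> N \<Longrightarrow> wfd N (map (sh k) (cups n)) (N + 2 * n)"
  by (induction n) (auto simp: cups_def wfd_append intro!: exI[of _ "N + 2 * _"])

lemma wfd_caps: "k \<le> N \<Longrightarrow> wfd (N + 2 * n) (map (sh k) (caps n)) N"
proof (induction n)
  case (Suc n)
  thus ?case by (simp add: caps_def)
qed (simp add: caps_def)

lemma vertex_free_cups [simp]: "vertex_free (map (sh k) (cups n))" "vertex_free (map (sh k) (caps n))"
  by (auto simp: vertex_free_def cups_def caps_def)

lemma sh_0 [simp]: "map (sh 0) D = D"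
proof -
  have "sh 0 l = l" for l by (cases l) simp_all
  thus ?thesis by (simp add: map_idI)
qed

lemma wfd_core:
  assumes "loc l i C C'"
  shows "wfd (sum_list C) (core l C C') (sum_list C')" "vertex_free (core l C C')"
proof -
  show "wfd (sum_list C) (core l C C') (sum_list C')"
    using assms
  proof cases
    case (1 n)
    thus ?thesis using wfd_cups[of 0 0 n] by (simp add: mult_2)
  next
    case (2 n)
    thus ?thesis using wfd_caps[of 0 0 n] by (simp add: mult_2)
  next
    case (3 n m)
    thus ?thesis using wfd_xcab[of Pos 0 n m "n + m"] by (simp add: add.commute)
  next
    case (4 n m)
    thus ?thesis using wfd_xcab[of Neg 0 n m "n + m"] by (simp add: add.commute)
  next
    case (5 x s y)
    have e: "x + y + 2 * s = x + s + (s + y)" by simp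
    have "wfd (x + s + (s + y)) (map (sh x) (caps s)) (x + y)"
      using wfd_caps[of x "x + y" s] unfolding e by simp
    thus ?thesis using 5 by (simp add: Let_def)
  next
    case (6 x y s)
    have e: "x + y + 2 * s = x + s + (s + y)" by simp
    have "wfd (x + y) (map (sh x) (cups s)) (x + s + (s + y))"
      using wfd_cups[of x "x + y" s] unfolding e by simp
    thus ?thesis using 6 by (simp add: Let_def)
  qed
  have "vertex_free (cups n)" "vertex_free (caps n)" for n
    using vertex_free_cups[of 0 n] by simp_all
  thus "vertex_free (core l C C')"
    by (cases l) (simp_all add: xword_vertex_free Let_def)
qed

definition lcl :: "layer \<Rightarrow> nat list \<Rightarrow> nat list \<Rightarrow> bool list list \<Rightarrow> bvec \<Rightarrow> scalar" where
  "lcl l C C' S f = ev (core l C C') (\<lambda>z. f (cut C z)) (concat S)"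

lemma lfun_lcl: "lfun (lcl l C C' S)"
  unfolding lcl_def[abs_def] by (rule lfun_comp[OF lfun_ev]) auto

lemma lay_local:
  assumes "loc l i C C'" "length A = i" "shape SA = A" "shape S = C'" "shape SB = B"
  shows "lay l (A @ C @ B) (A @ C' @ B) v (SA @ S @ SB) = lcl l C C' S (\<lambda>T. v (SA @ T @ SB))"
proof -
  let ?D = "core l C C'"
  have len: "length (concat S) = sum_list C'" "length (concat SA) = sum_list A"
    using assms by (auto simp: length_concat)
  have "lay l (A @ C @ B) (A @ C' @ B) v (SA @ S @ SB) =
      ev (map (sh (sum_list A)) ?D) (\<lambda>s. v (cut (A @ C @ B) s)) (concat SA @ concat S @ concat SB)"
    by (simp add: lay_def cable_layer_core[OF assms(1,2)])
  also have "\<dots> = ev ?D (\<lambda>z. v (cut (A @ C @ B) (concat SA @ z @ concat SB))) (concat S)"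
    by (rule ev_local[OF _ wfd_core(2)[OF assms(1)] len(2)]) (use wfd_core(1)[OF assms(1)] len in simp)
  also have "\<dots> = ev ?D (\<lambda>z. v (SA @ cut C z @ SB)) (concat S)"
  proof (rule ev_cong[OF wfd_core[OF assms(1)] _ len(1)])
    fix z :: "bool list" assume "length z = sum_list C"
    thus "v (cut (A @ C @ B) (concat SA @ z @ concat SB)) = v (SA @ cut C z @ SB)"
      using assms len by (simp add: cut_append cut_concat)
  qed
  finally show ?thesis by (simp add: lcl_def)
qed

lemma lcl_cong:
  assumes "loc l i C C'" "shape S = C'" "\<And>T. shape T = C \<Longrightarrow> f T = g T"
  shows "lcl l C C' S f = lcl l C C' S g"
  unfolding lcl_def
  by (rule ev_cong[OF wfd_core[OF assms(1)]])
    (use assms(2,3) in \<open>auto simp: shape_cut length_concat\<close>)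

lemma lcl_Cup:
  assumes "length x = n" "length y = n"
  shows "lcl (Cup i) [] [n, n] [x, y] f = (if y = bar x then cw x * f [] else 0)"
  using ev_cups[OF assms, of "[]" 0 "\<lambda>z. f []" "[]"] by (simp add: lcl_def)

lemma lcl_Cap: "lcl (Cap i) [n, n] [] [] f = (\<Sum>x\<in>strs n. kw x * f [x, bar x])"
proof -
  have "lcl (Cap i) [n, n] [] [] f = (\<Sum>x\<in>strs n. kw x * f (cut [n, n] (x @ bar x)))"
    using ev_caps[of "[]" 0 n "\<lambda>z. f (cut [n, n] z)" "[]"] by (simp add: lcl_def)
  thus ?thesis by (simp add: strs_def)
qed

lemma lcl_Merge:
  assumes "length x = a" "length z = b"
  shows "lcl (Merge i) [a + s, s + b] [a + b] [x @ z] f = (\<Sum>y\<in>strs s. kw y * f [x @ y, bar y @ z])"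
proof -
  have "lcl (Merge i) [a + s, s + b] [a + b] [x @ z] f =
      (\<Sum>y\<in>strs s. kw y * f (cut [a + s, s + b] (x @ y @ bar y @ z)))"
    using ev_caps[OF assms(1), of s "\<lambda>z. f (cut [a + s, s + b] z)" z] by (simp add: lcl_def)
  thus ?thesis using assms by (simp add: strs_def)
qed

lemma lcl_Split:
  assumes "length x = a" "length y = s" "length y' = s" "length z = b"
  shows "lcl (Split i) [a + b] [a + s, s + b] [x @ y, y' @ z] f = (if y' = bar y then cw y * f [x @ z] else 0)"
  using ev_cups[OF assms(2,3,1), of "\<lambda>z. f (cut [a + b] z)" z] assms by (simp add: lcl_def)

subsection \<open>Sliding the Jones--Wenzl element\<close>

lemma slide_before:
  assumes "loc l i C C'" "length A = i" "j < i" "shape ss = A @ C' @ B"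
  shows "lay l (A @ C @ B) (A @ C' @ B) (app j (JW (A ! j)) v) ss =
    app j (JW (A ! j)) (lay l (A @ C @ B) (A @ C' @ B) v) ss"
proof -
  obtain SA S SB where ss: "ss = SA @ S @ SB" "shape SA = A" "shape S = C'" "shape SB = B"
    using assms(4) by (metis shape_append_cases)
  have j: "j < length SA" using ss assms by (metis length_map)
  have len: "length (SA ! j) = A ! j" using ss(2) j by auto
  have upd: "shape (SA[j := z]) = A" if "length z = A ! j" for z
    using that ss(2) by (metis list_update_id map_update)
  have "lay l (A @ C @ B) (A @ C' @ B) (app j (JW (A ! j)) v) ss =
      lcl l C C' S (\<lambda>T. JW (A ! j) (\<lambda>z. v (SA[j := z] @ T @ SB)) (SA ! j))"
    unfolding ss(1) lay_local[OF assms(1,2) ss(2-4)] using j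
    by (simp add: app_def nth_append list_update_append)
  also have "\<dots> = JW (A ! j) (\<lambda>z. lcl l C C' S (\<lambda>T. v (SA[j := z] @ T @ SB))) (SA ! j)"
    by (rule lfun_swap[OF lfun_lcl lfun_JW])
  also have "\<dots> = JW (A ! j) (\<lambda>z. lay l (A @ C @ B) (A @ C' @ B) v (SA[j := z] @ S @ SB)) (SA ! j)"
    by (rule JW_cong[OF _ len]) (rule lay_local[OF assms(1,2) upd ss(3,4), symmetric])
  also have "\<dots> = app j (JW (A ! j)) (lay l (A @ C @ B) (A @ C' @ B) v) ss"
    unfolding ss(1) using j by (simp add: app_def nth_append list_update_append)
  finally show ?thesis .
qed

lemma slide_after:
  assumes "loc l i C C'" "length A = i" "j < length B" "shape ss = A @ C' @ B"
  shows "lay l (A @ C @ B) (A @ C' @ B) (app (i + length C + j) (JW (B ! j)) v) ss =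
    app (i + length C' + j) (JW (B ! j)) (lay l (A @ C @ B) (A @ C' @ B) v) ss"
proof -
  obtain SA S SB where ss: "ss = SA @ S @ SB" "shape SA = A" "shape S = C'" "shape SB = B"
    using assms(4) by (metis shape_append_cases)
  have j: "j < length SB" using ss assms by (metis length_map)
  have len: "length (SB ! j) = B ! j" using ss(4) j by auto
  have lens: "length SA = i" "length S = length C'" using ss assms(2) by auto
  have upd: "shape (SB[j := z]) = B" if "length z = B ! j" for z
    using that ss(4) by (metis list_update_id map_update)
  have "lay l (A @ C @ B) (A @ C' @ B) (app (i + length C + j) (JW (B ! j)) v) ss =
      lcl l C C' S (\<lambda>T. app (i + length C + j) (JW (B ! j)) v (SA @ T @ SB))"
    unfolding ss(1) lay_local[OF assms(1,2) ss(2-4)] ..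
  also have "\<dots> = lcl l C C' S (\<lambda>T. JW (B ! j) (\<lambda>z. v (SA @ T @ SB[j := z])) (SB ! j))"
  proof (rule lcl_cong[OF assms(1) ss(3)])
    fix T assume "shape T = C"
    hence "length T = length C" by auto
    thus "app (i + length C + j) (JW (B ! j)) v (SA @ T @ SB) =
        JW (B ! j) (\<lambda>z. v (SA @ T @ SB[j := z])) (SB ! j)"
      using lens by (simp add: app_def nth_append list_update_append)
  qed
  also have "\<dots> = JW (B ! j) (\<lambda>z. lcl l C C' S (\<lambda>T. v (SA @ T @ SB[j := z]))) (SB ! j)"
    by (rule lfun_swap[OF lfun_lcl lfun_JW])
  also have "\<dots> = JW (B ! j) (\<lambda>z. lay l (A @ C @ B) (A @ C' @ B) v (SA @ S @ SB[j := z])) (SB ! j)"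
    by (rule JW_cong[OF _ len]) (rule lay_local[OF assms(1,2) ss(2,3) upd, symmetric])
  also have "\<dots> = app (i + length C' + j) (JW (B ! j)) (lay l (A @ C @ B) (A @ C' @ B) v) ss"
    unfolding ss(1) using lens by (simp add: app_def nth_append list_update_append)
  finally show ?thesis .
qed

section \<open>Jones--Wenzl elements through cabled crossings\<close>

lemma ev_braid_left:
  assumes "bword n w" "length z = n + m"
  shows "ev (map Pos w) (\<lambda>a. F (a @ drop n z)) (take n z) = ev (map Pos w) F z"
proof -
  have "ev (map Pos w) F (take n z @ drop n z) = ev (map Pos w) (\<lambda>a. F (a @ drop n z)) (take n z)"
    by (rule ev_suffix[OF wfd_Pos[OF assms(1)]]) (use assms(2) in \<open>simp_all add: xword_vertex_free\<close>)
  thus ?thesis by simp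
qed

lemma map_sh_Pos: "map (sh k) (map Pos w) = map (\<lambda>i. Pos (k + i)) w"
  by simp

lemma ev_braid_right:
  assumes "length z = n + m"
  shows "ev (map Pos w) (\<lambda>b. F (take n z @ b)) (drop n z) = ev (map (\<lambda>i. Pos (n + i)) w) F z"
  using ev_shift[of "take n z" "map Pos w" F "drop n z"] assms by (simp add: map_sh_Pos comp_def min_absorb2)

lemma min_braid_perms: "\<sigma> \<in> perms n \<Longrightarrow> bword n (min_braid n \<sigma>)"
  using min_braid(1)[of \<sigma> n] by (simp add: perms_def)

text \<open>The element is a combination of positive braids, and each of them slides through the
  cable as a word.\<close>

lemma xcab_JW_left:
  assumes X: "crossing X" and "length x = m" "length y = n"
  shows "ev (xcab X 0 n m) (\<lambda>z. JW n (\<lambda>a. F (a @ drop n z)) (take n z)) (x @ y) =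
    JW n (\<lambda>z. ev (xcab X 0 n m) F (x @ z)) y"
proof -
  let ?W = "xcab X 0 n m"
  have "ev ?W (\<lambda>z. JW n (\<lambda>a. F (a @ drop n z)) (take n z)) (x @ y) =
      (\<Sum>\<sigma>\<in>perms n. jc n \<sigma> * ev ?W (\<lambda>z. ev (map Pos (min_braid n \<sigma>)) (\<lambda>a. F (a @ drop n z)) (take n z)) (x @ y))"
    unfolding JW_def by (simp only: lfun_sums[OF lfun_ev] lfun_scaled[OF lfun_ev])
  also have "\<dots> = (\<Sum>\<sigma>\<in>perms n. jc n \<sigma> * ev (map Pos (min_braid n \<sigma>)) (\<lambda>z. ev ?W F (x @ z)) y)"
  proof (intro sum.cong refl arg_cong2[of _ _ _ _ "(*)"])
    fix \<sigma> assume "\<sigma> \<in> perms n"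
    hence w: "bword n (min_braid n \<sigma>)" by (rule min_braid_perms)
    let ?w = "min_braid n \<sigma>"
    have "ev ?W (\<lambda>z. ev (map Pos ?w) (\<lambda>a. F (a @ drop n z)) (take n z)) (x @ y) = ev ?W (ev (map Pos ?w) F) (x @ y)"
      by (rule ev_x_cong[of _ "n + m"]) (use X assms ev_braid_left[OF w] in auto)
    also have "\<dots> = ev (map (\<lambda>i. Pos (0 + i)) ?w @ ?W) F (x @ y)" by (simp add: ev_append)
    also have "\<dots> = ev (?W @ map (\<lambda>i. Pos (0 + m + i)) ?w) F (x @ y)"
      using slide_left_word[OF X w, of 0 m "n + m"] assms by (simp add: eqd_def)
    also have "\<dots> = ev (map (sh (length x)) (map Pos ?w)) (ev ?W F) (x @ y)"
      using assms by (simp add: ev_append comp_def)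
    also have "\<dots> = ev (map Pos ?w) (\<lambda>z. ev ?W F (x @ z)) y" by (rule ev_shift)
    finally show "ev ?W (\<lambda>z. ev (map Pos ?w) (\<lambda>a. F (a @ drop n z)) (take n z)) (x @ y) =
        ev (map Pos ?w) (\<lambda>z. ev ?W F (x @ z)) y" .
  qed
  finally show ?thesis by (simp add: JW_def)
qed

lemma xcab_JW_right:
  assumes X: "crossing X" and "length x = m" "length y = n"
  shows "ev (xcab X 0 n m) (\<lambda>z. JW m (\<lambda>b. F (take n z @ b)) (drop n z)) (x @ y) =
    JW m (\<lambda>z. ev (xcab X 0 n m) F (z @ y)) x"
proof -
  let ?W = "xcab X 0 n m"
  have "ev ?W (\<lambda>z. JW m (\<lambda>b. F (take n z @ b)) (drop n z)) (x @ y) =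
      (\<Sum>\<sigma>\<in>perms m. jc m \<sigma> * ev ?W (\<lambda>z. ev (map Pos (min_braid m \<sigma>)) (\<lambda>b. F (take n z @ b)) (drop n z)) (x @ y))"
    unfolding JW_def by (simp only: lfun_sums[OF lfun_ev] lfun_scaled[OF lfun_ev])
  also have "\<dots> = (\<Sum>\<sigma>\<in>perms m. jc m \<sigma> * ev (map Pos (min_braid m \<sigma>)) (\<lambda>z. ev ?W F (z @ y)) x)"
  proof (intro sum.cong refl arg_cong2[of _ _ _ _ "(*)"])
    fix \<sigma> assume "\<sigma> \<in> perms m"
    hence w: "bword m (min_braid m \<sigma>)" by (rule min_braid_perms)
    let ?w = "min_braid m \<sigma>"
    have "ev ?W (\<lambda>z. ev (map Pos ?w) (\<lambda>b. F (take n z @ b)) (drop n z)) (x @ y) =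
        ev ?W (ev (map (\<lambda>i. Pos (n + i)) ?w) F) (x @ y)"
      by (rule ev_x_cong[of _ "n + m"]) (use X assms ev_braid_right in auto)
    also have "\<dots> = ev (map (\<lambda>i. Pos (0 + n + i)) ?w @ ?W) F (x @ y)" by (simp add: ev_append)
    also have "\<dots> = ev (?W @ map (\<lambda>i. Pos (0 + i)) ?w) F (x @ y)"
      using slide_right_word[OF X w, of 0 n "n + m"] assms by (simp add: eqd_def)
    also have "\<dots> = ev (map Pos ?w) (ev ?W F) (x @ y)" by (simp add: ev_append)
    also have "\<dots> = ev (map Pos ?w) (\<lambda>z. ev ?W F (z @ y)) x"
      by (rule ev_suffix[OF wfd_Pos[OF w]]) (simp_all add: assms xword_vertex_free)
    finally show "ev ?W (\<lambda>z. ev (map Pos ?w) (\<lambda>b. F (take n z @ b)) (drop n z)) (x @ y) =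
        ev (map Pos ?w) (\<lambda>z. ev ?W F (z @ y)) x" .
  qed
  finally show ?thesis by (simp add: JW_def)
qed

lemma cut2: "length z = n + m \<Longrightarrow> cut [n, m] z = [take n z, drop n z]"
  by simp

lemma crossing_layer: "crossing X \<Longrightarrow> core (X i) [n, m] [m, n] = xcab X 0 n m"
  by auto

lemma crossing_loc: "crossing X \<Longrightarrow> loc (X i) i [n, m] [m, n]"
  using loc.intros(3,4) by auto

lemma lay_crossing:
  assumes X: "crossing X" and "length A = i" "shape SA = A" "shape SB = B" "length x = m" "length y = n"
  shows "lay (X i) (A @ [n, m] @ B) (A @ [m, n] @ B) u (SA @ x # y # SB) =
      ev (xcab X 0 n m) (\<lambda>z. u (SA @ take n z # drop n z # SB)) (x @ y)"
proof -
  note loc = lay_local[OF crossing_loc[OF X, of i n m] assms(2,3) _ assms(4)]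
  have "lay (X i) (A @ [n, m] @ B) (A @ [m, n] @ B) u (SA @ [x, y] @ SB) =
      ev (xcab X 0 n m) (\<lambda>z. u (SA @ cut [n, m] z @ SB)) (x @ y)"
    by (subst loc) (use assms in \<open>simp_all add: lcl_def crossing_layer[OF X]\<close>)
  also have "\<dots> = ev (xcab X 0 n m) (\<lambda>z. u (SA @ take n z # drop n z # SB)) (x @ y)"
    by (rule ev_x_cong[of _ "n + m"]) (use assms in \<open>simp_all del: cut.simps add: cut2\<close>)
  finally show ?thesis by simp
qed

lemma slide_crossing:
  assumes X: "crossing X" and "length A = i" "shape ss = A @ [m, n] @ B"
  shows "lay (X i) (A @ [n, m] @ B) (A @ [m, n] @ B) (app i (JW n) v) ss =
      app (Suc i) (JW n) (lay (X i) (A @ [n, m] @ B) (A @ [m, n] @ B) v) ss"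
    and "lay (X i) (A @ [n, m] @ B) (A @ [m, n] @ B) (app (Suc i) (JW m) v) ss =
      app i (JW m) (lay (X i) (A @ [n, m] @ B) (A @ [m, n] @ B) v) ss"
proof -
  obtain SA S SB where ss': "ss = SA @ S @ SB" "shape SA = A" "shape S = [m, n]" "shape SB = B"
    using assms(3) by (metis shape_append_cases)
  then obtain x y where xy: "S = [x, y]" "length x = m" "length y = n"
    by (auto simp: Cons_eq_map_conv map_eq_Cons_conv)
  have lenA: "length SA = i" using ss' assms(2) by auto
  note lay_eq = lay_crossing[OF X assms(2) ss'(2,4)]
  define F where "F z = v (SA @ take n z # drop n z # SB)" for z
  have "lay (X i) (A @ [n, m] @ B) (A @ [m, n] @ B) (app i (JW n) v) (SA @ x # y # SB) =
      ev (xcab X 0 n m) (\<lambda>z. JW n (\<lambda>a. F (a @ drop n z)) (take n z)) (x @ y)"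
    unfolding lay_eq[OF xy(2,3)]
    by (rule ev_x_cong[of _ "n + m"])
      (use X xy lenA in \<open>simp_all add: app_pat, intro JW_cong, simp_all add: F_def\<close>)
  also have "\<dots> = JW n (\<lambda>z. ev (xcab X 0 n m) F (x @ z)) y"
    by (rule xcab_JW_left[OF X xy(2,3)])
  also have "\<dots> = JW n (\<lambda>z. lay (X i) (A @ [n, m] @ B) (A @ [m, n] @ B) v (SA @ x # z # SB)) y"
    by (rule JW_cong) (simp_all only: lay_eq xy F_def[abs_def])
  also have "\<dots> = app (Suc i) (JW n) (lay (X i) (A @ [n, m] @ B) (A @ [m, n] @ B) v) ((SA @ [x]) @ y # SB)"
    by (subst app_pat) (simp_all add: lenA)
  finally show "lay (X i) (A @ [n, m] @ B) (A @ [m, n] @ B) (app i (JW n) v) ss =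
      app (Suc i) (JW n) (lay (X i) (A @ [n, m] @ B) (A @ [m, n] @ B) v) ss"
    by (simp add: ss' xy)
  have app: "app (Suc i) (JW m) v (SA @ a # b # SB) = JW m (\<lambda>z. v (SA @ a # z # SB)) b" for a b
    using app_pat[of "SA @ [a]" "Suc i" "JW m" v b SB] lenA by simp
  have "lay (X i) (A @ [n, m] @ B) (A @ [m, n] @ B) (app (Suc i) (JW m) v) (SA @ x # y # SB) =
      ev (xcab X 0 n m) (\<lambda>z. JW m (\<lambda>b. F (take n z @ b)) (drop n z)) (x @ y)"
    unfolding lay_eq[OF xy(2,3)]
    by (rule ev_x_cong[of _ "n + m"])
      (use X xy lenA in \<open>simp_all add: app, intro JW_cong, simp_all add: F_def\<close>)
  also have "\<dots> = JW m (\<lambda>z. ev (xcab X 0 n m) F (z @ y)) x"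
    by (rule xcab_JW_right[OF X xy(2,3)])
  also have "\<dots> = JW m (\<lambda>z. lay (X i) (A @ [n, m] @ B) (A @ [m, n] @ B) v (SA @ z # y # SB)) x"
    by (rule JW_cong) (simp_all only: lay_eq xy F_def[abs_def])
  also have "\<dots> = app i (JW m) (lay (X i) (A @ [n, m] @ B) (A @ [m, n] @ B) v) (SA @ x # y # SB)"
    by (subst app_pat) (simp_all add: lenA)
  finally show "lay (X i) (A @ [n, m] @ B) (A @ [m, n] @ B) (app (Suc i) (JW m) v) ss =
      app i (JW m) (lay (X i) (A @ [n, m] @ B) (A @ [m, n] @ B) v) ss"
    by (simp add: ss' xy)
qed

text \<open>Projecting one leg of nested cups gives a multiple of \<open>Uw x * Uw y\<close> on
  complementary weights. Both legs give the same multiple because \<open>bar\<close> changes neither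
  \<open>Uw\<close> nor the norm.\<close>

lemma JW_cup:
  assumes "length x = n" "length y = n"
  shows "JW n (\<lambda>z. if y = bar z then cw z * c else 0) x =
      (if cnt y = n - cnt x then Uw x * Uw y * cw x * c / nrm n (cnt x) else 0)"
    and "JW n (\<lambda>z. if z = bar x then cw x * c else 0) y =
      (if cnt y = n - cnt x then Uw x * Uw y * cw x * c / nrm n (cnt x) else 0)"
proof -
  have lx: "cnt x \<le> n" "cnt y \<le> n" using assms cnt_le_length by metis+
  have eq: "y = bar z \<longleftrightarrow> z = bar y" for z by auto
  have mem: "bar y \<in> cl n (cnt x) \<longleftrightarrow> cnt y = n - cnt x"
    using lx assms by (auto simp: cl_def cnt_bar)
  have "(\<Sum>z\<in>cl n (cnt x). Uw z * (if y = bar z then cw z * c else 0)) =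
      (\<Sum>z\<in>cl n (cnt x). if z = bar y then Uw y * cw (bar y) * c else 0)"
    unfolding eq by (intro sum.cong refl) auto
  also have "\<dots> = (if cnt y = n - cnt x then Uw y * cw x * c else 0)"
    using mem lx by (simp add: sum.delta' cw_def assms cnt_bar)
  finally show "JW n (\<lambda>z. if y = bar z then cw z * c else 0) x =
      (if cnt y = n - cnt x then Uw x * Uw y * cw x * c / nrm n (cnt x) else 0)"
    unfolding JW_eq[OF assms(1)] jw_def by simp
  have mem': "bar x \<in> cl n (cnt y) \<longleftrightarrow> cnt y = n - cnt x"
    using lx assms by (auto simp: cl_def cnt_bar)
  have "(\<Sum>z\<in>cl n (cnt y). Uw z * (if z = bar x then cw x * c else 0)) =
      (\<Sum>z\<in>cl n (cnt y). if z = bar x then Uw x * cw x * c else 0)"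
    by (intro sum.cong refl) auto
  also have "\<dots> = (if cnt y = n - cnt x then Uw x * cw x * c else 0)"
    using mem' by (simp add: sum.delta')
  finally show "JW n (\<lambda>z. if z = bar x then cw x * c else 0) y =
      (if cnt y = n - cnt x then Uw x * Uw y * cw x * c / nrm n (cnt x) else 0)"
    unfolding JW_eq[OF assms(2)] jw_def using nrm_sym[OF lx(1)] by simp
qed

lemma slide_cup:
  assumes "length A = i" "shape ss = A @ [n, n] @ B"
  shows "app i (JW n) (lay (Cup i) (A @ [] @ B) (A @ [n, n] @ B) v) ss =
      app (Suc i) (JW n) (lay (Cup i) (A @ [] @ B) (A @ [n, n] @ B) v) ss"
proof -
  obtain SA S SB where ss: "ss = SA @ S @ SB" "shape SA = A" "shape S = [n, n]" "shape SB = B"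
    using assms(2) by (metis shape_append_cases)
  then obtain x y where xy: "S = [x, y]" "length x = n" "length y = n"
    by (auto simp: Cons_eq_map_conv map_eq_Cons_conv)
  have lenA: "length SA = i" using ss assms by auto
  have lay_eq: "lay (Cup i) (A @ [] @ B) (A @ [n, n] @ B) v (SA @ x' # y' # SB) =
      (if y' = bar x' then cw x' * v (SA @ SB) else 0)" if "length x' = n" "length y' = n" for x' y'
    using lay_local[OF loc.intros(1) assms(1) ss(2) _ ss(4), of "[x', y']" n v] that
    by (simp add: lcl_Cup)
  have "app i (JW n) (lay (Cup i) (A @ [] @ B) (A @ [n, n] @ B) v) (SA @ x # y # SB) =
      JW n (\<lambda>z. if y = bar z then cw z * v (SA @ SB) else 0) x"
    unfolding app_pat[OF lenA] by (rule JW_cong) (simp_all only: lay_eq xy)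
  moreover have "app (Suc i) (JW n) (lay (Cup i) (A @ [] @ B) (A @ [n, n] @ B) v) ((SA @ [x]) @ y # SB) =
      JW n (\<lambda>z. if z = bar x then cw x * v (SA @ SB) else 0) y"
    by (subst app_pat, simp add: lenA, rule JW_cong) (simp_all add: lay_eq[simplified] xy)
  ultimately show ?thesis unfolding JW_cup[OF xy(2,3)] by (simp add: ss xy)
qed

text \<open>The kernel of the projection is symmetric in its arguments and invariant under
  \<open>bar\<close>, and \<open>kw\<close> depends on the weight only; hence exchanging the two
  summations moves the projection to the other leg.\<close>

lemma JW_cap:
  "(\<Sum>x\<in>strs n. kw x * JW n (\<lambda>z. f z (bar x)) x) = (\<Sum>x\<in>strs n. kw x * JW n (\<lambda>z. f x z) (bar x))"
proof -
  define g where "g x z = kw x * Uw x * Uw z * f z (bar x) / nrm n (cnt x)" for x z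
  have "(\<Sum>x\<in>strs n. kw x * JW n (\<lambda>z. f z (bar x)) x) =
      (\<Sum>x\<in>strs n. \<Sum>z\<in>strs n. if cnt z = cnt x then g x z else 0)"
  proof (intro sum.cong refl)
    fix x assume "x \<in> strs n"
    hence lx: "length x = n" by (simp add: strs_def)
    show "kw x * JW n (\<lambda>z. f z (bar x)) x = (\<Sum>z\<in>strs n. if cnt z = cnt x then g x z else 0)"
      by (simp add: JW_eq[OF lx] jw_def sum_cl[symmetric] sum_distrib_left sum_divide_distrib g_def mult_ac)
  qed
  also have "\<dots> = (\<Sum>z\<in>strs n. \<Sum>x\<in>strs n. if cnt z = cnt x then g x z else 0)"
    by (rule sum.swap)
  also have "\<dots> = (\<Sum>x\<in>strs n. kw x * JW n (\<lambda>z. f x z) (bar x))"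
  proof (intro sum.cong refl)
    fix x assume x: "x \<in> strs n"
    hence lx: "length x = n" "cnt x \<le> n" using cnt_le_length[of x] by (auto simp: strs_def)
    have "(\<Sum>z\<in>strs n. if cnt x = cnt z then g z x else 0) = (\<Sum>z\<in>cl n (cnt x). g z x)"
      by (subst sum_cl) (intro sum.cong, auto)
    also have "\<dots> = (\<Sum>z\<in>cl n (n - cnt x). g (bar z) x)"
      by (rule sum.reindex_bij_witness[of _ bar bar]) (use lx in \<open>auto simp: cl_def cnt_bar\<close>)
    also have "\<dots> = (\<Sum>z\<in>cl n (n - cnt x). kw x * (Uw x * (Uw z * f x z) / nrm n (cnt x)))"
      by (intro sum.cong refl) (use lx in \<open>auto simp: g_def cl_def cnt_bar kw_def\<close>)
    also have "\<dots> = kw x * JW n (\<lambda>z. f x z) (bar x)"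
      using lx by (simp add: JW_eq jw_def cnt_bar nrm_sym sum_distrib_left sum_divide_distrib)
    finally show "(\<Sum>z\<in>strs n. if cnt x = cnt z then g z x else 0) = kw x * JW n (\<lambda>z. f x z) (bar x)" .
  qed
  finally show ?thesis .
qed

lemma slide_cap:
  assumes "length A = i" "shape ss = A @ [] @ B"
  shows "lay (Cap i) (A @ [n, n] @ B) (A @ [] @ B) (app i (JW n) v) ss =
      lay (Cap i) (A @ [n, n] @ B) (A @ [] @ B) (app (Suc i) (JW n) v) ss"
proof -
  obtain SA SB where ss: "ss = SA @ [] @ SB" "shape SA = A" "shape SB = B"
    using assms(2) by (auto elim: shape_append_cases)
  have lenA: "length SA = i" using ss assms by auto
  have lay_eq: "lay (Cap i) (A @ [n, n] @ B) (A @ [] @ B) u (SA @ [] @ SB) =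
      (\<Sum>x\<in>strs n. kw x * u (SA @ x # bar x # SB))" for u
    using lay_local[OF loc.intros(2) assms(1) ss(2) _ ss(3), of "[]" n u] by (simp add: lcl_Cap)
  have app: "app (Suc i) (JW n) v (SA @ a # b # SB) = JW n (\<lambda>z. v (SA @ a # z # SB)) b" for a b
    using app_pat[of "SA @ [a]" "Suc i" "JW n" v b SB] lenA by simp
  show ?thesis unfolding ss(1) lay_eq app_pat[OF lenA] app by (rule JW_cap)
qed

section \<open>The matrix of a cabled crossing\<close>

text \<open>
  Positive and negative crossings are treated together: reversing the sign of a crossing amounts to
  exchanging the two basis vectors and inverting \<open>hh\<close>.
\<close>

primrec cg :: "bool \<Rightarrow> bool list \<Rightarrow> nat" where
  "cg c [] = 0"
| "cg c (a # s) = (if a = c then Suc (cg c s) else cg c s)"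

primrec ug :: "scalar \<Rightarrow> bool \<Rightarrow> bool list \<Rightarrow> scalar" where
  "ug hh c [] = 1"
| "ug hh c (a # s) = (if a = c then 1 else hh powi (2 * int (cg c s))) * ug hh c s"

definition dg :: "scalar \<Rightarrow> int \<Rightarrow> scalar" where "dg hh z = hh powi (2 * z) - hh powi (- 2 * z)"

definition eg :: "scalar \<Rightarrow> nat \<Rightarrow> nat \<Rightarrow> scalar" where
  "eg hh m k = hh powi (int m - 2 - 2 * int k) * dg hh (int m - int k)"

lemma pm:
  assumes "(hh :: scalar) \<noteq> 0"
  shows "hh powi a * hh powi b = hh powi (a + b)" "hh powi a * (hh powi b * z) = hh powi (a + b) * z"
  using assms by (simp_all add: power_int_add)

lemma xop_powi:
  assumes "length p = i"
  shows "xop hh c i v (p @ a # b # r) = (if a = b then hh powi 1 * v (p @ a # b # r)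
    else hh powi (-1) * v (p @ b # a # r) + (if a = c then 0 else (hh powi 1 - hh powi (-3)) * v (p @ a # b # r)))"
  by (simp add: xop_pat[OF assms] power_int_minus power_inverse)

text \<open>One strand crosses a bundle in a q-symmetric state. The R-matrix is triangular, so next
  to the diagonal term there is a single term in which the strand exchanges a sign with the bundle;
  \<open>eg\<close> is its coefficient.\<close>

lemma row_matrix:
  assumes X: "\<And>i. layer_op (X i) = xop hh c i" "crossing X" and hh: "hh \<noteq> 0"
    and v: "\<And>e z. length z = m \<Longrightarrow> v (e # z) = \<alpha> e (cg c z) * ug hh c z"
    and x: "length x = m"
  shows "ev (row X 0 m) v (x @ [d]) = ug hh c x *
    (if d = c then hh powi (2 * int (cg c x) - int m) * \<alpha> c (cg c x) + eg hh m (cg c x) * \<alpha> (\<not> c) (Suc (cg c x))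
     else hh powi (int m - 2 * int (cg c x)) * \<alpha> (\<not> c) (cg c x))"
  using v x
proof (induction m arbitrary: v \<alpha> x)
  case 0
  have "v [d] = \<alpha> d 0" using "0.prems"(1)[of "[]" d] by simp
  thus ?case using "0.prems"(2) by (cases "d = c") (auto simp: eg_def dg_def)
next
  case (Suc m)
  obtain x0 z where x: "x = x0 # z" "length z = m" using Suc.prems(2) by (cases x) auto
  define w where "w = xop hh c 0 v"
  define k where "k = cg c z"
  \<comment> \<open>The coefficient functions after the first crossing, with the sign
    \<open>x0\<close> that has come out on the left kept fixed.\<close>
  define \<alpha>' where "\<alpha>' e k = (if x0 = c then (if e = c then hh powi 1 * \<alpha> c (Suc k) else hh powi (-1) * \<alpha> (\<not> c) (Suc k))
     else (if e = c then hh powi (2 * int k - 1) * \<alpha> c k + (hh powi 1 - hh powi (-3)) * \<alpha> (\<not> c) (Suc k)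
           else hh powi (2 * int k + 1) * \<alpha> (\<not> c) k))" for e k
  have w: "w (x0 # e # y) = \<alpha>' e (cg c y) * ug hh c y" if "length y = m" for e y
  proof -
    have v: "v (a # b # y) = \<alpha> a (cg c (b # y)) * ug hh c (b # y)" for a b
      using Suc.prems(1)[of "b # y" a] that by simp
    have w: "w (x0 # e # y) = (if x0 = e then hh powi 1 * v (x0 # e # y)
      else hh powi (-1) * v (e # x0 # y) + (if x0 = c then 0 else (hh powi 1 - hh powi (-3)) * v (x0 # e # y)))"
      using xop_powi[of "[]" 0 hh c v x0 e y] by (simp add: w_def)
    consider "x0 = c" "e = c" | "x0 = c" "e = (\<not> c)" | "x0 = (\<not> c)" "e = c" | "x0 = (\<not> c)" "e = (\<not> c)"
      by blast
    thus ?thesis unfolding w v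
    proof cases
      case 1
      thus "(if x0 = e then hh powi 1 * (\<alpha> x0 (cg c (e # y)) * ug hh c (e # y))
     else hh powi - 1 * (\<alpha> e (cg c (x0 # y)) * ug hh c (x0 # y)) +
          (if x0 = c then 0 else (hh powi 1 - hh powi - 3) * (\<alpha> x0 (cg c (e # y)) * ug hh c (e # y)))) =
    \<alpha>' e (cg c y) * ug hh c y" by (simp add: \<alpha>'_def)
    next
      case 2
      thus "(if x0 = e then hh powi 1 * (\<alpha> x0 (cg c (e # y)) * ug hh c (e # y))
     else hh powi - 1 * (\<alpha> e (cg c (x0 # y)) * ug hh c (x0 # y)) +
          (if x0 = c then 0 else (hh powi 1 - hh powi - 3) * (\<alpha> x0 (cg c (e # y)) * ug hh c (e # y)))) =
    \<alpha>' e (cg c y) * ug hh c y" by (simp add: \<alpha>'_def)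
    next
      case 3
      have "hh powi (2 * int (cg c y) - 1) = hh powi - 1 * hh powi (2 * int (cg c y))"
        unfolding pm(1)[OF hh] by simp
      with 3 show "(if x0 = e then hh powi 1 * (\<alpha> x0 (cg c (e # y)) * ug hh c (e # y))
     else hh powi - 1 * (\<alpha> e (cg c (x0 # y)) * ug hh c (x0 # y)) +
          (if x0 = c then 0 else (hh powi 1 - hh powi - 3) * (\<alpha> x0 (cg c (e # y)) * ug hh c (e # y)))) =
    \<alpha>' e (cg c y) * ug hh c y" by (simp add: \<alpha>'_def algebra_simps)
    next
      case 4
      have "hh powi (2 * int (cg c y) + 1) = hh powi 1 * hh powi (2 * int (cg c y))"
        unfolding pm(1)[OF hh] by (simp add: add.commute)
      with 4 show "(if x0 = e then hh powi 1 * (\<alpha> x0 (cg c (e # y)) * ug hh c (e # y))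
     else hh powi - 1 * (\<alpha> e (cg c (x0 # y)) * ug hh c (x0 # y)) +
          (if x0 = c then 0 else (hh powi 1 - hh powi - 3) * (\<alpha> x0 (cg c (e # y)) * ug hh c (e # y)))) =
    \<alpha>' e (cg c y) * ug hh c y" by (simp add: \<alpha>'_def)
    qed
  qed
  have "ev (row X 0 (Suc m)) v (x @ [d]) = ev (map (sh (length [x0])) (row X 0 m)) w ([x0] @ (z @ [d]))"
    using row_sh[OF X(2), of "Suc 0" 0 m] by (simp add: row_Suc' ev_Cons X(1) w_def x)
  also have "\<dots> = ev (row X 0 m) (\<lambda>u. w (x0 # u)) (z @ [d])"
    by (subst ev_shift) simp
  also have "\<dots> = ug hh c z *
    (if d = c then hh powi (2 * int k - int m) * \<alpha>' c k + eg hh m k * \<alpha>' (\<not> c) (Suc k)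
     else hh powi (int m - 2 * int k) * \<alpha>' (\<not> c) k)"
    unfolding k_def by (rule Suc.IH) (use w x in auto)
  finally have *: "ev (row X 0 (Suc m)) v (x @ [d]) = \<dots>" .
  show ?case
  proof (cases "x0 = c")
    case True
    have 1: "eg hh m k * hh powi - 1 = eg hh (Suc m) (Suc k)"
      unfolding eg_def mult.commute[of _ "hh powi - 1"] pm(2)[OF hh] by (simp add: algebra_simps)
    have 2: "hh powi (2 * int k - int m) * hh powi 1 = hh powi (2 * int (Suc k) - int (Suc m))"
      unfolding pm(1)[OF hh] by (simp add: algebra_simps)
    have 3: "hh powi (int m - 2 * int k) * hh powi - 1 = hh powi (int (Suc m) - 2 * int (Suc k))"
      unfolding pm(1)[OF hh] by (simp add: algebra_simps)
    have "cg c x = Suc k" "ug hh c x = ug hh c z" using True by (simp_all add: x k_def)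
    thus ?thesis unfolding * using True
      by (simp add: \<alpha>'_def 1[symmetric] 2[symmetric] 3[symmetric] mult.assoc
          del: of_nat_Suc power_int_minus1_right power_int_1_right)
  next
    case False
    have cg: "cg c x = k" "ug hh c x = hh powi (2 * int k) * ug hh c z" using False by (simp_all add: x k_def)
    have 1: "hh powi (2 * int k) * hh powi (2 * int k - int (Suc m)) = hh powi (2 * int k - int m) * hh powi (2 * int k - 1)"
      unfolding pm(1)[OF hh] by (simp add: algebra_simps)
    have 2: "hh powi (2 * int k) * hh powi (int (Suc m) - 2 * int k) = hh powi (int m - 2 * int k) * hh powi (2 * int k + 1)"
      unfolding pm(1)[OF hh] by (simp add: algebra_simps)
    have 3: "hh powi (2 * int k) * eg hh (Suc m) k =
        hh powi (2 * int k - int m) * (hh powi 1 - hh powi - 3) + eg hh m k * hh powi (2 * int (Suc k) + 1)"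
      unfolding eg_def dg_def right_diff_distrib left_diff_distrib pm[OF hh]
      by (simp add: algebra_simps)
    have R: "ug hh c z * (hh powi (2 * int k - int m) * \<alpha>' c k + eg hh m k * \<alpha>' (\<not> c) (Suc k)) =
       ug hh c z * ((hh powi (2 * int k - int m) * hh powi (2 * int k - 1)) * \<alpha> c k +
         (hh powi (2 * int k - int m) * (hh powi 1 - hh powi - 3) + eg hh m k * hh powi (2 * int (Suc k) + 1)) * \<alpha> (\<not> c) (Suc k))"
      using False by (simp add: \<alpha>'_def algebra_simps del: of_nat_Suc power_int_minus1_right power_int_1_right)
    have R': "ug hh c z * (hh powi (int m - 2 * int k) * \<alpha>' (\<not> c) k) =
       ug hh c z * ((hh powi (int m - 2 * int k) * hh powi (2 * int k + 1)) * \<alpha> (\<not> c) k)"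
      using False by (simp add: \<alpha>'_def)
    show ?thesis unfolding * cg if_distrib[of "(*) (ug hh c z)"] R R' unfolding 1[symmetric] 2[symmetric] 3[symmetric]
      by (simp add: algebra_simps del: of_nat_Suc)
  qed
qed

definition gexp :: "int \<Rightarrow> int \<Rightarrow> int \<Rightarrow> int \<Rightarrow> int \<Rightarrow> int" where
  "gexp n m k l j = (2 * k - m) * (2 * l - n) - 2 * j * n - 3 * j * j - j + 2 * j * m - 4 * j * k + 4 * j * l"

text \<open>The R-matrix coefficient that transfers j signs c between the bundles: one operator
  contributes the product of the \<open>dg\<close>, the other acts by a divided power and
  contributes \<open>qbin l j\<close>. The exponent \<open>gexp\<close> solves the recursions
  \<open>G_far\<close>, \<open>G_near_0\<close> and \<open>G_near\<close> that come from adding one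
  strand.\<close>

definition G :: "scalar \<Rightarrow> nat \<Rightarrow> nat \<Rightarrow> nat \<Rightarrow> nat \<Rightarrow> nat \<Rightarrow> scalar" where
  "G hh n m k l j = hh powi gexp (int n) (int m) (int k) (int l) (int j) * qbin l j * (\<Prod>i<j. dg hh (int m - int k - int i))"

lemma G_far: "hh \<noteq> 0 \<Longrightarrow> G hh (Suc n) m k l j = hh powi (int m - 2 * int k - 2 * int j) * G hh n m k l j"
  unfolding G_def by (simp add: mult.assoc[symmetric] power_int_add[symmetric]) (simp add: gexp_def algebra_simps)

lemma G_eq_0: "l < j \<Longrightarrow> G hh n m k l j = 0"
  by (simp add: G_def qbin_eq_0)

lemma qbin_pascal:
  assumes "hh = qh \<or> hh = inverse qh"
  shows "qbin (Suc l) (Suc j) = hh powi (- 2 * int (Suc j)) * qbin l (Suc j) + hh powi (2 * (int l - int j)) * qbin l j"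
proof (cases "j \<le> l")
  case True
  have *: "(inverse qh) powi x = qh powi (- x)" for x by (simp add: power_int_minus power_int_inverse)
  from True assms show ?thesis
    using qbin_Suc[OF True] qbin_Suc'[OF True] by (auto simp: q_powi * of_nat_diff algebra_simps)
next
  case False
  thus ?thesis by (simp add: qbin_eq_0)
qed

text \<open>The q-Pascal rule splits \<open>qbin (Suc l) (Suc j)\<close>: in one part the added
  strand keeps its sign, in the other it takes part in the exchange, which accounts for
  \<open>eg hh m k\<close>.\<close>

lemma G_near:
  assumes "hh = qh \<or> hh = inverse qh"
  shows "G hh (Suc n) m k (Suc l) (Suc j) = hh powi (2 * int k - int m) * G hh n m k l (Suc j)
    + eg hh m k * (hh powi (2 * (int l - int j)) * G hh n m (Suc k) l j)"
proof -
  have hh: "hh \<noteq> 0" using assms by auto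
  have prod: "(\<Prod>i<Suc j. dg hh (int m - int k - int i)) = dg hh (int m - int k) * (\<Prod>i<j. dg hh (int m - int (Suc k) - int i))"
    by (subst prod.lessThan_Suc_shift) (simp add: algebra_simps)
  let ?P = "\<Prod>i<j. dg hh (int m - int (Suc k) - int i)"
  let ?e = "gexp (int (Suc n)) (int m) (int k) (int (Suc l)) (int (Suc j))"
  have e1: "?e + (- 2 * int (Suc j)) = (2 * int k - int m) + gexp (int n) (int m) (int k) (int l) (int (Suc j))"
    by (simp add: gexp_def algebra_simps)
  have e2: "?e + 2 * (int l - int j) = (int m - 2 - 2 * int k) + (2 * (int l - int j) + gexp (int n) (int m) (int (Suc k)) (int l) (int j))"
    by (simp add: gexp_def algebra_simps)
  have "G hh (Suc n) m k (Suc l) (Suc j) =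
     (hh powi ?e * hh powi (- 2 * int (Suc j)) * qbin l (Suc j) + hh powi ?e * hh powi (2 * (int l - int j)) * qbin l j)
       * (dg hh (int m - int k) * ?P)"
    unfolding G_def prod qbin_pascal[OF assms] by (simp only: algebra_simps)
  also have "\<dots> = hh powi (2 * int k - int m) * G hh n m k l (Suc j)
    + eg hh m k * (hh powi (2 * (int l - int j)) * G hh n m (Suc k) l j)"
    unfolding pm(1)[OF hh] e1 e2 unfolding pm(1)[OF hh, symmetric]
    unfolding G_def prod eg_def by (simp only: algebra_simps)
  finally show ?thesis .
qed

lemma G_near_0: "hh \<noteq> 0 \<Longrightarrow> G hh (Suc n) m k (Suc l) 0 = hh powi (2 * int k - int m) * G hh n m k l 0"
  unfolding G_def by (simp add: power_int_add[symmetric]) (simp add: gexp_def algebra_simps)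

text \<open>Induction on the left bundle: its first strand is split off and crosses in the last row,
  after all the others, so that \<open>row_matrix\<close> applies to the result of the induction
  hypothesis.\<close>

lemma xcab_matrix:
  assumes X: "\<And>i. layer_op (X i) = xop hh c i" "crossing X" and hh: "hh = qh \<or> hh = inverse qh"
    and v: "\<And>a b. length a = n \<Longrightarrow> length b = m \<Longrightarrow> v (a @ b) = A (cg c a) (cg c b) * ug hh c a * ug hh c b"
    and "length x = m" "length y = n"
  shows "ev (xcab X 0 n m) v (x @ y) = ug hh c x * ug hh c y *
    (\<Sum>j\<le>cg c y. G hh n m (cg c x) (cg c y) j * A (cg c y - j) (cg c x + j))"
  using v assms(5,6)
proof (induction n arbitrary: v A x y)
  case 0
  have "v x = A 0 (cg c x) * ug hh c x" using "0.prems"(1)[of "[]" x] "0.prems"(2) by simp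
  thus ?case using "0.prems"(3) by (simp add: G_def gexp_def)
next
  case (Suc n)
  have hh0: "hh \<noteq> 0" using hh by auto
  obtain d z where y: "y = d # z" "length z = n" using Suc.prems(3) by (cases y) auto
  let ?k = "cg c x" and ?l = "cg c z"
  define w where "w = ev (xcab X (Suc 0) n m) v"
  define A' where "A' e k l = (if e = c then A (Suc k) l else hh powi (2 * int k) * A k l)" for e k l
  define \<alpha> where "\<alpha> e k = ug hh c z * (\<Sum>j\<le>?l. G hh n m k ?l j * A' e (?l - j) (k + j))" for e k
  have w: "w (e # u @ z) = \<alpha> e (cg c u) * ug hh c u" if "length u = m" for e u
  proof -
    have "w (e # u @ z) = ev (map (sh (length [e])) (xcab X 0 n m)) v ([e] @ (u @ z))"
      using xcab_sh[OF X(2), of "Suc 0" 0 n m] by (simp add: w_def)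
    also have "\<dots> = ev (xcab X 0 n m) (\<lambda>s. v (e # s)) (u @ z)"
      by (subst ev_shift) simp
    also have "\<dots> = ug hh c u * ug hh c z * (\<Sum>j\<le>?l. G hh n m (cg c u) ?l j * A' e (?l - j) (cg c u + j))"
    proof (rule Suc.IH[OF _ that y(2)])
      fix a b :: "bool list" assume "length a = n" "length b = m"
      thus "v (e # a @ b) = A' e (cg c a) (cg c b) * ug hh c a * ug hh c b"
        using Suc.prems(1)[of "e # a" b] by (simp add: A'_def)
    qed
    finally show ?thesis by (simp add: \<alpha>_def)
  qed
  have "ev (xcab X 0 (Suc n) m) v (x @ y) = ev (row X 0 m) w ((x @ [d]) @ z)"
    by (simp add: xcab_Suc' ev_append w_def y)
  also have "\<dots> = ev (row X 0 m) (\<lambda>s. w (s @ z)) (x @ [d])"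
    by (rule ev_suffix[OF wfd_row[OF X(2), of 0 m "Suc m"]]) (use X(2) Suc.prems(2) in \<open>simp_all add: xword_vertex_free\<close>)
  also have "\<dots> = ug hh c x *
    (if d = c then hh powi (2 * int ?k - int m) * \<alpha> c ?k + eg hh m ?k * \<alpha> (\<not> c) (Suc ?k)
     else hh powi (int m - 2 * int ?k) * \<alpha> (\<not> c) ?k)"
    by (rule row_matrix[OF X hh0 _ Suc.prems(2)]) (use w in simp)
  finally have *: "ev (xcab X 0 (Suc n) m) v (x @ y) = \<dots>" .
  show ?case
  proof (cases "d = c")
    case True
    let ?S = "\<lambda>j. G hh (Suc n) m ?k (Suc ?l) j * A (Suc ?l - j) (?k + j)"
    let ?T = "\<lambda>j. hh powi (2 * int ?k - int m) * G hh n m ?k ?l j * A (Suc ?l - j) (?k + j)"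
    let ?V = "\<lambda>j. eg hh m ?k * (hh powi (2 * (int ?l - int j)) * G hh n m (Suc ?k) ?l j) * A (?l - j) (Suc ?k + j)"
    have "(\<Sum>j\<le>Suc ?l. ?S j) = ?S 0 + (\<Sum>j\<le>?l. ?S (Suc j))"
      by (rule sum.atMost_Suc_shift)
    also have "(\<Sum>j\<le>?l. ?S (Suc j)) = (\<Sum>j\<le>?l. ?T (Suc j)) + (\<Sum>j\<le>?l. ?V j)"
      unfolding sum.distrib[symmetric] by (intro sum.cong refl) (simp add: G_near[OF hh] algebra_simps)
    also have "?S 0 + ((\<Sum>j\<le>?l. ?T (Suc j)) + (\<Sum>j\<le>?l. ?V j)) = (\<Sum>j\<le>Suc ?l. ?T j) + (\<Sum>j\<le>?l. ?V j)"
      unfolding sum.atMost_Suc_shift by (simp add: G_near_0[OF hh0])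
    also have "(\<Sum>j\<le>Suc ?l. ?T j) = (\<Sum>j\<le>?l. ?T j)"
      by (simp add: G_eq_0)
    finally have S: "(\<Sum>j\<le>Suc ?l. ?S j) = (\<Sum>j\<le>?l. ?T j) + (\<Sum>j\<le>?l. ?V j)" .
    have T: "hh powi (2 * int ?k - int m) * \<alpha> c ?k = ug hh c z * (\<Sum>j\<le>?l. ?T j)"
      unfolding \<alpha>_def sum_distrib_left
      by (intro sum.cong refl) (simp add: A'_def Suc_diff_le mult_ac)
    have V: "eg hh m ?k * \<alpha> (\<not> c) (Suc ?k) = ug hh c z * (\<Sum>j\<le>?l. ?V j)"
      unfolding \<alpha>_def sum_distrib_left
      by (intro sum.cong refl) (simp add: A'_def of_nat_diff mult_ac)
    show ?thesis unfolding * T V using True S by (simp add: y algebra_simps)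
  next
    case False
    have "hh powi (int m - 2 * int ?k) * (G hh n m ?k ?l j * A' (\<not> c) (?l - j) (?k + j)) =
        hh powi (2 * int ?l) * (G hh (Suc n) m ?k ?l j * A (?l - j) (?k + j))" if "j \<le> ?l" for j
    proof -
      have e: "hh powi (int m - 2 * int ?k) * hh powi (2 * int (?l - j)) =
          hh powi (2 * int ?l) * hh powi (int m - 2 * int ?k - 2 * int j)"
        unfolding pm(1)[OF hh0] using that by (simp add: of_nat_diff algebra_simps)
      have "hh powi (int m - 2 * int ?k) * (G hh n m ?k ?l j * A' (\<not> c) (?l - j) (?k + j)) =
         (hh powi (int m - 2 * int ?k) * hh powi (2 * int (?l - j))) * (G hh n m ?k ?l j * A (?l - j) (?k + j))"
        by (simp add: A'_def mult_ac)
      thus ?thesis unfolding e G_far[OF hh0] by (simp add: mult_ac)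
    qed
    hence "hh powi (int m - 2 * int ?k) * \<alpha> (\<not> c) ?k = ug hh c z * (hh powi (2 * int ?l) *
        (\<Sum>j\<le>?l. G hh (Suc n) m ?k ?l j * A (?l - j) (?k + j)))"
      unfolding \<alpha>_def sum_distrib_left mult.left_commute[of "hh powi (int m - 2 * int ?k)" "ug hh c z"]
      by (intro sum.cong refl) simp
    thus ?thesis unfolding * using False by (simp add: y mult_ac)
  qed
qed

subsection \<open>Integrality of the matrix of a crossing\<close>

text \<open>
  The integral form of the representation with highest weight \<open>n\<close> which makes every vertex and every
  crossing integral is spanned by the vectors \<open>[k]! u\<^sub>k\<close>, i.e. ordinary powers in one variable and
  divided powers in the other one.
\<close>

definition mw :: "bool list \<Rightarrow> scalar" where "mw x = qfact (cnt x) * Uw x"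

lemma cg_True [simp]: "cg True s = cnt s"
  by (induction s) auto

lemma cg_False: "cg False s = length s - cnt s"
  by (induction s) (auto simp: Suc_diff_le cnt_le_length)

lemma qh_powi_2: "qh powi (2 * int k) = q ^ k" "inverse qh powi (2 * int k) = inverse (q ^ k)"
  using q_powi[of "int k"] by (simp_all add: power_int_inverse)

lemma ug_True: "ug qh True s = Uw s"
  by (induction s) (auto simp: qh_powi_2)

text \<open>Pairs - before + and pairs + before - together make up all pairs of opposite signs,
  which explains the exponent.\<close>

lemma ug_False: "Uw s = q ^ (cnt s * (length s - cnt s)) * ug (inverse qh) False s"
proof (induction s)
  case (Cons a s)
  obtain d where d: "length s = cnt s + d" using cnt_le_length[of s] le_Suc_ex by blast
  show ?case using Cons
    by (cases a) (simp_all add: cg_False d power_add qh_powi_2 mult.assoc mult.left_commute)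
qed simp

lemma dg_qh: "dg qh (int z) = qdiff * qint z"
  unfolding dg_def qdiff_qint q_powi by simp

lemma dg_inverse_qh: "dg (inverse qh) (int z) = - qdiff * qint z"
  using qdiff_qint[of z] unfolding q_powi by (simp add: dg_def power_int_inverse power_int_minus algebra_simps)

text \<open>The product is a falling q-factorial; it vanishes as soon as it runs past
  \<open>a\<close>, which truncates the sum over j in the matrix of a crossing.\<close>

lemma prod_dg:
  assumes "\<And>z. dg hh (int z) = c * qint z"
  shows "(\<Prod>i<j. dg hh (int a - int i)) = (if j \<le> a then c ^ j * (qfact a / qfact (a - j)) else 0)"
proof (cases "j \<le> a")
  case True
  thus ?thesis
  proof (induction j)
    case (Suc j)
    have "int a - int j = int (a - j)" using Suc.prems by simp
    moreover have "qfact (a - j) = qint (a - j) * qfact (a - Suc j)"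
      using Suc.prems qfact_Suc[of "a - Suc j"] by (simp add: Suc_diff_Suc)
    ultimately show ?case using Suc Suc.prems
      by (simp add: assms del: of_nat_diff)
  qed simp
next
  case False
  hence "a < j" by simp
  have "dg hh (int a - int a) = 0" by (simp add: dg_def)
  hence "(\<Prod>i<j. dg hh (int a - int i)) = 0"
    using \<open>a < j\<close> by (intro prod_zero bexI[of _ a]) auto
  thus ?thesis using False by simp
qed

text \<open>The exponent is n m plus an even number, so all half-integral powers of q in a cabled
  crossing collect in one factor.\<close>

lemma gexp_parity: "\<exists>z. gexp n m k l j = n * m + 2 * z"
proof -
  have "even (j * j + j)" by simp
  then obtain w where w: "j * j + j = 2 * w" by (rule evenE)
  have "gexp n m k l j = n * m + 2 * (2 * k * l - k * n - m * l - j * n - j * j - w + j * m - 2 * j * k + 2 * j * l)"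
    using w by (simp add: gexp_def algebra_simps)
  thus ?thesis by blast
qed

lemma qfact_ratio: "qfact (k + j) / qfact k \<in> int_laurent"
  by (simp add: qfact_add_split int_laurent_prod)

text \<open>The coefficient is separated into the common half-integral power, an integral factor and
  a quotient of factorials. What becomes of the latter depends on the sign of the crossing.\<close>

lemma crossing_integral_aux:
  assumes hh: "hh = qh \<or> hh = inverse qh" and dg: "\<And>z. dg hh (int z) = c * qint z" and c: "c \<in> int_laurent"
    and "k \<le> m" "j \<le> l"
  shows "\<exists>r\<in>int_laurent. G hh n m k l j = hh powi (int n * int m) * r *
     (if j \<le> m - k then qfact l / (qfact (l - j)) * (qfact (m - k) / (qfact j * qfact (m - k - j))) else 0)"
proof -
  obtain z where z: "gexp (int n) (int m) (int k) (int l) (int j) = int n * int m + 2 * z"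
    using gexp_parity by blast
  have hh0: "hh \<noteq> 0" using hh by auto
  have u: "hh powi (2 * z) \<in> int_laurent"
    using hh int_laurent_powi[of z] int_laurent_powi[of "- z"]
    by (auto simp: q_powi power_int_inverse power_int_minus)
  have mk: "int m - int k = int (m - k)" using assms(4) by simp
  have A: "G hh n m k l j = hh powi (int n * int m) * (hh powi (2 * z) * c ^ j) *
     (if j \<le> m - k then qbin l j * (qfact (m - k) / qfact (m - k - j)) else 0)"
    unfolding G_def z power_int_add[OF disjI1[OF hh0]] mk prod_dg[OF dg] by simp
  have B: "qbin l j * (qfact (m - k) / qfact (m - k - j)) =
      qfact l / (qfact (l - j)) * (qfact (m - k) / (qfact j * qfact (m - k - j)))"
    using assms(5) by (simp add: qbin_def mult.commute)
  show ?thesis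
  proof (rule bexI)
    show "hh powi (2 * z) * c ^ j \<in> int_laurent" by (intro int_laurent_mult int_laurent_power u c)
  qed (unfold A B, rule refl)
qed

text \<open>In the basis scaled by [k]! the factorials recombine into the binomial of m-k over j and
  the integral quotient [k+j]!/[k]!, so that [j]! disappears.\<close>

lemma crossing_term_pos:
  assumes "k \<le> m" "j \<le> l"
  shows "\<exists>r\<in>int_laurent. G qh n m k l j * (qfact (l - j) * qfact (k + j)) =
    qh powi (int n * int m) * r * (qfact k * qfact l)"
proof -
  obtain r where r: "r \<in> int_laurent" "G qh n m k l j = qh powi (int n * int m) * r *
     (if j \<le> m - k then qfact l / (qfact (l - j)) * (qfact (m - k) / (qfact j * qfact (m - k - j))) else 0)"
    using crossing_integral_aux[OF disjI1[OF refl] dg_qh int_laurent_qdiff assms, of n] by (rule bexE)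
  show ?thesis
  proof (cases "j \<le> m - k")
    case True
    have "qfact (m - k) / (qfact j * qfact (m - k - j)) = qbin (m - k) j"
      using True by (simp add: qbin_def)
    hence "G qh n m k l j * (qfact (l - j) * qfact (k + j)) =
        qh powi (int n * int m) * (r * qbin (m - k) j * (qfact (k + j) / qfact k)) * (qfact k * qfact l)"
      using True by (simp add: r(2))
    thus ?thesis
      by (rule bexI) (intro int_laurent_mult int_laurent_qbin r(1) qfact_ratio)
  next
    case False
    thus ?thesis by (intro bexI[of _ 0] int_laurent_0) (simp add: r(2))
  qed
qed

text \<open>The mirrored computation counts signs -, hence the complements m-k and n-l, whereas the
  scaling still counts signs +. The denominator [j]! now goes into the binomial of n-l over
  j.\<close>

lemma crossing_term_neg:
  assumes "k \<le> m" "l \<le> n" "j \<le> n - l"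
  shows "\<exists>r\<in>int_laurent. G (inverse qh) n m (m - k) (n - l) j * (qfact (l + j) * qfact (k - j)) =
    qh powi (- int n * int m) * r * (qfact k * qfact l)"
proof -
  obtain r where r: "r \<in> int_laurent" "G (inverse qh) n m (m - k) (n - l) j = inverse qh powi (int n * int m) * r *
     (if j \<le> m - (m - k) then qfact (n - l) / (qfact (n - l - j)) *
       (qfact (m - (m - k)) / (qfact j * qfact (m - (m - k) - j))) else 0)"
  proof -
    have "m - k \<le> m" by simp
    from crossing_integral_aux[OF disjI2[OF refl] dg_inverse_qh int_laurent_uminus[OF int_laurent_qdiff] this assms(3), of n]
    show ?thesis using that by (rule bexE)
  qed
  have u: "inverse qh powi (int n * int m) = qh powi (- int n * int m)"
    by (simp add: power_int_inverse power_int_minus)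
  show ?thesis
  proof (cases "j \<le> k")
    case True
    let ?E = "qfact (n - l) / (qfact (n - l - j)) * (qfact k / (qfact j * qfact (k - j)))"
    have E: "?E * (qfact (l + j) * qfact (k - j)) = qbin (n - l) j * (qfact (l + j) / qfact l) * (qfact k * qfact l)"
      using assms(3) by (simp add: qbin_def mult_ac)
    have "m - (m - k) = k" using assms(1) by simp
    hence "G (inverse qh) n m (m - k) (n - l) j = qh powi (- int n * int m) * r * ?E"
      using True by (simp only: r(2) u if_True)
    hence "G (inverse qh) n m (m - k) (n - l) j * (qfact (l + j) * qfact (k - j)) =
        qh powi (- int n * int m) * r * (?E * (qfact (l + j) * qfact (k - j)))"
      by (simp only: mult.assoc)
    hence "G (inverse qh) n m (m - k) (n - l) j * (qfact (l + j) * qfact (k - j)) =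
        qh powi (- int n * int m) * (r * (qbin (n - l) j * (qfact (l + j) / qfact l))) * (qfact k * qfact l)"
      unfolding E by (simp only: mult.assoc)
    thus ?thesis
      by (rule bexI) (intro int_laurent_mult int_laurent_qbin r(1) qfact_ratio)
  next
    case False
    thus ?thesis using assms(1) by (intro bexI[of _ 0] int_laurent_0) (simp add: r(2))
  qed
qed

lemma crossing_matrix_pos:
  assumes v: "\<And>a b. length a = n \<Longrightarrow> length b = m \<Longrightarrow> v (a @ b) = B (cnt a) (cnt b) * mw a * mw b"
    and B: "\<And>k l. B k l \<in> int_laurent"
  shows "\<exists>B'. (\<forall>k l. B' k l \<in> int_laurent) \<and> (\<forall>x y. length x = m \<longrightarrow> length y = n \<longrightarrow>
    ev (xcab Pos 0 n m) v (x @ y) = qh powi (int n * int m) * B' (cnt x) (cnt y) * mw x * mw y)"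
proof -
  define r where "r k l j = (SOME r. r \<in> int_laurent \<and> G qh n m k l j * (qfact (l - j) * qfact (k + j)) =
    qh powi (int n * int m) * r * (qfact k * qfact l))" for k l j
  have r: "r k l j \<in> int_laurent \<and> G qh n m k l j * (qfact (l - j) * qfact (k + j)) =
    qh powi (int n * int m) * r k l j * (qfact k * qfact l)" if "k \<le> m" "j \<le> l" for k l j
    unfolding r_def by (rule someI_ex) (rule crossing_term_pos[OF that, unfolded Bex_def])
  define B' where "B' k l = (if k \<le> m then \<Sum>j\<le>l. r k l j * B (l - j) (k + j) else 0)" for k l
  have b1: "B' k l \<in> int_laurent" for k l
    unfolding B'_def using r B by (auto intro!: int_laurent_sum int_laurent_mult)
  have b2: "ev (xcab Pos 0 n m) v (x @ y) = qh powi (int n * int m) * B' (cnt x) (cnt y) * mw x * mw y"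
    if "length x = m" "length y = n" for x y
  proof -
    let ?k = "cnt x" and ?l = "cnt y"
    have k: "?k \<le> m" using cnt_le_length[of x] that by simp
    have "ev (xcab Pos 0 n m) v (x @ y) = ug qh True x * ug qh True y *
      (\<Sum>j\<le>cg True y. G qh n m (cg True x) (cg True y) j *
        (B (cg True y - j) (cg True x + j) * qfact (cg True y - j) * qfact (cg True x + j)))"
      by (rule xcab_matrix[where A = "\<lambda>k l. B k l * qfact k * qfact l", OF layer_op_Pos _ _ _ that])
        (simp_all add: v mw_def ug_True mult_ac)
    also have "\<dots> = Uw x * Uw y * (\<Sum>j\<le>?l. (G qh n m ?k ?l j * (qfact (?l - j) * qfact (?k + j))) * B (?l - j) (?k + j))"
      by (simp add: ug_True mult_ac)
    also have "(\<Sum>j\<le>?l. (G qh n m ?k ?l j * (qfact (?l - j) * qfact (?k + j))) * B (?l - j) (?k + j)) =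
       (\<Sum>j\<le>?l. (qh powi (int n * int m) * (qfact ?k * qfact ?l)) * (r ?k ?l j * B (?l - j) (?k + j)))"
    proof (intro sum.cong refl)
      fix j assume "j \<in> {..?l}"
      hence "G qh n m ?k ?l j * (qfact (?l - j) * qfact (?k + j)) =
          qh powi (int n * int m) * r ?k ?l j * (qfact ?k * qfact ?l)" using r[OF k, of j ?l] by simp
      thus "(G qh n m ?k ?l j * (qfact (?l - j) * qfact (?k + j))) * B (?l - j) (?k + j) =
          (qh powi (int n * int m) * (qfact ?k * qfact ?l)) * (r ?k ?l j * B (?l - j) (?k + j))"
        by (simp only:) (simp only: mult_ac)
    qed
    also have "\<dots> = (qh powi (int n * int m) * (qfact ?k * qfact ?l)) * B' ?k ?l"
      using k by (simp add: B'_def sum_distrib_left)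
    finally show ?thesis by (simp add: mw_def mult_ac)
  qed
  show ?thesis by (rule exI[of _ B']) (intro conjI allI impI b1 b2)
qed

lemma crossing_matrix_neg:
  assumes v: "\<And>a b. length a = n \<Longrightarrow> length b = m \<Longrightarrow> v (a @ b) = B (cnt a) (cnt b) * mw a * mw b"
    and B: "\<And>k l. B k l \<in> int_laurent"
  shows "\<exists>B'. (\<forall>k l. B' k l \<in> int_laurent) \<and> (\<forall>x y. length x = m \<longrightarrow> length y = n \<longrightarrow>
    ev (xcab Neg 0 n m) v (x @ y) = qh powi (- int n * int m) * B' (cnt x) (cnt y) * mw x * mw y)"
proof -
  define r where "r k l j = (SOME r. r \<in> int_laurent \<and>
    G (inverse qh) n m (m - k) (n - l) j * (qfact (l + j) * qfact (k - j)) =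
    qh powi (- int n * int m) * r * (qfact k * qfact l))" for k l j
  have r: "r k l j \<in> int_laurent \<and> G (inverse qh) n m (m - k) (n - l) j * (qfact (l + j) * qfact (k - j)) =
    qh powi (- int n * int m) * r k l j * (qfact k * qfact l)" if "k \<le> m" "l \<le> n" "j \<le> n - l" for k l j
    unfolding r_def by (rule someI_ex) (rule crossing_term_neg[OF that, unfolded Bex_def])
  \<comment> \<open>The factor by which \<open>Uw\<close> differs from its mirrored version in
    \<open>ug_False\<close>. It is a power of q, and the prefactor of \<open>B'\<close> cancels it
    on the strings above.\<close>
  define p where "p N k = q powi (int (k * (N - k)))" for N k :: nat
  define B' where "B' k l = (if k \<le> m \<and> l \<le> n then
      q powi (- int (k * (m - k)) - int (l * (n - l))) *
      (\<Sum>j\<le>n - l. r k l j * (p n (l + j) * p m (k - j) * B (l + j) (k - j))) else 0)" for k l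
  have b1: "B' k l \<in> int_laurent" for k l
  proof -
    have "r k l j * (p n (l + j) * p m (k - j) * B (l + j) (k - j)) \<in> int_laurent"
      if "k \<le> m" "l \<le> n" "j \<le> n - l" for j
      unfolding p_def by (intro int_laurent_mult int_laurent_powi B) (use r[OF that] in simp)
    hence "(\<Sum>j\<le>n - l. r k l j * (p n (l + j) * p m (k - j) * B (l + j) (k - j))) \<in> int_laurent"
      if "k \<le> m \<and> l \<le> n" using that by (intro int_laurent_sum) simp
    thus ?thesis unfolding B'_def
      by (cases "k \<le> m \<and> l \<le> n") (simp_all only: if_True if_False simp_thms int_laurent_mult int_laurent_powi int_laurent_0)
  qed
  have b2: "ev (xcab Neg 0 n m) v (x @ y) = qh powi (- int n * int m) * B' (cnt x) (cnt y) * mw x * mw y"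
    if "length x = m" "length y = n" for x y
  proof -
    let ?k = "cnt x" and ?l = "cnt y"
    let ?u = "ug (inverse qh) False"
    have k: "?k \<le> m" "?l \<le> n" using cnt_le_length[of x] cnt_le_length[of y] that by simp_all
    have Uw: "Uw a = p (length a) (cnt a) * ?u a" for a
      unfolding p_def power_int_of_nat by (rule ug_False)
    let ?A = "\<lambda>K L. p n (n - K) * p m (m - L) * B (n - K) (m - L) * qfact (n - K) * qfact (m - L)"
    have "ev (xcab Neg 0 n m) v (x @ y) = ?u x * ?u y *
      (\<Sum>j\<le>cg False y. G (inverse qh) n m (cg False x) (cg False y) j * ?A (cg False y - j) (cg False x + j))"
    proof (rule xcab_matrix[where A = ?A, OF layer_op_Neg _ _ _ that])
      fix a b :: "bool list" assume ab: "length a = n" "length b = m"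
      have "n - cg False a = cnt a" "m - cg False b = cnt b"
        using ab cnt_le_length[of a] cnt_le_length[of b] by (simp_all add: cg_False)
      thus "v (a @ b) = ?A (cg False a) (cg False b) * ?u a * ?u b"
        using ab by (simp add: v mw_def Uw mult_ac)
    qed simp_all
    also have "\<dots> = ?u x * ?u y * (\<Sum>j\<le>n - ?l. (G (inverse qh) n m (m - ?k) (n - ?l) j * (qfact (?l + j) * qfact (?k - j))) *
        (p n (?l + j) * p m (?k - j) * B (?l + j) (?k - j)))"
    proof -
      have c: "cg False x = m - ?k" "cg False y = n - ?l" using that by (simp_all add: cg_False)
      show ?thesis unfolding c
      proof (intro arg_cong[of _ _ "\<lambda>s. ?u x * ?u y * s"] sum.cong refl)
        fix j assume "j \<in> {..n - ?l}"
        hence "n - (n - ?l - j) = ?l + j" "m - (m - ?k + j) = ?k - j" using k by auto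
        thus "G (inverse qh) n m (m - ?k) (n - ?l) j * ?A (n - ?l - j) (m - ?k + j) =
            (G (inverse qh) n m (m - ?k) (n - ?l) j * (qfact (?l + j) * qfact (?k - j))) *
            (p n (?l + j) * p m (?k - j) * B (?l + j) (?k - j))"
          by (simp only: mult_ac)
      qed
    qed
    also have "(\<Sum>j\<le>n - ?l. (G (inverse qh) n m (m - ?k) (n - ?l) j * (qfact (?l + j) * qfact (?k - j))) *
        (p n (?l + j) * p m (?k - j) * B (?l + j) (?k - j))) =
       (\<Sum>j\<le>n - ?l. (qh powi (- int n * int m) * (qfact ?k * qfact ?l)) *
          (r ?k ?l j * (p n (?l + j) * p m (?k - j) * B (?l + j) (?k - j))))"
    proof (intro sum.cong refl)
      fix j assume "j \<in> {..n - ?l}"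
      hence e: "G (inverse qh) n m (m - ?k) (n - ?l) j * (qfact (?l + j) * qfact (?k - j)) =
          qh powi (- int n * int m) * r ?k ?l j * (qfact ?k * qfact ?l)" using r[OF k, of j] by simp
      show "(G (inverse qh) n m (m - ?k) (n - ?l) j * (qfact (?l + j) * qfact (?k - j))) *
          (p n (?l + j) * p m (?k - j) * B (?l + j) (?k - j)) =
          (qh powi (- int n * int m) * (qfact ?k * qfact ?l)) *
            (r ?k ?l j * (p n (?l + j) * p m (?k - j) * B (?l + j) (?k - j)))"
        unfolding e by (simp only: mult_ac)
    qed
    also have "\<dots> = (qh powi (- int n * int m) * (qfact ?k * qfact ?l)) * (p m ?k * p n ?l * B' ?k ?l)"
    proof -
      let ?c = "q powi (- int (?k * (m - ?k)) - int (?l * (n - ?l)))"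
      let ?S = "\<Sum>j\<le>n - ?l. r ?k ?l j * (p n (?l + j) * p m (?k - j) * B (?l + j) (?k - j))"
      have 1: "p m ?k * p n ?l * ?c = 1"
        unfolding p_def power_int_add[OF disjI1[OF q_nonzero], symmetric] by simp
      have "B' ?k ?l = ?c * ?S" using k by (simp only: B'_def simp_thms if_True)
      hence "p m ?k * p n ?l * B' ?k ?l = (p m ?k * p n ?l * ?c) * ?S" by (simp only: mult.assoc)
      hence S: "p m ?k * p n ?l * B' ?k ?l = ?S" unfolding 1 by simp
      show ?thesis unfolding S by (rule sum_distrib_left[symmetric])
    qed
    finally have "ev (xcab Neg 0 n m) v (x @ y) = ?u x * ?u y *
        (qh powi (- int n * int m) * (qfact ?k * qfact ?l) * (p m ?k * p n ?l * B' ?k ?l))" .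
    also have "\<dots> = qh powi (- int n * int m) * B' ?k ?l * (qfact ?k * (p m ?k * ?u x)) * (qfact ?l * (p n ?l * ?u y))"
      by (simp only: mult_ac)
    finally show ?thesis unfolding mw_def Uw that .
  qed
  show ?thesis by (rule exI[of _ B']) (intro conjI allI impI b1 b2)
qed

section \<open>The integral form and its behaviour under cabled layers\<close>

definition Mw :: "bvec" where "Mw ss = prod_list (map mw ss)"

lemma Mw_simps [simp]: "Mw [] = 1" "Mw (x # ss) = mw x * Mw ss" "Mw (ss @ ss') = Mw ss * Mw ss'"
  by (simp_all add: Mw_def)

text \<open>
  The denominator which a layer needs in order to preserve integrality; at a vertex it consists of
  the factorials of the numbers of strands joining two of its edges.
\<close>

fun scale_of :: "layer \<Rightarrow> nat list \<Rightarrow> nat list \<Rightarrow> scalar" where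
  "scale_of (Cup i) C C' = 1 / qfact (C' ! 0)"
| "scale_of (Cap i) C C' = qfact (C ! 0)"
| "scale_of (Pos i) C C' = qh powi (int (C ! 0) * int (C ! 1))"
| "scale_of (Neg i) C C' = qh powi (- int (C ! 0) * int (C ! 1))"
| "scale_of (Merge i) C C' = (let s = (C ! 0 + C ! 1 - C' ! 0) div 2 in
     qfact s * qfact (C ! 0 - s) * qfact (C ! 1 - s) / qfact (C' ! 0))"
| "scale_of (Split i) C C' = (let s = (C' ! 0 + C' ! 1 - C ! 0) div 2 in
     qfact s * qfact (C' ! 0 - s) * qfact (C' ! 1 - s) / (qfact (C' ! 0) * qfact (C' ! 1)))"

text \<open>Jones--Wenzl elements are added only where a layer would leave the q-symmetric vectors.
  One leg of a cup suffices; caps and crossings need none.\<close>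

fun jloc :: "layer \<Rightarrow> nat list \<Rightarrow> bvec \<Rightarrow> bvec" where
  "jloc (Cup i) C' g = app 0 (JW (C' ! 0)) g"
| "jloc (Merge i) C' g = app 0 (JW (C' ! 0)) g"
| "jloc (Split i) C' g = app 1 (JW (C' ! 1)) (app 0 (JW (C' ! 0)) g)"
| "jloc l C' g = g"

section \<open>Integrality of each kind of layer\<close>

lemma nrm_fact: "k \<le> n \<Longrightarrow> nrm n k = q ^ (k * (n - k)) * qfact n / (qfact k * qfact (n - k))"
  by (simp add: nrm_eq qbin_def)

lemma sum_strs_cnt2: "(\<Sum>u\<in>strs a. \<Sum>z\<in>strs b. (Uw u)\<^sup>2 * ((Uw z)\<^sup>2 * f (cnt u) (cnt z))) =
   (\<Sum>j\<le>a. \<Sum>j'\<le>b. nrm a j * (nrm b j' * f j j'))"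
proof -
  have "(\<Sum>u\<in>strs a. \<Sum>z\<in>strs b. (Uw u)\<^sup>2 * ((Uw z)\<^sup>2 * f (cnt u) (cnt z))) =
      (\<Sum>u\<in>strs a. (Uw u)\<^sup>2 * (\<Sum>j'\<le>b. nrm b j' * f (cnt u) j'))"
    by (intro sum.cong refl) (simp only: sum_distrib_left[symmetric] sum_strs_cnt)
  also have "\<dots> = (\<Sum>j\<le>a. nrm a j * (\<Sum>j'\<le>b. nrm b j' * f j j'))"
    by (rule sum_strs_cnt)
  finally show ?thesis by (simp only: sum_distrib_left)
qed

lemma sum_strs_cnt3:
  "(\<Sum>u\<in>strs a. \<Sum>z\<in>strs b. \<Sum>y\<in>strs c. (Uw u)\<^sup>2 * ((Uw z)\<^sup>2 * ((Uw y)\<^sup>2 * f (cnt u) (cnt z) (cnt y)))) =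
   (\<Sum>j\<le>a. \<Sum>j'\<le>b. \<Sum>k\<le>c. nrm a j * (nrm b j' * (nrm c k * f j j' k)))"
proof -
  have "(\<Sum>u\<in>strs a. \<Sum>z\<in>strs b. \<Sum>y\<in>strs c. (Uw u)\<^sup>2 * ((Uw z)\<^sup>2 * ((Uw y)\<^sup>2 * f (cnt u) (cnt z) (cnt y)))) =
      (\<Sum>u\<in>strs a. (Uw u)\<^sup>2 * (\<Sum>j'\<le>b. \<Sum>k\<le>c. nrm b j' * (nrm c k * f (cnt u) j' k)))"
    by (intro sum.cong refl, subst sum_strs_cnt2[symmetric]) (simp only: sum_distrib_left)
  also have "\<dots> = (\<Sum>j\<le>a. nrm a j * (\<Sum>j'\<le>b. \<Sum>k\<le>c. nrm b j' * (nrm c k * f j j' k)))"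
    by (rule sum_strs_cnt)
  finally show ?thesis by (simp only: sum_distrib_left)
qed

lemma int_laurent_unit: "(- q) ^ k \<in> int_laurent" "(- inverse q) ^ k \<in> int_laurent"
  "q ^ k \<in> int_laurent" "inverse (q ^ k) \<in> int_laurent"
proof -
  have "inverse (q ^ k) = inverse q ^ k" by (simp add: power_inverse)
  thus "(- q) ^ k \<in> int_laurent" "(- inverse q) ^ k \<in> int_laurent"
    "q ^ k \<in> int_laurent" "inverse (q ^ k) \<in> int_laurent"
    by (simp_all only:) (intro int_laurent_power int_laurent_uminus int_laurent_q)+
qed

text \<open>The projection contributes 1/\<open>nrm n k\<close>, which is [k]! [n-k]! / [n]! up to a
  power of q. The numerator is absorbed by the basis vectors of the two legs, and 1/[n]! remains as
  the scale.\<close>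

lemma local_cup:
  assumes "\<And>ks. \<beta> ks \<in> int_laurent"
  shows "\<exists>\<beta>'. (\<forall>ks. \<beta>' ks \<in> int_laurent) \<and> (\<forall>S. shape S = [n, n] \<longrightarrow>
    jloc (Cup i) [n, n] (\<lambda>S. lcl (Cup i) [] [n, n] S (\<lambda>T. \<beta> (map cnt T) * Mw T)) S =
    1 / qfact n * \<beta>' (map cnt S) * Mw S)"
proof -
  define \<beta>' where "\<beta>' ks = (let k = ks ! 0 in if k \<le> n \<and> ks ! 1 = n - k
    then (- inverse q) ^ (n - k) * inverse (q ^ (k * (n - k))) * \<beta> [] else 0)" for ks
  have int: "\<beta>' ks \<in> int_laurent" for ks
    unfolding \<beta>'_def Let_def using assms by (auto intro!: int_laurent_mult int_laurent_unit)
  have val: "jloc (Cup i) [n, n] (\<lambda>S. lcl (Cup i) [] [n, n] S (\<lambda>T. \<beta> (map cnt T) * Mw T)) S =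
    1 / qfact n * \<beta>' (map cnt S) * Mw S" if S0: "shape S = [n, n]" for S
  proof -
    obtain x y where S: "S = [x, y]" "length x = n" "length y = n"
      using S0 by (auto simp: map_eq_Cons_conv)
    have lx: "cnt x \<le> n" "cnt y \<le> n" using S cnt_le_length by metis+
    have "jloc (Cup i) [n, n] (\<lambda>S. lcl (Cup i) [] [n, n] S (\<lambda>T. \<beta> (map cnt T) * Mw T)) S =
        JW n (\<lambda>z. if y = bar z then cw z * \<beta> [] else 0) x"
    proof -
      have "lcl (Cup i) [] [n, n] [z, y] (\<lambda>T. \<beta> (map cnt T) * Mw T) = (if y = bar z then cw z * \<beta> [] else 0)"
        if "length z = n" for z by (subst lcl_Cup[OF that S(3)]) simp
      thus ?thesis by (simp add: S app_def) (intro JW_cong, simp_all add: S)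
    qed
    also have "\<dots> = (if cnt y = n - cnt x then Uw x * Uw y * cw x * \<beta> [] / nrm n (cnt x) else 0)"
      by (rule JW_cup(1)[OF S(2,3)])
    also have "\<dots> = 1 / qfact n * \<beta>' (map cnt S) * Mw S"
      using lx by (simp add: S(1) \<beta>'_def Let_def mw_def cw_def S(2) nrm_fact field_simps)
    finally show ?thesis .
  qed
  show ?thesis by (rule exI[of _ \<beta>']) (intro conjI allI impI int val)
qed

lemma local_cap:
  assumes "\<And>ks. \<beta> ks \<in> int_laurent"
  shows "\<exists>\<beta>'. (\<forall>ks. \<beta>' ks \<in> int_laurent) \<and> (\<forall>S. shape S = [] \<longrightarrow>
    jloc (Cap i) [] (\<lambda>S. lcl (Cap i) [n, n] [] S (\<lambda>T. \<beta> (map cnt T) * Mw T)) S =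
    qfact n * \<beta>' (map cnt S) * Mw S)"
proof -
  define b where "b = (\<Sum>k\<le>n. q ^ (k * (n - k)) * (- q) ^ k * \<beta> [k, n - k])"
  have "b \<in> int_laurent"
    unfolding b_def by (intro int_laurent_sum int_laurent_mult int_laurent_unit assms)
  moreover have "lcl (Cap i) [n, n] [] [] (\<lambda>T. \<beta> (map cnt T) * Mw T) = qfact n * b"
  proof -
    have "lcl (Cap i) [n, n] [] [] (\<lambda>T. \<beta> (map cnt T) * Mw T) =
        (\<Sum>x\<in>strs n. (Uw x)\<^sup>2 * ((- q) ^ cnt x * \<beta> [cnt x, n - cnt x] * (qfact (cnt x) * qfact (n - cnt x))))"
      unfolding lcl_Cap
      by (intro sum.cong refl) (simp add: kw_def cnt_bar strs_def mw_def power2_eq_square)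
    also have "\<dots> = (\<Sum>k\<le>n. nrm n k * ((- q) ^ k * \<beta> [k, n - k] * (qfact k * qfact (n - k))))"
      by (rule sum_strs_cnt)
    also have "\<dots> = qfact n * b"
      unfolding b_def sum_distrib_left by (intro sum.cong refl) (simp add: nrm_fact)
    finally show ?thesis .
  qed
  ultimately show ?thesis by (intro exI[of _ "\<lambda>_. b"]) simp
qed

lemma local_crossing:
  assumes "\<And>ks. \<beta> ks \<in> int_laurent" and X: "X = Pos \<or> X = Neg"
  shows "\<exists>\<beta>'. (\<forall>ks. \<beta>' ks \<in> int_laurent) \<and> (\<forall>S. shape S = [m, n] \<longrightarrow>
    lcl (X i) [n, m] [m, n] S (\<lambda>T. \<beta> (map cnt T) * Mw T) =
    scale_of (X i) [n, m] [m, n] * \<beta>' (map cnt S) * Mw S)"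
proof -
  let ?f = "\<lambda>T. \<beta> (map cnt T) * Mw T"
  define v where "v z = ?f (cut [n, m] z)" for z
  have v: "v (a @ b) = \<beta> [cnt a, cnt b] * mw a * mw b" if "length a = n" "length b = m" for a b
    using that by (simp add: v_def)
  have "\<exists>B'. (\<forall>k l. B' k l \<in> int_laurent) \<and> (\<forall>x y. length x = m \<longrightarrow> length y = n \<longrightarrow>
    ev (xcab X 0 n m) v (x @ y) = scale_of (X i) [n, m] [m, n] * B' (cnt x) (cnt y) * mw x * mw y)"
    using X crossing_matrix_pos[OF v assms(1)] crossing_matrix_neg[OF v assms(1)] by auto
  then obtain B' where B': "\<And>k l. B' k l \<in> int_laurent" "\<And>x y. length x = m \<Longrightarrow> length y = n \<Longrightarrow>
    ev (xcab X 0 n m) v (x @ y) = scale_of (X i) [n, m] [m, n] * B' (cnt x) (cnt y) * mw x * mw y" by blast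
  show ?thesis
  proof (intro exI[of _ "\<lambda>ks. B' (ks ! 0) (ks ! 1)"] conjI allI impI B'(1))
    fix S assume "shape S = [m, n]"
    then obtain x y where S: "S = [x, y]" "length x = m" "length y = n"
      by (auto simp: map_eq_Cons_conv)
    show "lcl (X i) [n, m] [m, n] S ?f =
        scale_of (X i) [n, m] [m, n] * B' (map cnt S ! 0) (map cnt S ! 1) * Mw S"
      unfolding lcl_def crossing_layer[OF X] v_def[symmetric]
      using B'(2)[OF S(2,3)] by (simp add: S(1) mult.assoc)
  qed
qed

text \<open>The three bundles at the vertex carry weights j, j' and r. After projection the
  factorials in the norms and in the basis recombine into one q-binomial for each of the three
  edges, times the factorials of the bundles over that of the upper edge.\<close>

lemma local_merge:
  assumes \<beta>: "\<And>ks. \<beta> ks \<in> int_laurent"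
  shows "\<exists>\<beta>'. (\<forall>ks. \<beta>' ks \<in> int_laurent) \<and> (\<forall>S. shape S = [a + b] \<longrightarrow>
    jloc (Merge i) [a + b] (\<lambda>S. lcl (Merge i) [a + s, s + b] [a + b] S (\<lambda>T. \<beta> (map cnt T) * Mw T)) S =
    qfact s * qfact a * qfact b / qfact (a + b) * \<beta>' (map cnt S) * Mw S)"
proof -
  let ?f = "\<lambda>T. \<beta> (map cnt T) * Mw T"
  let ?g = "\<lambda>S. lcl (Merge i) [a + s, s + b] [a + b] S ?f"
  \<comment> \<open>The factor (-q)^r is \<open>kw\<close> of the contracted bundle; the other two
    powers of q come from \<open>Uw\<close> of the concatenated strings on the two lower
    edges.\<close>
  define \<phi> where "\<phi> j j' r = (- q) ^ r * q ^ ((a - j) * r) * q ^ (r * j') * \<beta> [j + r, s - r + j']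
     * (qfact (j + r) * qfact (s - r + j'))" for j j' r
  define \<Phi> where "\<Phi> j j' = (\<Sum>r\<le>s. nrm s r * \<phi> j j' r)" for j j'
  have g: "?g [u @ z] = Uw u * Uw z * \<Phi> (cnt u) (cnt z)" if "length u = a" "length z = b" for u z
  proof -
    have "?g [u @ z] = (\<Sum>t\<in>strs s. kw t * ?f [u @ t, bar t @ z])"
      by (rule lcl_Merge[OF that])
    also have "\<dots> = (\<Sum>t\<in>strs s. Uw u * Uw z * ((Uw t)\<^sup>2 * \<phi> (cnt u) (cnt z) (cnt t)))"
    proof (intro sum.cong refl)
      fix t assume "t \<in> strs s"
      hence t: "length t = s" "cnt t \<le> s" using cnt_le_length[of t] by (auto simp: strs_def)
      show "kw t * ?f [u @ t, bar t @ z] = Uw u * Uw z * ((Uw t)\<^sup>2 * \<phi> (cnt u) (cnt z) (cnt t))"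
        using t that by (simp add: kw_def mw_def Uw_append cnt_bar \<phi>_def power2_eq_square)
    qed
    also have "\<dots> = Uw u * Uw z * \<Phi> (cnt u) (cnt z)"
      unfolding sum_distrib_left[symmetric] sum_strs_cnt \<Phi>_def ..
    finally show ?thesis .
  qed
  define W where "W k = (\<Sum>j\<le>a. \<Sum>j'\<le>b. nrm a j * (nrm b j' * (if j + j' = k then q ^ ((a - j) * j') * \<Phi> j j' else 0)))" for k
  have sum: "(\<Sum>w\<in>cl (a + b) k. Uw w * ?g [w]) = W k" for k
  proof -
    have "(\<Sum>w\<in>cl (a + b) k. Uw w * ?g [w]) =
        (\<Sum>u\<in>strs a. \<Sum>z\<in>strs b. if cnt (u @ z) = k then Uw (u @ z) * ?g [u @ z] else 0)"
      unfolding sum_cl sum_strs_add ..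
    also have "\<dots> = (\<Sum>u\<in>strs a. \<Sum>z\<in>strs b. (Uw u)\<^sup>2 * ((Uw z)\<^sup>2 *
        (if cnt u + cnt z = k then q ^ ((a - cnt u) * cnt z) * \<Phi> (cnt u) (cnt z) else 0)))"
      by (intro sum.cong refl) (simp add: g strs_def Uw_append power2_eq_square)
    also have "\<dots> = W k"
      unfolding W_def by (rule sum_strs_cnt2)
    finally show ?thesis .
  qed
  define co where "co k j j' r = q ^ (j * (a - j)) * q ^ (j' * (b - j')) * q ^ (r * (s - r)) *
     inverse (q ^ (k * (a + b - k))) * q ^ ((a - j) * j') * ((- q) ^ r * q ^ ((a - j) * r) * q ^ (r * j')) *
     (qbin (j + r) j * qbin (s - r + j') j' * qbin (a - j + (b - j')) (a - j)) * \<beta> [j + r, s - r + j']" for k j j' r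
  define \<beta>' where "\<beta>' ks = (\<Sum>j\<le>a. \<Sum>j'\<le>b. if j + j' = ks ! 0 then \<Sum>r\<le>s. co (ks ! 0) j j' r else 0)" for ks
  have co_int: "co k j j' r \<in> int_laurent" for k j j' r
    unfolding co_def by (intro int_laurent_mult int_laurent_unit int_laurent_qbin \<beta>)
  have int: "\<beta>' ks \<in> int_laurent" for ks
    unfolding \<beta>'_def by (intro int_laurent_sum) (simp add: co_int int_laurent_sum)
  have W: "W k / nrm (a + b) k = qfact s * qfact a * qfact b / qfact (a + b) * (\<beta>' [k] * qfact k)"
    if "k \<le> a + b" for k
  proof -
    define K where "K = qfact s * qfact a * qfact b / qfact (a + b) * qfact k"
    have trm: "nrm a j * (nrm b j' * (q ^ ((a - j) * j') * (nrm s r * \<phi> j j' r))) / nrm (a + b) k = K * co k j j' r"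
      if "j \<le> a" "j' \<le> b" "j + j' = k" "r \<le> s" for j j' r
    proof -
      have e: "a = j + (a - j)" "b = j' + (b - j')" "s = r + (s - r)" using that by simp_all
      \<comment> \<open>The complementary weights become variables of their own, so that no
        truncated subtraction is left when fractions are cleared.\<close>
      define j0 j0' r0 where "j0 = a - j" and "j0' = b - j'" and "r0 = s - r"
      note e = e[folded this]
      have d: "a - j = j0" "b - j' = j0'" "s - r = r0" "a + b - k = j0 + j0'" using that e by simp_all
      have n: "nrm a j = q ^ (j * j0) * qfact a / (qfact j * qfact j0)"
        "nrm b j' = q ^ (j' * j0') * qfact b / (qfact j' * qfact j0')"
        "nrm s r = q ^ (r * r0) * qfact s / (qfact r * qfact r0)"
        "nrm (a + b) k = q ^ (k * (j0 + j0')) * qfact (a + b) / (qfact k * qfact (j0 + j0'))"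
        using nrm_fact[of j a] nrm_fact[of j' b] nrm_fact[of r s] nrm_fact[of k "a + b"] that d by simp_all
      have "qbin (r0 + j') j' = qfact (r0 + j') / (qfact j' * qfact r0)" by (simp add: qbin_def)
      thus ?thesis
        unfolding n \<phi>_def co_def K_def d qbin_add by (simp add: field_simps)
    qed
    have "W k / nrm (a + b) k = (\<Sum>j\<le>a. \<Sum>j'\<le>b. if j + j' = k then
        \<Sum>r\<le>s. nrm a j * (nrm b j' * (q ^ ((a - j) * j') * (nrm s r * \<phi> j j' r))) / nrm (a + b) k else 0)"
      unfolding W_def sum_divide_distrib
      by (intro sum.cong refl) (simp add: \<Phi>_def sum_distrib_left sum_divide_distrib)
    also have "\<dots> = (\<Sum>j\<le>a. \<Sum>j'\<le>b. if j + j' = k then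
        \<Sum>r\<le>s. K * co k j j' r else 0)"
      by (intro sum.cong refl if_cong) (use trm in auto)
    also have "\<dots> = (\<Sum>j\<le>a. \<Sum>j'\<le>b. K * (if j + j' = k then \<Sum>r\<le>s. co k j j' r else 0))"
      by (intro sum.cong refl) (simp add: sum_distrib_left)
    also have "\<dots> = K * \<beta>' [k]"
      unfolding \<beta>'_def nth_Cons_0 by (simp only: sum_distrib_left)
    finally show ?thesis by (simp only: K_def mult.assoc mult.commute[of "qfact k"])
  qed
  have val: "jloc (Merge i) [a + b] ?g S =
    qfact s * qfact a * qfact b / qfact (a + b) * \<beta>' (map cnt S) * Mw S" if S: "shape S = [a + b]" for S
  proof -
    obtain w where w: "S = [w]" "length w = a + b" using S by (auto simp: map_eq_Cons_conv)
    have k: "cnt w \<le> a + b" using w cnt_le_length[of w] by simp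
    have "jloc (Merge i) [a + b] ?g S = Uw w * (W (cnt w) / nrm (a + b) (cnt w))"
      using sum[of "cnt w"] by (simp add: w app_def JW_eq jw_def)
    also have "\<dots> = qfact s * qfact a * qfact b / qfact (a + b) * \<beta>' (map cnt S) * Mw S"
      unfolding W[OF k] by (simp add: w mw_def)
    finally show ?thesis .
  qed
  show ?thesis by (rule exI[of _ \<beta>']) (intro conjI allI impI int val)
qed

text \<open>Both upper edges are projected, hence two norms in the denominator. The cups force t' to
  be \<open>bar t\<close> on the bundle between these edges, which leaves a sum over three weights
  and again one q-binomial per edge.\<close>

lemma local_split:
  assumes \<beta>: "\<And>ks. \<beta> ks \<in> int_laurent"
  shows "\<exists>\<beta>'. (\<forall>ks. \<beta>' ks \<in> int_laurent) \<and> (\<forall>S. shape S = [a + s, s + b] \<longrightarrow>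
    jloc (Split i) [a + s, s + b] (\<lambda>S. lcl (Split i) [a + b] [a + s, s + b] S (\<lambda>T. \<beta> (map cnt T) * Mw T)) S =
    qfact s * qfact a * qfact b / (qfact (a + s) * qfact (s + b)) * \<beta>' (map cnt S) * Mw S)"
proof -
  let ?f = "\<lambda>T. \<beta> (map cnt T) * Mw T"
  let ?g = "\<lambda>S. lcl (Split i) [a + b] [a + s, s + b] S ?f"
  define \<phi> where "\<phi> j r j' = q ^ ((a - j) * r) * q ^ (r * j') * q ^ ((a - j) * j') * (- inverse q) ^ (s - r)
     * \<beta> [j + j'] * qfact (j + j')" for j r j'
  define W where "W k k' = (\<Sum>j\<le>a. \<Sum>r\<le>s. \<Sum>j'\<le>b. nrm a j * (nrm s r * (nrm b j' *
     (if j + r = k \<and> s - r + j' = k' then \<phi> j r j' else 0))))" for k k'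
  have sum: "(\<Sum>w'\<in>cl (s + b) k'. Uw w' * (\<Sum>w\<in>cl (a + s) k. Uw w * ?g [w, w'])) = W k k'" for k k'
  proof -
    have inner: "(\<Sum>t'\<in>strs s. if t' = bar t then F t' else 0) = F (bar t)" if "length t = s"
      for t and F :: "bool list \<Rightarrow> scalar"
    proof -
      have "bar t \<in> strs s" using that by (simp add: strs_def)
      thus ?thesis by (simp add: sum.delta)
    qed
    have "(\<Sum>w'\<in>cl (s + b) k'. Uw w' * (\<Sum>w\<in>cl (a + s) k. Uw w * ?g [w, w'])) =
        (\<Sum>w'\<in>strs (s + b). \<Sum>w\<in>strs (a + s). if cnt w = k \<and> cnt w' = k' then Uw w * (Uw w' * ?g [w, w']) else 0)"
      unfolding sum_cl
    proof (intro sum.cong refl)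
      fix w' :: "bool list"
      show "(if cnt w' = k' then Uw w' * (\<Sum>w\<in>strs (a + s). if cnt w = k then Uw w * ?g [w, w'] else 0) else 0) =
          (\<Sum>w\<in>strs (a + s). if cnt w = k \<and> cnt w' = k' then Uw w * (Uw w' * ?g [w, w']) else 0)"
      proof (cases "cnt w' = k'")
        case True
        show ?thesis unfolding sum_distrib_left if_P[OF True]
          by (intro sum.cong refl) (simp add: True mult.left_commute)
      qed simp
    qed
    also have "\<dots> = (\<Sum>w\<in>strs (a + s). \<Sum>w'\<in>strs (s + b). if cnt w = k \<and> cnt w' = k' then Uw w * (Uw w' * ?g [w, w']) else 0)"
      by (rule sum.swap)
    also have "\<dots> = (\<Sum>u\<in>strs a. \<Sum>t\<in>strs s. \<Sum>t'\<in>strs s. \<Sum>z\<in>strs b.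
        if cnt (u @ t) = k \<and> cnt (t' @ z) = k' then Uw (u @ t) * (Uw (t' @ z) * ?g [u @ t, t' @ z]) else 0)"
      unfolding sum_strs_add ..
    also have "\<dots> = (\<Sum>u\<in>strs a. \<Sum>t\<in>strs s. \<Sum>z\<in>strs b. \<Sum>t'\<in>strs s.
        if cnt (u @ t) = k \<and> cnt (t' @ z) = k' then Uw (u @ t) * (Uw (t' @ z) * ?g [u @ t, t' @ z]) else 0)"
      by (rule sum.cong[OF refl], rule sum.cong[OF refl], rule sum.swap)
    also have "\<dots> = (\<Sum>u\<in>strs a. \<Sum>t\<in>strs s. \<Sum>z\<in>strs b.
        (if cnt (u @ t) = k \<and> cnt (bar t @ z) = k' then Uw (u @ t) * (Uw (bar t @ z) * (cw t * ?f [u @ z])) else 0))"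
    proof (intro sum.cong refl)
      fix u t z assume "u \<in> strs a" "t \<in> strs s" "z \<in> strs b"
      hence l: "length u = a" "length t = s" "length z = b" by (simp_all add: strs_def)
      have "(\<Sum>t'\<in>strs s. if cnt (u @ t) = k \<and> cnt (t' @ z) = k' then Uw (u @ t) * (Uw (t' @ z) * ?g [u @ t, t' @ z]) else 0) =
         (\<Sum>t'\<in>strs s. if t' = bar t then
        (if cnt (u @ t) = k \<and> cnt (t' @ z) = k' then Uw (u @ t) * (Uw (t' @ z) * (cw t * ?f [u @ z])) else 0) else 0)"
      proof (intro sum.cong refl)
        fix t' assume "t' \<in> strs s"
        hence "length t' = s" by (simp add: strs_def)
        from lcl_Split[OF l(1,2) this l(3), of i ?f]
        have g: "?g [u @ t, t' @ z] = (if t' = bar t then cw t * ?f [u @ z] else 0)" .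
        show "(if cnt (u @ t) = k \<and> cnt (t' @ z) = k' then Uw (u @ t) * (Uw (t' @ z) * ?g [u @ t, t' @ z]) else 0) =
          (if t' = bar t then
        (if cnt (u @ t) = k \<and> cnt (t' @ z) = k' then Uw (u @ t) * (Uw (t' @ z) * (cw t * ?f [u @ z])) else 0) else 0)"
          unfolding g by (cases "t' = bar t") simp_all
      qed
      also have "\<dots> = (if cnt (u @ t) = k \<and> cnt (bar t @ z) = k' then Uw (u @ t) * (Uw (bar t @ z) * (cw t * ?f [u @ z])) else 0)"
        by (rule inner[OF l(2)])
      finally show "(\<Sum>t'\<in>strs s. if cnt (u @ t) = k \<and> cnt (t' @ z) = k' then Uw (u @ t) * (Uw (t' @ z) * ?g [u @ t, t' @ z]) else 0) =
          (if cnt (u @ t) = k \<and> cnt (bar t @ z) = k' then Uw (u @ t) * (Uw (bar t @ z) * (cw t * ?f [u @ z])) else 0)" .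
    qed
    also have "\<dots> = (\<Sum>u\<in>strs a. \<Sum>t\<in>strs s. \<Sum>z\<in>strs b. (Uw u)\<^sup>2 * ((Uw t)\<^sup>2 * ((Uw z)\<^sup>2 *
       (if cnt u + cnt t = k \<and> s - cnt t + cnt z = k' then \<phi> (cnt u) (cnt t) (cnt z) else 0))))"
    proof (intro sum.cong refl)
      fix u t z assume "u \<in> strs a" "t \<in> strs s" "z \<in> strs b"
      hence l: "length u = a" "length t = s" "length z = b" "cnt t \<le> s"
        using cnt_le_length[of t] by (auto simp: strs_def)
      show "(if cnt (u @ t) = k \<and> cnt (bar t @ z) = k' then Uw (u @ t) * (Uw (bar t @ z) * (cw t * ?f [u @ z])) else 0) =
        (Uw u)\<^sup>2 * ((Uw t)\<^sup>2 * ((Uw z)\<^sup>2 *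
       (if cnt u + cnt t = k \<and> s - cnt t + cnt z = k' then \<phi> (cnt u) (cnt t) (cnt z) else 0)))"
        using l by (simp add: cnt_bar Uw_append cw_def mw_def \<phi>_def power2_eq_square)
    qed
    also have "\<dots> = W k k'"
      unfolding W_def by (rule sum_strs_cnt3)
    finally show ?thesis .
  qed
  define co where "co k k' j r j' = q ^ (j * (a - j)) * q ^ (j' * (b - j')) * q ^ (r * (s - r)) *
     inverse (q ^ (k * (a + s - k))) * inverse (q ^ (k' * (s + b - k'))) *
     (q ^ ((a - j) * r) * q ^ (r * j') * q ^ ((a - j) * j') * (- inverse q) ^ (s - r)) *
     (qbin (j + j') j * qbin (a - j + (s - r)) (a - j) * qbin (r + (b - j')) r) * \<beta> [j + j']" for k k' j r j'
  define \<beta>' where "\<beta>' ks = (\<Sum>j\<le>a. \<Sum>r\<le>s. \<Sum>j'\<le>b. if j + r = ks ! 0 \<and> s - r + j' = ks ! 1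
     then co (ks ! 0) (ks ! 1) j r j' else 0)" for ks
  have co_int: "co k k' j r j' \<in> int_laurent" for k k' j r j'
    unfolding co_def by (intro int_laurent_mult int_laurent_unit int_laurent_qbin \<beta>)
  have int: "\<beta>' ks \<in> int_laurent" for ks
    unfolding \<beta>'_def by (intro int_laurent_sum) (simp add: co_int)
  have W: "W k k' / (nrm (a + s) k * nrm (s + b) k') =
      qfact s * qfact a * qfact b / (qfact (a + s) * qfact (s + b)) * (\<beta>' [k, k'] * (qfact k * qfact k'))"
    if "k \<le> a + s" "k' \<le> s + b" for k k'
  proof -
    define K where "K = qfact s * qfact a * qfact b / (qfact (a + s) * qfact (s + b)) * (qfact k * qfact k')"
    have trm: "nrm a j * (nrm s r * (nrm b j' * \<phi> j r j')) / (nrm (a + s) k * nrm (s + b) k') = K * co k k' j r j'"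
      if "j \<le> a" "r \<le> s" "j' \<le> b" "j + r = k" "s - r + j' = k'" for j r j'
    proof -
      have e: "a = j + (a - j)" "b = j' + (b - j')" "s = r + (s - r)" using that by simp_all
      define j0 j0' r0 where "j0 = a - j" and "j0' = b - j'" and "r0 = s - r"
      note e = e[folded this]
      have d: "a - j = j0" "b - j' = j0'" "s - r = r0" "a + s - k = j0 + r0" "s + b - k' = r + j0'"
        using that e by simp_all
      have n: "nrm a j = q ^ (j * j0) * qfact a / (qfact j * qfact j0)"
        "nrm b j' = q ^ (j' * j0') * qfact b / (qfact j' * qfact j0')"
        "nrm s r = q ^ (r * r0) * qfact s / (qfact r * qfact r0)"
        "nrm (a + s) k = q ^ (k * (j0 + r0)) * qfact (a + s) / (qfact k * qfact (j0 + r0))"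
        "nrm (s + b) k' = q ^ (k' * (r + j0')) * qfact (s + b) / (qfact k' * qfact (r + j0'))"
        using nrm_fact[of j a] nrm_fact[of j' b] nrm_fact[of r s] nrm_fact[of k "a + s"] nrm_fact[of k' "s + b"] that d
        by simp_all
      show ?thesis
        unfolding n \<phi>_def co_def K_def d qbin_add by (simp add: field_simps)
    qed
    have "W k k' / (nrm (a + s) k * nrm (s + b) k') = (\<Sum>j\<le>a. \<Sum>r\<le>s. \<Sum>j'\<le>b.
       if j + r = k \<and> s - r + j' = k' then nrm a j * (nrm s r * (nrm b j' * \<phi> j r j')) / (nrm (a + s) k * nrm (s + b) k') else 0)"
      unfolding W_def sum_divide_distrib
      by (intro sum.cong refl) simp
    also have "\<dots> = (\<Sum>j\<le>a. \<Sum>r\<le>s. \<Sum>j'\<le>b. K * (if j + r = k \<and> s - r + j' = k' then co k k' j r j' else 0))"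
      by (intro sum.cong refl) (use trm in auto)
    also have "\<dots> = K * \<beta>' [k, k']"
      unfolding \<beta>'_def One_nat_def nth_Cons_Suc nth_Cons_0 by (simp only: sum_distrib_left)
    finally show ?thesis by (simp only: K_def mult.assoc mult.commute[of "\<beta>' [k, k']"])
  qed
  have val: "jloc (Split i) [a + s, s + b] ?g S =
    qfact s * qfact a * qfact b / (qfact (a + s) * qfact (s + b)) * \<beta>' (map cnt S) * Mw S"
    if S: "shape S = [a + s, s + b]" for S
  proof -
    obtain w w' where w: "S = [w, w']" "length w = a + s" "length w' = s + b"
      using S by (auto simp: map_eq_Cons_conv)
    have k: "cnt w \<le> a + s" "cnt w' \<le> s + b" using w cnt_le_length[of w] cnt_le_length[of w'] by simp_all
    have "jloc (Split i) [a + s, s + b] ?g S =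
       JW (s + b) (\<lambda>y. JW (a + s) (\<lambda>x. ?g [x, y]) w) w'"
      by (simp add: w app_def)
    also have "\<dots> = Uw w' * (\<Sum>y\<in>cl (s + b) (cnt w'). Uw y * (Uw w * (\<Sum>x\<in>cl (a + s) (cnt w). Uw x * ?g [x, y])
        / nrm (a + s) (cnt w))) / nrm (s + b) (cnt w')"
      by (simp add: JW_eq w jw_def)
    also have "\<dots> = Uw w * Uw w' * ((\<Sum>y\<in>cl (s + b) (cnt w'). Uw y * (\<Sum>x\<in>cl (a + s) (cnt w). Uw x * ?g [x, y]))
        / (nrm (a + s) (cnt w) * nrm (s + b) (cnt w')))"
    proof -
      have "(\<Sum>y\<in>cl (s + b) (cnt w'). Uw y * (Uw w * (\<Sum>x\<in>cl (a + s) (cnt w). Uw x * ?g [x, y]) / nrm (a + s) (cnt w))) =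
          Uw w / nrm (a + s) (cnt w) * (\<Sum>y\<in>cl (s + b) (cnt w'). Uw y * (\<Sum>x\<in>cl (a + s) (cnt w). Uw x * ?g [x, y]))"
        unfolding sum_distrib_left[of "Uw w / nrm (a + s) (cnt w)"]
        by (intro sum.cong refl) simp
      thus ?thesis by (simp only:) simp
    qed
    also have "\<dots> = qfact s * qfact a * qfact b / (qfact (a + s) * qfact (s + b)) * \<beta>' (map cnt S) * Mw S"
      unfolding sum W[OF k] by (simp add: w mw_def)
    finally show ?thesis .
  qed
  show ?thesis by (rule exI[of _ \<beta>']) (intro conjI allI impI int val)
qed

lemma local_integral:
  assumes "loc l i C C'" "\<And>ks. \<beta> ks \<in> int_laurent"
  shows "\<exists>\<beta>'. (\<forall>ks. \<beta>' ks \<in> int_laurent) \<and> (\<forall>S. shape S = C' \<longrightarrow>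
    jloc l C' (\<lambda>S. lcl l C C' S (\<lambda>T. \<beta> (map cnt T) * Mw T)) S = scale_of l C C' * \<beta>' (map cnt S) * Mw S)"
  using assms(1)
proof cases
  case (1 n)
  show ?thesis unfolding 1 using local_cup[OF assms(2), of n i] by simp
next
  case (2 n)
  show ?thesis unfolding 2 using local_cap[OF assms(2), of i n] by simp
next
  case (3 n m)
  show ?thesis unfolding 3 using local_crossing[OF assms(2), of Pos m n i] by simp
next
  case (4 n m)
  show ?thesis unfolding 4 using local_crossing[OF assms(2), of Neg m n i] by simp
next
  case (5 x s y)
  have "scale_of (Merge i) [x + s, s + y] [x + y] = qfact s * qfact x * qfact y / qfact (x + y)"
    by (simp add: Let_def)
  thus ?thesis unfolding 5 using local_merge[OF assms(2), of x y i s] by (simp only:)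
next
  case (6 x y s)
  have "scale_of (Split i) [x + y] [x + s, s + y] = qfact s * qfact x * qfact y / (qfact (x + s) * qfact (s + y))"
    by (simp add: Let_def)
  thus ?thesis unfolding 6 using local_split[OF assms(2), of x s y i] by (simp only:)
qed

section \<open>Evaluation of a sequence of cabled layers\<close>

definition eqs :: "nat list \<Rightarrow> bvec \<Rightarrow> bvec \<Rightarrow> bool" where
  "eqs ns v w \<longleftrightarrow> (\<forall>ss. shape ss = ns \<longrightarrow> v ss = w ss)"

lemma eqsI: "(\<And>ss. shape ss = ns \<Longrightarrow> v ss = w ss) \<Longrightarrow> eqs ns v w"
  by (simp add: eqs_def)

lemma eqsD: "eqs ns v w \<Longrightarrow> shape ss = ns \<Longrightarrow> v ss = w ss"
  by (simp add: eqs_def)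

lemma eqs_refl [simp]: "eqs ns v v"
  by (simp add: eqs_def)

lemma eqs_sym: "eqs ns v w \<Longrightarrow> eqs ns w v"
  by (simp add: eqs_def)

lemma eqs_trans [trans]: "eqs ns u v \<Longrightarrow> eqs ns v w \<Longrightarrow> eqs ns u w"
  by (simp add: eqs_def)

lemma app_cong:
  assumes "eqs ns v w" "i < length ns"
  shows "eqs ns (app i (JW (ns ! i)) v) (app i (JW (ns ! i)) w)"
proof (rule eqsI)
  fix ss assume ss: "shape ss = ns"
  have i: "i < length ss" using ss assms(2) by auto
  show "app i (JW (ns ! i)) v ss = app i (JW (ns ! i)) w ss"
    unfolding app_def
  proof (rule JW_cong)
    show "length (ss ! i) = ns ! i" using ss i by auto
    fix z :: "bool list" assume "length z = ns ! i"
    hence "shape (ss[i := z]) = ns" using ss by (metis list_update_id map_update)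
    thus "v (ss[i := z]) = w (ss[i := z])" using assms(1) by (rule eqsD[rotated])
  qed
qed

lemma shape3:
  assumes "shape ss = A @ C @ B"
  obtains SA S SB where "ss = SA @ S @ SB" "shape SA = A" "shape S = C" "shape SB = B"
proof -
  obtain SA R where 1: "ss = SA @ R" "shape SA = A" "shape R = C @ B"
    using assms by (rule shape_append_cases)
  obtain S SB where 2: "R = S @ SB" "shape S = C" "shape SB = B"
    using 1(3) by (rule shape_append_cases)
  show ?thesis using that[of SA S SB] 1 2 by simp
qed

lemma lay_cong:
  assumes "loc l (length A) C C'" "eqs (A @ C @ B) v w"
  shows "eqs (A @ C' @ B) (lay l (A @ C @ B) (A @ C' @ B) v) (lay l (A @ C @ B) (A @ C' @ B) w)"
proof (rule eqsI)
  fix ss assume "shape ss = A @ C' @ B"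
  then obtain SA S SB where ss: "ss = SA @ S @ SB" "shape SA = A" "shape S = C'" "shape SB = B"
    by (rule shape3)
  show "lay l (A @ C @ B) (A @ C' @ B) v ss = lay l (A @ C @ B) (A @ C' @ B) w ss"
    unfolding ss(1) lay_local[OF assms(1) refl ss(2-4)]
    by (rule lcl_cong[OF assms(1) ss(3)]) (rule eqsD[OF assms(2)], simp add: ss)
qed

subsection \<open>Integral vectors\<close>

text \<open>The coefficients depend on the weights of the blocks only, so such a vector is fixed by
  all Jones--Wenzl elements. The scale \<open>c\<close> collects everything that is not
  integral.\<close>

definition integral_vec :: "nat list \<Rightarrow> scalar \<Rightarrow> bvec \<Rightarrow> bool" where
  "integral_vec ns c v \<longleftrightarrow> (\<exists>b. (\<forall>ks. b ks \<in> int_laurent) \<and>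
     (\<forall>ss. shape ss = ns \<longrightarrow> v ss = c * b (map cnt ss) * Mw ss))"

lemma integral_vec_cong: "integral_vec ns c v \<Longrightarrow> eqs ns v w \<Longrightarrow> integral_vec ns c w"
  unfolding integral_vec_def eqs_def by metis

lemma jw_sym:
  assumes "length s = n"
  shows "jw n (\<lambda>z. f (cnt z) * Uw z) s = f (cnt s) * Uw s"
proof -
  have n0: "nrm n (cnt s) \<noteq> 0" using nrm_nonzero[of "cnt s" n] cnt_le_length[of s] assms by simp
  have "(\<Sum>z\<in>cl n (cnt s). Uw z * (f (cnt z) * Uw z)) = (\<Sum>z\<in>cl n (cnt s). (Uw z)\<^sup>2 * f (cnt s))"
    by (intro sum.cong refl) (simp add: cl_def power2_eq_square)
  also have "\<dots> = nrm n (cnt s) * f (cnt s)"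
    by (simp only: nrm_def sum_distrib_right)
  finally show ?thesis using n0 by (simp add: jw_def)
qed

lemma integral_vec_fix:
  assumes "integral_vec ns c v" "i < length ns"
  shows "eqs ns (app i (JW (ns ! i)) v) v"
proof (rule eqsI)
  fix ss assume ss: "shape ss = ns"
  obtain b where b: "\<And>ss. shape ss = ns \<Longrightarrow> v ss = c * b (map cnt ss) * Mw ss"
    using assms(1) unfolding integral_vec_def by blast
  have i: "i < length ss" using ss assms(2) by auto
  define SA SB where "SA = take i ss" and "SB = drop (Suc i) ss"
  have ss_eq: "ss = SA @ ss ! i # SB" using i unfolding SA_def SB_def by (rule id_take_nth_drop)
  have lSA: "length SA = i" using i by (simp add: SA_def)
  define x where "x = ss ! i"
  have x: "length x = ns ! i" using ss i by (auto simp: x_def)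
  define f where "f k = c * b (map cnt SA @ k # map cnt SB) * (Mw SA * qfact k * Mw SB)" for k
  have v: "v (SA @ z # SB) = f (cnt z) * Uw z" if "length z = ns ! i" for z
  proof -
    have "shape (SA @ z # SB) = ns"
      using that x ss ss_eq by (metis list.simps(9) map_append x_def)
    from b[OF this] show ?thesis by (simp add: f_def mw_def)
  qed
  have "app i (JW (ns ! i)) v (SA @ x # SB) = JW (ns ! i) (\<lambda>z. f (cnt z) * Uw z) x"
    unfolding app_pat[OF lSA] by (rule JW_cong[OF v x])
  also have "\<dots> = v (SA @ x # SB)"
    unfolding v[OF x] JW_eq[OF x] by (rule jw_sym[OF x])
  finally show "app i (JW (ns ! i)) v ss = v ss"
    using ss_eq by (simp add: x_def)
qed

section \<open>Jones--Wenzl elements on several blocks\<close>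

definition jlist :: "nat list \<Rightarrow> nat list \<Rightarrow> bvec \<Rightarrow> bvec" where
  "jlist js ns v = fold (\<lambda>i. app i (JW (ns ! i))) js v"

lemma jlist_simps [simp]: "jlist [] ns v = v" "jlist (j # js) ns v = jlist js ns (app j (JW (ns ! j)) v)"
  by (simp_all add: jlist_def)

lemma jlist_append: "jlist (js @ js') ns v = jlist js' ns (jlist js ns v)"
  by (simp add: jlist_def)

lemma app_commute: "app i (JW (ns ! i)) (app j (JW (ns ! j)) v) = app j (JW (ns ! j)) (app i (JW (ns ! i)) v)"
  by (cases "i = j") (simp_all add: app_JW_commute)

lemma app_jlist: "app i (JW (ns ! i)) (jlist js ns v) = jlist js ns (app i (JW (ns ! i)) v)"
proof (induction js arbitrary: v)
  case (Cons j js)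
  show ?case using Cons.IH[of "app j (JW (ns ! j)) v"] by (simp only: jlist_simps app_commute[of i])
qed simp

lemma jlist_cong:
  assumes "set js \<subseteq> {..<length ns}" "eqs ns v w"
  shows "eqs ns (jlist js ns v) (jlist js ns w)"
  using assms
proof (induction js arbitrary: v w)
  case (Cons j js)
  have "eqs ns (app j (JW (ns ! j)) v) (app j (JW (ns ! j)) w)"
    using Cons.prems by (intro app_cong) auto
  thus ?case using Cons by simp
qed simp

lemma jlist_integral_vec:
  assumes "set js \<subseteq> {..<length ns}" "integral_vec ns c v"
  shows "eqs ns (jlist js ns v) v"
  using assms(1)
proof (induction js)
  case (Cons j js)
  have "eqs ns (jlist js ns (app j (JW (ns ! j)) v)) (jlist js ns v)"
    using Cons.prems integral_vec_fix[OF assms(2)] by (intro jlist_cong) auto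
  also have "eqs ns \<dots> v" using Cons by simp
  finally show ?case by simp
qed simp

lemma jlist_perm:
  assumes "mset js = mset js'"
  shows "jlist js ns v = jlist js' ns v"
proof -
  have "fold (\<lambda>i. app i (JW (ns ! i))) js = fold (\<lambda>i. app i (JW (ns ! i))) js'"
    by (rule fold_multiset_equiv[OF _ assms]) (simp add: fun_eq_iff app_commute)
  thus ?thesis by (simp add: jlist_def)
qed

abbreviation jall :: "nat list \<Rightarrow> bvec \<Rightarrow> bvec" where "jall ns \<equiv> jlist [0..<length ns] ns"

text \<open>The elements commute, so those at the remaining blocks can be applied last, and there
  they act trivially on a vector that depends on weights only.\<close>

lemma jall_absorb:
  assumes "distinct js" "set js \<subseteq> {..<length ns}" "integral_vec ns c (jlist js ns v)"
  shows "eqs ns (jall ns v) (jlist js ns v)"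
proof -
  let ?R = "filter (\<lambda>i. i \<notin> set js) [0..<length ns]"
  have "set (js @ ?R) = set [0..<length ns]" using assms(2) by auto
  moreover have "distinct (js @ ?R)" using assms(1) by auto
  ultimately have "mset (js @ ?R) = mset [0..<length ns]"
    using set_eq_iff_mset_eq_distinct[of "js @ ?R" "[0..<length ns]"] by simp
  from jlist_perm[OF this, of ns v]
  have "jall ns v = jlist ?R ns (jlist js ns v)" by (simp add: jlist_append)
  moreover have "eqs ns (jlist ?R ns (jlist js ns v)) (jlist js ns v)"
    by (rule jlist_integral_vec[OF _ assms(3)]) auto
  ultimately show ?thesis by simp
qed

fun jidx :: "layer \<Rightarrow> nat list" where
  "jidx (Cup i) = [i]" | "jidx (Merge i) = [i]" | "jidx (Split i) = [i, Suc i]" | "jidx l = []"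

lemma app_mid:
  assumes "length SA = i" "j < length S"
  shows "app (i + j) X w (SA @ S @ SB) = app j X (\<lambda>T. w (SA @ T @ SB)) S"
  using assms by (simp add: app_def nth_append list_update_append)

lemma jlist_jidx:
  assumes "loc l i C C'" "length A = i" "shape SA = A" "shape S = C'"
  shows "jlist (jidx l) (A @ C' @ B) w (SA @ S @ SB) = jloc l C' (\<lambda>T. w (SA @ T @ SB)) S"
  using assms(1)
proof cases
  case (1 n)
  have "length SA = i" "0 < length S" using assms 1 by auto
  thus ?thesis using app_mid[of SA i 0 S "JW n" w SB] assms(2) by (simp add: 1 nth_append)
next
  case (5 x s y)
  have "length SA = i" "0 < length S" using assms 5 by auto
  thus ?thesis using app_mid[of SA i 0 S "JW (x + y)" w SB] assms(2) by (simp add: 5 nth_append)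
next
  case (6 x y s)
  have l: "length SA = i" "length S = 2" using assms 6 by auto
  let ?w = "app i (JW (x + s)) w"
  have "app (i + 1) (JW (s + y)) ?w (SA @ S @ SB) = app 1 (JW (s + y)) (\<lambda>T. ?w (SA @ T @ SB)) S"
    by (rule app_mid) (use l in auto)
  also have "\<dots> = app 1 (JW (s + y)) (app 0 (JW (x + s)) (\<lambda>T. w (SA @ T @ SB))) S"
  proof -
    have "?w (SA @ S[1 := z] @ SB) = app 0 (JW (x + s)) (\<lambda>T. w (SA @ T @ SB)) (S[1 := z])" for z
      using app_mid[of SA i 0 "S[1 := z]" "JW (x + s)" w SB] l by simp
    thus ?thesis by (simp only: app_def[of 1])
  qed
  finally show ?thesis using assms(2) by (simp add: 6 nth_append)
qed simp_all

lemma jloc_cong: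
  assumes "loc l i C C'" "shape S = C'" "\<And>T. shape T = C' \<Longrightarrow> g T = h T"
  shows "jloc l C' g S = jloc l C' h S"
proof -
  have *: "app j (JW (C' ! j)) g' T = app j (JW (C' ! j)) h' T"
    if "j < length C'" "\<And>T. shape T = C' \<Longrightarrow> g' T = h' T" "shape T = C'" for j g' h' T
    using app_cong[of C' g' h' j] that by (auto simp: eqs_def)
  have S1: "app 0 (JW (C' ! 0)) g T = app 0 (JW (C' ! 0)) h T" if "0 < length C'" "shape T = C'" for T
    using *[OF that(1) assms(3) that(2)] .
  show ?thesis using assms(1)
  proof cases
    case (6 x y s)
    have l: "0 < length C'" "1 < length C'" using 6 by auto
    show ?thesis unfolding 6(1) jloc.simps by (rule *[OF l(2) S1[OF l(1)] assms(2)])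
  qed (use S1[OF _ assms(2)] assms in auto)
qed

lemma jloc_scale: "jloc l C' (\<lambda>T. K * g T) S = K * jloc l C' g S"
  by (cases l) (simp_all add: app_def lfun_scaled[OF lfun_JW])

lemma jidx_range:
  assumes "loc l (length A) C C'"
  shows "distinct (jidx l)" "set (jidx l) \<subseteq> {..<length (A @ C' @ B)}"
proof -
  have "distinct (jidx l) \<and> set (jidx l) \<subseteq> {..<length (A @ C' @ B)}"
    using assms by cases simp_all
  thus "distinct (jidx l)" "set (jidx l) \<subseteq> {..<length (A @ C' @ B)}" by simp_all
qed

lemma integral_vec_layer:
  assumes loc: "loc l (length A) C C'" and v: "integral_vec (A @ C @ B) c v"
  shows "integral_vec (A @ C' @ B) (c * scale_of l C C') (jlist (jidx l) (A @ C' @ B) (lay l (A @ C @ B) (A @ C' @ B) v))"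
proof -
  obtain b where b: "\<And>ks. b ks \<in> int_laurent" "\<And>ss. shape ss = A @ C @ B \<Longrightarrow> v ss = c * b (map cnt ss) * Mw ss"
    using v unfolding integral_vec_def by blast
  \<comment> \<open>The weights of the blocks beside the layer are parameters: the local statement
    is applied for each pair of such weight lists, and its coefficient functions are collected by
    choice.\<close>
  have "\<forall>p. \<exists>\<beta>'. (\<forall>ks. \<beta>' ks \<in> int_laurent) \<and> (\<forall>S. shape S = C' \<longrightarrow>
     jloc l C' (\<lambda>S. lcl l C C' S (\<lambda>T. b (fst p @ map cnt T @ snd p) * Mw T)) S = scale_of l C C' * \<beta>' (map cnt S) * Mw S)"
    by (rule allI) (rule local_integral[OF loc], rule b(1))
  from choice[OF this] obtain F where F: "\<And>p ks. F p ks \<in> int_laurent"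
    "\<And>p S. shape S = C' \<Longrightarrow>
     jloc l C' (\<lambda>S. lcl l C C' S (\<lambda>T. b (fst p @ map cnt T @ snd p) * Mw T)) S = scale_of l C C' * F p (map cnt S) * Mw S"
    by blast
  define i m where "i = length A" and "m = length C'"
  define b' where "b' ks = F (take i ks, drop (i + m) ks) (take m (drop i ks))" for ks
  have "jlist (jidx l) (A @ C' @ B) (lay l (A @ C @ B) (A @ C' @ B) v) ss = (c * scale_of l C C') * b' (map cnt ss) * Mw ss"
    if sss: "shape ss = A @ C' @ B" for ss
  proof -
    obtain SA S SB where ss: "ss = SA @ S @ SB" "shape SA = A" "shape S = C'" "shape SB = B"
      using sss by (rule shape3)
    have l: "length SA = i" "length S = m" using ss by (auto simp: i_def m_def)
    define K where "K = c * (Mw SA * Mw SB)"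
    let ?p = "(map cnt SA, map cnt SB)"
    let ?h = "\<lambda>T. b (map cnt SA @ map cnt T @ map cnt SB) * Mw T"
    have "jlist (jidx l) (A @ C' @ B) (lay l (A @ C @ B) (A @ C' @ B) v) ss =
        jloc l C' (\<lambda>T. lay l (A @ C @ B) (A @ C' @ B) v (SA @ T @ SB)) S"
      unfolding ss(1) by (rule jlist_jidx[OF loc refl ss(2,3)])
    also have "\<dots> = jloc l C' (\<lambda>T. K * lcl l C C' T ?h) S"
    proof (rule jloc_cong[OF loc ss(3)])
      fix T assume T: "shape T = C'"
      have "lay l (A @ C @ B) (A @ C' @ B) v (SA @ T @ SB) = lcl l C C' T (\<lambda>U. v (SA @ U @ SB))"
        by (rule lay_local[OF loc refl ss(2) T ss(4)])
      also have "\<dots> = lcl l C C' T (\<lambda>U. K * ?h U)"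
        by (rule lcl_cong[OF loc T]) (simp add: b(2) ss K_def)
      also have "\<dots> = K * lcl l C C' T ?h" by (rule lfun_scaled[OF lfun_lcl])
      finally show "lay l (A @ C @ B) (A @ C' @ B) v (SA @ T @ SB) = K * lcl l C C' T ?h" .
    qed
    also have "\<dots> = K * jloc l C' (\<lambda>T. lcl l C C' T ?h) S" by (rule jloc_scale)
    also have "jloc l C' (\<lambda>T. lcl l C C' T ?h) S = scale_of l C C' * F ?p (map cnt S) * Mw S"
      using F(2)[OF ss(3), of ?p] by simp
    also have "F ?p (map cnt S) = b' (map cnt ss)"
      using l by (simp add: b'_def ss(1))
    finally show ?thesis by (simp add: K_def ss(1))
  qed
  thus ?thesis unfolding integral_vec_def using F(1) by (intro exI[of _ b']) (simp add: b'_def)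
qed

section \<open>Sequences of layers with projections on all blocks\<close>

definition step_op :: "layer \<Rightarrow> nat list \<Rightarrow> nat list \<Rightarrow> bvec \<Rightarrow> bvec" where
  "step_op l ns ns' v = jall ns' (lay l ns ns' v)"

lemma step_op_cong:
  assumes "loc l (length A) C C'" "eqs (A @ C @ B) v w"
  shows "eqs (A @ C' @ B) (step_op l (A @ C @ B) (A @ C' @ B) v) (step_op l (A @ C @ B) (A @ C' @ B) w)"
  unfolding step_op_def by (rule jlist_cong) (use lay_cong[OF assms] in auto)

lemma step_op_eq:
  assumes "loc l (length A) C C'" "integral_vec (A @ C @ B) c v"
  shows "eqs (A @ C' @ B) (step_op l (A @ C @ B) (A @ C' @ B) v)
    (jlist (jidx l) (A @ C' @ B) (lay l (A @ C @ B) (A @ C' @ B) v))"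
  unfolding step_op_def by (rule jall_absorb[OF jidx_range[OF assms(1)] integral_vec_layer[OF assms]])

lemma integral_vec_step_op:
  assumes "loc l (length A) C C'" "integral_vec (A @ C @ B) c v"
  shows "integral_vec (A @ C' @ B) (c * scale_of l C C') (step_op l (A @ C @ B) (A @ C' @ B) v)"
  by (rule integral_vec_cong[OF integral_vec_layer[OF assms] eqs_sym[OF step_op_eq[OF assms]]])

fun run_path :: "nat list \<Rightarrow> (layer \<times> nat list) list \<Rightarrow> bvec \<Rightarrow> bvec" where
  "run_path ns [] v = v"
| "run_path ns ((l, ns') # E) v = run_path ns' E (step_op l ns ns' v)"

text \<open>Composable layers with the product of their scales, kept independent of any diagram
  because the detour of a strand to the far left inserts layers that are not in the given
  one.\<close>

inductive layer_path :: "nat list \<Rightarrow> (layer \<times> nat list) list \<Rightarrow> nat list \<Rightarrow> scalar \<Rightarrow> bool" where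
  layer_path_Nil: "layer_path ns [] ns 1"
| layer_path_Cons: "loc l (length A) C C' \<Longrightarrow> layer_path (A @ C' @ B) E ns c \<Longrightarrow>
    layer_path (A @ C @ B) ((l, A @ C' @ B) # E) ns (scale_of l C C' * c)"

lemma layer_path_append: "layer_path ns E ns' c \<Longrightarrow> layer_path ns' E' ns'' c' \<Longrightarrow> layer_path ns (E @ E') ns'' (c * c')"
proof (induction rule: layer_path.induct)
  case (layer_path_Cons l A C C' B E ns c)
  thus ?case using layer_path.layer_path_Cons[of l A C C' B "E @ E'" ns'' "c * c'"] by (simp add: mult.assoc)
qed simp

lemma run_path_append: "layer_path ns E ns' c \<Longrightarrow> run_path ns (E @ E') v = run_path ns' E' (run_path ns E v)"
  by (induction arbitrary: v rule: layer_path.induct) auto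

lemma run_path_cong: "layer_path ns E ns' c \<Longrightarrow> eqs ns v w \<Longrightarrow> eqs ns' (run_path ns E v) (run_path ns E w)"
proof (induction arbitrary: v w rule: layer_path.induct)
  case (layer_path_Cons l A C C' B E ns c)
  show ?case using layer_path_Cons.IH[OF step_op_cong[OF layer_path_Cons.hyps(1) layer_path_Cons.prems]] by simp
qed simp

lemma integral_vec_run_path: "layer_path ns E ns' c \<Longrightarrow> integral_vec ns d v \<Longrightarrow> integral_vec ns' (d * c) (run_path ns E v)"
proof (induction arbitrary: v d rule: layer_path.induct)
  case (layer_path_Cons l A C C' B E ns c)
  show ?case using layer_path_Cons.IH[OF integral_vec_step_op[OF layer_path_Cons.hyps(1) layer_path_Cons.prems]] by (simp add: mult.assoc)
qed simp

subsection \<open>Moving a strand across other strands and back\<close>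

text \<open>The projections between the two crossings are absorbed since the vector stays integral;
  what is left is a cable followed by its inverse.\<close>

lemma cross_back:
  assumes "integral_vec (A @ [n, m] @ B) c v"
  shows "eqs (A @ [n, m] @ B) (step_op (Neg (length A)) (A @ [m, n] @ B) (A @ [n, m] @ B)
    (step_op (Pos (length A)) (A @ [n, m] @ B) (A @ [m, n] @ B) v)) v"
proof -
  let ?i = "length A" and ?ns = "A @ [n, m] @ B" and ?ns' = "A @ [m, n] @ B"
  have 1: "eqs ?ns' (step_op (Pos ?i) ?ns ?ns' v) (lay (Pos ?i) ?ns ?ns' v)"
    using step_op_eq[OF loc.intros(3) assms] by simp
  have 2: "eqs ?ns (lay (Neg ?i) ?ns' ?ns (lay (Pos ?i) ?ns ?ns' v)) v"
  proof (rule eqsI)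
    fix ss assume "shape ss = ?ns"
    then obtain SA S SB where ss: "ss = SA @ S @ SB" "shape SA = A" "shape S = [n, m]" "shape SB = B"
      by (rule shape3)
    obtain x y where xy: "S = [x, y]" "length x = n" "length y = m"
      using ss(3) by (auto simp: map_eq_Cons_conv)
    define F where "F z = v (SA @ take n z # drop n z # SB)" for z
    have "lay (Neg ?i) ?ns' ?ns (lay (Pos ?i) ?ns ?ns' v) (SA @ x # y # SB) =
        ev (xcab Neg 0 m n) (\<lambda>z. lay (Pos ?i) ?ns ?ns' v (SA @ take m z # drop m z # SB)) (x @ y)"
      by (rule lay_crossing) (simp_all add: ss xy)
    also have "\<dots> = ev (xcab Neg 0 m n) (ev (xcab Pos 0 n m) F) (x @ y)"
    proof (rule ev_x_cong[of _ "n + m"])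
      fix z :: "bool list" assume z: "length z = n + m"
      have "lay (Pos ?i) ?ns ?ns' v (SA @ take m z # drop m z # SB) = ev (xcab Pos 0 n m) F (take m z @ drop m z)"
        unfolding F_def by (rule lay_crossing) (simp_all add: ss z)
      thus "lay (Pos ?i) ?ns ?ns' v (SA @ take m z # drop m z # SB) = ev (xcab Pos 0 n m) F z" by simp
    qed (simp_all add: xy)
    also have "\<dots> = ev (xcab Pos 0 n m @ xcab Neg 0 m n) F (x @ y)" by (simp add: ev_append)
    also have "\<dots> = F (x @ y)"
      using xcab_inverse[of "n + m" 0 n m] xy by (simp add: eqd_def)
    also have "\<dots> = v (SA @ x # y # SB)" by (simp add: F_def xy)
    finally show "lay (Neg ?i) ?ns' ?ns (lay (Pos ?i) ?ns ?ns' v) ss = v ss"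
      by (simp add: ss(1) xy(1))
  qed
  have "eqs ?ns (step_op (Neg ?i) ?ns' ?ns (step_op (Pos ?i) ?ns ?ns' v)) (step_op (Neg ?i) ?ns' ?ns (lay (Pos ?i) ?ns ?ns' v))"
    by (rule step_op_cong[OF loc.intros(4) 1])
  also have "eqs ?ns \<dots> (jall ?ns v)"
    unfolding step_op_def by (rule jlist_cong[OF _ 2]) auto
  also have "eqs ?ns \<dots> v"
    by (rule jlist_integral_vec[OF _ assms]) auto
  finally show ?thesis .
qed

text \<open>The strand passes its left neighbours one by one. The scales of a crossing and of its
  inverse are opposite powers of \<open>qh\<close>, so the detour does not affect the
  normalization.\<close>

lemma move_to_front:
  assumes "integral_vec (A @ n # B) d v"
  shows "\<exists>E E' c c'. layer_path (A @ n # B) E (n # A @ B) c \<and> layer_path (n # A @ B) E' (A @ n # B) c' \<and>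
    c * c' = 1 \<and> eqs (A @ n # B) (run_path (n # A @ B) E' (run_path (A @ n # B) E v)) v"
  using assms
proof (induction A arbitrary: B v d rule: rev_induct)
  case Nil
  have "layer_path (n # B) [] (n # B) 1" by (rule layer_path_Nil)
  moreover have "eqs (n # B) (run_path (n # B) [] (run_path (n # B) [] v)) v" by simp
  moreover have "(1::scalar) * 1 = 1" by simp
  ultimately show ?case unfolding append_Nil by blast
next
  case (snoc a A)
  let ?i = "length A" and ?ns = "A @ [a, n] @ B" and ?ns' = "A @ [n, a] @ B"
  let ?w = "step_op (Pos ?i) ?ns ?ns' v"
  have v: "integral_vec ?ns d v" using snoc.prems by simp
  have w: "integral_vec (A @ n # (a # B)) (d * scale_of (Pos ?i) [a, n] [n, a]) ?w"
    using integral_vec_step_op[OF loc.intros(3) v] by simp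
  obtain E E' c c' where IH: "layer_path ?ns' E (n # A @ a # B) c" "layer_path (n # A @ a # B) E' ?ns' c'" "c * c' = 1"
    "eqs ?ns' (run_path (n # A @ a # B) E' (run_path ?ns' E ?w)) ?w"
    using snoc.IH[OF w] by auto
  let ?F = "(Pos ?i, ?ns') # E" and ?F' = "E' @ [(Neg ?i, ?ns)]"
  have p1: "layer_path ?ns ?F (n # A @ a # B) (scale_of (Pos ?i) [a, n] [n, a] * c)"
    by (rule layer_path_Cons[OF loc.intros(3) IH(1)])
  have p2: "layer_path (n # A @ a # B) ?F' ?ns (c' * (scale_of (Neg ?i) [n, a] [a, n] * 1))"
    by (rule layer_path_append[OF IH(2) layer_path_Cons[OF loc.intros(4) layer_path_Nil]])
  have pp: "scale_of (Pos ?i) [a, n] [n, a] * scale_of (Neg ?i) [n, a] [a, n] = 1"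
    by (simp add: power_int_add[symmetric] mult.commute)
  have p3: "scale_of (Pos ?i) [a, n] [n, a] * c * (c' * (scale_of (Neg ?i) [n, a] [a, n] * 1)) = 1"
  proof -
    have "a * c * (c' * (b * 1)) = (a * b) * (c * c')" for a b :: scalar by (simp add: mult_ac)
    thus ?thesis by (simp only: IH(3) pp mult_1)
  qed
  have "run_path (n # A @ a # B) ?F' (run_path ?ns ?F v) = step_op (Neg ?i) ?ns' ?ns (run_path (n # A @ a # B) E' (run_path ?ns' E ?w))"
    by (simp add: run_path_append[OF IH(2)])
  moreover have "eqs ?ns (step_op (Neg ?i) ?ns' ?ns (run_path (n # A @ a # B) E' (run_path ?ns' E ?w))) (step_op (Neg ?i) ?ns' ?ns ?w)"
    by (rule step_op_cong[OF loc.intros(4) IH(4)])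
  ultimately have "eqs ?ns (run_path (n # A @ a # B) ?F' (run_path ?ns ?F v)) v"
    using cross_back[OF v] by (simp only: eqs_trans)
  with p1 p2 p3 have "\<exists>E E' c c'. layer_path ?ns E (n # A @ a # B) c \<and> layer_path (n # A @ a # B) E' ?ns c' \<and>
    c * c' = 1 \<and> eqs ?ns (run_path (n # A @ a # B) E' (run_path ?ns E v)) v" by blast
  thus ?case by simp
qed

subsection \<open>Invariance\<close>

definition fl :: "nat list \<Rightarrow> bvec \<Rightarrow> vec" where "fl ns v s = v (cut ns s)"

definition lower_blocks :: "nat list \<Rightarrow> bvec \<Rightarrow> bvec" where "lower_blocks ns v ss = lower (concat ss) (fl ns v)"

lemma wfd_sh: "wfd a D b \<Longrightarrow> vertex_free D \<Longrightarrow> wfd (k + a + r) (map (sh k) D) (k + b + r)"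
proof (induction D arbitrary: a)
  case (Cons l D)
  have l: "fits l a" "wfd (width_after l a) D b" "vertex_free D" "\<nexists>i. l = Merge i \<or> l = Split i"
    using Cons.prems by auto
  have "fits (sh k l) (k + a + r)" using l(1,4) by (cases l) auto
  moreover have "width_after (sh k l) (k + a + r) = k + width_after l a + r" using l(1,4) by (cases l) auto
  ultimately show ?case using Cons.IH[OF l(2,3)] by simp
qed simp

lemma vertex_free_sh [simp]: "vertex_free (map (sh k) D) \<longleftrightarrow> vertex_free D"
proof -
  have "(\<exists>i. sh k l = Merge i \<or> sh k l = Split i) \<longleftrightarrow> (\<exists>i. l = Merge i \<or> l = Split i)" for l
    by (cases l) auto
  hence "(\<forall>i. sh k l \<noteq> Merge i \<and> sh k l \<noteq> Split i) \<longleftrightarrow> (\<forall>i. l \<noteq> Merge i \<and> l \<noteq> Split i)" for l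
    by blast
  thus ?thesis by (simp add: vertex_free_def)
qed

text \<open>Cabled layers and Jones--Wenzl elements are both finite combinations of vertex-free
  diagrams of fixed widths, and this form suffices for invariance and for conservation of weight.
  The index type is that of permutations, which index the Jones--Wenzl sum.\<close>

definition link_span :: "nat list \<Rightarrow> nat list \<Rightarrow> (bvec \<Rightarrow> bvec) \<Rightarrow> bool" where
  "link_span ns ns' T \<longleftrightarrow> (\<exists>I :: (nat \<Rightarrow> nat) set. \<exists>c D. finite I \<and>
     (\<forall>i\<in>I. wfd (sum_list ns) (D i) (sum_list ns') \<and> vertex_free (D i)) \<and>
     (\<forall>v ss. shape ss = ns' \<longrightarrow> T v ss = (\<Sum>i\<in>I. c i * ev (D i) (fl ns v) (concat ss))))"

lemma link_span_lay:
  assumes "loc l (length A) C C'"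
  shows "link_span (A @ C @ B) (A @ C' @ B) (lay l (A @ C @ B) (A @ C' @ B))"
proof -
  let ?D = "map (sh (sum_list A)) (core l C C')"
  have "wfd (sum_list (A @ C @ B)) ?D (sum_list (A @ C' @ B))"
    using wfd_sh[OF wfd_core[OF assms], of "sum_list A" "sum_list B"] by (simp add: add.assoc)
  thus ?thesis unfolding link_span_def
    by (intro exI[of _ "{id}"] exI[of _ "\<lambda>_. 1"] exI[of _ "\<lambda>_. ?D"])
      (simp add: wfd_core(2)[OF assms] lay_def cable_layer_core[OF assms refl] fl_def[abs_def])
qed

lemma link_span_app:
  assumes "i < length ns"
  shows "link_span ns ns (app i (JW (ns ! i)))"
proof -
  define A B n where "A = take i ns" and "B = drop (Suc i) ns" and "n = ns ! i"
  have ns: "ns = A @ [n] @ B" using id_take_nth_drop[OF assms] by (simp add: A_def B_def n_def)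
  have lA: "length A = i" using assms by (simp add: A_def)
  let ?D = "\<lambda>\<sigma>. map (sh (sum_list A)) (map Pos (min_braid n \<sigma>))"
  have "wfd (sum_list ns) (?D \<sigma>) (sum_list ns)" if "\<sigma> \<in> perms n" for \<sigma>
    using wfd_sh[OF wfd_Pos[OF min_braid_perms[OF that]], of "sum_list A" "sum_list B"]
    by (simp add: ns add.assoc xword_vertex_free del: map_map)
  moreover have "app i (JW n) v ss = (\<Sum>\<sigma>\<in>perms n. jc n \<sigma> * ev (?D \<sigma>) (fl ns v) (concat ss))"
    if sss: "shape ss = ns" for v ss
  proof -
    obtain SA S SB where ss: "ss = SA @ S @ SB" "shape SA = A" "shape S = [n]" "shape SB = B"
      using sss unfolding ns by (rule shape3)
    obtain x where x: "S = [x]" "length x = n" using ss(3) by (auto simp: map_eq_Cons_conv)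
    have lens: "length SA = i" "length (concat SA) = sum_list A" using ss(2) lA by (auto simp: length_concat)
    have "app i (JW n) v ss = (\<Sum>\<sigma>\<in>perms n. jc n \<sigma> * ev (map Pos (min_braid n \<sigma>)) (\<lambda>z. v (SA @ z # SB)) x)"
      using app_pat[OF lens(1), of "JW n" v x SB] by (simp add: ss(1) x(1) JW_def)
    also have "\<dots> = (\<Sum>\<sigma>\<in>perms n. jc n \<sigma> * ev (?D \<sigma>) (fl ns v) (concat ss))"
    proof (intro sum.cong refl arg_cong2[of _ _ _ _ "(*)"])
      fix \<sigma> assume "\<sigma> \<in> perms n"
      note w = wfd_Pos[OF min_braid_perms[OF this]]
      have "ev (?D \<sigma>) (fl ns v) (concat SA @ x @ concat SB) =
          ev (map Pos (min_braid n \<sigma>)) (\<lambda>z. fl ns v (concat SA @ z @ concat SB)) x"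
        by (rule ev_local) (use w x lens in \<open>simp_all add: xword_vertex_free\<close>)
      also have "\<dots> = ev (map Pos (min_braid n \<sigma>)) (\<lambda>z. v (SA @ z # SB)) x"
      proof (rule ev_x_cong[of _ n])
        fix z :: "bool list" assume "length z = n"
        hence "cut ns (concat SA @ z @ concat SB) = SA @ z # SB"
          using cut_concat[of "SA @ z # SB" ns] ss ns by simp
        thus "fl ns v (concat SA @ z @ concat SB) = v (SA @ z # SB)" by (simp add: fl_def)
      qed (simp_all add: x)
      finally show "ev (map Pos (min_braid n \<sigma>)) (\<lambda>z. v (SA @ z # SB)) x = ev (?D \<sigma>) (fl ns v) (concat ss)"
        by (simp add: ss(1) x(1))
    qed
    finally show ?thesis .
  qed
  ultimately show ?thesis unfolding link_span_def n_def[symmetric]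
    by (intro exI[of _ "perms n"] exI[of _ "jc n"] exI[of _ ?D]) (simp add: xword_vertex_free del: map_map)
qed

lemma link_span_lower_blocks:
  assumes "link_span ns ns' T"
  shows "eqs ns' (T (lower_blocks ns v)) (lower_blocks ns' (T v))"
proof (rule eqsI)
  fix ss assume ss: "shape ss = ns'"
  obtain I :: "(nat \<Rightarrow> nat) set" and c D where T: "finite I" "\<And>i. i \<in> I \<Longrightarrow> wfd (sum_list ns) (D i) (sum_list ns')"
     "\<And>i. i \<in> I \<Longrightarrow> vertex_free (D i)"
     "\<And>v ss. shape ss = ns' \<Longrightarrow> T v ss = (\<Sum>i\<in>I. c i * ev (D i) (fl ns v) (concat ss))"
    using assms unfolding link_span_def by blast
  have len: "length (concat ss) = sum_list ns'" using ss by (auto simp: length_concat)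
  have "lower_blocks ns' (T v) ss = lower (concat ss) (\<lambda>s. \<Sum>i\<in>I. c i * ev (D i) (fl ns v) s)"
    unfolding lower_blocks_def
  proof (rule lower_cong)
    fix z :: "bool list" assume "length z = length (concat ss)"
    hence z: "length z = sum_list ns'" using len by simp
    show "fl ns' (T v) z = (\<Sum>i\<in>I. c i * ev (D i) (fl ns v) z)"
      using T(4)[OF shape_cut[OF z], of v] by (simp add: fl_def concat_cut[OF z])
  qed
  also have "\<dots> = (\<Sum>i\<in>I. c i * lower (concat ss) (ev (D i) (fl ns v)))"
    by (simp add: lower_sum[OF T(1)] lower_scale)
  also have "\<dots> = (\<Sum>i\<in>I. c i * ev (D i) (fl ns (lower_blocks ns v)) (concat ss))"
  proof (intro sum.cong refl arg_cong2[of _ _ _ _ "(*)"])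
    fix i assume i: "i \<in> I"
    have "lower (concat ss) (ev (D i) (fl ns v)) = ev (D i) (\<lambda>z. lower z (fl ns v)) (concat ss)"
      by (rule lower_ev[OF T(2,3)[OF i] len])
    also have "\<dots> = ev (D i) (fl ns (lower_blocks ns v)) (concat ss)"
      by (rule ev_cong[OF T(2,3)[OF i] _ len]) (simp add: fl_def lower_blocks_def concat_cut)
    finally show "lower (concat ss) (ev (D i) (fl ns v)) = ev (D i) (fl ns (lower_blocks ns v)) (concat ss)" .
  qed
  also have "\<dots> = T (lower_blocks ns v) ss" by (rule T(4)[OF ss, symmetric])
  finally show "T (lower_blocks ns v) ss = lower_blocks ns' (T v) ss" by simp
qed

definition spin_zero :: "nat list \<Rightarrow> bvec \<Rightarrow> bool" where
  "spin_zero ns v \<longleftrightarrow> (\<forall>ss. shape ss = ns \<longrightarrow> spin (concat ss) \<noteq> 0 \<longrightarrow> v ss = 0)"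

text \<open>Cups and caps create and remove opposite signs, so every layer conserves the total
  weight.\<close>

lemma layer_op_spin_zero:
  assumes "\<And>s. spin s \<noteq> 0 \<Longrightarrow> v s = 0" "spin s \<noteq> 0"
  shows "layer_op l v s = 0"
proof -
  have cup: "opcup i u s = 0" if u: "\<And>s. spin s \<noteq> 0 \<Longrightarrow> u s = 0" for i u
  proof (cases "Suc i < length s")
    case True
    then obtain p a b r where s: "s = p @ a # b # r" "length p = i" by (rule split_list2)
    have "cupw a = 0 \<or> u (p @ r) = 0" if "a \<noteq> b"
    proof -
      have "spin (p @ r) = spin s" using that by (cases a; cases b) (simp_all add: s(1))
      thus ?thesis using u assms(2) by simp
    qed
    thus ?thesis unfolding s(1) opcup_pat[OF s(2)] by auto
  qed (simp add: opcup_def)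
  have cap: "opcap i v s' = 0" if "spin s' \<noteq> 0" for i s'
  proof -
    have "spin (take i s') + spin (drop i s') = spin s'"
      using spin_simps(4)[of "take i s'" "drop i s'"] by simp
    thus ?thesis using that by (simp add: opcap_def assms(1))
  qed
  show ?thesis using cup[OF assms(1)] cup[OF cap] cap[OF assms(2)] assms
    by (cases l) simp_all
qed

lemma ev_spin_zero: "(\<And>s. spin s \<noteq> 0 \<Longrightarrow> v s = 0) \<Longrightarrow> spin s \<noteq> 0 \<Longrightarrow> ev D v s = 0"
proof (induction D arbitrary: v)
  case (Cons l D)
  have "ev D (layer_op l v) s = 0"
    by (rule Cons.IH[OF layer_op_spin_zero[OF Cons.prems(1)] Cons.prems(2)])
  thus ?case by (simp add: ev_Cons)
qed simp

lemma link_span_spin_zero: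
  assumes "link_span ns ns' T" "spin_zero ns v"
  shows "spin_zero ns' (T v)"
  unfolding spin_zero_def
proof (intro allI impI)
  fix ss assume ss: "shape ss = ns'" "spin (concat ss) \<noteq> 0"
  obtain I :: "(nat \<Rightarrow> nat) set" and c D where T: "finite I" "\<And>i. i \<in> I \<Longrightarrow> wfd (sum_list ns) (D i) (sum_list ns')"
     "\<And>i. i \<in> I \<Longrightarrow> vertex_free (D i)"
     "\<And>v ss. shape ss = ns' \<Longrightarrow> T v ss = (\<Sum>i\<in>I. c i * ev (D i) (fl ns v) (concat ss))"
    using assms unfolding link_span_def by blast
  have len: "length (concat ss) = sum_list ns'" using ss by (auto simp: length_concat)
  \<comment> \<open>Nothing is known about \<open>fl ns v\<close> on strings of other lengths, so it
    is cut off to zero there before weights are compared.\<close>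
  define u where "u s = (if length s = sum_list ns then fl ns v s else 0)" for s
  have u: "u s = 0" if "spin s \<noteq> 0" for s
  proof (cases "length s = sum_list ns")
    case True
    thus ?thesis using assms(2) that shape_cut[OF True] concat_cut[OF True]
      unfolding u_def fl_def spin_zero_def by simp
  qed (simp add: u_def)
  have "ev (D i) (fl ns v) (concat ss) = 0" if "i \<in> I" for i
  proof -
    have "ev (D i) (fl ns v) (concat ss) = ev (D i) u (concat ss)"
      by (rule ev_cong[OF T(2,3)[OF that] _ len]) (simp add: u_def)
    thus ?thesis using ev_spin_zero[OF u ss(2)] by simp
  qed
  thus "T v ss = 0" by (simp add: T(4)[OF ss(1)])
qed

lemma jlist_lower_blocks:
  assumes "set js \<subseteq> {..<length ns}"
  shows "eqs ns (jlist js ns (lower_blocks ns v)) (lower_blocks ns (jlist js ns v))"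
  using assms
proof (induction js arbitrary: v)
  case (Cons j js)
  have j: "j < length ns" "set js \<subseteq> {..<length ns}" using Cons.prems by auto
  have "eqs ns (jlist js ns (app j (JW (ns ! j)) (lower_blocks ns v))) (jlist js ns (lower_blocks ns (app j (JW (ns ! j)) v)))"
    by (rule jlist_cong[OF j(2) link_span_lower_blocks[OF link_span_app[OF j(1)]]])
  also have "eqs ns \<dots> (lower_blocks ns (jlist js ns (app j (JW (ns ! j)) v)))"
    by (rule Cons.IH[OF j(2)])
  finally show ?case by simp
qed simp

lemma jlist_spin_zero:
  assumes "set js \<subseteq> {..<length ns}" "spin_zero ns v"
  shows "spin_zero ns (jlist js ns v)"
  using assms
proof (induction js arbitrary: v)
  case (Cons j js)
  thus ?case using link_span_spin_zero[OF link_span_app] by simp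
qed simp

lemma step_op_lower_blocks:
  assumes "loc l (length A) C C'"
  shows "eqs (A @ C' @ B) (step_op l (A @ C @ B) (A @ C' @ B) (lower_blocks (A @ C @ B) v))
    (lower_blocks (A @ C' @ B) (step_op l (A @ C @ B) (A @ C' @ B) v))"
  unfolding step_op_def
  by (rule eqs_trans[OF jlist_cong[OF _ link_span_lower_blocks[OF link_span_lay[OF assms]]] jlist_lower_blocks]) auto

lemma run_path_lower_blocks: "layer_path ns E ns' c \<Longrightarrow> eqs ns' (run_path ns E (lower_blocks ns v)) (lower_blocks ns' (run_path ns E v))"
proof (induction arbitrary: v rule: layer_path.induct)
  case (layer_path_Cons l A C C' B E ns c)
  have "eqs ns (run_path (A @ C' @ B) E (step_op l (A @ C @ B) (A @ C' @ B) (lower_blocks (A @ C @ B) v)))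
    (run_path (A @ C' @ B) E (lower_blocks (A @ C' @ B) (step_op l (A @ C @ B) (A @ C' @ B) v)))"
    by (rule run_path_cong[OF layer_path_Cons.hyps(2) step_op_lower_blocks[OF layer_path_Cons.hyps(1)]])
  also have "eqs ns \<dots> (lower_blocks ns (run_path (A @ C' @ B) E (step_op l (A @ C @ B) (A @ C' @ B) v)))"
    by (rule layer_path_Cons.IH)
  finally show ?case by simp
qed simp

lemma run_path_spin_zero: "layer_path ns E ns' c \<Longrightarrow> spin_zero ns v \<Longrightarrow> spin_zero ns' (run_path ns E v)"
proof (induction arbitrary: v rule: layer_path.induct)
  case (layer_path_Cons l A C C' B E ns c)
  have "spin_zero (A @ C' @ B) (step_op l (A @ C @ B) (A @ C' @ B) v)"
    unfolding step_op_def
    by (rule jlist_spin_zero[OF _ link_span_spin_zero[OF link_span_lay[OF layer_path_Cons.hyps(1)] layer_path_Cons.prems]]) auto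
  thus ?case using layer_path_Cons.IH by simp
qed simp

lemma lfun_jlist: "lfun (\<lambda>v. jlist js ns v ss)"
proof (induction js arbitrary: ss)
  case (Cons j js)
  have "lfun (\<lambda>v. app j (JW (ns ! j)) v x)" for x
    unfolding app_def by (rule lfun_comp[OF lfun_JW]) (rule lfun_point)
  from lfun_comp[OF Cons.IH this] show ?case by simp
qed (simp add: lfun_point)

lemma lfun_step_op: "lfun (\<lambda>v. step_op l ns ns' v ss)"
proof -
  have "lfun (\<lambda>v. lay l ns ns' v x)" for x
    unfolding lay_def by (rule lfun_comp[OF lfun_ev]) (rule lfun_point)
  from lfun_comp[OF lfun_jlist this] show ?thesis by (simp add: step_op_def)
qed

lemma lfun_run_path: "lfun (\<lambda>v. run_path ns E v ss)"
proof (induction E arbitrary: ns)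
  case (Cons e E)
  obtain l ns' where e: "e = (l, ns')" by (cases e)
  show ?case using lfun_comp[OF Cons.IH lfun_step_op] by (simp add: e)
qed (simp add: lfun_point)

subsection \<open>Divisibility\<close>

definition block_vac :: bvec where "block_vac ss = (if ss = [] then 1 else 0)"

lemma integral_vec_block_vac: "integral_vec [] 1 block_vac"
  unfolding integral_vec_def by (intro exI[of _ "\<lambda>_. 1"]) (simp add: int_laurent_1 block_vac_def)

lemma run_path_integral:
  assumes "layer_path [] E [] c"
  shows "\<exists>r\<in>int_laurent. run_path [] E block_vac [] = c * r"
proof -
  obtain b where b: "\<And>ks. b ks \<in> int_laurent"
     "\<And>ss. shape ss = [] \<Longrightarrow> run_path [] E block_vac ss = 1 * c * b (map cnt ss) * Mw ss"
    using integral_vec_run_path[OF assms integral_vec_block_vac] unfolding integral_vec_def by blast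
  have "run_path [] E block_vac [] = c * b []" using b(2)[of "[]"] by simp
  thus ?thesis using b(1) by blast
qed

lemma eqs_lower_blocks_block_vac: "eqs [] (lower_blocks [] block_vac) (\<lambda>_. 0)"
  by (simp add: eqs_def lower_blocks_def)

text \<open>The vacuum is annihilated by lowering, and every layer and every projection commutes
  with lowering.\<close>

lemma run_path_lower_blocks_block_vac:
  assumes "layer_path [] E ns c"
  shows "eqs ns (lower_blocks ns (run_path [] E block_vac)) (\<lambda>_. 0)"
proof -
  have "eqs ns (run_path [] E (lower_blocks [] block_vac)) (run_path [] E (\<lambda>_. 0))"
    by (rule run_path_cong[OF assms eqs_lower_blocks_block_vac])
  moreover have "run_path [] E (\<lambda>_. 0) = (\<lambda>_. 0)"
    using lfun_zero[OF lfun_run_path, of "[]" E] by (simp add: fun_eq_iff)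
  ultimately show ?thesis using run_path_lower_blocks[OF assms, of block_vac] unfolding eqs_def by metis
qed

lemma spin_zero_block_vac: "spin_zero [] block_vac"
  by (simp add: spin_zero_def block_vac_def)

text \<open>The two terms of the coproduct: lowering in the front block, with the weight factor of
  the rest, and lowering in the rest.\<close>

lemma lower_blocks_Cons:
  assumes "length x = n" "shape ts = ns" "\<And>z ts. length z = n \<Longrightarrow> shape ts = ns \<Longrightarrow> v (z # ts) = f (cnt z) ts * Uw z"
  shows "lower_blocks (n # ns) v (x # ts) =
    (q powi spin (concat ts) * (f (Suc (cnt x)) ts * qint (n - cnt x)) + lower (concat ts) (\<lambda>r. f (cnt x) (cut ns r))) * Uw x"
proof -
  have lt: "length (concat ts) = sum_list ns" using assms(2) by (auto simp: length_concat)
  have ct: "cut ns (concat ts) = ts" using assms(2) by (rule cut_concat)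
  have "lower x (\<lambda>z. fl (n # ns) v (z @ concat ts)) = lower x (\<lambda>z. f (cnt z) ts * Uw z)"
    by (rule lower_cong) (simp add: fl_def assms ct)
  also have "\<dots> = f (Suc (cnt x)) ts * (qint (n - cnt x) * Uw x)"
    using lower_weighted[of x "\<lambda>k. f k ts"] by (simp add: lower_Uw assms(1))
  finally have 1: "lower x (\<lambda>z. fl (n # ns) v (z @ concat ts)) = f (Suc (cnt x)) ts * (qint (n - cnt x) * Uw x)" .
  have "lower (concat ts) (\<lambda>r. fl (n # ns) v (x @ r)) = lower (concat ts) (\<lambda>r. Uw x * f (cnt x) (cut ns r))"
    by (rule lower_cong) (use assms lt in \<open>simp add: fl_def shape_cut\<close>)
  also have "\<dots> = Uw x * lower (concat ts) (\<lambda>r. f (cnt x) (cut ns r))" by (rule lower_scale)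
  finally have 2: "lower (concat ts) (\<lambda>r. fl (n # ns) v (x @ r)) = Uw x * lower (concat ts) (\<lambda>r. f (cnt x) (cut ns r))" .
  show ?thesis unfolding lower_blocks_def concat.simps lower_append 1 2 by (simp add: algebra_simps)
qed

text \<open>Invariance of the vector below the cut trades a lowering of the rest for a lowering of
  the front strand. Invariance of the functional \<open>A\<close> above the cut then becomes a
  relation between the contributions of neighbouring weights of that strand.\<close>

lemma front_divisible:
  assumes E: "layer_path [] E (n # ns) c" and E': "layer_path (n # ns) E' [] c'"
  shows "\<exists>r\<in>int_laurent. run_path (n # ns) E' (run_path [] E block_vac) [] = c * c' * qint (n + 1) * r"
proof -
  define v where "v = run_path [] E block_vac"
  define A where "A w = run_path (n # ns) E' w []" for w
  have A_lfun: "lfun A" using lfun_run_path by (simp add: A_def[abs_def])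
  have A_cong: "A u = A w" if "eqs (n # ns) u w" for u w
    using eqsD[OF run_path_cong[OF E' that]] by (simp add: A_def)
  have A_lower_blocks: "A (lower_blocks (n # ns) w) = 0" for w
    using eqsD[OF run_path_lower_blocks[OF E'], of "[]" w] by (simp add: A_def lower_blocks_def)
  have w0: "spin_zero (n # ns) v" using run_path_spin_zero[OF E spin_zero_block_vac] by (simp add: v_def)
  obtain b where b: "\<And>ks. b ks \<in> int_laurent" "\<And>ss. shape ss = n # ns \<Longrightarrow> v ss = c * b (map cnt ss) * Mw ss"
    using integral_vec_run_path[OF E integral_vec_block_vac] unfolding integral_vec_def v_def by auto
  define f where "f k ts = c * b (k # map cnt ts) * (qfact k * Mw ts)" for k ts
  have v: "v (z # ts) = f (cnt z) ts * Uw z" if "length z = n" "shape ts = ns" for z ts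
    using b(2)[of "z # ts"] that by (simp add: f_def mw_def)
  define vk where "vk k ss = (case ss of [] \<Rightarrow> 0 | x # ts \<Rightarrow> if cnt x = k then f k ts * Uw x else 0)" for k ss
  \<comment> \<open>Weight conservation: next to a strand with k signs + the rest has weight n - 2k,
    so the weight-dependent powers of q below become constants for each k.\<close>
  have vk_0: "vk k (x # ts) = 0" if "length x = n" "shape ts = ns" "spin (concat ts) \<noteq> int n - 2 * int k" for k x ts
  proof (cases "cnt x = k")
    case True
    have "spin (concat (x # ts)) \<noteq> 0" using that(3) True that(1) by (simp add: spin_def)
    hence "v (x # ts) = 0" using w0 that(1,2) unfolding spin_zero_def by simp
    thus ?thesis using v[OF that(1,2)] True by (simp add: vk_def)
  qed (simp add: vk_def)
  have fopf: "lower (concat ts) (\<lambda>r. f k (cut ns r)) = - (q powi spin (concat ts) * (f (Suc k) ts * qint (n - k)))"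
    if "k \<le> n" "shape ts = ns" for k ts
  proof -
    define x where "x = replicate k True @ replicate (n - k) False"
    have x: "length x = n" "cnt x = k" using that(1) by (simp_all add: x_def cnt_append)
    have "lower_blocks (n # ns) v (x # ts) = 0"
      using eqsD[OF run_path_lower_blocks_block_vac[OF E], of "x # ts"] x(1) that(2) by (simp add: v_def)
    moreover have "lower_blocks (n # ns) v (x # ts) = (q powi spin (concat ts) * (f (Suc (cnt x)) ts * qint (n - cnt x)) +
        lower (concat ts) (\<lambda>r. f (cnt x) (cut ns r))) * Uw x"
      by (rule lower_blocks_Cons[OF x(1) that(2) v])
    ultimately have "q powi spin (concat ts) * (f (Suc k) ts * qint (n - k)) + lower (concat ts) (\<lambda>r. f k (cut ns r)) = 0"
      by (simp add: x(2))
    thus ?thesis by (simp add: eq_neg_iff_add_eq_0 add.commute)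
  qed
  have step: "A (vk (Suc k)) = q ^ 2 * A (vk k)" if k: "k < n" for k
  proof -
    \<comment> \<open>\<open>Z\<close> combines the rest belonging to k with a strand of k+1 signs
      +, so its total weight is 2. Lowering the strand gives a multiple of \<open>vk k\<close>;
      lowering the rest gives, by \<open>fopf\<close>, a multiple of
      \<open>vk (Suc k)\<close>.\<close>
    define Z where "Z ss = (case ss of [] \<Rightarrow> 0 | x # ts \<Rightarrow> (if cnt x = Suc k then f k ts else 0) * Uw x)" for ss :: "bool list list"
    let ?a = "q powi (int n - 2 * int k) * qint (n - k)" and ?b = "q powi (int n - 2 * int (Suc k)) * qint (n - k)"
    have "eqs (n # ns) (lower_blocks (n # ns) Z) (\<lambda>ss. ?a * vk k ss + (- ?b) * vk (Suc k) ss)"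
    proof (rule eqsI)
      fix ss assume "shape ss = n # ns"
      then obtain x ts where ss: "ss = x # ts" "length x = n" "shape ts = ns"
        by (auto simp: map_eq_Cons_conv)
      define g where "g j ts = (if j = Suc k then f k ts else 0)" for j and ts :: "bool list list"
      have Z: "Z (z # ts) = g (cnt z) ts * Uw z" for z ts by (simp add: Z_def g_def)
      have "lower_blocks (n # ns) Z ss = (q powi spin (concat ts) * (g (Suc (cnt x)) ts * qint (n - cnt x)) +
          lower (concat ts) (\<lambda>r. g (cnt x) (cut ns r))) * Uw x"
        unfolding ss(1) by (rule lower_blocks_Cons[OF ss(2,3) Z])
      also have "\<dots> = q powi spin (concat ts) * qint (n - k) * vk k ss
          + - (q powi spin (concat ts) * qint (n - k)) * vk (Suc k) ss"
      proof -
        note fk = fopf[OF less_imp_le[OF k] ss(3)]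
        consider "cnt x = k" | "cnt x = Suc k" | "cnt x \<noteq> k" "cnt x \<noteq> Suc k" by blast
        thus ?thesis by cases (simp_all add: g_def vk_def ss(1) fk)
      qed
      also have "q powi spin (concat ts) * qint (n - k) * vk k ss = ?a * vk k ss"
      proof (cases "spin (concat ts) = int n - 2 * int k")
        case False
        show ?thesis unfolding ss(1) vk_0[OF ss(2,3) False] by simp
      qed (simp only:)
      also have "- (q powi spin (concat ts) * qint (n - k)) * vk (Suc k) ss = - ?b * vk (Suc k) ss"
      proof (cases "spin (concat ts) = int n - 2 * int (Suc k)")
        case False
        show ?thesis unfolding ss(1) vk_0[OF ss(2,3) False] by simp
      qed (simp only:)
      finally show "lower_blocks (n # ns) Z ss = ?a * vk k ss + - ?b * vk (Suc k) ss" .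
    qed
    from A_cong[OF this] have 1: "?a * A (vk k) + (- ?b) * A (vk (Suc k)) = 0"
      unfolding A_lower_blocks lfun_lin[OF A_lfun] by (rule sym)
    \<comment> \<open>The weight of the rest drops by 2 when k grows by 1; this is the ratio of the
      progression.\<close>
    have 2: "?a = q ^ 2 * ?b"
    proof -
      have e: "q powi (i + 2) = q ^ 2 * q powi i" for i :: int
        using power_int_add[of q i 2] by simp
      have "int n - 2 * int k = (int n - 2 * int (Suc k)) + 2" by simp
      thus ?thesis by (simp only: e mult.assoc)
    qed
    have "b * (z * x - y) = 0" if "a * x + - b * y = 0" "a = z * b" for a b x y z :: scalar
    proof -
      have "b * (z * x - y) = (z * b) * x + - b * y" by (simp add: algebra_simps)
      also have "\<dots> = 0" using that(1) unfolding that(2) .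
      finally show ?thesis .
    qed
    from this[OF 1 2] have 3: "?b * (q ^ 2 * A (vk k) - A (vk (Suc k))) = 0" .
    have "q powi (int n - 2 * int (Suc k)) \<noteq> 0" by (rule power_int_not_zero) (simp only: q_nonzero not_False_eq_True simp_thms)
    moreover have "qint (n - k) \<noteq> 0" by (rule qint_nonzero) (use k in simp)
    ultimately have "?b \<noteq> 0" by (rule no_zero_divisors)
    with 3 have "q ^ 2 * A (vk k) - A (vk (Suc k)) = 0" by (simp only: mult_eq_0_iff simp_thms)
    thus ?thesis by (rule eq_iff_diff_eq_0[THEN iffD2, symmetric])
  qed
  have A_vk: "A (vk k) = q ^ (2 * k) * A (vk 0)" if "k \<le> n" for k
    using that
  proof (induction k)
    case (Suc k)
    have "q ^ (2 * Suc k) = q ^ 2 * q ^ (2 * k)" by (simp add: power_add[symmetric])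
    moreover have "A (vk (Suc k)) = q ^ 2 * A (vk k)" "A (vk k) = q ^ (2 * k) * A (vk 0)"
      using step[of k] Suc by simp_all
    ultimately show ?case by (simp only: mult.assoc)
  qed simp
  have "eqs (n # ns) v (\<lambda>ss. \<Sum>k\<le>n. vk k ss)"
  proof (rule eqsI)
    fix ss assume "shape ss = n # ns"
    then obtain x ts where ss: "ss = x # ts" "length x = n" "shape ts = ns"
      by (auto simp: map_eq_Cons_conv)
    have "(\<Sum>k\<le>n. vk k ss) = (\<Sum>k\<le>n. if cnt x = k then f (cnt x) ts * Uw x else 0)"
      by (intro sum.cong refl) (auto simp: vk_def ss(1))
    also have "\<dots> = f (cnt x) ts * Uw x" using cnt_le_length[of x] ss(2) by simp
    finally show "v ss = (\<Sum>k\<le>n. vk k ss)" using v[OF ss(2,3)] ss(1) by simp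
  qed
  from A_cong[OF this] have "A v = (\<Sum>k\<le>n. A (vk k))" by (simp only: lfun_sums[OF A_lfun])
  also have "\<dots> = (\<Sum>k\<le>n. q ^ (2 * k)) * A (vk 0)"
    unfolding sum_distrib_right by (intro sum.cong refl A_vk) simp
  finally have tot: "A v = q ^ n * qint (n + 1) * A (vk 0)" by (simp only: q_geometric Suc_eq_plus1)
  \<comment> \<open>The part with k = 0 alone is integral with the same scale, so the first term of
    the progression is \<open>c * c'\<close> times an element of Z[q,1/q].\<close>
  have "integral_vec (n # ns) c (vk 0)"
    unfolding integral_vec_def
  proof (intro exI[of _ "\<lambda>ks. if hd ks = 0 then b ks else 0"] conjI allI impI)
    fix ks show "(if hd ks = 0 then b ks else 0) \<in> int_laurent" using b(1) int_laurent_0 by (cases "hd ks = 0") simp_all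
  next
    fix ss assume "shape ss = n # ns"
    then obtain x ts where ss: "ss = x # ts" "length x = n" "shape ts = ns"
      by (auto simp: map_eq_Cons_conv)
    show "vk 0 ss = c * (if hd (map cnt ss) = 0 then b (map cnt ss) else 0) * Mw ss"
      by (cases "cnt x = 0") (simp_all add: ss(1) vk_def f_def mw_def)
  qed
  then obtain b' :: "nat list \<Rightarrow> scalar" where b': "\<And>ks. b' ks \<in> int_laurent" "A (vk 0) = c * c' * b' []"
  proof -
    obtain b' where b': "\<And>ks. b' ks \<in> int_laurent"
      "\<And>ss. shape ss = [] \<Longrightarrow> run_path (n # ns) E' (vk 0) ss = c * c' * b' (map cnt ss) * Mw ss"
      using integral_vec_run_path[OF E' \<open>integral_vec (n # ns) c (vk 0)\<close>] unfolding integral_vec_def by blast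
    have "A (vk 0) = c * c' * b' []" using b'(2)[of "[]"] by (simp add: A_def)
    with b'(1) show ?thesis by (rule that)
  qed
  show ?thesis
  proof (rule bexI)
    show "run_path (n # ns) E' (run_path [] E block_vac) [] = c * c' * qint (n + 1) * (q powi int n * b' [])"
    proof -
      have "run_path (n # ns) E' (run_path [] E block_vac) [] = q ^ n * qint (n + 1) * (c * c' * b' [])"
        using tot unfolding b'(2) by (simp only: A_def v_def)
      thus ?thesis by (simp add: mult_ac)
    qed
    show "q powi int n * b' [] \<in> int_laurent" by (intro int_laurent_mult int_laurent_powi b'(1))
  qed
qed

theorem run_path_divisible:
  assumes E: "layer_path [] E (A @ n # B) c" and E': "layer_path (A @ n # B) E' [] c'"
  shows "\<exists>r\<in>int_laurent. run_path [] (E @ E') block_vac [] = c * c' * qint (n + 1) * r"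
proof -
  define v where "v = run_path [] E block_vac"
  have "integral_vec (A @ n # B) (1 * c) v" unfolding v_def by (rule integral_vec_run_path[OF E integral_vec_block_vac])
  from move_to_front[OF this] obtain F F' d d' where
    F: "layer_path (A @ n # B) F (n # A @ B) d" "layer_path (n # A @ B) F' (A @ n # B) d'" "d * d' = 1"
       "eqs (A @ n # B) (run_path (n # A @ B) F' (run_path (A @ n # B) F v)) v" by blast
  obtain r where r: "r \<in> int_laurent"
    "run_path (n # A @ B) (F' @ E') (run_path [] (E @ F) block_vac) [] = c * d * (d' * c') * qint (n + 1) * r"
    using front_divisible[OF layer_path_append[OF E F(1)] layer_path_append[OF F(2) E']] by blast
  have "run_path [] (E @ E') block_vac [] = run_path (A @ n # B) E' v []"
    by (simp only: run_path_append[OF E] v_def)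
  also have "\<dots> = run_path (A @ n # B) E' (run_path (n # A @ B) F' (run_path (A @ n # B) F v)) []"
    using eqsD[OF run_path_cong[OF E' F(4)], of "[]"] by simp
  also have "\<dots> = run_path (n # A @ B) (F' @ E') (run_path [] (E @ F) block_vac) []"
    by (simp only: run_path_append[OF E] run_path_append[OF F(2)] v_def)
  also have "\<dots> = (d * d') * (c * c' * qint (n + 1) * r)" unfolding r(2) by (simp only: mult_ac)
  finally show ?thesis using F(3) r(1) by auto
qed

section \<open>The cabled diagram\<close>

text \<open>The bracket sums over whole families of permutations, while a projection is expanded at
  one edge at a time. \<open>good\<close> stands for the linearity of the remaining operators, which
  has to survive each replacement.\<close>

lemma multilinear_expand:
  fixes F :: "('e \<Rightarrow> 'x) \<Rightarrow> scalar"
  assumes "finite E"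
    and lin: "\<And>e Z. e \<in> E \<Longrightarrow> good Z \<Longrightarrow> F (Z(e := S e)) = (\<Sum>\<sigma>\<in>P e. c e \<sigma> * F (Z(e := Y e \<sigma>)))"
    and S: "\<And>e Z. e \<in> E \<Longrightarrow> good Z \<Longrightarrow> good (Z(e := S e))"
    and Y: "\<And>e Z \<sigma>. e \<in> E \<Longrightarrow> good Z \<Longrightarrow> good (Z(e := Y e \<sigma>))"
    and Z: "good Z"
  shows "F (\<lambda>e. if e \<in> E then S e else Z e) =
    (\<Sum>\<sigma>\<in>Pi\<^sub>E E P. (\<Prod>e\<in>E. c e (\<sigma> e)) * F (\<lambda>e. if e \<in> E then Y e (\<sigma> e) else Z e))"
  using assms(1) lin S Y Z
proof (induction E arbitrary: Z)
  case empty
  show ?case by simp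
next
  case (insert a E)
  define W where "W \<sigma> = (\<lambda>e. if e \<in> E then Y e (\<sigma> e) else Z e)" for \<sigma>
  have good: "good (\<lambda>e. if e \<in> E' then Y e (\<sigma> e) else Z e)" if "finite E'" "E' \<subseteq> E" for \<sigma> E'
    using that
  proof (induction E')
    case (insert b E')
    have "(\<lambda>e. if e \<in> insert b E' then Y e (\<sigma> e) else Z e) =
        (\<lambda>e. if e \<in> E' then Y e (\<sigma> e) else Z e)(b := Y b (\<sigma> b))" by (auto simp: fun_eq_iff)
    moreover have "b \<in> insert a E" using insert.prems by blast
    ultimately show ?case using insert.IH insert.prems \<open>\<And>e Z \<sigma>. e \<in> insert a E \<Longrightarrow> good Z \<Longrightarrow> good (Z(e := Y e \<sigma>))\<close>
      by simp
  qed (use \<open>good Z\<close> in simp)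
  have W: "good (W \<sigma>)" for \<sigma> unfolding W_def by (rule good[OF insert.hyps(1) order_refl])
  have inj: "inj_on (\<lambda>(y, g). g(a := y)) (P a \<times> Pi\<^sub>E E P)" by (rule inj_combinator[OF insert.hyps(2)])
  have "F (\<lambda>e. if e \<in> insert a E then S e else Z e) = F (\<lambda>e. if e \<in> E then S e else (Z(a := S a)) e)"
    using insert.hyps(2) by (intro arg_cong[of _ _ F]) (auto simp: fun_eq_iff)
  also have "\<dots> = (\<Sum>\<sigma>\<in>Pi\<^sub>E E P. (\<Prod>e\<in>E. c e (\<sigma> e)) * F (\<lambda>e. if e \<in> E then Y e (\<sigma> e) else (Z(a := S a)) e))"
    by (rule insert.IH) (use insert.prems in auto)
  also have "\<dots> = (\<Sum>\<sigma>\<in>Pi\<^sub>E E P. \<Sum>\<tau>\<in>P a. (c a \<tau> * (\<Prod>e\<in>E. c e (\<sigma> e))) * F ((W \<sigma>)(a := Y a \<tau>)))"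
  proof (intro sum.cong refl)
    fix \<sigma> assume "\<sigma> \<in> Pi\<^sub>E E P"
    have "(\<lambda>e. if e \<in> E then Y e (\<sigma> e) else (Z(a := S a)) e) = (W \<sigma>)(a := S a)"
      using insert.hyps(2) by (auto simp: fun_eq_iff W_def)
    moreover have "F ((W \<sigma>)(a := S a)) = (\<Sum>\<tau>\<in>P a. c a \<tau> * F ((W \<sigma>)(a := Y a \<tau>)))"
      by (rule insert.prems(1)[OF _ W]) simp
    ultimately show "(\<Prod>e\<in>E. c e (\<sigma> e)) * F (\<lambda>e. if e \<in> E then Y e (\<sigma> e) else (Z(a := S a)) e) =
      (\<Sum>\<tau>\<in>P a. (c a \<tau> * (\<Prod>e\<in>E. c e (\<sigma> e))) * F ((W \<sigma>)(a := Y a \<tau>)))"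
      by (simp add: sum_distrib_left mult.assoc mult.left_commute)
  qed
  also have "\<dots> = (\<Sum>(\<tau>, \<sigma>)\<in>P a \<times> Pi\<^sub>E E P. (c a \<tau> * (\<Prod>e\<in>E. c e (\<sigma> e))) * F ((W \<sigma>)(a := Y a \<tau>)))"
    by (subst sum.swap) (rule sum.cartesian_product)
  also have "\<dots> = (\<Sum>(\<tau>, \<sigma>)\<in>P a \<times> Pi\<^sub>E E P. (\<Prod>e\<in>insert a E. c e ((\<sigma>(a := \<tau>)) e)) *
      F (\<lambda>e. if e \<in> insert a E then Y e ((\<sigma>(a := \<tau>)) e) else Z e))"
  proof (intro sum.cong refl, clarify)
    fix \<tau> \<sigma>
    have "(\<Prod>e\<in>insert a E. c e ((\<sigma>(a := \<tau>)) e)) = c a \<tau> * (\<Prod>e\<in>E. c e (\<sigma> e))"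
      unfolding prod.insert[OF insert.hyps] using insert.hyps(2)
      by (simp, intro disjI2 prod.cong) auto
    moreover have "(\<lambda>e. if e \<in> insert a E then Y e ((\<sigma>(a := \<tau>)) e) else Z e) = (W \<sigma>)(a := Y a \<tau>)"
      using insert.hyps(2) by (auto simp: fun_eq_iff W_def)
    ultimately show "(c a \<tau> * (\<Prod>e\<in>E. c e (\<sigma> e))) * F ((W \<sigma>)(a := Y a \<tau>)) =
       (\<Prod>e\<in>insert a E. c e ((\<sigma>(a := \<tau>)) e)) * F (\<lambda>e. if e \<in> insert a E then Y e ((\<sigma>(a := \<tau>)) e) else Z e)"
      by simp
  qed
  also have "\<dots> = (\<Sum>\<sigma>\<in>(\<lambda>(y, g). g(a := y)) ` (P a \<times> Pi\<^sub>E E P). (\<Prod>e\<in>insert a E. c e (\<sigma> e)) *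
      F (\<lambda>e. if e \<in> insert a E then Y e (\<sigma> e) else Z e))"
    unfolding sum.reindex[OF inj] comp_def case_prod_beta by (rule refl)
  finally show ?case by (simp only: PiE_insert_eq)
qed

lemma app_id: "app i (\<lambda>v. v) v = v"
  by (simp add: app_def fun_eq_iff)

text \<open>Only strand numbers and their splitting at each layer are recorded, which keeps the
  sliding arguments free of colors.\<close>

locale cabling =
  fixes D :: diagram and ns :: "nat \<Rightarrow> nat list" and As Cs Cs' Bs :: "nat \<Rightarrow> nat list"
  assumes below: "\<And>k. k < length D \<Longrightarrow> ns k = As k @ Cs k @ Bs k"
    and above: "\<And>k. k < length D \<Longrightarrow> ns (Suc k) = As k @ Cs' k @ Bs k"
    and loc: "\<And>k. k < length D \<Longrightarrow> loc (D ! k) (length (As k)) (Cs k) (Cs' k)"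
    and ends [simp]: "ns 0 = []" "ns (length D) = []"
    and len: "\<And>k. k \<le> length D \<Longrightarrow> length (ns k) = width D k"
begin

text \<open>The evaluation as one list of operations: the operators at the points of a level, then
  the layer above it. Every point occurs at most once, so splitting the list there shows linearity
  in its operator.\<close>

definition items :: "nat \<Rightarrow> (point + nat) list" where
  "items n = concat (map (\<lambda>k. map (\<lambda>i. Inl (k, i)) [0..<width D k] @ [Inr k]) [0..<n])"

fun item :: "(point \<Rightarrow> vec \<Rightarrow> vec) \<Rightarrow> point + nat \<Rightarrow> bvec \<Rightarrow> bvec" where
  "item X (Inl p) v = app (snd p) (X p) v"
| "item X (Inr k) v = lay (D ! k) (ns k) (ns (Suc k)) v"

definition run :: "(point \<Rightarrow> vec \<Rightarrow> vec) \<Rightarrow> nat \<Rightarrow> bvec" where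
  "run X n = fold (item X) (items n) block_vac"

definition lev :: "(point \<Rightarrow> vec \<Rightarrow> vec) \<Rightarrow> nat \<Rightarrow> bvec \<Rightarrow> bvec" where
  "lev X k v = fold (\<lambda>i. app i (X (k, i))) [0..<width D k] v"

lemma run_0 [simp]: "run X 0 = block_vac"
  by (simp add: run_def items_def)

lemma fold_item: "fold (item X) (map (\<lambda>i. Inl (k, i)) is) v = fold (\<lambda>i. app i (X (k, i))) is v"
  by (induction "is" arbitrary: v) simp_all

lemma run_Suc: "run X (Suc n) = lay (D ! n) (ns n) (ns (Suc n)) (lev X n (run X n))"
  by (simp add: run_def items_def lev_def fold_item)

lemma distinct_items: "distinct (items n)"
proof -
  have "set (items n) \<subseteq> {x. \<exists>k<n. x = Inr k \<or> (\<exists>i. x = Inl (k, i))}" for n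
    by (auto simp: items_def)
  hence *: "x \<in> set (items n) \<Longrightarrow> \<exists>k<n. x = Inr k \<or> (\<exists>i. x = Inl (k, i))" for x n by blast
  show ?thesis
  proof (induction n)
    case (Suc n)
    have "items (Suc n) = items n @ map (\<lambda>i. Inl (n, i)) [0..<width D n] @ [Inr n]"
      by (simp add: items_def)
    moreover have "set (items n) \<inter> set (map (\<lambda>i. Inl (n, i)) [0..<width D n] @ [Inr n]) = {}"
      using *[of _ n] by fastforce
    moreover have "distinct (map (\<lambda>i. Inl (n, i) :: point + nat) [0..<width D n] @ [Inr n])"
      by (auto simp: distinct_map inj_on_def)
    ultimately show ?case using Suc by simp
  qed (simp add: items_def)
qed

lemma lfun_item: "(\<And>p s. lfun (\<lambda>v. X p v s)) \<Longrightarrow> lfun (\<lambda>v. item X x v ss)"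
proof (cases x)
  case (Inl p)
  assume "\<And>p s. lfun (\<lambda>v. X p v s)"
  from lfun_comp[OF this lfun_point] show ?thesis by (simp add: Inl app_def)
next
  case (Inr k)
  have "lfun (\<lambda>v. lay (D ! k) (ns k) (ns (Suc k)) v ss)"
    unfolding lay_def by (rule lfun_comp[OF lfun_ev lfun_point])
  thus ?thesis by (simp add: Inr)
qed

lemma lfun_items: "(\<And>p s. lfun (\<lambda>v. X p v s)) \<Longrightarrow> lfun (\<lambda>v. fold (item X) xs v ss)"
proof (induction xs)
  case (Cons x xs)
  show ?case using lfun_comp[OF Cons.IH[OF Cons.prems] lfun_item[OF Cons.prems]] by simp
qed (simp add: lfun_point)

lemma fold_item_cong: "(\<And>p. Inl p \<in> set xs \<Longrightarrow> X p = Y p) \<Longrightarrow> fold (item X) xs v = fold (item Y) xs v"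
proof (induction xs arbitrary: v)
  case (Cons x xs)
  have "item X x v = item Y x v" using Cons.prems by (cases x) simp_all
  thus ?case using Cons by simp
qed simp

lemma run_cong:
  assumes "\<And>p. p \<in> points D \<Longrightarrow> X p = Y p" "n \<le> length D"
  shows "run X n = run Y n"
  unfolding run_def by (rule fold_item_cong, rule assms(1)) (use assms(2) in \<open>auto simp: items_def points_def\<close>)

lemma run_linear:
  assumes X: "\<And>p s. lfun (\<lambda>v. X p v s)" and p: "p \<in> points D" "fst p < n"
  shows "run (X(p := (\<lambda>v s. \<Sum>\<sigma>\<in>P. c \<sigma> * Y \<sigma> v s))) n ss = (\<Sum>\<sigma>\<in>P. c \<sigma> * run (X(p := Y \<sigma>)) n ss)"
proof -
  have "fst p \<in> {0..<n}" "snd p \<in> {0..<width D (fst p)}" using p by (auto simp: points_def)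
  hence "Inl p \<in> set (map (\<lambda>i. Inl (fst p, i)) [0..<width D (fst p)] @ [Inr (fst p)])"
    by (cases p) simp
  hence "Inl p \<in> set (items n)" unfolding items_def set_concat set_map
    by (rule UN_I[rotated]) (use p in simp)
  then obtain L L' where L: "items n = L @ Inl p # L'" using split_list by metis
  have nin: "Inl p \<notin> set L" "Inl p \<notin> set L'" using distinct_items[of n] unfolding L by auto
  define w where "w = fold (item X) L block_vac"
  have *: "run (X(p := Z)) n ss = fold (item X) L' (app (snd p) Z w) ss" for Z
  proof -
    have "fold (item (X(p := Z))) L block_vac = w" "\<And>u. fold (item (X(p := Z))) L' u = fold (item X) L' u"
      unfolding w_def using nin by (auto intro!: fold_item_cong)
    thus ?thesis unfolding run_def L by simp
  qed
  note lf = lfun_items[of X L' ss, OF X]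
  have "app (snd p) (\<lambda>v s. \<Sum>\<sigma>\<in>P. c \<sigma> * Y \<sigma> v s) w = (\<lambda>ss. \<Sum>\<sigma>\<in>P. c \<sigma> * app (snd p) (Y \<sigma>) w ss)"
    by (simp add: app_def fun_eq_iff)
  thus ?thesis unfolding * by (simp only: lfun_sums[OF lf] lfun_scaled[OF lf])
qed

subsection \<open>The cabled diagram as an operator on block vectors\<close>

definition braids :: "(point \<Rightarrow> nat list) \<Rightarrow> nat \<Rightarrow> diagram" where
  "braids w k = concat (map (\<lambda>i. map (\<lambda>x. Pos (sum_list (take i (ns k)) + x)) (w (k, i))) [0..<width D k])"

definition cab :: "(point \<Rightarrow> nat list) \<Rightarrow> nat \<Rightarrow> diagram" where
  "cab w n = concat (map (\<lambda>k. braids w k @ cable_layer ((!) (ns k)) ((!) (ns (Suc k))) (D ! k)) [0..<n])"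

lemma map_Pos_sh: "map (\<lambda>x. Pos (k + x)) w = map (sh k) (map Pos w)"
  by simp

lemma ev_braid:
  assumes "bword (m ! i) w" "i < length m" "shape ss = m"
  shows "wfd (sum_list m) (map (\<lambda>x. Pos (sum_list (take i m) + x)) w) (sum_list m)"
    and "ev (map (\<lambda>x. Pos (sum_list (take i m) + x)) w) u (concat ss) =
      app i (ev (map Pos w)) (\<lambda>ss. u (concat ss)) ss"
proof -
  define A B n where "A = take i m" and "B = drop (Suc i) m" and "n = m ! i"
  have m: "m = A @ [n] @ B" using id_take_nth_drop[OF assms(2)] by (simp add: A_def B_def n_def)
  have w: "bword n w" using assms(1) by (simp add: n_def)
  show "wfd (sum_list m) (map (\<lambda>x. Pos (sum_list (take i m) + x)) w) (sum_list m)"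
    unfolding map_Pos_sh A_def[symmetric]
    using wfd_sh[OF wfd_Pos[OF w], of "sum_list A" "sum_list B"]
    by (simp add: m add.assoc xword_vertex_free del: map_map)
  obtain SA S SB where ss: "ss = SA @ S @ SB" "shape SA = A" "shape S = [n]" "shape SB = B"
    using assms(3) unfolding m by (rule shape3)
  obtain x where x: "S = [x]" "length x = n" using ss(3) by (auto simp: map_eq_Cons_conv)
  have lens: "length SA = i" "length (concat SA) = sum_list A"
    using ss(2) assms(2) by (auto simp: length_concat A_def dest: arg_cong[of _ _ length])
  have "ev (map (sh (sum_list A)) (map Pos w)) u (concat SA @ x @ concat SB) =
      ev (map Pos w) (\<lambda>z. u (concat SA @ z @ concat SB)) x"
    by (rule ev_local) (use wfd_Pos[OF w] x lens in \<open>simp_all add: xword_vertex_free\<close>)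
  thus "ev (map (\<lambda>x. Pos (sum_list (take i m) + x)) w) u (concat ss) =
      app i (ev (map Pos w)) (\<lambda>ss. u (concat ss)) ss"
    unfolding map_Pos_sh A_def[symmetric] ss(1) x(1) by (simp add: app_pat[OF lens(1)] del: map_map)
qed

lemma ev_braids:
  assumes w: "\<And>i. i < length m \<Longrightarrow> bword (m ! i) (w i)" and js: "set js \<subseteq> {..<length m}"
    and uv: "\<And>ss. shape ss = m \<Longrightarrow> u (concat ss) = v ss"
  shows "wfd (sum_list m) (concat (map (\<lambda>i. map (\<lambda>x. Pos (sum_list (take i m) + x)) (w i)) js)) (sum_list m)"
    and "shape ss = m \<Longrightarrow> ev (concat (map (\<lambda>i. map (\<lambda>x. Pos (sum_list (take i m) + x)) (w i)) js)) u (concat ss) =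
      fold (\<lambda>i. app i (ev (map Pos (w i)))) js v ss"
proof -
  let ?B = "\<lambda>i. map (\<lambda>x. Pos (sum_list (take i m) + x)) (w i)"
  have sh: "\<exists>ss. shape ss = m" by (rule exI[of _ "map (\<lambda>n. replicate n True) m"]) (simp add: comp_def)
  then obtain s0 where s0: "shape s0 = m" by blast
  show "wfd (sum_list m) (concat (map ?B js)) (sum_list m)"
    using js
  proof (induction js)
    case (Cons i js)
    have i: "i < length m" using Cons.prems by simp
    show ?case using ev_braid(1)[OF w[OF i] i s0] Cons by (auto simp: wfd_append)
  qed simp
  show "ev (concat (map ?B js)) u (concat ss) = fold (\<lambda>i. app i (ev (map Pos (w i)))) js v ss" if "shape ss = m"
    using js uv that
  proof (induction js arbitrary: u v ss)
    case (Cons i js)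
    have i: "i < length m" using Cons.prems by simp
    have "ev (concat (map ?B (i # js))) u (concat ss) = ev (concat (map ?B js)) (ev (?B i) u) (concat ss)"
      by (simp add: ev_append)
    also have "\<dots> = fold (\<lambda>i. app i (ev (map Pos (w i)))) js (app i (ev (map Pos (w i))) v) ss"
    proof (rule Cons.IH)
      fix ss assume ss: "shape ss = m"
      have "ev (?B i) u (concat ss) = app i (ev (map Pos (w i))) (\<lambda>ss. u (concat ss)) ss"
        by (rule ev_braid(2)[OF w[OF i] i ss])
      also have "\<dots> = app i (ev (map Pos (w i))) v ss"
        unfolding app_def
      proof (rule ev_x_cong[of _ "m ! i"])
        fix z :: "bool list" assume z: "length z = m ! i"
        have "shape (ss[i := z]) = m" using ss z by (metis list_update_id map_update)
        thus "u (concat (ss[i := z])) = v (ss[i := z])" by (rule Cons.prems(2))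
      qed (use ss i in auto)
      finally show "ev (?B i) u (concat ss) = app i (ev (map Pos (w i))) v ss" .
    qed (use Cons.prems in auto)
    finally show ?case by simp
  qed simp
qed

lemma cab_run:
  assumes w: "\<And>k i. k < length D \<Longrightarrow> i < width D k \<Longrightarrow> bword (ns k ! i) (w (k, i))" and "n \<le> length D"
  shows "wfd 0 (cab w n) (sum_list (ns n)) \<and> vertex_free (cab w n) \<and>
    (\<forall>ss. shape ss = ns n \<longrightarrow> ev (cab w n) vac (concat ss) = run (\<lambda>p. ev (map Pos (w p))) n ss)"
  using assms(2)
proof (induction n)
  case 0
  show ?case by (simp add: cab_def block_vac_def vac_def)
next
  case (Suc n)
  hence n: "n < length D" "length (ns n) = width D n" using len[of n] by auto
  let ?X = "\<lambda>p. ev (map Pos (w p))"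
  have IH: "wfd 0 (cab w n) (sum_list (ns n))" "vertex_free (cab w n)"
     "\<And>ss. shape ss = ns n \<Longrightarrow> ev (cab w n) vac (concat ss) = run ?X n ss"
    using Suc by auto
  let ?cl = "cable_layer ((!) (ns n)) ((!) (ns (Suc n))) (D ! n)"
  have cl: "wfd (sum_list (ns n)) ?cl (sum_list (ns (Suc n)))" "vertex_free ?cl"
    using wfd_sh[OF wfd_core[OF loc[OF n(1)]], of "sum_list (As n)" "sum_list (Bs n)"] wfd_core(2)[OF loc[OF n(1)]]
    unfolding below[OF n(1)] above[OF n(1)] cable_layer_core[OF loc[OF n(1)] refl] by (simp_all add: add.assoc)
  have wn: "\<And>i. i < length (ns n) \<Longrightarrow> bword (ns n ! i) (w (n, i))" using w n by simp
  have sub: "set [0..<width D n] \<subseteq> {..<length (ns n)}" using n by auto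
  have br: "wfd (sum_list (ns n)) (braids w n) (sum_list (ns n))"
    "\<And>ss. shape ss = ns n \<Longrightarrow> ev (braids w n) (ev (cab w n) vac) (concat ss) = lev ?X n (run ?X n) ss"
    unfolding braids_def lev_def
    using ev_braids[where w="\<lambda>i. w (n, i)" and m="ns n" and js="[0..<width D n]"
      and u="ev (cab w n) vac" and v="run ?X n", OF wn sub IH(3)] by simp_all
  have lb: "vertex_free (braids w n)" by (auto simp: braids_def vertex_free_def)
  have cab: "cab w (Suc n) = cab w n @ braids w n @ ?cl" by (simp add: cab_def)
  have "ev (cab w (Suc n)) vac (concat ss) = run ?X (Suc n) ss" if ss: "shape ss = ns (Suc n)" for ss
  proof -
    have "ev (cab w (Suc n)) vac (concat ss) = ev ?cl (ev (braids w n) (ev (cab w n) vac)) (concat ss)"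
      by (simp add: cab ev_append)
    also have "\<dots> = ev ?cl (\<lambda>s. lev ?X n (run ?X n) (cut (ns n) s)) (concat ss)"
    proof (rule ev_cong[OF cl])
      fix s :: "bool list" assume s: "length s = sum_list (ns n)"
      show "ev (braids w n) (ev (cab w n) vac) s = lev ?X n (run ?X n) (cut (ns n) s)"
        using br(2)[OF shape_cut[OF s]] by (simp add: concat_cut[OF s])
    qed (rule length_concat_shape[OF ss])
    finally show ?thesis by (simp add: run_Suc lay_def)
  qed
  thus ?case using IH(1,2) br(1) cl lb by (auto simp: cab wfd_append)
qed

subsection \<open>Moving the Jones--Wenzl elements along the edges\<close>

definition XJ :: "point set \<Rightarrow> point \<Rightarrow> vec \<Rightarrow> vec" where
  "XJ S p = (if p \<in> S then JW (ns (fst p) ! snd p) else (\<lambda>v. v))"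

definition jst :: "point set \<Rightarrow> nat \<Rightarrow> bvec \<Rightarrow> bvec" where
  "jst S k v = jlist (filter (\<lambda>i. (k, i) \<in> S) [0..<width D k]) (ns k) v"

lemma lev_XJ: "lev (XJ S) k v = jst S k v"
proof -
  have "fold (\<lambda>i. app i (XJ S (k, i))) is v = jlist (filter (\<lambda>i. (k, i) \<in> S) is) (ns k) v" for "is"
    by (induction "is" arbitrary: v) (simp_all add: XJ_def app_id)
  thus ?thesis by (simp add: lev_def jst_def)
qed

abbreviation st :: "point set \<Rightarrow> nat \<Rightarrow> bvec" where "st S \<equiv> run (XJ S)"

abbreviation ly :: "nat \<Rightarrow> bvec \<Rightarrow> bvec" where "ly k \<equiv> lay (D ! k) (ns k) (ns (Suc k))"

lemma st_Suc: "st S (Suc n) = ly n (jst S n (st S n))"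
  by (simp add: run_Suc lev_XJ)

abbreviation aJ :: "nat \<Rightarrow> nat \<Rightarrow> bvec \<Rightarrow> bvec" where "aJ k i \<equiv> app i (JW (ns k ! i))"

lemma ly_cong: "k < length D \<Longrightarrow> eqs (ns k) v w \<Longrightarrow> eqs (ns (Suc k)) (ly k v) (ly k w)"
  using lay_cong[OF loc] by (simp only: below above)

lemma jst_cong: "k \<le> length D \<Longrightarrow> eqs (ns k) v w \<Longrightarrow> eqs (ns k) (jst S k v) (jst S k w)"
  unfolding jst_def by (rule jlist_cong) (auto simp: len)

lemma aJ_jst: "aJ k i (jst S k v) = jst S k (aJ k i v)"
  unfolding jst_def by (rule app_jlist)

lemma jst_insert:
  assumes "(k, i) \<notin> S" "i < width D k"
  shows "jst (insert (k, i) S) k v = jst S k (aJ k i v)"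
proof -
  have "mset (filter (\<lambda>j. (k, j) \<in> insert (k, i) S) [0..<width D k]) =
      mset (i # filter (\<lambda>j. (k, j) \<in> S) [0..<width D k])"
    by (rule set_eq_iff_mset_eq_distinct[THEN iffD1]) (use assms in auto)
  from jlist_perm[OF this, of "ns k" v] show ?thesis by (simp add: jst_def)
qed

lemma jst_other: "fst p \<noteq> k \<Longrightarrow> jst (insert p S) k v = jst S k v"
  unfolding jst_def by (rule arg_cong[of _ _ "\<lambda>is. jlist is (ns k) v"], rule filter_cong) auto

lemma jst_absorb:
  assumes "(k, i) \<in> S" "i < width D k" "k \<le> length D"
  shows "eqs (ns k) (jst S k (aJ k i v)) (jst S k v)"
proof -
  have S: "S = insert (k, i) (S - {(k, i)})" using assms(1) by blast
  have e: "jst S k u = jst (S - {(k, i)}) k (aJ k i u)" for u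
    by (subst S, rule jst_insert[OF _ assms(2)]) simp
  have "eqs (ns k) (aJ k i (aJ k i v)) (aJ k i v)"
  proof (rule eqsI)
    fix ss assume "shape ss = ns k"
    hence "length ss = width D k" "\<And>j. j < width D k \<Longrightarrow> length (ss ! j) = ns k ! j"
      using len[OF assms(3)] by (metis length_map, metis length_map nth_map)
    thus "aJ k i (aJ k i v) ss = aJ k i v ss"
      using assms(2) by (intro app_JW_idem) auto
  qed
  thus ?thesis unfolding e by (rule jst_cong[OF assms(3)])
qed

section \<open>Adding a projection at the other end of an arc\<close>

lemma st_insert_below: "k \<le> fst p \<Longrightarrow> st (insert p S) k = st S k"
  by (induction k) (simp_all add: st_Suc jst_other)

lemma st_above:
  assumes "k \<le> length D" "\<And>j v. k < j \<Longrightarrow> jst S j v = jst T j v" "eqs (ns k) (jst S k (st S k)) (jst T k (st T k))"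
  shows "eqs [] (st S (length D)) (st T (length D))"
proof -
  have "eqs (ns m) (jst S m (st S m)) (jst T m (st T m))" if "k \<le> m" "m \<le> length D" for m
    using that
  proof (induction m rule: dec_induct)
    case (step m)
    have m: "m < length D" "k < Suc m" using step.hyps step.prems by auto
    have "eqs (ns (Suc m)) (jst T (Suc m) (st S (Suc m))) (jst T (Suc m) (st T (Suc m)))"
      unfolding st_Suc by (rule jst_cong[OF _ ly_cong[OF m(1) step.IH]]) (use m in auto)
    thus ?case by (simp only: assms(2)[OF m(2)])
  qed (rule assms(3))
  from this[OF assms(1) order_refl] show ?thesis
    using len[of "length D"] by (simp add: jst_def)
qed

text \<open>An arc runs through its layer, along a cup or along a cap. The three predicates say that
  a projection may be moved between its ends in the respective case.\<close>

definition through :: "nat \<Rightarrow> nat \<Rightarrow> nat \<Rightarrow> bool" where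
  "through k j j' \<longleftrightarrow> (\<forall>v. eqs (ns (Suc k)) (ly k (aJ k j v)) (aJ (Suc k) j' (ly k v)))"

definition bottom :: "nat \<Rightarrow> nat \<Rightarrow> nat \<Rightarrow> bool" where
  "bottom k j j' \<longleftrightarrow> (\<forall>v. eqs (ns (Suc k)) (aJ (Suc k) j (ly k v)) (aJ (Suc k) j' (ly k v)))"

definition top :: "nat \<Rightarrow> nat \<Rightarrow> nat \<Rightarrow> bool" where
  "top k j j' \<longleftrightarrow> (\<forall>v. eqs (ns (Suc k)) (ly k (aJ k j v)) (ly k (aJ k j' v)))"

text \<open>A projection is doubled by idempotence: one copy stays at (k, j), the other passes
  through the layer. Projections thus spread without disappearing from where they were.\<close>

lemma slide_up:
  assumes "through k j j'" "(k, j) \<in> S" "(Suc k, j') \<notin> S" "k < length D" "j < width D k" "j' < width D (Suc k)"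
  shows "eqs [] (st S (length D)) (st (insert (Suc k, j') S) (length D))"
proof (rule st_above[of "Suc k"])
  let ?T = "insert (Suc k, j') S" and ?u = "jst S k (st S k)"
  have "eqs (ns k) (aJ k j ?u) ?u"
    unfolding aJ_jst by (rule jst_absorb) (use assms in auto)
  hence "eqs (ns (Suc k)) (ly k (aJ k j ?u)) (ly k ?u)" by (rule ly_cong[OF assms(4)])
  hence "eqs (ns (Suc k)) (ly k ?u) (aJ (Suc k) j' (ly k ?u))"
    using assms(1) unfolding through_def by (blast intro: eqs_sym eqs_trans)
  hence "eqs (ns (Suc k)) (jst S (Suc k) (st S (Suc k))) (jst S (Suc k) (aJ (Suc k) j' (st S (Suc k))))"
    unfolding st_Suc by (rule jst_cong[rotated]) (use assms in simp)
  thus "eqs (ns (Suc k)) (jst S (Suc k) (st S (Suc k))) (jst ?T (Suc k) (st ?T (Suc k)))"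
    by (simp only: jst_insert[OF assms(3,6)] st_insert_below[of "Suc k" "(Suc k, j')"] fst_conv order_refl)
  show "jst S i v = jst ?T i v" if "Suc k < i" for i v
    using that jst_other[of "(Suc k, j')" i S v] by simp
qed (use assms in simp)

lemma slide_down:
  assumes "through k j j'" "(Suc k, j') \<in> S" "(k, j) \<notin> S" "k < length D" "j < width D k" "j' < width D (Suc k)"
  shows "eqs [] (st S (length D)) (st (insert (k, j) S) (length D))"
proof (rule st_above[of "Suc k"])
  let ?T = "insert (k, j) S" and ?u = "jst S k (st S k)"
  have T: "st ?T (Suc k) = ly k (aJ k j ?u)"
    by (simp only: st_Suc jst_insert[OF assms(3,5)] st_insert_below[of k "(k, j)"] fst_conv order_refl aJ_jst)
  have "eqs (ns (Suc k)) (jst S (Suc k) (ly k (aJ k j ?u))) (jst S (Suc k) (aJ (Suc k) j' (ly k ?u)))"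
    using assms(1,4) unfolding through_def by (intro jst_cong) auto
  also have "eqs (ns (Suc k)) \<dots> (jst S (Suc k) (ly k ?u))"
    by (rule jst_absorb) (use assms in auto)
  finally show "eqs (ns (Suc k)) (jst S (Suc k) (st S (Suc k))) (jst ?T (Suc k) (st ?T (Suc k)))"
    unfolding T jst_other[of "(k, j)" "Suc k", simplified] st_Suc[of S] by (rule eqs_sym)
  show "jst S i v = jst ?T i v" if "Suc k < i" for i v
    using that jst_other[of "(k, j)" i S v] by simp
qed (use assms in simp)

lemma slide_bottom:
  assumes "bottom k j j'" "(Suc k, j) \<in> S" "(Suc k, j') \<notin> S" "k < length D" "j < width D (Suc k)" "j' < width D (Suc k)"
  shows "eqs [] (st S (length D)) (st (insert (Suc k, j') S) (length D))"
proof (rule st_above[of "Suc k"])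
  let ?T = "insert (Suc k, j') S" and ?u = "jst S k (st S k)"
  have "eqs (ns (Suc k)) (jst S (Suc k) (aJ (Suc k) j (ly k ?u))) (jst S (Suc k) (ly k ?u))"
    by (rule jst_absorb) (use assms in auto)
  moreover have "eqs (ns (Suc k)) (jst S (Suc k) (aJ (Suc k) j (ly k ?u))) (jst S (Suc k) (aJ (Suc k) j' (ly k ?u)))"
    using assms(1,4) unfolding bottom_def by (intro jst_cong) auto
  ultimately have "eqs (ns (Suc k)) (jst S (Suc k) (ly k ?u)) (jst S (Suc k) (aJ (Suc k) j' (ly k ?u)))"
    using eqs_sym eqs_trans by blast
  thus "eqs (ns (Suc k)) (jst S (Suc k) (st S (Suc k))) (jst ?T (Suc k) (st ?T (Suc k)))"
    by (simp only: jst_insert[OF assms(3,6)] st_insert_below[of "Suc k" "(Suc k, j')"] fst_conv order_refl st_Suc[of S])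
  show "jst S i v = jst ?T i v" if "Suc k < i" for i v
    using that jst_other[of "(Suc k, j')" i S v] by simp
qed (use assms in simp)

lemma slide_top:
  assumes "top k j j'" "(k, j) \<in> S" "(k, j') \<notin> S" "k < length D" "j < width D k" "j' < width D k"
  shows "eqs [] (st S (length D)) (st (insert (k, j') S) (length D))"
proof (rule st_above[of "Suc k"])
  let ?T = "insert (k, j') S" and ?u = "jst S k (st S k)"
  have T: "st ?T (Suc k) = ly k (aJ k j' ?u)"
    by (simp only: st_Suc jst_insert[OF assms(3,6)] st_insert_below[of k "(k, j')"] fst_conv order_refl aJ_jst)
  have "eqs (ns k) (aJ k j ?u) ?u"
    unfolding aJ_jst by (rule jst_absorb) (use assms in auto)
  hence "eqs (ns (Suc k)) (ly k (aJ k j ?u)) (ly k ?u)" by (rule ly_cong[OF assms(4)])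
  hence "eqs (ns (Suc k)) (st S (Suc k)) (st ?T (Suc k))"
    using assms(1) unfolding top_def T st_Suc[of S] by (blast intro: eqs_sym eqs_trans)
  thus "eqs (ns (Suc k)) (jst S (Suc k) (st S (Suc k))) (jst ?T (Suc k) (st ?T (Suc k)))"
    unfolding jst_other[of "(k, j')" "Suc k", simplified] by (rule jst_cong[rotated]) (use assms in simp)
  show "jst S i v = jst ?T i v" if "Suc k < i" for i v
    using that jst_other[of "(k, j')" i S v] by simp
qed (use assms in simp)

lemma through_before:
  assumes "k < length D" "j < length (As k)"
  shows "through k j j"
  using slide_before[OF loc[OF assms(1)] refl assms(2), of _ "Bs k"] assms
  by (simp add: through_def eqs_def below above nth_append)

lemma through_after:
  assumes "k < length D" "j = length (As k) + length (Cs k) + i" "j' = length (As k) + length (Cs' k) + i" "i < length (Bs k)"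
  shows "through k j j'"
  using slide_after[OF loc[OF assms(1)] refl assms(4)] assms
  by (simp add: through_def eqs_def below above nth_append)

lemma crossing_arc:
  assumes k: "k < length D" and X: "crossing X" "D ! k = X (length (As k))" "Cs k = [n, m]" "Cs' k = [m, n]"
    and arc: "(x, y) \<in> arcs (D ! k) k" and px: "snd x < width D (fst x)" "snd y < width D (fst y)"
  shows "\<exists>j j'. x = (k, j) \<and> y = (Suc k, j') \<and> through k j j'"
proof -
  let ?i = "length (As k)"
  have w: "width D k = length (As k @ [n, m] @ Bs k)"
    using len[of k] k below[OF k] X by simp
  obtain j where j: "x = (k, j)" "y = (Suc k, transpose ?i (Suc ?i) j)"
    using X(1) arc unfolding X(2) by auto
  consider "j < ?i" | "j = ?i" | "j = Suc ?i" | "j > Suc ?i" by linarith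
  hence "through k j (transpose ?i (Suc ?i) j)"
  proof cases
    case 1
    thus ?thesis using through_before[OF k 1] by (simp add: transpose_apply_other)
  next
    case 2
    have "through k ?i (Suc ?i)"
      using slide_crossing(1)[OF X(1) refl, of _ "As k" m n "Bs k"]
      by (simp add: through_def eqs_def below[OF k] above[OF k] X nth_append)
    thus ?thesis by (simp add: 2)
  next
    case 3
    have "through k (Suc ?i) ?i"
      using slide_crossing(2)[OF X(1) refl, of _ "As k" m n "Bs k"]
      by (simp add: through_def eqs_def below[OF k] above[OF k] X nth_append)
    thus ?thesis by (simp add: 3)
  next
    case 4
    have "through k j j"
      by (rule through_after[OF k, of _ "j - ?i - 2"]) (use 4 px(1) w j(1) X in auto)
    thus ?thesis using 4 by (simp add: transpose_apply_other)
  qed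
  thus ?thesis using j by blast
qed

lemma arc_slide:
  assumes k: "k < length D" and arc: "(x, y) \<in> arcs (D ! k) k" and pts: "x \<in> points D" "y \<in> points D"
  obtains j j' where "x = (k, j)" "y = (Suc k, j')" "through k j j'"
  | j j' where "x = (Suc k, j)" "y = (Suc k, j')" "bottom k j j'"
  | j j' where "x = (k, j)" "y = (k, j')" "top k j j'"
proof -
  note loc = loc[OF k]
  have w: "width D k = length (As k @ Cs k @ Bs k)" "width D (Suc k) = length (As k @ Cs' k @ Bs k)"
    using len[of k] len[of "Suc k"] k below[OF k] above[OF k] by simp_all
  have px: "snd x < width D (fst x)" "snd y < width D (fst y)" using pts by (auto simp: points_def)
  have "(\<exists>j j'. x = (k, j) \<and> y = (Suc k, j') \<and> through k j j') \<or>
    (\<exists>j j'. x = (Suc k, j) \<and> y = (Suc k, j') \<and> bottom k j j') \<or>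
    (\<exists>j j'. x = (k, j) \<and> y = (k, j') \<and> top k j j')"
    using loc
  proof cases
    case (1 n)
    note w' = w[unfolded 1]
    consider j where "x = (k, j)" "y = (Suc k, j)" "j < length (As k)"
      | j where "x = (k, j)" "y = (Suc k, j + 2)" "length (As k) \<le> j"
      | "x = (Suc k, length (As k))" "y = (Suc k, Suc (length (As k)))"
      using arc unfolding 1 by auto
    thus ?thesis
    proof cases
      case a: (1 j)
      thus ?thesis using through_before[OF k a(3)] by blast
    next
      case a: (2 j)
      have "through k j (j + 2)"
        by (rule through_after[OF k, of _ "j - length (As k)"]) (use a px w' in \<open>auto simp: 1\<close>)
      thus ?thesis using a by blast
    next
      case a: 3
      have "bottom k (length (As k)) (Suc (length (As k)))"
        using slide_cup[OF refl, of _ "As k" n "Bs k"]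
        by (simp add: bottom_def eqs_def below[OF k] above[OF k] 1 nth_append)
      thus ?thesis using a by blast
    qed
  next
    case (2 n)
    note w' = w[unfolded 2]
    consider j where "x = (k, j)" "y = (Suc k, j)" "j < length (As k)"
      | j where "x = (k, j + 2)" "y = (Suc k, j)" "length (As k) \<le> j"
      | "x = (k, length (As k))" "y = (k, Suc (length (As k)))"
      using arc unfolding 2 by auto
    thus ?thesis
    proof cases
      case a: (1 j)
      thus ?thesis using through_before[OF k a(3)] by blast
    next
      case a: (2 j)
      have "through k (j + 2) j"
        by (rule through_after[OF k, of _ "j - length (As k)"]) (use a px w' in \<open>auto simp: 2\<close>)
      thus ?thesis using a by blast
    next
      case a: 3
      have "top k (length (As k)) (Suc (length (As k)))"
        using slide_cap[OF refl, of _ "As k" "Bs k" n]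
        by (simp add: top_def eqs_def below[OF k] above[OF k] 2 nth_append)
      thus ?thesis using a by blast
    qed
  next
    case (5 a s b)
    note w' = w[unfolded 5]
    consider j where "x = (k, j)" "y = (Suc k, j)" "j < length (As k)"
      | j where "x = (k, Suc j)" "y = (Suc k, j)" "length (As k) < j"
      using arc unfolding 5 by auto
    thus ?thesis
    proof cases
      case a: (1 j)
      thus ?thesis using through_before[OF k a(3)] by blast
    next
      case a: (2 j)
      have "through k (Suc j) j"
        by (rule through_after[OF k, of _ "j - length (As k) - 1"]) (use a px w' in \<open>auto simp: 5\<close>)
      thus ?thesis using a by blast
    qed
  next
    case (6 a b s)
    note w' = w[unfolded 6]
    consider j where "x = (k, j)" "y = (Suc k, j)" "j < length (As k)"
      | j where "x = (k, j)" "y = (Suc k, Suc j)" "length (As k) < j"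
      using arc unfolding 6 by auto
    thus ?thesis
    proof cases
      case a: (1 j)
      thus ?thesis using through_before[OF k a(3)] by blast
    next
      case a: (2 j)
      have "through k j (Suc j)"
        by (rule through_after[OF k, of _ "j - length (As k) - 1"]) (use a px w' in \<open>auto simp: 6\<close>)
      thus ?thesis using a by blast
    qed
  next
    case (3 n m)
    show ?thesis using crossing_arc[OF k disjI1[OF refl] 3 arc px] by blast
  next
    case (4 n m)
    show ?thesis using crossing_arc[OF k disjI2[OF refl] 4 arc px] by blast
  qed
  thus thesis using that by blast
qed

lemma points_width: "(k, i) \<in> points D \<longleftrightarrow> k \<le> length D \<and> i < width D k"
  by (simp add: points_def)

lemma width_last: "width D (length D) = 0" "width D 0 = 0"
  using len[of "length D"] len[of 0] by simp_all

lemma st_insert_linked: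
  assumes "(x, y) \<in> linked D \<or> (y, x) \<in> linked D" "x \<in> S"
  shows "eqs [] (st S (length D)) (st (insert y S) (length D))"
proof (cases "y \<in> S")
  case False
  obtain k a b where k: "k < length D" "(a, b) \<in> arcs (D ! k) k" "a \<in> points D" "b \<in> points D"
    "(a = x \<and> b = y) \<or> (a = y \<and> b = x)"
  proof -
    have "\<exists>k<length D. (a, b) \<in> arcs (D ! k) k \<and> a \<in> points D \<and> b \<in> points D" if "(a, b) \<in> linked D" for a b
      using that by (auto simp: linked_def)
    thus ?thesis using that assms(1) by blast
  qed
  have pts: "x \<in> points D" "y \<in> points D" using k by auto
  from k(2-4) show ?thesis
  proof (rule arc_slide[OF k(1)])
    fix j j' assume s: "a = (k, j)" "b = (Suc k, j')" "through k j j'"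
    show ?thesis using k(5)
    proof (elim disjE conjE)
      assume ab: "a = x" "b = y"
      note e = s(1,2)[unfolded ab]
      show ?thesis unfolding e(2)
        by (rule slide_up[OF s(3)]) (use e False assms(2) pts k(1) in \<open>simp_all add: points_width\<close>)
    next
      assume ab: "a = y" "b = x"
      note e = s(1,2)[unfolded ab]
      show ?thesis unfolding e(1)
        by (rule slide_down[OF s(3)]) (use e False assms(2) pts k(1) in \<open>simp_all add: points_width\<close>)
    qed
  next
    fix j j' assume s: "a = (Suc k, j)" "b = (Suc k, j')" "bottom k j j'"
    have s': "bottom k j' j" using s(3) eqs_sym unfolding bottom_def by blast
    show ?thesis using k(5)
    proof (elim disjE conjE)
      assume ab: "a = x" "b = y"
      note e = s(1,2)[unfolded ab]
      show ?thesis unfolding e(2)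
        by (rule slide_bottom[OF s(3)]) (use e False assms(2) pts k(1) in \<open>simp_all add: points_width\<close>)
    next
      assume ab: "a = y" "b = x"
      note e = s(1,2)[unfolded ab]
      show ?thesis unfolding e(1)
        by (rule slide_bottom[OF s']) (use e False assms(2) pts k(1) in \<open>simp_all add: points_width\<close>)
    qed
  next
    fix j j' assume s: "a = (k, j)" "b = (k, j')" "top k j j'"
    have s': "top k j' j" using s(3) eqs_sym unfolding top_def by blast
    show ?thesis using k(5)
    proof (elim disjE conjE)
      assume ab: "a = x" "b = y"
      note e = s(1,2)[unfolded ab]
      show ?thesis unfolding e(2)
        by (rule slide_top[OF s(3)]) (use e False assms(2) pts k(1) in \<open>simp_all add: points_width\<close>)
    next
      assume ab: "a = y" "b = x"
      note e = s(1,2)[unfolded ab]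
      show ?thesis unfolding e(1)
        by (rule slide_top[OF s']) (use e False assms(2) pts k(1) in \<open>simp_all add: points_width\<close>)
    qed
  qed
qed (simp add: insert_absorb)

text \<open>A maximal set of points among those giving the same value as \<open>S0\<close> contains
  both ends of every arc it meets, hence everything connected to \<open>S0\<close>.\<close>

lemma st_spread:
  assumes S0: "S0 \<subseteq> points D" and conn: "\<And>p. p \<in> points D \<Longrightarrow> \<exists>b\<in>S0. (b, p) \<in> conn D"
  shows "eqs [] (st S0 (length D)) (st (points D) (length D))"
proof -
  define Q where "Q S \<longleftrightarrow> S0 \<subseteq> S \<and> S \<subseteq> points D \<and> eqs [] (st S0 (length D)) (st S (length D))" for S
  have "finite {S. Q S}" by (rule finite_subset[of _ "Pow (points D)"]) (auto simp: Q_def finite_points)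
  moreover have "{S. Q S} \<noteq> {}" using S0 by (auto simp: Q_def)
  ultimately obtain S where S: "Q S" "\<And>T. Q T \<Longrightarrow> S \<subseteq> T \<Longrightarrow> T = S"
    using finite_has_maximal[of "{S. Q S}"] by auto
  have "p \<in> S" if p: "p \<in> points D" for p
  proof -
    obtain b where b: "b \<in> S0" "(b, p) \<in> conn D" using conn[OF p] by blast
    have "b \<in> S" using b(1) S(1) by (auto simp: Q_def)
    show ?thesis using b(2) unfolding conn_def
    proof (induction rule: rtrancl_induct)
      case (step x y)
      have lk: "(x, y) \<in> linked D \<or> (y, x) \<in> linked D" using step.hyps(2) by auto
      hence "y \<in> points D" by (auto simp: linked_def)
      hence "Q (insert y S)"
        using S(1) st_insert_linked[OF lk step.IH] eqs_trans by (fastforce simp: Q_def)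
      thus ?case using S(2)[of "insert y S"] by blast
    qed (rule \<open>b \<in> S\<close>)
  qed
  hence "S = points D" using S(1) by (auto simp: Q_def)
  thus ?thesis using S(1) by (simp add: Q_def)
qed

section \<open>The diagram with projections everywhere as a sequence of layers\<close>

definition level_path :: "nat \<Rightarrow> nat \<Rightarrow> (layer \<times> nat list) list" where
  "level_path a b = map (\<lambda>k. (D ! k, ns (Suc k))) [a..<b]"

definition level_scale :: "nat \<Rightarrow> scalar" where "level_scale k = scale_of (D ! k) (Cs k) (Cs' k)"

lemma layer_path_level_path:
  assumes "a \<le> b" "b \<le> length D"
  shows "layer_path (ns a) (level_path a b) (ns b) (\<Prod>k=a..<b. level_scale k)"
  using assms
proof (induction b rule: dec_induct)
  case (step b)
  hence b: "b < length D" by simp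
  have "layer_path (ns b) [(D ! b, ns (Suc b))] (ns (Suc b)) (level_scale b * 1)"
    unfolding level_scale_def below[OF b] above[OF b] by (rule layer_path_Cons[OF loc[OF b] layer_path_Nil])
  from layer_path_append[OF _ this] step b show ?case by (simp add: level_path_def)
qed (simp add: level_path_def layer_path_Nil)

lemma run_path_level_path:
  assumes "n \<le> length D"
  shows "run_path [] (level_path 0 n) block_vac = jst (points D) n (st (points D) n)"
  using assms
proof (induction n)
  case 0
  show ?case by (simp add: level_path_def jst_def width_last)
next
  case (Suc n)
  have "filter (\<lambda>i. (Suc n, i) \<in> points D) [0..<width D (Suc n)] = [0..<length (ns (Suc n))]"
    unfolding len[OF Suc.prems] by (rule filter_True) (use Suc.prems in \<open>simp add: points_width\<close>)
  hence "jst (points D) (Suc n) v = jall (ns (Suc n)) v" for v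
    by (simp add: jst_def)
  moreover have "layer_path [] (level_path 0 n) (ns n) (\<Prod>k=0..<n. level_scale k)"
    using layer_path_level_path[of 0 n] Suc.prems by simp
  moreover have "level_path 0 (Suc n) = level_path 0 n @ [(D ! n, ns (Suc n))]" by (simp add: level_path_def)
  ultimately show ?case using Suc by (simp add: run_path_append step_op_def st_Suc)
qed

lemma run_path_total:
  assumes "S0 \<subseteq> points D" "\<And>p. p \<in> points D \<Longrightarrow> \<exists>b\<in>S0. (b, p) \<in> conn D"
  shows "st S0 (length D) [] = run_path [] (level_path 0 (length D)) block_vac []"
proof -
  have "st S0 (length D) [] = st (points D) (length D) []"
    using eqsD[OF st_spread[OF assms], of "[]"] by simp
  thus ?thesis by (simp add: run_path_level_path jst_def width_last)
qed

lemma st_integral: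
  assumes "S0 \<subseteq> points D" "\<And>p. p \<in> points D \<Longrightarrow> \<exists>b\<in>S0. (b, p) \<in> conn D"
  shows "\<exists>r\<in>int_laurent. st S0 (length D) [] = (\<Prod>k=0..<length D. level_scale k) * r"
  using run_path_integral layer_path_level_path[of 0 "length D"] by (simp add: run_path_total[OF assms])

text \<open>Cutting at level k exhibits the strand at position i between a part below and a part
  above, whose scales multiply to the total one.\<close>

lemma st_divisible:
  assumes "S0 \<subseteq> points D" "\<And>p. p \<in> points D \<Longrightarrow> \<exists>b\<in>S0. (b, p) \<in> conn D" and k: "k < length D" "i < width D k"
  shows "\<exists>r\<in>int_laurent. st S0 (length D) [] = (\<Prod>k=0..<length D. level_scale k) * qint (ns k ! i + 1) * r"
proof -
  let ?L = "length D" and ?A = "take i (ns k)" and ?n = "ns k ! i" and ?B = "drop (Suc i) (ns k)"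
  have nk: "ns k = ?A @ ?n # ?B" by (rule id_take_nth_drop) (use len[of k] k in simp)
  have p1: "layer_path [] (level_path 0 k) (?A @ ?n # ?B) (\<Prod>k=0..<k. level_scale k)"
    using layer_path_level_path[of 0 k] k nk by simp
  have p2: "layer_path (?A @ ?n # ?B) (level_path k ?L) [] (\<Prod>k=k..<?L. level_scale k)"
    using layer_path_level_path[of k ?L] k nk by simp
  have "level_path 0 ?L = level_path 0 k @ level_path k ?L"
    using k(1) upt_add_eq_append[of 0 k "?L - k"] by (simp add: level_path_def flip: map_append)
  moreover have "(\<Prod>k=0..<k. level_scale k) * (\<Prod>k=k..<?L. level_scale k) = (\<Prod>k=0..<?L. level_scale k)"
    by (rule prod.atLeastLessThan_concat) (use k in auto)
  ultimately show ?thesis using run_path_divisible[OF p1 p2] by (simp only: run_path_total[OF assms(1,2)])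
qed

text \<open>Here \<open>b e\<close> is the base point of the edge \<open>e\<close> and
  \<open>ed p\<close> the edge through \<open>p\<close>. Projections at the base points alone
  reproduce the sum over permutations in the definition of the bracket.\<close>

lemma st_expand:
  fixes b :: "'e \<Rightarrow> point" and ed :: "point \<Rightarrow> 'e" and Ed :: "'e set"
  assumes Ed: "finite Ed" "\<And>e. e \<in> Ed \<Longrightarrow> b e \<in> points D \<and> ed (b e) = e" "\<And>p. p \<in> points D \<Longrightarrow> ed p \<in> Ed"
    and m: "\<And>e. e \<in> Ed \<Longrightarrow> m e = ns (fst (b e)) ! snd (b e)"
  shows "st (b ` Ed) (length D) [] =
    (\<Sum>\<sigma>\<in>Pi\<^sub>E Ed (\<lambda>e. perms (m e)). (\<Prod>e\<in>Ed. jc (m e) (\<sigma> e)) *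
       link_bracket (cab (\<lambda>p. if b (ed p) = p then min_braid (m (ed p)) (\<sigma> (ed p)) else []) (length D)))"
proof -
  \<comment> \<open>Operators are indexed by edges and act at base points only, so replacing the
    operator of one edge changes the evaluation at a single point.\<close>
  define XX where "XX Z = (\<lambda>p. if b (ed p) = p then Z (ed p) else (\<lambda>v. v))" for Z :: "'e \<Rightarrow> vec \<Rightarrow> vec"
  define good where "good Z \<longleftrightarrow> (\<forall>e s. lfun (\<lambda>v. Z e v s))" for Z :: "'e \<Rightarrow> vec \<Rightarrow> vec"
  define F where "F Z = run (XX Z) (length D) []" for Z
  have upd: "XX (Z(e := y)) = (XX Z)(b e := y)" if "e \<in> Ed" for Z e y
    using Ed(2)[OF that] by (auto simp: XX_def fun_eq_iff)
  have lf: "lfun (\<lambda>v. XX Z p v s)" if "good Z" for Z p s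
    using that by (simp add: XX_def good_def lfun_point)
  have fst: "fst p < length D" if "p \<in> points D" for p
    using that width_last by (cases p) (auto simp: points_width le_less)
  have exp: "F (\<lambda>e. if e \<in> Ed then JW (m e) else (\<lambda>v. v)) =
    (\<Sum>\<sigma>\<in>Pi\<^sub>E Ed (\<lambda>e. perms (m e)). (\<Prod>e\<in>Ed. jc (m e) (\<sigma> e)) *
       F (\<lambda>e. if e \<in> Ed then ev (map Pos (min_braid (m e) (\<sigma> e))) else (\<lambda>v. v)))"
  proof (rule multilinear_expand[where good = good, OF Ed(1)])
    fix e Z assume e: "e \<in> Ed" and Z: "good Z"
    have JW: "JW (m e) = (\<lambda>v s. \<Sum>\<sigma>\<in>perms (m e). jc (m e) \<sigma> * ev (map Pos (min_braid (m e) \<sigma>)) v s)"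
      by (simp add: JW_def fun_eq_iff)
    show "F (Z(e := JW (m e))) =
        (\<Sum>\<sigma>\<in>perms (m e). jc (m e) \<sigma> * F (Z(e := ev (map Pos (min_braid (m e) \<sigma>)))))"
      unfolding F_def upd[OF e] JW by (rule run_linear[OF lf[OF Z]]) (use Ed(2)[OF e] fst in auto)
  next
    fix e Z assume "good Z"
    thus "good (Z(e := JW (m e)))" by (simp add: good_def lfun_JW)
  next
    fix e Z \<sigma> assume "good Z"
    thus "good (Z(e := ev (map Pos (min_braid (m e) \<sigma>))))" by (simp add: good_def lfun_ev)
  qed (simp add: good_def lfun_point)
  have Fst: "F (\<lambda>e. if e \<in> Ed then JW (m e) else (\<lambda>v. v)) = st (b ` Ed) (length D) []"
  proof -
    have "XX (\<lambda>e. if e \<in> Ed then JW (m e) else (\<lambda>v. v)) p = XJ (b ` Ed) p" if p: "p \<in> points D" for p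
    proof -
      have "p \<in> b ` Ed \<longleftrightarrow> b (ed p) = p"
      proof
        assume "p \<in> b ` Ed"
        thus "b (ed p) = p" using Ed(2) by auto
      next
        assume "b (ed p) = p"
        thus "p \<in> b ` Ed" using Ed(3)[OF p] by (metis imageI)
      qed
      thus ?thesis using Ed(3)[OF p] m[OF Ed(3)[OF p]] by (simp add: XX_def XJ_def)
    qed
    from run_cong[OF this order_refl] show ?thesis by (simp add: F_def)
  qed
  have Flb: "F (\<lambda>e. if e \<in> Ed then ev (map Pos (min_braid (m e) (\<sigma> e))) else (\<lambda>v. v)) =
     link_bracket (cab (\<lambda>p. if b (ed p) = p then min_braid (m (ed p)) (\<sigma> (ed p)) else []) (length D))"
    (is "_ = link_bracket (cab ?w _)") if \<sigma>: "\<sigma> \<in> Pi\<^sub>E Ed (\<lambda>e. perms (m e))" for \<sigma>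
  proof -
    have w: "bword (ns k ! i) (?w (k, i))" if k: "k < length D" "i < width D k" for k i
    proof (cases "b (ed (k, i)) = (k, i)")
      case True
      have e: "ed (k, i) \<in> Ed" by (rule Ed(3)) (use k in \<open>simp add: points_width\<close>)
      have "\<sigma> (ed (k, i)) \<in> perms (m (ed (k, i)))" using \<sigma> e by blast
      from min_braid_perms[OF this] show ?thesis using m[OF e] True by simp
    qed simp
    note xop = cab_run[of ?w, OF w order_refl]
    have "F (\<lambda>e. if e \<in> Ed then ev (map Pos (min_braid (m e) (\<sigma> e))) else (\<lambda>v. v)) = run (\<lambda>p. ev (map Pos (?w p))) (length D) []"
    proof -
      have "XX (\<lambda>e. if e \<in> Ed then ev (map Pos (min_braid (m e) (\<sigma> e))) else (\<lambda>v. v)) p = ev (map Pos (?w p))"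
        if "p \<in> points D" for p
        using Ed(3)[OF that] by (simp add: XX_def fun_eq_iff)
      from run_cong[OF this order_refl] show ?thesis by (simp add: F_def)
    qed
    also have "\<dots> = ev (cab ?w (length D)) vac []"
      using xop[THEN conjunct2, THEN conjunct2, rule_format, of "[]"] by simp
    also have "\<dots> = link_bracket (cab ?w (length D))"
      by (rule link_bracket_ev[symmetric]) (use xop in simp_all)
    finally show ?thesis .
  qed
  show ?thesis unfolding Fst[symmetric] exp by (rule sum.cong[OF refl]) (simp only: Flb)
qed

end

section \<open>Counting arcs\<close>

fun lpos :: "layer \<Rightarrow> nat" where
  "lpos (Cup i) = i" | "lpos (Cap i) = i" | "lpos (Pos i) = i" | "lpos (Neg i) = i"
| "lpos (Merge i) = i" | "lpos (Split i) = i"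

fun lin :: "layer \<Rightarrow> nat" where
  "lin (Cup i) = 0" | "lin (Split i) = 1" | "lin l = 2"

fun lout :: "layer \<Rightarrow> nat" where
  "lout (Cap i) = 0" | "lout (Merge i) = 1" | "lout l = 2"

fun lmid :: "layer \<Rightarrow> nat \<Rightarrow> (point \<times> point) list" where
  "lmid (Cup i) k = [((Suc k, i), (Suc k, Suc i))]"
| "lmid (Cap i) k = [((k, i), (k, Suc i))]"
| "lmid (Pos i) k = [((k, i), (Suc k, Suc i)), ((k, Suc i), (Suc k, i))]"
| "lmid (Neg i) k = [((k, i), (Suc k, Suc i)), ((k, Suc i), (Suc k, i))]"
| "lmid l k = []"

lemma fits_iff: "fits l w \<longleftrightarrow> lpos l + lin l \<le> w"
  by (cases l) auto

lemma width_after_eq: "fits l w \<Longrightarrow> width_after l w = w - lin l + lout l"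
  by (cases l) auto

text \<open>\<open>arcs\<close> does not know the width and is an infinite set. This list contains
  once each the arcs to the left of the piece, those of the piece and \<open>b\<close> arcs to its
  right.\<close>

definition larcs :: "layer \<Rightarrow> nat \<Rightarrow> nat \<Rightarrow> (point \<times> point) list" where
  "larcs l k b = map (\<lambda>j. ((k, j), (Suc k, j))) [0..<lpos l] @ lmid l k @
     map (\<lambda>j. ((k, lpos l + lin l + j), (Suc k, lpos l + lout l + j))) [0..<b]"

lemma distinct_larcs: "distinct (larcs l k b)"
  by (cases l) (auto simp: larcs_def distinct_map inj_on_def)

lemma mem_arcs:
  "((k1, j1), (k2, j2)) \<in> arcs l k \<longleftrightarrow>
    (k1 = k \<and> k2 = Suc k \<and> (j1 < lpos l \<and> j2 = j1 \<or> lpos l + lin l \<le> j1 \<and> j2 + lin l = j1 + lout l)) \<or>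
    ((k1, j1), (k2, j2)) \<in> set (lmid l k)"
proof (cases l)
  case (Pos i)
  show ?thesis by (auto simp: Pos transpose_def)
next
  case (Neg i)
  show ?thesis by (auto simp: Neg transpose_def)
next
  case (Cap i)
  have "(\<exists>j. j1 = j + 2 \<and> j2 = j \<and> i \<le> j) \<longleftrightarrow> i + 2 \<le> j1 \<and> j2 + 2 = j1" by auto
  thus ?thesis by (auto simp: Cap)
next
  case (Merge i)
  have "(\<exists>j. j1 = Suc j \<and> j2 = j \<and> i < j) \<longleftrightarrow> i + 2 \<le> j1 \<and> j2 + 2 = j1 + 1" by auto
  thus ?thesis by (auto simp: Merge)
qed auto

lemma set_larcs:
  assumes "x \<in> set (larcs l k b)" "w = lpos l + lin l + b"
  shows "x \<in> arcs l k" "fst (fst x) = k \<and> snd (fst x) < w \<or> fst (fst x) = Suc k \<and> snd (fst x) < w - lin l + lout l"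
    "fst (snd x) = k \<and> snd (snd x) < w \<or> fst (snd x) = Suc k \<and> snd (snd x) < w - lin l + lout l"
proof -
  obtain k1 j1 k2 j2 where x: "x = ((k1, j1), (k2, j2))" by (metis surj_pair)
  have mid: "((k1, j1), (k2, j2)) \<in> set (lmid l k) \<Longrightarrow>
    (k1 = k \<and> j1 < w \<or> k1 = Suc k \<and> j1 < w - lin l + lout l) \<and> (k2 = k \<and> j2 < w \<or> k2 = Suc k \<and> j2 < w - lin l + lout l)"
    unfolding assms(2) by (cases l) auto
  show "x \<in> arcs l k" using assms(1) unfolding x mem_arcs by (auto simp: larcs_def)
  show "fst (fst x) = k \<and> snd (fst x) < w \<or> fst (fst x) = Suc k \<and> snd (fst x) < w - lin l + lout l"
    "fst (snd x) = k \<and> snd (snd x) < w \<or> fst (snd x) = Suc k \<and> snd (snd x) < w - lin l + lout l"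
    using assms mid unfolding x by (auto simp: larcs_def)
qed

lemma set_larcs_eq:
  assumes "fits (D ! k) (width D k)" "k < length D" "width D (Suc k) = width_after (D ! k) (width D k)"
  shows "set (larcs (D ! k) k (width D k - lpos (D ! k) - lin (D ! k))) = arcs (D ! k) k \<inter> points D \<times> points D"
    (is "set ?L = _")
proof -
  let ?l = "D ! k" and ?w = "width D k"
  have w: "?w = lpos ?l + lin ?l + (?w - lpos ?l - lin ?l)" using assms(1) by (simp add: fits_iff)
  have w': "width D (Suc k) = ?w - lin ?l + lout ?l" using assms by (simp add: width_after_eq)
  have "x \<in> arcs ?l k \<inter> points D \<times> points D" if "x \<in> set ?L" for x
    using set_larcs[OF that w] assms(2) unfolding w'[symmetric]
    by (cases x) (auto simp: points_def)
  moreover have "x \<in> set ?L" if x: "x \<in> arcs ?l k \<inter> points D \<times> points D" for x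
  proof -
    obtain k1 j1 k2 j2 where xe: "x = ((k1, j1), (k2, j2))" by (metis surj_pair)
    have b: "j1 < width D k1" using x by (simp add: xe points_def)
    from x consider "k1 = k" "k2 = Suc k" "j1 < lpos ?l" "j2 = j1"
      | "k1 = k" "k2 = Suc k" "lpos ?l + lin ?l \<le> j1" "j2 + lin ?l = j1 + lout ?l"
      | "x \<in> set (lmid ?l k)" unfolding xe by (auto simp: mem_arcs)
    thus ?thesis
    proof cases
      case 2
      define j where "j = j1 - (lpos ?l + lin ?l)"
      have "j1 = lpos ?l + lin ?l + j" "j2 = lpos ?l + lout ?l + j" "j < ?w - lpos ?l - lin ?l"
        using 2 b by (auto simp: j_def)
      thus ?thesis using 2 by (auto simp: larcs_def xe)
    qed (auto simp: larcs_def xe)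
  qed
  ultimately show ?thesis by blast
qed

lemma map_upt_split:
  "map f [0..<a + c + b] = map f [0..<a] @ map (\<lambda>j. f (a + j)) [0..<c] @ map (\<lambda>j. f (a + c + j)) [0..<b]"
proof -
  have "[0..<a + c + b] = [0..<a] @ [a..<a + c] @ [a + c..<a + c + b]"
    by (metis append.assoc le_add1 upt_add_eq_append zero_le)
  moreover have "[m..<m + n] = map (\<lambda>j. m + j) [0..<n]" for m n :: nat
    by (simp add: map_add_upt add.commute)
  ultimately show ?thesis by (simp add: comp_def)
qed

text \<open>Spanning tree bound: a maximal subset containing \<open>v0\<close> and spanned by enough
  edges is everything, because an edge leaving it would allow a larger one.\<close>

lemma card_connected_le:
  fixes V :: "'p set" and R :: "('p \<times> 'p) set"
  assumes V: "finite V" "v0 \<in> V" and R: "finite R" "R \<subseteq> V \<times> V"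
    and conn: "\<And>v. v \<in> V \<Longrightarrow> (v0, v) \<in> (R \<union> R\<inverse>)\<^sup>*"
  shows "card V \<le> card R + 1"
proof -
  define Q where "Q T \<longleftrightarrow> v0 \<in> T \<and> T \<subseteq> V \<and> card T \<le> card (R \<inter> T \<times> T) + 1" for T
  have "finite {T. Q T}" by (rule finite_subset[of _ "Pow V"]) (auto simp: Q_def V)
  moreover have "Q {v0}" using V by (simp add: Q_def)
  ultimately obtain T where T: "Q T" "\<And>T'. Q T' \<Longrightarrow> T \<subseteq> T' \<Longrightarrow> T' = T"
    using finite_has_maximal[of "{T. Q T}"] by blast
  have fT: "finite T" using T(1) V(1) finite_subset by (auto simp: Q_def)
  have "v \<in> T" if "v \<in> V" for v
    using conn[OF that]
  proof (induction rule: rtrancl_induct)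
    case (step x y)
    show ?case
    proof (rule ccontr)
      assume y: "y \<notin> T"
      obtain r where r: "r \<in> R" "r = (x, y) \<or> r = (y, x)" using step.hyps(2) by auto
      have yV: "y \<in> V" using r R(2) by auto
      have "insert r (R \<inter> T \<times> T) \<subseteq> R \<inter> insert y T \<times> insert y T" using r step.IH by auto
      moreover have "r \<notin> R \<inter> T \<times> T" using r y by auto
      ultimately have "card (R \<inter> T \<times> T) + 1 \<le> card (R \<inter> insert y T \<times> insert y T)"
        using card_mono[of "R \<inter> insert y T \<times> insert y T" "insert r (R \<inter> T \<times> T)"] R(1) by simp
      hence "Q (insert y T)" using T(1) yV y fT by (simp add: Q_def)
      thus False using T(2)[of "insert y T"] y by blast
    qed
  qed (use T(1) in \<open>simp add: Q_def\<close>)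
  hence "T = V" using T(1) by (auto simp: Q_def)
  hence "card V \<le> card (R \<inter> V \<times> V) + 1" using T(1) by (simp add: Q_def)
  also have "R \<inter> V \<times> V = R" using R(2) by blast
  finally show ?thesis .
qed

lemma triangle_nat:
  fixes a b c :: rat
  assumes "2 * a \<in> \<nat>" "2 * b \<in> \<nat>" "2 * c \<in> \<nat>" "a + b + c \<in> \<nat>" "a + b \<ge> c" "b + c \<ge> a" "c + a \<ge> b"
  obtains x s y where "to_nat (2 * a) = x + s" "to_nat (2 * b) = s + y" "to_nat (2 * c) = x + y"
    "to_nat (a + b - c) = s" "to_nat (b + c - a) = y" "to_nat (c + a - b) = x"
proof -
  have *: "\<exists>n. u - v = of_nat n" if uv: "u \<in> \<nat>" "v \<in> \<nat>" "v \<le> u" for u v :: rat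
  proof -
    obtain i where "u = of_nat i" using uv(1) by (auto elim: Nats_cases)
    moreover obtain j where "v = of_nat j" using uv(2) by (auto elim: Nats_cases)
    ultimately show ?thesis using uv(3) by (intro exI[of _ "i - j"]) (simp add: of_nat_diff)
  qed
  \<comment> \<open>a + b - c is (a + b + c) - 2c, a difference of two natural numbers.\<close>
  obtain s where s: "a + b + c - 2 * c = of_nat s" using *[OF assms(4,3)] assms(5) by auto
  obtain y where y: "a + b + c - 2 * a = of_nat y" using *[OF assms(4,1)] assms(6) by auto
  obtain x where x: "a + b + c - 2 * b = of_nat x" using *[OF assms(4,2)] assms(7) by auto
  have t: "to_nat (of_nat n) = n" for n by (simp add: to_nat_def)
  have "2 * a = of_nat (x + s)" "2 * b = of_nat (s + y)" "2 * c = of_nat (x + y)"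
    "a + b - c = of_nat s" "b + c - a = of_nat y" "c + a - b = of_nat x"
    using s y x by simp_all
  thus ?thesis using that[of x s y] t by metis
qed

lemma cable_layer_cong:
  assumes "fits l w" "\<And>i. i < w \<Longrightarrow> m i = n i" "\<And>i. i < width_after l w \<Longrightarrow> m' i = n' i"
  shows "cable_layer m m' l = cable_layer n n' l"
proof -
  have s: "(\<Sum>l<i. m l) = (\<Sum>l<i. n l)" if "i \<le> w" for i
    by (rule sum.cong[OF refl]) (use assms(2) that in auto)
  show ?thesis
    using assms by (cases l) (simp_all add: s Let_def)
qed

locale colored =
  fixes D :: diagram and col :: coloring
  assumes closed: "closed_diagram D" and adm: "admissible D col"
begin

lemma fits: "k < length D \<Longrightarrow> fits (D ! k) (width D k)"
  using closed by (simp add: closed_diagram_def)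

lemma width_Suc: "k < length D \<Longrightarrow> width D (Suc k) = width_after (D ! k) (width D k)"
  by (simp add: width_def take_Suc_conv_app_nth)

lemma width_ends: "width D 0 = 0" "width D (length D) = 0"
  using closed by (simp_all add: closed_diagram_def width_def)

definition rest :: "nat \<Rightarrow> nat" where "rest k = width D k - lpos (D ! k) - lin (D ! k)"

lemma width_split:
  assumes "k < length D"
  shows "width D k = lpos (D ! k) + lin (D ! k) + rest k" "width D (Suc k) = lpos (D ! k) + lout (D ! k) + rest k"
  using fits[OF assms] width_after_eq[OF fits[OF assms]] by (simp_all add: rest_def fits_iff width_Suc[OF assms])

definition level_arcs :: "nat \<Rightarrow> (point \<times> point) list" where "level_arcs k = larcs (D ! k) k (rest k)"

lemma set_level_arcs: "k < length D \<Longrightarrow> set (level_arcs k) = arcs (D ! k) k \<inter> points D \<times> points D"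
  unfolding level_arcs_def rest_def by (rule set_larcs_eq) (simp_all add: fits width_Suc)

lemma level_arcs_linked: "k < length D \<Longrightarrow> x \<in> set (level_arcs k) \<Longrightarrow> x \<in> linked D"
  by (auto simp: set_level_arcs linked_def)

lemma level_arcs_points: "k < length D \<Longrightarrow> x \<in> set (level_arcs k) \<Longrightarrow> fst x \<in> points D \<and> snd x \<in> points D"
  by (auto simp: set_level_arcs)

lemma level_arcs_edge: "k < length D \<Longrightarrow> (p, p') \<in> set (level_arcs k) \<Longrightarrow> edge_of D p = edge_of D p'"
  using level_arcs_points[of k "(p, p')"] level_arcs_linked[of k "(p, p')"] edge_of_eq_iff[of p' D p] linked_conn by fastforce

lemma level_arcs_strands: "k < length D \<Longrightarrow> ((a, b), (c, d)) \<in> set (level_arcs k) \<Longrightarrow> strands D col a b = strands D col c d"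
  using level_arcs_edge by (simp add: strands_def)

lemma vertex_iff: "k \<in> vertices D \<longleftrightarrow> k < length D \<and> (\<exists>i. D ! k = Merge i \<or> D ! k = Split i)"
  by (simp add: vertices_def)

lemma vertex_points:
  assumes "k \<in> vertices D" "ends D k = (x, y, z)"
  shows "x \<in> points D" "y \<in> points D" "z \<in> points D"
  using assms width_split[of k] by (auto simp: vertex_iff ends_def points_def)

lemma edge_color: "p \<in> points D \<Longrightarrow> 2 * col (edge_of D p) \<in> \<nat>"
  using adm by (simp add: admissible_def edges_def)

lemma vertex_triangle:
  assumes "k \<in> vertices D" "ends D k = (p, p', p'')" "end_colors D col k = (a, b, c)"
  obtains x s y where "strands D col (fst p) (snd p) = x + s" "strands D col (fst p') (snd p') = s + y"
    "strands D col (fst p'') (snd p'') = x + y"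
    "to_nat (a + b - c) = s" "to_nat (b + c - a) = y" "to_nat (c + a - b) = x"
proof -
  have abc: "a = col (edge_of D p)" "b = col (edge_of D p')" "c = col (edge_of D p'')"
    using assms(2,3) by (auto simp: end_colors_def)
  have "a + b + c \<in> \<nat>" "a + b \<ge> c" "b + c \<ge> a" "c + a \<ge> b"
    using adm assms(1,3) unfolding admissible_def by (auto dest!: bspec[of _ _ k])
  moreover note edge_color[OF vertex_points(1)[OF assms(1,2)]]
    edge_color[OF vertex_points(2)[OF assms(1,2)]] edge_color[OF vertex_points(3)[OF assms(1,2)]]
  ultimately show ?thesis
    using triangle_nat[of a b c thesis] that by (simp add: abc strands_def)
qed

definition lv :: "nat \<Rightarrow> nat list" where "lv k = map (strands D col k) [0..<width D k]"

definition lvA :: "nat \<Rightarrow> nat list" where "lvA k = map (strands D col k) [0..<lpos (D ! k)]"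

definition lvC :: "nat \<Rightarrow> nat list" where
  "lvC k = map (\<lambda>j. strands D col k (lpos (D ! k) + j)) [0..<lin (D ! k)]"

definition lvC' :: "nat \<Rightarrow> nat list" where
  "lvC' k = map (\<lambda>j. strands D col (Suc k) (lpos (D ! k) + j)) [0..<lout (D ! k)]"

definition lvB :: "nat \<Rightarrow> nat list" where
  "lvB k = map (\<lambda>j. strands D col k (lpos (D ! k) + lin (D ! k) + j)) [0..<rest k]"

lemma two_upt: "[0..<2] = [0, Suc 0]" "[0..<Suc 0] = [0]" "[0..<1] = [0]"
  by (simp_all add: numeral_2_eq_2)

lemma lv_loc:
  assumes k: "k < length D"
  shows "loc (D ! k) (length (lvA k)) (lvC k) (lvC' k)"
proof -
  note st = level_arcs_strands[OF k]
  have mid: "x \<in> set (lmid (D ! k) k) \<Longrightarrow> x \<in> set (level_arcs k)" for x by (auto simp: level_arcs_def larcs_def)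
  show ?thesis
  proof (cases "D ! k")
    case (Cup i)
    have "strands D col (Suc k) i = strands D col (Suc k) (Suc i)"
      by (rule st, rule mid) (simp add: Cup)
    thus ?thesis using loc.intros(1)[of i] by (simp add: Cup lvA_def lvC_def lvC'_def two_upt)
  next
    case (Cap i)
    have "strands D col k i = strands D col k (Suc i)"
      by (rule st, rule mid) (simp add: Cap)
    thus ?thesis using loc.intros(2)[of i] by (simp add: Cap lvA_def lvC_def lvC'_def two_upt)
  next
    case (Pos i)
    have "strands D col k i = strands D col (Suc k) (Suc i)" "strands D col k (Suc i) = strands D col (Suc k) i"
      by (rule st, rule mid, simp add: Pos)+
    thus ?thesis using loc.intros(3)[of i] by (simp add: Pos lvA_def lvC_def lvC'_def two_upt)
  next
    case (Neg i)
    have "strands D col k i = strands D col (Suc k) (Suc i)" "strands D col k (Suc i) = strands D col (Suc k) i"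
      by (rule st, rule mid, simp add: Neg)+
    thus ?thesis using loc.intros(4)[of i] by (simp add: Neg lvA_def lvC_def lvC'_def two_upt)
  next
    case (Merge i)
    have v: "k \<in> vertices D" using k Merge by (simp add: vertex_iff)
    have e: "ends D k = ((k, i), (k, Suc i), (Suc k, i))" by (simp add: ends_def Merge)
    obtain a b c where abc: "end_colors D col k = (a, b, c)" by (metis surj_pair)
    obtain x s y where xy: "strands D col k i = x + s" "strands D col k (Suc i) = s + y" "strands D col (Suc k) i = x + y"
      by (rule vertex_triangle[OF v e abc]) auto
    show ?thesis using loc.intros(5)[of i x s y] by (simp add: Merge lvA_def lvC_def lvC'_def two_upt xy)
  next
    case (Split i)
    have v: "k \<in> vertices D" using k Split by (simp add: vertex_iff)
    have e: "ends D k = ((Suc k, i), (Suc k, Suc i), (k, i))" by (simp add: ends_def Split)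
    obtain a b c where abc: "end_colors D col k = (a, b, c)" by (metis surj_pair)
    obtain x s y where xy: "strands D col (Suc k) i = x + s" "strands D col (Suc k) (Suc i) = s + y" "strands D col k i = x + y"
      by (rule vertex_triangle[OF v e abc]) auto
    show ?thesis using loc.intros(6)[of i x y s] by (simp add: Split lvA_def lvC_def lvC'_def two_upt xy)
  qed
qed

lemma through_strands:
  assumes k: "k < length D"
  shows "j < lpos (D ! k) \<Longrightarrow> strands D col (Suc k) j = strands D col k j"
    "j < rest k \<Longrightarrow> strands D col (Suc k) (lpos (D ! k) + lout (D ! k) + j) = strands D col k (lpos (D ! k) + lin (D ! k) + j)"
  by (rule level_arcs_strands[OF k, symmetric], simp add: level_arcs_def larcs_def)+

sublocale cabling D lv lvA lvC lvC' lvB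
proof
  fix k assume k: "k < length D"
  show "lv k = lvA k @ lvC k @ lvB k"
    by (simp only: lv_def lvA_def lvC_def lvB_def width_split(1)[OF k] map_upt_split)
  have "lv (Suc k) = map (strands D col (Suc k)) [0..<lpos (D ! k)] @ lvC' k @
     map (\<lambda>j. strands D col (Suc k) (lpos (D ! k) + lout (D ! k) + j)) [0..<rest k]"
    by (simp only: lv_def lvC'_def width_split(2)[OF k] map_upt_split)
  thus "lv (Suc k) = lvA k @ lvC' k @ lvB k"
    by (simp add: lvA_def lvB_def through_strands[OF k])
  show "loc (D ! k) (length (lvA k)) (lvC k) (lvC' k)" by (rule lv_loc[OF k])
qed (simp_all add: lv_def width_ends)

subsection \<open>The total scale\<close>

definition hg :: "(point \<Rightarrow> nat) \<Rightarrow> nat \<Rightarrow> nat" where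
  "hg g k = (if k \<in> vertices D then case ends D k of (x, y, z) \<Rightarrow> g x + g y + g z else 0)"

lemma sum_list_level_arcs:
  "sum_list (map F (level_arcs k)) = (\<Sum>j<lpos (D ! k). F ((k, j), (Suc k, j))) + sum_list (map F (lmid (D ! k) k)) +
     (\<Sum>j<rest k. F ((k, lpos (D ! k) + lin (D ! k) + j), (Suc k, lpos (D ! k) + lout (D ! k) + j)))"
  by (simp add: level_arcs_def larcs_def interv_sum_list_conv_sum_set_nat comp_def atLeast0LessThan add.assoc)

lemma sum_level:
  fixes f :: "nat \<Rightarrow> 'a :: comm_monoid_add"
  shows "(\<Sum>i<a + c + b. f i) = (\<Sum>i<a. f i) + (\<Sum>j<c. f (a + j)) + (\<Sum>j<b. f (a + c + j))"
proof -
  have *: "(\<Sum>i<n. h i) = sum_list (map h [0..<n])" for h :: "nat \<Rightarrow> 'a" and n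
    by (simp add: interv_sum_list_conv_sum_set_nat atLeast0LessThan)
  show ?thesis unfolding * map_upt_split sum_list_append by (rule add.assoc[symmetric])
qed

lemma prod_upt:
  fixes f :: "nat \<Rightarrow> 'a :: comm_monoid_mult"
  shows "prod_list (map f [0..<n]) = (\<Prod>i<n. f i)"
  using prod.distinct_set_conv_list[of "[0..<n]" f] by (simp add: atLeast0LessThan)

lemma prod_level:
  fixes f :: "nat \<Rightarrow> 'a :: comm_monoid_mult"
  shows "(\<Prod>i<a + c + b. f i) = (\<Prod>i<a. f i) * (\<Prod>j<c. f (a + j)) * (\<Prod>j<b. f (a + c + j))"
  by (simp only: prod_upt[symmetric] map_upt_split prod_list.append mult.assoc)

lemma prod_list_level_arcs:
  fixes F :: "point \<times> point \<Rightarrow> 'a :: comm_monoid_mult"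
  shows "prod_list (map F (level_arcs k)) = (\<Prod>j<lpos (D ! k). F ((k, j), (Suc k, j))) * prod_list (map F (lmid (D ! k) k)) *
     (\<Prod>j<rest k. F ((k, lpos (D ! k) + lin (D ! k) + j), (Suc k, lpos (D ! k) + lout (D ! k) + j)))"
  by (simp add: level_arcs_def larcs_def prod_upt comp_def mult.assoc)

text \<open>A point on one of the two levels bordering a layer is an end of exactly one arc of the
  layer, or of an edge at its vertex.\<close>

lemma layer_count:
  assumes k: "k < length D"
  shows "(\<Sum>i<width D k. g (k, i)) + (\<Sum>i<width D (Suc k). g (Suc k, i)) =
    (\<Sum>(p, p')\<in>set (level_arcs k). g p + g p') + hg g k"
proof -
  have v: "k \<in> vertices D \<longleftrightarrow> (\<exists>i. D ! k = Merge i \<or> D ! k = Split i)" using k by (simp add: vertex_iff)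
  have "(\<Sum>(p, p')\<in>set (level_arcs k). g p + g p') = sum_list (map (\<lambda>(p, p'). g p + g p') (level_arcs k))"
    by (rule sum.distinct_set_conv_list) (simp add: level_arcs_def distinct_larcs)
  thus ?thesis unfolding width_split[OF k] sum_level sum_list_level_arcs
    by (cases "D ! k") (simp_all add: hg_def v sum.distrib ends_def numeral_2_eq_2)
qed

definition fact_at :: "point \<Rightarrow> scalar" where "fact_at p = qfact (strands D col (fst p) (snd p))"

definition vertex_fact :: "nat \<Rightarrow> scalar" where
  "vertex_fact k = (if k \<in> vertices D then case end_colors D col k of (a, b, c) \<Rightarrow>
     qfact (to_nat (a + b - c)) * qfact (to_nat (b + c - a)) * qfact (to_nat (c + a - b)) else 1)"

text \<open>The factorials of the points above a layer are charged to the layer, so that each arc is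
  left with one factorial: a cup has 1/[n]! and two points above, a cap has [n]! and none. At a
  vertex exactly the three factorials of the normalization remain.\<close>

lemma layer_scale:
  assumes k: "k < length D"
  shows "\<exists>m. level_scale k * (\<Prod>i<width D (Suc k). fact_at (Suc k, i)) = qh powi m * vertex_fact k * (\<Prod>(p, p')\<in>set (level_arcs k). fact_at p)"
proof -
  have v: "k \<in> vertices D \<longleftrightarrow> (\<exists>i. D ! k = Merge i \<or> D ! k = Split i)" using k by (simp add: vertex_iff)
  define P where "P = (\<Prod>j<lpos (D ! k). fact_at (k, j))"
  define R where "R = (\<Prod>j<rest k. fact_at (k, lpos (D ! k) + lin (D ! k) + j))"
  have arcs: "(\<Prod>(p, p')\<in>set (level_arcs k). fact_at p) = P * prod_list (map (\<lambda>(p, p'). fact_at p) (lmid (D ! k) k)) * R"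
    unfolding prod.distinct_set_conv_list[OF distinct_larcs[of "D ! k" k "rest k", folded level_arcs_def]] prod_list_level_arcs
    by (simp add: P_def R_def)
  have pts: "(\<Prod>i<width D (Suc k). fact_at (Suc k, i)) =
      P * (\<Prod>j<lout (D ! k). fact_at (Suc k, lpos (D ! k) + j)) * R"
    unfolding width_split(2)[OF k] prod_level
    by (simp add: P_def R_def fact_at_def through_strands[OF k])
  have nz: "qfact n \<noteq> 0" for n by simp
  have "\<exists>m. level_scale k * (\<Prod>j<lout (D ! k). fact_at (Suc k, lpos (D ! k) + j)) =
      qh powi m * vertex_fact k * prod_list (map (\<lambda>(p, p'). fact_at p) (lmid (D ! k) k))"
  proof -
    note st = level_arcs_strands[OF k]
    have mid: "x \<in> set (lmid (D ! k) k) \<Longrightarrow> x \<in> set (level_arcs k)" for x by (auto simp: level_arcs_def larcs_def)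
    show ?thesis
    proof (cases "D ! k")
      case (Cup i)
      have "strands D col (Suc k) i = strands D col (Suc k) (Suc i)"
        by (rule st, rule mid) (simp add: Cup)
      thus ?thesis
        by (intro exI[of _ 0]) (simp add: Cup level_scale_def lvC_def lvC'_def two_upt vertex_fact_def v fact_at_def numeral_2_eq_2)
    next
      case (Cap i)
      have "strands D col k i = strands D col k (Suc i)"
        by (rule st, rule mid) (simp add: Cap)
      thus ?thesis
        by (intro exI[of _ 0]) (simp add: Cap level_scale_def lvC_def lvC'_def two_upt vertex_fact_def v fact_at_def)
    next
      case (Pos i)
      have "strands D col k i = strands D col (Suc k) (Suc i)" "strands D col k (Suc i) = strands D col (Suc k) i"
        by (rule st, rule mid, simp add: Pos)+
      thus ?thesis
        by (intro exI[of _ "int (strands D col k i) * int (strands D col k (Suc i))"])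
          (simp add: Pos level_scale_def lvC_def lvC'_def two_upt vertex_fact_def v fact_at_def numeral_2_eq_2 mult_ac)
    next
      case (Neg i)
      have "strands D col k i = strands D col (Suc k) (Suc i)" "strands D col k (Suc i) = strands D col (Suc k) i"
        by (rule st, rule mid, simp add: Neg)+
      thus ?thesis
        by (intro exI[of _ "- int (strands D col k i) * int (strands D col k (Suc i))"])
          (simp add: Neg level_scale_def lvC_def lvC'_def two_upt vertex_fact_def v fact_at_def numeral_2_eq_2 mult_ac)
    next
      case (Merge i)
      have v': "k \<in> vertices D" using k Merge by (simp add: vertex_iff)
      have e: "ends D k = ((k, i), (k, Suc i), (Suc k, i))" by (simp add: ends_def Merge)
      obtain a b c where abc: "end_colors D col k = (a, b, c)" by (metis surj_pair)
      obtain x s y where xy: "strands D col k i = x + s" "strands D col k (Suc i) = s + y" "strands D col (Suc k) i = x + y"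
          "to_nat (a + b - c) = s" "to_nat (b + c - a) = y" "to_nat (c + a - b) = x"
        by (rule vertex_triangle[OF v' e abc]) auto
      have "(x + s + (s + y) - (x + y)) div 2 = s" by simp
      thus ?thesis
        by (intro exI[of _ 0]) (simp add: Merge level_scale_def lvC_def lvC'_def two_upt vertex_fact_def v fact_at_def xy abc)
    next
      case (Split i)
      have v': "k \<in> vertices D" using k Split by (simp add: vertex_iff)
      have e: "ends D k = ((Suc k, i), (Suc k, Suc i), (k, i))" by (simp add: ends_def Split)
      obtain a b c where abc: "end_colors D col k = (a, b, c)" by (metis surj_pair)
      obtain x s y where xy: "strands D col (Suc k) i = x + s" "strands D col (Suc k) (Suc i) = s + y" "strands D col k i = x + y"
          "to_nat (a + b - c) = s" "to_nat (b + c - a) = y" "to_nat (c + a - b) = x"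
        by (rule vertex_triangle[OF v' e abc]) auto
      have "(x + s + (s + y) - (x + y)) div 2 = s" by simp
      thus ?thesis
        by (intro exI[of _ 0]) (simp add: Split level_scale_def lvC_def lvC'_def two_upt vertex_fact_def v fact_at_def xy abc numeral_2_eq_2)
    qed
  qed
  then obtain m where m: "level_scale k * (\<Prod>j<lout (D ! k). fact_at (Suc k, lpos (D ! k) + j)) =
      qh powi m * vertex_fact k * prod_list (map (\<lambda>(p, p'). fact_at p) (lmid (D ! k) k))" by blast
  have "s * (P * w * R) = z * v * (P * u * R)" if "s * w = z * v * u" for s w z v u
  proof -
    have "s * (P * w * R) = (s * w) * (P * R)" by (simp only: mult_ac)
    thus ?thesis unfolding that by (simp only: mult_ac)
  qed
  from this[OF m] show ?thesis unfolding arcs pts by blast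
qed

text \<open>
  Arcs are counted together with their layer: a cup directly followed by a cap has two arcs with
  the same endpoints, which \<open>linked\<close> identifies.
\<close>

definition all_arcs :: "(nat \<times> point \<times> point) set" where "all_arcs = (SIGMA k:{..<length D}. set (level_arcs k))"

lemma finite_all_arcs [simp]: "finite all_arcs"
  by (simp add: all_arcs_def)

section \<open>Double counting of points, arcs and half-edges\<close>

lemma points_upper: "points D = (SIGMA k:{..<length D}. {..<width D k})"
  using width_ends by (auto simp: points_def le_less)

lemma sum_points:
  fixes g :: "point \<Rightarrow> nat"
  shows "(\<Sum>k<length D. \<Sum>i<width D k. g (k, i)) = sum g (points D)"
    "(\<Sum>k<length D. \<Sum>i<width D (Suc k). g (Suc k, i)) = sum g (points D)"
proof -
  show 1: "(\<Sum>k<length D. \<Sum>i<width D k. g (k, i)) = sum g (points D)"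
    unfolding points_upper by (simp add: sum.Sigma)
  have "(\<Sum>k<Suc (length D). \<Sum>i<width D k. g (k, i)) = (\<Sum>k<length D. \<Sum>i<width D (Suc k). g (Suc k, i))"
    by (subst sum.lessThan_Suc_shift) (simp add: width_ends)
  thus "(\<Sum>k<length D. \<Sum>i<width D (Suc k). g (Suc k, i)) = sum g (points D)"
    using 1 by (simp add: width_ends)
qed

lemma prod_points:
  fixes g :: "point \<Rightarrow> scalar"
  shows "(\<Prod>k<length D. \<Prod>i<width D (Suc k). g (Suc k, i)) = prod g (points D)"
proof -
  have 1: "(\<Prod>k<length D. \<Prod>i<width D k. g (k, i)) = prod g (points D)"
    unfolding points_upper by (simp add: prod.Sigma)
  have "(\<Prod>k<Suc (length D). \<Prod>i<width D k. g (k, i)) = (\<Prod>k<length D. \<Prod>i<width D (Suc k). g (Suc k, i))"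
    by (subst prod.lessThan_Suc_shift) (simp add: width_ends)
  thus ?thesis using 1 by (simp add: width_ends)
qed

lemma vertices_sub: "vertices D \<subseteq> {..<length D}"
  by (auto simp: vertices_def)

lemma finite_vertices [simp]: "finite (vertices D)"
  by (rule finite_subset[OF vertices_sub]) simp

text \<open>The lowest and the highest level are empty, so every point borders exactly two
  layers.\<close>

lemma total_count:
  "2 * sum g (points D) = (\<Sum>(k, p, p')\<in>all_arcs. g p + g p') + (\<Sum>k\<in>vertices D. hg g k)"
proof -
  have "2 * sum g (points D) = (\<Sum>k<length D. (\<Sum>i<width D k. g (k, i)) + (\<Sum>i<width D (Suc k). g (Suc k, i)))"
    by (simp add: sum.distrib sum_points)
  also have "\<dots> = (\<Sum>k<length D. \<Sum>(p, p')\<in>set (level_arcs k). g p + g p') + (\<Sum>k<length D. hg g k)"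
    by (simp add: layer_count sum.distrib)
  also have "(\<Sum>k<length D. \<Sum>(p, p')\<in>set (level_arcs k). g p + g p') = (\<Sum>(k, p, p')\<in>all_arcs. g p + g p')"
    unfolding all_arcs_def by (subst sum.Sigma) (auto simp: case_prod_beta)
  also have "(\<Sum>k<length D. hg g k) = (\<Sum>k\<in>vertices D. hg g k)"
    by (rule sum.mono_neutral_right) (auto simp: hg_def vertices_sub[THEN subsetD, THEN lessThan_iff[THEN iffD1]])
  finally show ?thesis .
qed

lemma edge_mem: "e \<in> edges D \<Longrightarrow> p \<in> points D \<Longrightarrow> p \<in> e \<longleftrightarrow> edge_of D p = e"
proof -
  assume e: "e \<in> edges D" and p: "p \<in> points D"
  obtain p0 where p0: "p0 \<in> points D" "e = edge_of D p0" using e by (auto simp: edges_def)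
  have "p \<in> e \<longleftrightarrow> (p0, p) \<in> conn D" using p by (simp add: p0 edge_of_def conn_def)
  also have "\<dots> \<longleftrightarrow> edge_of D p0 = edge_of D p" by (rule edge_of_eq_iff[OF p, symmetric])
  finally show ?thesis by (auto simp: p0)
qed

lemma edge_sub: "e \<in> edges D \<Longrightarrow> e \<subseteq> points D"
  by (auto simp: edges_def edge_of_def)

lemma finite_edge: "e \<in> edges D \<Longrightarrow> finite e"
  using edge_sub finite_points finite_subset by blast

lemma finite_edges [simp]: "finite (edges D)"
  by (simp add: edges_def finite_points)

lemma edge_of_edges: "p \<in> points D \<Longrightarrow> edge_of D p \<in> edges D"
  by (simp add: edges_def)

definition arcs_on :: "edge \<Rightarrow> (nat \<times> point \<times> point) set" where "arcs_on e = {x \<in> all_arcs. fst (snd x) \<in> e}"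

definition half_count :: "edge \<Rightarrow> nat" where "half_count e = (\<Sum>k\<in>vertices D. hg (\<lambda>p. if p \<in> e then 1 else 0) k)"

lemma all_arcs_points: "(k, p, p') \<in> all_arcs \<Longrightarrow> p \<in> points D \<and> p' \<in> points D \<and> edge_of D p = edge_of D p'"
  using level_arcs_points[of k "(p, p')"] level_arcs_edge[of k p p'] by (auto simp: all_arcs_def)

lemma all_arcs_mem:
  assumes "e \<in> edges D" "(k, p, p') \<in> all_arcs"
  shows "p' \<in> e \<longleftrightarrow> p \<in> e"
  using edge_mem[OF assms(1), of p] edge_mem[OF assms(1), of p'] all_arcs_points[OF assms(2)] by simp

lemma edge_count:
  assumes e: "e \<in> edges D"
  shows "2 * card e = 2 * card (arcs_on e) + half_count e"
proof -
  let ?g = "\<lambda>p. if p \<in> e then 1 else 0 :: nat"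
  have "sum ?g (points D) = card e"
    using edge_sub[OF e] finite_points by (simp add: sum.If_cases Int_absorb1)
  moreover have "(\<Sum>(k, p, p')\<in>all_arcs. ?g p + ?g p') = (\<Sum>x\<in>all_arcs. if fst (snd x) \<in> e then 2 else 0)"
    by (rule sum.cong[OF refl]) (auto simp: all_arcs_mem[OF e])
  moreover have "\<dots> = 2 * card (arcs_on e)"
    by (simp add: arcs_on_def sum.inter_filter[symmetric])
  ultimately show ?thesis using total_count[of ?g] by (simp add: half_count_def)
qed

text \<open>An edge is connected by the arcs on it, so the spanning tree bound applies; arcs of
  different layers with equal ends only enlarge the right-hand side.\<close>

lemma edge_arcs:
  assumes e: "e \<in> edges D"
  shows "card e \<le> card (arcs_on e) + 1"
proof -
  let ?R = "linked D \<inter> e \<times> e"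
  obtain p0 where p0: "p0 \<in> points D" "e = edge_of D p0" using e by (auto simp: edges_def)
  have "p0 \<in> e" using p0 by (simp add: edge_of_def)
  have conn: "(p0, p) \<in> (?R \<union> ?R\<inverse>)\<^sup>*" if "p \<in> e" for p
  proof -
    have "(p0, p) \<in> (linked D \<union> (linked D)\<inverse>)\<^sup>*" using that by (simp add: p0 edge_of_def)
    thus ?thesis
    proof (induction rule: rtrancl_induct)
      case (step x y)
      have "x \<in> points D" "y \<in> points D" using step.hyps(2) by (auto simp: linked_def)
      moreover have "(p0, y) \<in> (linked D \<union> (linked D)\<inverse>)\<^sup>*" by (rule rtrancl.rtrancl_into_rtrancl[OF step.hyps])
      ultimately have "x \<in> e" "y \<in> e" using step.hyps(1) by (simp_all add: p0 edge_of_def)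
      hence "(x, y) \<in> ?R \<union> ?R\<inverse>" using step.hyps(2) by auto
      with step.IH show ?case by (rule rtrancl.rtrancl_into_rtrancl)
    qed simp
  qed
  have sub: "?R \<subseteq> snd ` arcs_on e"
  proof
    fix x assume x: "x \<in> ?R"
    then obtain k where k: "k < length D" "x \<in> set (level_arcs k)" by (auto simp: linked_def set_level_arcs)
    have "(k, x) \<in> arcs_on e" using x k by (auto simp: arcs_on_def all_arcs_def)
    thus "x \<in> snd ` arcs_on e" by force
  qed
  have fin: "finite (arcs_on e)" by (simp add: arcs_on_def)
  have "card e \<le> card ?R + 1"
    by (rule card_connected_le[OF finite_edge[OF e] \<open>p0 \<in> e\<close> _ _ conn]) (use finite_subset[OF sub] fin in auto)
  also have "card ?R \<le> card (arcs_on e)"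
    using surj_card_le[OF fin sub] .
  finally show ?thesis by simp
qed

lemma hg_pos: "hg g k > 0 \<longleftrightarrow> k \<in> vertices D \<and> (\<exists>p. (k, p) \<in> half_edges D \<and> g p > 0)"
  by (cases "ends D k") (auto simp: hg_def half_edges_def)

text \<open>By \<open>edge_count\<close> the number of half-edges on an edge is even, and
  \<open>edge_arcs\<close> bounds it by 2.\<close>

lemma edge_half:
  assumes e: "e \<in> edges D"
  shows "half_count e = (if touches_vertex D e then 2 else 0)"
proof -
  let ?g = "\<lambda>p. if p \<in> e then 1 else 0 :: nat"
  have "touches_vertex D e \<longleftrightarrow> (\<exists>k p. (k, p) \<in> half_edges D \<and> p \<in> e)"
    unfolding touches_vertex_def by fast
  also have "\<dots> \<longleftrightarrow> (\<exists>k\<in>vertices D. hg ?g k > 0)"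
  proof -
    have "(k, p) \<in> half_edges D \<Longrightarrow> k \<in> vertices D" for k p by (simp add: half_edges_def)
    moreover have "?g p > 0 \<longleftrightarrow> p \<in> e" for p by simp
    ultimately show ?thesis unfolding hg_pos by blast
  qed
  also have "\<dots> \<longleftrightarrow> half_count e \<noteq> 0"
    unfolding half_count_def by (subst sum_eq_0_iff) simp_all
  finally have t: "touches_vertex D e \<longleftrightarrow> half_count e \<noteq> 0" .
  have "half_count e \<noteq> 0 \<Longrightarrow> half_count e = 2" using edge_count[OF e] edge_arcs[OF e] by presburger
  thus ?thesis by (cases "half_count e = 0") (simp_all add: t)
qed

lemma edge_card: "e \<in> edges D \<Longrightarrow> card e = card (arcs_on e) + (if touches_vertex D e then 1 else 0)"
  using edge_count[of e] edge_half[of e] by (simp split: if_splits)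

definition en :: "edge \<Rightarrow> nat" where "en e = to_nat (2 * col e)"

lemma fact_at_edge: "fact_at p = qfact (en (edge_of D p))"
  by (simp add: fact_at_def strands_def en_def)

lemma prod_fact_at_points: "prod fact_at (points D) = (\<Prod>e\<in>edges D. qfact (en e) ^ card e)"
proof -
  have "prod fact_at (points D) = (\<Prod>e\<in>edges D. \<Prod>p\<in>{p \<in> points D. edge_of D p = e}. fact_at p)"
    by (rule prod.group[symmetric]) (use finite_points edge_of_edges in force)+
  also have "\<dots> = (\<Prod>e\<in>edges D. qfact (en e) ^ card e)"
  proof (rule prod.cong[OF refl])
    fix e assume e: "e \<in> edges D"
    have "{p \<in> points D. edge_of D p = e} = e" using edge_mem[OF e] edge_sub[OF e] by auto
    moreover have "(\<Prod>p\<in>{p \<in> points D. edge_of D p = e}. fact_at p) = (\<Prod>p\<in>{p \<in> points D. edge_of D p = e}. qfact (en e))"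
      by (rule prod.cong[OF refl]) (simp add: fact_at_edge)
    ultimately show "(\<Prod>p\<in>{p \<in> points D. edge_of D p = e}. fact_at p) = qfact (en e) ^ card e"
      by simp
  qed
  finally show ?thesis .
qed

lemma prod_fact_at_all_arcs: "(\<Prod>x\<in>all_arcs. fact_at (fst (snd x))) = (\<Prod>e\<in>edges D. qfact (en e) ^ card (arcs_on e))"
proof -
  have pts: "fst (snd x) \<in> points D" if "x \<in> all_arcs" for x
    using all_arcs_points[of "fst x" "fst (snd x)" "snd (snd x)"] that by simp
  have "(\<Prod>x\<in>all_arcs. fact_at (fst (snd x))) = (\<Prod>e\<in>edges D. \<Prod>x\<in>{x \<in> all_arcs. edge_of D (fst (snd x)) = e}. fact_at (fst (snd x)))"
    by (rule prod.group[symmetric]) (use pts edge_of_edges in force)+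
  also have "\<dots> = (\<Prod>e\<in>edges D. qfact (en e) ^ card (arcs_on e))"
  proof (rule prod.cong[OF refl])
    fix e assume e: "e \<in> edges D"
    have "{x \<in> all_arcs. edge_of D (fst (snd x)) = e} = arcs_on e" using edge_mem[OF e] pts by (auto simp: arcs_on_def)
    moreover have "(\<Prod>x\<in>{x \<in> all_arcs. edge_of D (fst (snd x)) = e}. fact_at (fst (snd x))) =
        (\<Prod>x\<in>{x \<in> all_arcs. edge_of D (fst (snd x)) = e}. qfact (en e))"
      by (rule prod.cong[OF refl]) (simp add: fact_at_edge)
    ultimately show "(\<Prod>x\<in>{x \<in> all_arcs. edge_of D (fst (snd x)) = e}. fact_at (fst (snd x))) = qfact (en e) ^ card (arcs_on e)"
      by simp
  qed
  finally show ?thesis .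
qed

definition normalization :: scalar where
  "normalization = (\<Prod>e\<in>{e \<in> edges D. touches_vertex D e}. qfact (en e)) / (\<Prod>k\<in>vertices D. vertex_fact k)"

lemma vertex_fact_nonzero: "vertex_fact k \<noteq> 0"
  by (cases "end_colors D col k") (simp add: vertex_fact_def)

lemma total_scale: "\<exists>M. (\<Prod>k=0..<length D. level_scale k) * normalization = qh powi M"
proof -
  have "\<exists>m. \<forall>k\<in>{..<length D}. level_scale k * (\<Prod>i<width D (Suc k). fact_at (Suc k, i)) = qh powi m k * vertex_fact k * (\<Prod>(p, p')\<in>set (level_arcs k). fact_at p)"
    by (rule bchoice) (use layer_scale in blast)
  then obtain m where m: "\<And>k. k < length D \<Longrightarrow>
      level_scale k * (\<Prod>i<width D (Suc k). fact_at (Suc k, i)) = qh powi m k * vertex_fact k * (\<Prod>(p, p')\<in>set (level_arcs k). fact_at p)" by blast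
  define S V T A where "S = (\<Prod>k=0..<length D. level_scale k)" and "V = (\<Prod>k\<in>vertices D. vertex_fact k)"
    and "T = (\<Prod>e\<in>{e \<in> edges D. touches_vertex D e}. qfact (en e))" and "A = (\<Prod>x\<in>all_arcs. fact_at (fst (snd x)))"
  define M where "M = (\<Sum>k<length D. m k)"
  have "S * prod fact_at (points D) = (\<Prod>k<length D. level_scale k * (\<Prod>i<width D (Suc k). fact_at (Suc k, i)))"
    by (simp only: S_def prod.distrib prod_points[of fact_at] atLeast0LessThan)
  also have "\<dots> = (\<Prod>k<length D. qh powi m k) * (\<Prod>k<length D. vertex_fact k) * (\<Prod>k<length D. \<Prod>(p, p')\<in>set (level_arcs k). fact_at p)"
    by (simp add: m prod.distrib)
  also have "(\<Prod>k<length D. qh powi m k) = qh powi M"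
  proof -
    have "(\<Prod>k<n. qh powi m k) = qh powi (\<Sum>k<n. m k)" for n
      by (induction n) (simp_all add: power_int_add)
    thus ?thesis by (simp add: M_def)
  qed
  also have "(\<Prod>k<length D. vertex_fact k) = V"
    unfolding V_def by (rule prod.mono_neutral_right) (use vertices_sub in \<open>auto simp: vertex_fact_def\<close>)
  also have "(\<Prod>k<length D. \<Prod>(p, p')\<in>set (level_arcs k). fact_at p) = A"
    unfolding A_def all_arcs_def by (subst prod.Sigma) (auto simp: case_prod_beta)
  finally have 1: "S * prod fact_at (points D) = qh powi M * V * A" .
  have "prod fact_at (points D) = (\<Prod>e\<in>edges D. qfact (en e) ^ card (arcs_on e) * (if touches_vertex D e then qfact (en e) else 1))"
    unfolding prod_fact_at_points by (rule prod.cong[OF refl]) (simp add: edge_card)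
  also have "\<dots> = A * T"
    by (simp add: prod.distrib A_def prod_fact_at_all_arcs T_def prod.inter_filter)
  finally have 2: "prod fact_at (points D) = A * T" .
  have nz: "A \<noteq> 0" "V \<noteq> 0" by (simp_all add: A_def V_def fact_at_def vertex_fact_nonzero)
  have "A * (S * T) = A * (qh powi M * V)" using 1 unfolding 2 by (simp only: mult_ac)
  hence "S * T = qh powi M * V" using nz(1) by (simp only: mult_cancel_left simp_thms)
  hence "S * (T / V) = qh powi M" using nz(2) by (simp add: field_simps)
  thus ?thesis by (auto simp: normalization_def S_def T_def V_def)
qed

lemma color_en: "e \<in> edges D \<Longrightarrow> 2 * col e = of_nat (en e)"
proof -
  assume "e \<in> edges D"
  hence "2 * col e \<in> \<nat>" using edge_color by (auto simp: edges_def)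
  then obtain n where "2 * col e = of_nat n" by (auto elim: Nats_cases)
  thus ?thesis by (simp add: en_def to_nat_def)
qed

lemma base_point_in: "e \<in> edges D \<Longrightarrow> base_point e \<in> e"
  unfolding base_point_def by (rule someI_ex) (auto simp: edges_def edge_of_def)

lemma base_point:
  assumes "e \<in> edges D"
  shows "base_point e \<in> points D" "edge_of D (base_point e) = e"
proof -
  show p: "base_point e \<in> points D" using base_point_in[OF assms] edge_sub[OF assms] by blast
  show "edge_of D (base_point e) = e" using base_point_in[OF assms] edge_mem[OF assms p] by simp
qed

lemma lv_nth: "i < width D k \<Longrightarrow> lv k ! i = en (edge_of D (k, i))"
  by (simp add: lv_def strands_def en_def)

lemma base_cover:
  "base_point ` edges D \<subseteq> points D" "p \<in> points D \<Longrightarrow> \<exists>b\<in>base_point ` edges D. (b, p) \<in> conn D"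
proof -
  show "base_point ` edges D \<subseteq> points D" using base_point by auto
  assume p: "p \<in> points D"
  let ?e = "edge_of D p"
  have e: "?e \<in> edges D" using p by (rule edge_of_edges)
  have "(base_point ?e, p) \<in> conn D"
    using edge_of_eq_iff[OF p] base_point(2)[OF e] by blast
  thus "\<exists>b\<in>base_point ` edges D. (b, p) \<in> conn D" using e by blast
qed

lemma cable_cab:
  "cable D col \<sigma> = cab (\<lambda>p. if base_point (edge_of D p) = p then min_braid (en (edge_of D p)) (\<sigma> (edge_of D p)) else [])
     (length D)" (is "_ = cab ?w _")
proof -
  have "insert_braids D col \<sigma> k = braids ?w k" for k
  proof -
    have "(\<Sum>l<i. strands D col k l) = sum_list (take i (lv k))" if "i < width D k" for i
    proof -
      have "take i (lv k) = map (strands D col k) [0..<i]" using that by (simp add: lv_def take_map)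
      thus ?thesis by (simp add: interv_sum_list_conv_sum_set_nat atLeast0LessThan)
    qed
    thus ?thesis unfolding insert_braids_def braids_def
      by (intro arg_cong[of _ _ concat] map_cong refl) (simp add: strands_def en_def)
  qed
  moreover have "cable_layer (strands D col k) (strands D col (Suc k)) (D ! k) =
      cable_layer ((!) (lv k)) ((!) (lv (Suc k))) (D ! k)" if "k < length D" for k
    by (rule cable_layer_cong[OF fits[OF that]]) (simp_all add: lv_def width_Suc[OF that])
  ultimately show ?thesis unfolding cable_def cab_def
    by (intro arg_cong[of _ _ concat] map_cong refl) simp
qed

lemma blackboard_st: "blackboard_bracket D col = st (base_point ` edges D) (length D) []"
proof -
  have "st (base_point ` edges D) (length D) [] =
    (\<Sum>\<sigma>\<in>Pi\<^sub>E (edges D) (\<lambda>e. perms (en e)). (\<Prod>e\<in>edges D. jc (en e) (\<sigma> e)) * link_bracket (cable D col \<sigma>))"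
    unfolding cable_cab
  proof (rule st_expand)
    fix e assume e: "e \<in> edges D"
    show "base_point e \<in> points D \<and> edge_of D (base_point e) = e" using base_point[OF e] by simp
    have "snd (base_point e) < width D (fst (base_point e))" using base_point(1)[OF e] by (auto simp: points_def)
    thus "en e = lv (fst (base_point e)) ! snd (base_point e)" using base_point(2)[OF e] by (simp add: lv_nth)
  qed (simp_all add: edge_of_edges)
  moreover have "(\<Prod>e\<in>edges D. jc (en e) (\<sigma> e)) = (\<Prod>e\<in>edges D. jw_coeff (col e) (\<sigma> e))"
    if "\<sigma> \<in> Pi\<^sub>E (edges D) (\<lambda>e. perms (en e))" for \<sigma>
  proof (rule prod.cong[OF refl])
    fix e assume e: "e \<in> edges D"
    hence "\<sigma> e permutes {..<en e}" using that by (auto simp: perms_def dest: PiE_mem)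
    thus "jc (en e) (\<sigma> e) = jw_coeff (col e) (\<sigma> e)"
      by (simp add: jw_coeff_eq[OF color_en[OF e]] jc_def)
  qed
  ultimately show ?thesis unfolding blackboard_bracket_def en_def[symmetric] perms_def[symmetric] by simp
qed

lemma blackboard_normalized:
  "\<exists>M. \<exists>r\<in>int_laurent. blackboard_bracket D col * normalization = qh powi M * r \<and>
    (\<forall>e\<in>edges D. \<exists>r'\<in>int_laurent. r = qint (en e + 1) * r')"
proof -
  obtain M where M: "(\<Prod>k=0..<length D. level_scale k) * normalization = qh powi M" using total_scale by blast
  obtain r where r: "r \<in> int_laurent" "blackboard_bracket D col = (\<Prod>k=0..<length D. level_scale k) * r"
    using st_integral[OF base_cover] unfolding blackboard_st by blast
  let ?S = "\<Prod>k=0..<length D. level_scale k"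
  \<comment> \<open>The total scale is nonzero, so the quotient \<open>r\<close> is the same
    whichever edge is cut, and every edge contributes its own divisor of it.\<close>
  have "?S * normalization \<noteq> 0" unfolding M by simp
  hence S: "?S \<noteq> 0" by auto
  have "\<exists>r'\<in>int_laurent. r = qint (en e + 1) * r'" if e: "e \<in> edges D" for e
  proof -
    obtain k i where ki: "(k, i) \<in> points D" "e = edge_of D (k, i)" using e by (auto simp: edges_def)
    hence k: "k < length D" "i < width D k" using width_ends by (auto simp: points_def le_less)
    obtain r' where r': "r' \<in> int_laurent" "blackboard_bracket D col = ?S * qint (lv k ! i + 1) * r'"
      using st_divisible[OF base_cover k] unfolding blackboard_st by blast
    have "?S * r = ?S * (qint (en e + 1) * r')"
      using r(2) r'(2) unfolding lv_nth[OF k(2)] ki(2)[symmetric] by (simp only: mult.assoc)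
    thus ?thesis using S r'(1) by (simp only: mult_cancel_left) blast
  qed
  moreover have "blackboard_bracket D col * normalization = qh powi M * r"
    unfolding r(2) M[symmetric] by (simp only: mult_ac)
  ultimately show ?thesis using r(1) by (intro exI[of _ M] bexI[of _ r]) simp_all
qed

subsection \<open>Half-edges and orientability\<close>

lemma half_edges_Sigma:
  "half_edges D = (SIGMA v:vertices D. case ends D v of (x, y, z) \<Rightarrow> {x, y, z})"
  by (auto simp: half_edges_def)

lemma ends_distinct:
  "v \<in> vertices D \<Longrightarrow> ends D v = (x, y, z) \<Longrightarrow> x \<noteq> y \<and> y \<noteq> z \<and> x \<noteq> z"
  by (auto simp: vertex_iff ends_def)

lemma sum_half_edges:
  fixes f :: "nat \<times> point \<Rightarrow> nat"
  shows "(\<Sum>hp\<in>half_edges D. f hp) = (\<Sum>v\<in>vertices D. case ends D v of (x, y, z) \<Rightarrow> f (v, x) + f (v, y) + f (v, z))"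
proof -
  have "(\<Sum>hp\<in>half_edges D. f hp) = (\<Sum>v\<in>vertices D. \<Sum>p\<in>(case ends D v of (x, y, z) \<Rightarrow> {x, y, z}). f (v, p))"
    unfolding half_edges_Sigma by (subst sum.Sigma) (auto split: prod.splits)
  also have "\<dots> = (\<Sum>v\<in>vertices D. case ends D v of (x, y, z) \<Rightarrow> f (v, x) + f (v, y) + f (v, z))"
  proof (rule sum.cong[OF refl])
    fix v assume v: "v \<in> vertices D"
    obtain x y z where e: "ends D v = (x, y, z)" by (metis surj_pair)
    show "(\<Sum>p\<in>(case ends D v of (x, y, z) \<Rightarrow> {x, y, z}). f (v, p)) =
        (case ends D v of (x, y, z) \<Rightarrow> f (v, x) + f (v, y) + f (v, z))"
      using ends_distinct[OF v e] by (simp add: e add.assoc)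
  qed
  finally show ?thesis .
qed

lemma finite_half_edges [simp]: "finite (half_edges D)"
  unfolding half_edges_Sigma by (auto split: prod.splits)

lemma half_edges_points: "(v, p) \<in> half_edges D \<Longrightarrow> v \<in> vertices D \<and> p \<in> points D"
  using vertex_points[of v] by (cases "ends D v") (auto simp: half_edges_def)

lemma card_half:
  assumes "e \<in> edges D" "touches_vertex D e"
  shows "card {hp \<in> half_edges D. snd hp \<in> e} = 2"
proof -
  have "card {hp \<in> half_edges D. snd hp \<in> e} = (\<Sum>hp\<in>half_edges D. if snd hp \<in> e then 1 else 0)"
    by (simp add: sum.inter_filter[symmetric])
  also have "\<dots> = half_count e" unfolding sum_half_edges half_count_def hg_def
    by (rule sum.cong[OF refl]) (simp split: prod.splits)
  finally show ?thesis using edge_half[OF assms(1)] assms(2) by simp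
qed

lemma orientable_even:
  fixes h :: "edge \<Rightarrow> int" and s :: "nat \<Rightarrow> bool"
  assumes h: "\<And>e. e \<in> edges D \<Longrightarrow> 2 * \<tau> e = of_int (h e)"
    and circ: "\<And>e. e \<in> edges D \<Longrightarrow> \<not> touches_vertex D e \<Longrightarrow> \<tau> e \<in> \<int>"
    and s: "\<And>e v p v' p'. e \<in> edges D \<Longrightarrow> (v, p) \<in> half_edges D \<Longrightarrow> (v', p') \<in> half_edges D \<Longrightarrow> p \<in> e \<Longrightarrow> p' \<in> e \<Longrightarrow>
        (v, p) \<noteq> (v', p') \<Longrightarrow> s v = s v' \<longleftrightarrow> (\<tau> e :: rat) \<in> \<int>"
  shows "even (\<Sum>e\<in>edges D. h e * int (en e))"
proof -
  have int_iff: "\<tau> e \<in> \<int> \<longleftrightarrow> even (h e)" if e: "e \<in> edges D" for e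
  proof
    assume "\<tau> e \<in> \<int>"
    then obtain j where "\<tau> e = of_int j" by (auto elim: Ints_cases)
    hence "of_int (h e) = (of_int (2 * j) :: rat)" using h[OF e] by simp
    hence "h e = 2 * j" by (simp only: of_int_eq_iff)
    thus "even (h e)" by simp
  next
    assume "even (h e)"
    then obtain j where "h e = 2 * j" by blast
    hence "\<tau> e = of_int j" using h[OF e] by simp
    thus "\<tau> e \<in> \<int>" by simp
  qed
  define w where "w v = (if s v then 1 else 0 :: nat)" for v
  define hh where "hh e = {hp \<in> half_edges D. snd hp \<in> e}" for e
  \<comment> \<open>The number of half twists is odd exactly when the orientation signs at the two
    ends of the band differ, that is, when the signs \<open>w\<close> at its half-edges have odd
    sum.\<close>
  have par: "even (h e) \<longleftrightarrow> even (\<Sum>hp\<in>hh e. w (fst hp))" if e: "e \<in> edges D" for e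
  proof (cases "touches_vertex D e")
    case True
    obtain a b where ab: "hh e = {a, b}" "a \<noteq> b"
      using card_half[OF e True] by (auto simp: card_2_iff hh_def)
    have "a \<in> hh e" "b \<in> hh e" by (simp_all add: ab)
    hence "s (fst a) = s (fst b) \<longleftrightarrow> \<tau> e \<in> \<int>"
      using s[OF e, of "fst a" "snd a" "fst b" "snd b"] ab(2) by (simp add: hh_def)
    thus ?thesis using int_iff[OF e] ab
      by (cases "s (fst a)"; cases "s (fst b)") (simp_all add: w_def)
  next
    case False
    have "hh e = {}" using False by (auto simp: hh_def touches_vertex_def)
    thus ?thesis using circ[OF e False] int_iff[OF e] by simp
  qed
  have "even (\<Sum>e\<in>edges D. h e * int (en e)) \<longleftrightarrow> even (\<Sum>e\<in>edges D. (\<Sum>hp\<in>hh e. w (fst hp)) * en e)"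
  proof -
    have "even (\<Sum>e\<in>F. h e * int (en e)) \<longleftrightarrow> even (\<Sum>e\<in>F. (\<Sum>hp\<in>hh e. w (fst hp)) * en e)"
      if "finite F" "F \<subseteq> edges D" for F
      using that by (induction F) (simp_all add: par)
    thus ?thesis by simp
  qed
  \<comment> \<open>The sum over edges is redistributed over half-edges, so that it can be taken
    vertex by vertex, where the sign is constant and the strand numbers add up to an even
    number.\<close>
  also have "(\<Sum>e\<in>edges D. (\<Sum>hp\<in>hh e. w (fst hp)) * en e) =
      (\<Sum>e\<in>edges D. \<Sum>hp\<in>{hp \<in> half_edges D. edge_of D (snd hp) = e}. w (fst hp) * en (edge_of D (snd hp)))"
  proof (rule sum.cong[OF refl])
    fix e assume e: "e \<in> edges D"
    have "hh e = {hp \<in> half_edges D. edge_of D (snd hp) = e}"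
      unfolding hh_def using edge_mem[OF e] half_edges_points by auto
    thus "(\<Sum>hp\<in>hh e. w (fst hp)) * en e =
       (\<Sum>hp\<in>{hp \<in> half_edges D. edge_of D (snd hp) = e}. w (fst hp) * en (edge_of D (snd hp)))"
      by (simp add: sum_distrib_right)
  qed
  also have "\<dots> = (\<Sum>hp\<in>half_edges D. w (fst hp) * en (edge_of D (snd hp)))"
    by (rule sum.group) (use half_edges_points edge_of_edges in force)+
  also have "even \<dots>"
    unfolding sum_half_edges
  proof (rule dvd_sum)
    fix v assume v: "v \<in> vertices D"
    obtain p p' p'' where e: "ends D v = (p, p', p'')" by (metis surj_pair)
    obtain a b c where abc: "end_colors D col v = (a, b, c)" by (metis surj_pair)
    obtain x s y where xy: "strands D col (fst p) (snd p) = x + s" "strands D col (fst p') (snd p') = s + y"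
      "strands D col (fst p'') (snd p'') = x + y"
      by (rule vertex_triangle[OF v e abc])
    have en: "en (edge_of D p) = x + s" "en (edge_of D p') = s + y" "en (edge_of D p'') = x + y"
      using xy by (simp_all add: strands_def en_def)
    have "w v * (x + s) + w v * (s + y) + w v * (x + y) = 2 * (w v * (x + s + y))" by (simp add: algebra_simps)
    thus "even (case ends D v of (x, y, z) \<Rightarrow> w (fst (v, x)) * en (edge_of D (snd (v, x))) +
        w (fst (v, y)) * en (edge_of D (snd (v, y))) + w (fst (v, z)) * en (edge_of D (snd (v, z))))"
      by (simp add: e en)
  qed
  finally show ?thesis by simp
qed

text \<open>The exponent of \<open>t\<close> in the framing factor: with h = 2g half twists and n =
  2 col strands, 2g(col^2 + col) equals h n (n+2) / 4. Modulo 2 the term h n (n+2) agrees with h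
  n.\<close>

definition twist_exponent :: "(edge \<Rightarrow> int) \<Rightarrow> int" where
  "twist_exponent h = (\<Sum>e\<in>edges D. h e * int (en e) * (int (en e) + 2))"

lemma even_twist_exponent: "even (\<Sum>e\<in>edges D. h e * int (en e)) \<Longrightarrow> even (twist_exponent h)"
proof -
  assume *: "even (\<Sum>e\<in>edges D. h e * int (en e))"
  have "even (\<Sum>e\<in>F. h e * int (en e) * (int (en e) + 2)) \<longleftrightarrow> even (\<Sum>e\<in>F. h e * int (en e))"
    if "finite F" for F
    using that by (induction F) auto
  thus ?thesis using * by (simp add: twist_exponent_def)
qed

end

section \<open>The framing factor and the conclusion\<close>

lemma prod_powi:
  fixes x :: scalar
  assumes "x \<noteq> 0"
  shows "(\<Prod>e\<in>A. x powi f e) = x powi (\<Sum>e\<in>A. f e)"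
  by (induction A rule: infinite_finite_induct) (simp_all add: power_int_add assms)

lemma imag_sq: "imag * imag = -1"
proof -
  have "imag * imag = to_fract ([:\<i>:] * [:\<i>:])" by (simp only: imag_def to_fract_mult)
  also have "[:\<i>:] * [:\<i>:] = - (1 :: complex poly)" by (simp add: one_pCons)
  finally show ?thesis by (simp add: to_fract_uminus)
qed

lemma imag_nonzero [simp]: "imag \<noteq> 0"
  using imag_sq by auto

lemma imag_even: "even m \<Longrightarrow> imag powi m = 1 \<or> imag powi m = -1"
proof -
  assume "even m"
  then obtain j where "m = 2 * j" by blast
  hence "imag powi m = (-1) powi j" by (simp add: power_int_mult power2_eq_square imag_sq)
  thus ?thesis by (cases "even j") simp_all
qed

lemma qpow_quarter: "qpow (of_int n / 4) = t powi n" "qpow (- of_int n / 4) = t powi (- n)"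
proof -
  have "4 * (of_int n / 4 :: rat) = of_int n" "4 * (- of_int n / 4 :: rat) = of_int (- n)" by simp_all
  thus "qpow (of_int n / 4) = t powi n" "qpow (- of_int n / 4) = t powi (- n)"
    unfolding qpow_def by (simp_all only: floor_of_int)
qed

theorem theorem3p2:
  fixes G :: ktg and col :: coloring
  assumes "closed_ktg G"
    and "admissible (diagram G) col"
  shows "(\<exists>m n :: int.
            renormalized_bracket G col \<in> {imag powi m * qpow (of_int n / 4) * P | P. P \<in> int_laurent}
          \<and> (\<forall>e\<in>edge_set G. divides_in_int_laurent (qint (to_nat (2 * col e + 1)))
                (renormalized_bracket G col * imag powi (- m) * qpow (- of_int n / 4))))
       \<and> (orientable_framing G \<longrightarrow>
          (\<exists>n :: int. even n
          \<and> renormalized_bracket G col \<in> {imag powi 0 * qpow (of_int n / 4) * P | P. P \<in> int_laurent}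
          \<and> (\<forall>e\<in>edge_set G. divides_in_int_laurent (qint (to_nat (2 * col e + 1)))
                (renormalized_bracket G col * imag powi 0 * qpow (- of_int n / 4)))))"
proof -
  interpret colored "diagram G" col
    using assms by unfold_locales (simp_all add: closed_ktg_def)
  let ?E = "edge_set G" and ?B = "renormalized_bracket G col"
  define h where "h e = \<lfloor>2 * twist G e\<rfloor>" for e
  have h: "2 * twist G e = of_int (h e)" if "e \<in> ?E" for e
    using assms(1) that by (auto simp: closed_ktg_def h_def elim: Ints_cases)
  define m where "m = (\<Sum>e\<in>?E. h e * int (en e))"
  have framing: "framing_factor G col = imag powi m * t powi twist_exponent h"
  proof -
    have "framing_factor G col = (\<Prod>e\<in>?E. imag powi (h e * int (en e)) * t powi (h e * int (en e) * (int (en e) + 2)))"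
      unfolding framing_factor_def
    proof (intro prod.cong refl arg_cong2[of _ _ _ _ "(*)"])
      fix e assume e: "e \<in> ?E"
      have "4 * twist G e * col e = (2 * twist G e) * (2 * col e)" by simp
      also have "\<dots> = of_int (h e * int (en e))" by (simp add: h[OF e] color_en[OF e])
      finally show "imag powi \<lfloor>4 * twist G e * col e\<rfloor> = imag powi (h e * int (en e))"
        by (simp only: floor_of_int)
      have "4 * (2 * twist G e * ((col e)\<^sup>2 + col e)) = (2 * twist G e) * (2 * col e) * (2 * col e + 2)"
        by (simp add: power2_eq_square algebra_simps)
      also have "\<dots> = of_int (h e * int (en e) * (int (en e) + 2))" by (simp add: h[OF e] color_en[OF e])
      finally show "qpow (2 * twist G e * ((col e)\<^sup>2 + col e)) = t powi (h e * int (en e) * (int (en e) + 2))"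
        by (simp only: qpow_def floor_of_int)
    qed
    thus ?thesis by (simp add: prod.distrib prod_powi m_def twist_exponent_def)
  qed
  obtain M r where r: "r \<in> int_laurent" "blackboard_bracket (diagram G) col * normalization = qh powi M * r"
    and div: "\<forall>e\<in>?E. \<exists>r'\<in>int_laurent. r = qint (en e + 1) * r'"
    using blackboard_normalized by (elim exE bexE conjE)
  \<comment> \<open>Since \<open>qh = t powi 2\<close>, crossings and normalization contribute the
    even number 2M, and the parity of \<open>n\<close> is decided by the framing.\<close>
  define n where "n = twist_exponent h + 2 * M"
  have vertex_fact: "(\<Prod>v\<in>vertices (diagram G). vertex_fact v) = (\<Prod>v\<in>vertex_set G. case end_colors (diagram G) col v of (a, b, c) \<Rightarrow>
          qfact (to_nat (a + b - c)) * qfact (to_nat (b + c - a)) * qfact (to_nat (c + a - b)))"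
    by (rule prod.cong[OF refl]) (simp add: vertex_fact_def)
  have "?B = framing_factor G col * (blackboard_bracket (diagram G) col * normalization)"
    by (simp add: renormalized_bracket_def kauffman_bracket_def normalization_def vertex_fact en_def)
  also have "\<dots> = imag powi m * (t powi twist_exponent h * qh powi M) * r"
    unfolding framing r(2) by (simp only: mult.assoc)
  also have "t powi twist_exponent h * qh powi M = t powi n"
    by (simp add: n_def qh_eq power_int_add power_int_mult)
  finally have B: "?B = imag powi m * t powi n * r" .
  have en1: "to_nat (2 * col e + 1) = en e + 1" if "e \<in> ?E" for e
  proof -
    have "2 * col e + 1 = of_nat (en e + 1)" using color_en[OF that] by simp
    thus ?thesis by (simp only: to_nat_def floor_of_nat nat_int)
  qed
  have divides: "divides_in_int_laurent (qint (to_nat (2 * col e + 1))) (u * r)"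
    if eu: "e \<in> ?E" "u \<in> int_laurent" for e u
  proof -
    obtain r' where r': "r' \<in> int_laurent" "r = qint (en e + 1) * r'" using bspec[OF div eu(1)] by (rule bexE)
    have "u * r = qint (en e + 1) * (u * r')" unfolding r'(2) by (simp only: mult_ac)
    thus ?thesis unfolding divides_in_int_laurent_def en1[OF eu(1)]
      using int_laurent_mult[OF eu(2) r(1)] int_laurent_mult[OF eu(2) r'(1)]
      by (intro conjI int_laurent_qint bexI[of _ "u * r'"])
  qed
  have cancel: "imag powi k * t powi n * r * imag powi (- k) * t powi (- n) = 1 * r" for k
  proof -
    have "imag powi k * t powi n * r * imag powi (- k) * t powi (- n) =
      (imag powi k * imag powi (- k)) * (t powi n * t powi (- n)) * r" by (simp only: mult_ac)
    thus ?thesis by (simp add: power_int_minus)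
  qed
  have A: "\<exists>m n :: int. ?B \<in> {imag powi m * qpow (of_int n / 4) * P | P. P \<in> int_laurent}
      \<and> (\<forall>e\<in>?E. divides_in_int_laurent (qint (to_nat (2 * col e + 1))) (?B * imag powi (- m) * qpow (- of_int n / 4)))"
  proof (intro exI conjI ballI)
    show "?B \<in> {imag powi m * qpow (of_int n / 4) * P | P. P \<in> int_laurent}"
      by (rule CollectI, rule exI[of _ r]) (simp only: qpow_quarter B r(1) simp_thms)
    fix e assume "e \<in> ?E"
    from divides[OF this int_laurent_1]
    show "divides_in_int_laurent (qint (to_nat (2 * col e + 1))) (?B * imag powi (- m) * qpow (- of_int n / 4))"
      by (simp only: qpow_quarter B cancel)
  qed
  have O: "\<exists>n :: int. even n \<and> ?B \<in> {imag powi 0 * qpow (of_int n / 4) * P | P. P \<in> int_laurent}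
      \<and> (\<forall>e\<in>?E. divides_in_int_laurent (qint (to_nat (2 * col e + 1))) (?B * imag powi 0 * qpow (- of_int n / 4)))"
    if or: "orientable_framing G"
  proof -
    obtain s :: "nat \<Rightarrow> bool" where s: "\<forall>e\<in>?E. \<forall>(v, p) \<in> half_edges (diagram G). \<forall>(v', p') \<in> half_edges (diagram G).
          p \<in> e \<and> p' \<in> e \<and> (v, p) \<noteq> (v', p') \<longrightarrow> (s v = s v' \<longleftrightarrow> twist G e \<in> \<int>)"
      and circ: "\<forall>e\<in>?E. \<not> touches_vertex (diagram G) e \<longrightarrow> twist G e \<in> \<int>"
      using or unfolding orientable_framing_def by (elim conjE exE)
    have ev: "even m"
      unfolding m_def by (rule orientable_even[where \<tau> = "twist G" and s = s, OF h circ[rule_format]]) (use s in fast)+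
    \<comment> \<open>For even m this is 1 or -1, so it can be moved into the Laurent polynomial,
      which makes the exponent of \<open>imag\<close> zero.\<close>
    define u where "u = imag powi m"
    have u: "u \<in> int_laurent" using imag_even[OF ev] int_laurent_1 int_laurent_uminus[OF int_laurent_1] by (auto simp: u_def)
    have even: "even n" using even_twist_exponent[of h] ev by (simp add: n_def m_def)
    have B1: "?B = imag powi 0 * t powi n * (u * r)" unfolding B u_def by (simp add: mult_ac)
    have B2: "?B * imag powi 0 * t powi (- n) = u * r"
    proof -
      have "?B * imag powi 0 * t powi (- n) = (t powi n * t powi (- n)) * (u * r)"
        unfolding B u_def by (simp add: mult_ac)
      thus ?thesis by (simp add: power_int_minus)
    qed
    show ?thesis
    proof (intro exI conjI ballI)
      show "even n" by (rule even)
      show "?B \<in> {imag powi 0 * qpow (of_int n / 4) * P | P. P \<in> int_laurent}"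
        unfolding qpow_quarter by (rule CollectI, rule exI[of _ "u * r"], rule conjI[OF B1 int_laurent_mult[OF u r(1)]])
      fix e assume "e \<in> ?E"
      from divides[OF this u]
      show "divides_in_int_laurent (qint (to_nat (2 * col e + 1))) (?B * imag powi 0 * qpow (- of_int n / 4))"
        by (simp only: qpow_quarter B2)
    qed
  qed
  show ?thesis using A O by (intro conjI impI)
qed

end
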